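(* Let $a,b\in\mathbb{R}$ satisfy $b\le -\frac{1}{3}a^2$, and consider the equation $v_{tt}+(-v+av^2+bv^3)_{xx}+v_{xxxx}=0$. Then every solitary wave of this equation is (orbitally) stable.
   Context: Write $p(v)=-v+av^2+bv^3$. A solitary wave of speed $c$ is a solution $v(x,t)=V(x-ct)$ with $V$ a non-identically-zero smooth function, $V(\xi)\to0$ as $\xi\to\pm\infty$. The equation is written as the first-order system $v_t-u_x=0$, $u_t+p(v)_x=-v_{xxx}$; the solitary wave corresponds to the traveling wave $(v,u)(x,t)=(V,U)(x-ct)$ of this system with $U=-cV$. The traveling wave $(V,U)$ is called (orbitally) stable if for every $\varepsilon>0$ there is $\delta>0$ such that for any solution $(v,u)\in (V,U)+C([0,T);H^3(\mathbb{R})\times H^2(\mathbb{R}))$ of the system with $\|(v,u)(\cdot,0)-(V,U)(\cdot)\|_{H^1\times L^2}<\delta$, the solution exists for all times (one may take $T=\infty$) and $\inf_{\sigma\in\mathbb{R}}\|(v,u)(\cdot,t)-(V,U)(\cdot+\sigma)\|_{H^1\times L^2}<\varepsilon$ for all $t>0$. (Solitary waves of the equation with $b\le-\frac13a^2$ are called Heimburg-Jackson pulses in the paper.) *)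

theory Defs
  imports "HOL-Analysis.Analysis" "HOL-Library.Extended_Real"
begin

definition pfun :: "real \<Rightarrow> real \<Rightarrow> real \<Rightarrow> real" where
  "pfun a b v = - v + a * v ^ 2 + b * v ^ 3"

definition smooth_fun :: "(real \<Rightarrow> real) \<Rightarrow> bool" where
  "smooth_fun f \<longleftrightarrow> (\<forall>n x. ((deriv ^^ n) f) differentiable (at x))"

definition test_fun :: "(real \<Rightarrow> real) \<Rightarrow> bool" where
  "test_fun \<phi> \<longleftrightarrow> smooth_fun \<phi> \<and> (\<exists>R. \<forall>x. R < \<bar>x\<bar> \<longrightarrow> \<phi> x = 0)"

definition time_test_fun :: "ereal \<Rightarrow> (real \<Rightarrow> real) \<Rightarrow> bool" where
  "time_test_fun T \<psi> \<longleftrightarrow> smooth_fun \<psi> \<and>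
     (\<exists>t0 t1. 0 < t0 \<and> ereal t1 < T \<and> (\<forall>t. t \<notin> {t0..t1} \<longrightarrow> \<psi> t = 0))"

definition L2_fun :: "(real \<Rightarrow> real) \<Rightarrow> bool" where
  "L2_fun f \<longleftrightarrow> f \<in> borel_measurable lborel \<and> integrable lborel (\<lambda>x. (f x)\<^sup>2)"

definition weak_deriv :: "(real \<Rightarrow> real) \<Rightarrow> (real \<Rightarrow> real) \<Rightarrow> bool" where
  "weak_deriv f g \<longleftrightarrow> (\<forall>\<phi>. test_fun \<phi> \<longrightarrow>
     integrable lborel (\<lambda>x. f x * deriv \<phi> x) \<and> integrable lborel (\<lambda>x. g x * \<phi> x) \<and>
     (\<integral>x. f x * deriv \<phi> x \<partial>lborel) = - (\<integral>x. g x * \<phi> x \<partial>lborel))"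

definition Hk_chain :: "nat \<Rightarrow> (real \<Rightarrow> real) \<Rightarrow> (nat \<Rightarrow> real \<Rightarrow> real) \<Rightarrow> bool" where
  "Hk_chain k f ds \<longleftrightarrow> ds 0 = f \<and> (\<forall>j\<le>k. L2_fun (ds j)) \<and>
     (\<forall>j<k. weak_deriv (ds j) (ds (Suc j)))"

definition in_H :: "nat \<Rightarrow> (real \<Rightarrow> real) \<Rightarrow> bool" where
  "in_H k f \<longleftrightarrow> (\<exists>ds. Hk_chain k f ds)"

text \<open>H^k norm (the weak derivatives are unique a.e., so this is well defined on H^k).\<close>
definition H_norm :: "nat \<Rightarrow> (real \<Rightarrow> real) \<Rightarrow> real" where
  "H_norm k f = (let ds = (SOME ds. Hk_chain k f ds) in
      sqrt (\<Sum>j\<le>k. \<integral>x. (ds j x)\<^sup>2 \<partial>lborel))"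

definition dist_H1L2 :: "(real \<Rightarrow> real) \<Rightarrow> (real \<Rightarrow> real) \<Rightarrow> (real \<Rightarrow> real) \<Rightarrow> (real \<Rightarrow> real) \<Rightarrow> real" where
  "dist_H1L2 v u V U = sqrt ((H_norm 1 (\<lambda>x. v x - V x))\<^sup>2 + (H_norm 0 (\<lambda>x. u x - U x))\<^sup>2)"

definition classical_sol :: "real \<Rightarrow> real \<Rightarrow> (real \<Rightarrow> real \<Rightarrow> real) \<Rightarrow> bool" where
  "classical_sol a b w \<longleftrightarrow> (\<forall>x t.
     deriv (\<lambda>s. deriv (\<lambda>r. w x r) s) t
     + deriv (\<lambda>y. deriv (\<lambda>z. pfun a b (w z t)) y) x
     + (deriv ^^ 4) (\<lambda>y. w y t) x = 0)"

definition solitary_wave :: "real \<Rightarrow> real \<Rightarrow> real \<Rightarrow> (real \<Rightarrow> real) \<Rightarrow> bool" where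
  "solitary_wave a b c V \<longleftrightarrow> smooth_fun V \<and> (\<exists>x. V x \<noteq> 0) \<and>
     (V \<longlongrightarrow> 0) at_top \<and> (V \<longlongrightarrow> 0) at_bot \<and>
     classical_sol a b (\<lambda>x t. V (x - c * t))"

text \<open>(v,u) (functions of (x,t)) is a solution of v_t - u_x = 0, u_t + p(v)_x = -v_xxx
  on [0,T) lying in (V,U) + C([0,T); H^3 x H^2); the equations hold in the sense of
  distributions on R x (0,T) (tested against products of test functions).\<close>
definition is_solution :: "real \<Rightarrow> real \<Rightarrow> (real \<Rightarrow> real) \<Rightarrow> (real \<Rightarrow> real) \<Rightarrow> ereal \<Rightarrow>
    (real \<Rightarrow> real \<Rightarrow> real) \<Rightarrow> (real \<Rightarrow> real \<Rightarrow> real) \<Rightarrow> bool" where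
  "is_solution a b V U T v u \<longleftrightarrow>
     (\<forall>t. 0 \<le> t \<and> ereal t < T \<longrightarrow>
        in_H 3 (\<lambda>x. v x t - V x) \<and> in_H 2 (\<lambda>x. u x t - U x) \<and>
        ((\<lambda>s. H_norm 3 (\<lambda>x. v x s - v x t)) \<longlongrightarrow> 0) (at t within {s. 0 \<le> s \<and> ereal s < T}) \<and>
        ((\<lambda>s. H_norm 2 (\<lambda>x. u x s - u x t)) \<longlongrightarrow> 0) (at t within {s. 0 \<le> s \<and> ereal s < T})) \<and>
     (\<forall>\<phi> \<psi>. test_fun \<phi> \<and> time_test_fun T \<psi> \<longrightarrow>
        (let f1 = (\<lambda>(x, t). - v x t * \<phi> x * deriv \<psi> t + u x t * deriv \<phi> x * \<psi> t);
             f2 = (\<lambda>(x, t). - u x t * \<phi> x * deriv \<psi> t - pfun a b (v x t) * deriv \<phi> x * \<psi> t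
                             - v x t * (deriv ^^ 3) \<phi> x * \<psi> t)
         in integrable (lborel \<Otimes>\<^sub>M lborel) f1 \<and> integral\<^sup>L (lborel \<Otimes>\<^sub>M lborel) f1 = 0 \<and>
            integrable (lborel \<Otimes>\<^sub>M lborel) f2 \<and> integral\<^sup>L (lborel \<Otimes>\<^sub>M lborel) f2 = 0))"

text \<open>Orbital stability of the traveling wave (V,U) in H^1 x L^2.  "The solution exists for
  all times" is rendered as: it coincides on [0,T) with a global solution (T = \<infinity>),
  which stays \<epsilon>-close to the orbit of translates.\<close>
definition orbitally_stable :: "real \<Rightarrow> real \<Rightarrow> (real \<Rightarrow> real) \<Rightarrow> (real \<Rightarrow> real) \<Rightarrow> bool" where
  "orbitally_stable a b V U \<longleftrightarrow> (\<forall>\<epsilon>>0. \<exists>\<delta>>0. \<forall>T v u.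
     0 < T \<and> is_solution a b V U T v u \<and> dist_H1L2 (\<lambda>x. v x 0) (\<lambda>x. u x 0) V U < \<delta> \<longrightarrow>
     (\<exists>v' u'. is_solution a b V U \<infinity> v' u' \<and>
        (\<forall>x t. 0 \<le> t \<and> ereal t < T \<longrightarrow> v' x t = v x t \<and> u' x t = u x t) \<and>
        (\<forall>t>0. (INF \<sigma>. dist_H1L2 (\<lambda>x. v' x t) (\<lambda>x. u' x t) (\<lambda>x. V (x + \<sigma>)) (\<lambda>x. U (x + \<sigma>))) < \<epsilon>)))"

end

theory Submission
  imports Defs
begin

text \<open>The system is Hamiltonian, with conserved energy \<open>E\<close> and momentum \<open>Q\<close>.  For a state whose \<open>v\<close> has
  maximum \<open>m\<close>, completing squares against the pulse of height \<open>m\<close> and speed \<open>c(m)\<close> gives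
  \<open>E + c(m) Q = d(m) + \<dots>\<close> with a sum of squares as remainder and \<open>d(m)\<close> the action of that pulse.
  When \<open>b \<le> -a\<^sup>2/3\<close> the function \<open>d(m) - c(m) Q\<close>, with \<open>Q\<close> the momentum of the wave, has a strict minimum at
  the height of the wave, so by conservation and continuity in time the maximum stays near that height; the squares
  are then small, which forces \<open>H\<^sup>1 \<times> L\<^sup>2\<close> closeness to a translate.  The energy is also coercive,
  which makes the solutions global: with \<open>v - v\<^sub>x\<close> as unknown the equation is a bounded perturbation of
  a unitary group on \<open>L\<^sup>2 \<times> L\<^sup>2\<close>, and after one differentiation in time it becomes an ordinary
  differential equation with locally Lipschitz right-hand side.\<close>

text \<open>The hypothesis on \<open>b\<close> acts twice. It is what completing a square in the
  energy needs for coercivity, and with \<open>m = 2 * a / (3 * be)\<close>,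
  \<open>be = - b\<close>, it reads \<open>be * m\<^sup>2 \<le> 4 / 3\<close>; this keeps the
  squared speed above 1/3 at every height and makes the size of the momentum strictly monotone along
  the family of pulses, which is the source of the strict minimum. The comparison pulse must have
  the height of the state rather than that of the wave, because the remainder is a sum of squares
  only if \<open>v\<close> does not pass the turning point of the pulse. Loss of mass at infinity is
  excluded by comparison: a small square says that \<open>v\<close> almost solves a first order
  equation, following it outwards from the peak bounds \<open>v\<close> below by the pulse, and the
  momentum fixes the L2 norm, so there is nothing left to lose. Solutions satisfy the equations only
  as distributions, yet their values at every point are prescribed. They are therefore turned into
  differentiable curves in a Hilbert space, where conservation is a computation, and the global
  curve has to be pasted onto the given functions without altering them.\<close>

notation tendsto (infixr "--->" 55)
notation scaleR (infixr "*R" 75)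
abbreviation LIMSEQ' :: "(nat \<Rightarrow> 'a::topological_space) \<Rightarrow> 'a \<Rightarrow> bool" (infix ">>>" 60)
  where "X >>> L \<equiv> (X ---> L) sequentially"

section \<open>The Hilbert space of square integrable functions\<close>

lemma L2_fun_mult_integrable:
 assumes "L2_fun f" "L2_fun g"
 shows "integrable lborel (%x. f x * g x)"
proof (rule Bochner_Integration.integrable_bound)
 show "integrable lborel (%x. (f x)^2 + (g x)^2)"
  using assms by (auto simp: L2_fun_def)
 show "(%x. f x * g x) : borel_measurable lborel"
  using assms by (auto simp: L2_fun_def)
 have "\<bar>s * t\<bar> <= s^2 + t^2" for s t :: real
 proof -
  have "2 * (\<bar>s\<bar> * \<bar>t\<bar>) <= \<bar>s\<bar>^2 + \<bar>t\<bar>^2"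
   using sum_squares_bound[of "\<bar>s\<bar>" "\<bar>t\<bar>"] by simp
  then show ?thesis by (simp add: abs_mult) (smt (verit) zero_le_power2)
 qed
 then show "AE x in lborel. norm (f x * g x) <= norm ((f x)^2 + (g x)^2)"
  by simp
qed

lemma L2_fun_zero: "L2_fun (%x. 0)"
 by (simp add: L2_fun_def)

lemma L2_fun_scale: "L2_fun f ==> L2_fun (%x. c * f x)"
 by (auto simp: L2_fun_def power_mult_distrib)

lemma L2_fun_add:
 assumes "L2_fun f" "L2_fun g"
 shows "L2_fun (%x. f x + g x)"
proof -
 have "integrable lborel (%x. (f x)^2 + (g x)^2 + 2 * (f x * g x))"
  using assms L2_fun_mult_integrable[OF assms]
  by (intro Bochner_Integration.integrable_add integrable_mult_right) (auto simp: L2_fun_def)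
 then show ?thesis
  using assms by (auto simp: L2_fun_def power2_sum algebra_simps)
qed

lemma L2_fun_uminus: "L2_fun f ==> L2_fun (%x. - f x)"
 by (simp add: L2_fun_def)

lemma L2_fun_diff: "L2_fun f ==> L2_fun g ==> L2_fun (%x. f x - g x)"
 using L2_fun_add[of f "%x. - g x"] L2_fun_uminus[of g] by simp

lemma L2_fun_measurable: "L2_fun f ==> f : borel_measurable borel"
 by (simp add: L2_fun_def)

lemma L2_fun_bounded_mult:
 assumes "L2_fun f" "h : borel_measurable borel" "!!x. \<bar>h x\<bar> <= C"
 shows "L2_fun (%x. h x * f x)"
 unfolding L2_fun_def
proof
 show "(%x. h x * f x) : borel_measurable lborel"
  using assms by (auto simp: L2_fun_def)
 show "integrable lborel (%x. (h x * f x)^2)"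
 proof (rule Bochner_Integration.integrable_bound)
  show "integrable lborel (%x. C^2 * (f x)^2)"
   using assms by (auto simp: L2_fun_def)
  show "(%x. (h x * f x)^2) : borel_measurable lborel"
   using assms by (auto simp: L2_fun_def)
  have "(h x)^2 <= C^2" for x
   using assms(3)[of x] by (metis abs_ge_zero order_trans power2_abs power_mono)
  then show "AE x in lborel. norm ((h x * f x)^2) <= norm (C^2 * (f x)^2)"
   by (auto simp: power_mult_distrib intro!: mult_right_mono)
 qed
qed

lemma L2_fun_bound:
 assumes "L2_fun f" "h : borel_measurable borel" "!!x. \<bar>h x\<bar> <= \<bar>f x\<bar>"
 shows "L2_fun h"
 unfolding L2_fun_def
proof
 show "integrable lborel (%x. (h x)^2)"
 proof (rule Bochner_Integration.integrable_bound)
  show "integrable lborel (%x. (f x)^2)"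
   using assms by (auto simp: L2_fun_def)
  show "AE x in lborel. norm ((h x)^2) <= norm ((f x)^2)"
   using assms(3) by (auto simp: abs_le_square_iff)
 qed (use assms in auto)
qed (use assms in auto)

text \<open>A partial equivalence: functions outside L2 are related to nothing, not even to
  themselves, so the quotient consists of classes of square integrable functions only.\<close>

definition l2_eq :: "(real => real) => (real => real) => bool" where
 "l2_eq f g \<longleftrightarrow> L2_fun f & L2_fun g & (AE x in lborel. f x = g x)"

lemma part_equivp_l2_eq: "part_equivp l2_eq"
proof (rule part_equivpI)
 show "\<exists>x. l2_eq x x"
  using L2_fun_zero by (auto simp: l2_eq_def)
 show "symp l2_eq"
  by (auto simp: l2_eq_def symp_def)
 show "transp l2_eq"
  unfolding l2_eq_def transp_def by (auto elim: AE_mp)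
qed

quotient_type l2 = "real => real" / partial: l2_eq
 morphisms fn toL2
 by (rule part_equivp_l2_eq)

lemma L2_fun_fn [simp]: "L2_fun (fn f)"
 using Quotient_rep_reflp[OF Quotient_l2] by (simp add: l2_eq_def)

lemma toL2_fn [simp]: "toL2 (fn f) = f"
 using Quotient_abs_rep[OF Quotient_l2] .

lemma toL2_eq_iff:
 assumes "L2_fun f" "L2_fun g"
 shows "toL2 f = toL2 g \<longleftrightarrow> (AE x in lborel. f x = g x)"
 using Quotient_rel[OF Quotient_l2, of f g] assms by (auto simp: l2_eq_def)

lemma AE_fn_toL2: "L2_fun f ==> AE x in lborel. fn (toL2 f) x = f x"
 by (metis L2_fun_fn toL2_eq_iff toL2_fn)

lemma fn_measurable [measurable]: "fn f : borel_measurable borel"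
 using L2_fun_fn[of f] by (simp add: L2_fun_def)

instantiation l2 :: real_inner
begin

lift_definition zero_l2 :: l2 is "%x. 0"
 by (simp add: l2_eq_def L2_fun_zero)

lift_definition plus_l2 :: "l2 => l2 => l2" is "%f g x. f x + g x"
 by (auto simp: l2_eq_def L2_fun_add)

lift_definition uminus_l2 :: "l2 => l2" is "%f x. - f x"
 by (auto simp: l2_eq_def L2_fun_uminus)

lift_definition minus_l2 :: "l2 => l2 => l2" is "%f g x. f x - g x"
 by (auto simp: l2_eq_def L2_fun_diff)

lift_definition scaleR_l2 :: "real => l2 => l2" is "%c f x. c * f x"
 by (auto simp: l2_eq_def L2_fun_scale)

lift_definition inner_l2 :: "l2 => l2 => real" is "%f g. \<integral>x. f x * g x \<partial>lborel"
 by (rule integral_cong_AE) (auto simp: l2_eq_def L2_fun_def)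

definition norm_l2 :: "l2 => real" where "norm_l2 f = sqrt (inner f f)"
definition dist_l2 :: "l2 => l2 => real" where "dist_l2 f g = norm (f - g)"
definition sgn_l2 :: "l2 => l2" where "sgn_l2 f = inverse (norm f) *R f"
definition uniformity_l2 :: "(l2 \<times> l2) filter" where
 "uniformity_l2 = (INF e\<in>{0<..}. principal {(x, y). dist x y < e})"
definition open_l2 :: "l2 set => bool" where
 "open_l2 U \<longleftrightarrow> (\<forall>x\<in>U. \<forall>\<^sub>F (x', y) in uniformity. x' = x --> y : U)"

instance
proof
 fix f g h :: l2 and c d :: real
 show "f + g + h = f + (g + h)"
  by transfer (auto simp: l2_eq_def L2_fun_add add.assoc)
 show "f + g = g + f"
  by transfer (auto simp: l2_eq_def L2_fun_add add.commute)
 show "0 + f = f"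
  by transfer (auto simp: l2_eq_def)
 show "- f + f = 0"
  by transfer (auto simp: l2_eq_def L2_fun_zero)
 show "f - g = f + - g"
  by transfer (auto simp: l2_eq_def L2_fun_diff)
 show "c *R (f + g) = c *R f + c *R g"
  by transfer (auto simp: l2_eq_def distrib_left intro!: L2_fun_add L2_fun_scale)
 show "(c + d) *R f = c *R f + d *R f"
  by transfer (auto simp: l2_eq_def distrib_right intro!: L2_fun_add L2_fun_scale)
 show "c *R d *R f = (c * d) *R f"
  by transfer (auto simp: l2_eq_def mult.assoc intro!: L2_fun_scale)
 show "1 *R f = f"
  by transfer (auto simp: l2_eq_def)
 show "dist f g = norm (f - g)" by (rule dist_l2_def)
 show "sgn f = inverse (norm f) *R f" by (rule sgn_l2_def)
 show "(uniformity :: (l2 \<times> l2) filter) = (INF e\<in>{0<..}. principal {(x, y). dist x y < e})"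
  by (rule uniformity_l2_def)
 show "open U \<longleftrightarrow> (\<forall>x\<in>U. \<forall>\<^sub>F (x', y) in uniformity. x' = x --> y : U)" for U :: "l2 set"
  by (rule open_l2_def)
 show "inner f g = inner g f"
  by transfer (simp add: mult.commute)
 show "inner (f + g) h = inner f h + inner g h"
  by transfer (auto simp: l2_eq_def distrib_right
    intro!: Bochner_Integration.integral_add L2_fun_mult_integrable)
 show "inner (c *R f) g = c * inner f g"
  by transfer (simp add: mult.assoc)
 show "0 <= inner f f"
  by transfer simp
 show "inner f f = 0 \<longleftrightarrow> f = 0"
 proof transfer
  fix f assume "l2_eq f f"
  then have f: "L2_fun f" by (simp add: l2_eq_def)
  then have "((\<integral>x. f x * f x \<partial>lborel) = 0) = (AE x in lborel. f x * f x = 0)"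
   by (intro integral_nonneg_eq_0_iff_AE) (auto simp: L2_fun_def power2_eq_square)
  then show "((\<integral>x. f x * f x \<partial>lborel) = 0) = l2_eq f (%x. 0)"
   using f by (simp add: l2_eq_def L2_fun_zero)
 qed
 show "norm f = sqrt (inner f f)" by (rule norm_l2_def)
qed

end

lemma toL2_zero: "toL2 (%x. 0) = 0"
 by (simp add: zero_l2.abs_eq)

lemma toL2_add: "L2_fun f ==> L2_fun g ==> toL2 (%x. f x + g x) = toL2 f + toL2 g"
 by (simp add: plus_l2.abs_eq l2_eq_def)

lemma toL2_diff: "L2_fun f ==> L2_fun g ==> toL2 (%x. f x - g x) = toL2 f - toL2 g"
 by (simp add: minus_l2.abs_eq l2_eq_def)

lemma toL2_uminus: "L2_fun f ==> toL2 (%x. - f x) = - toL2 f"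
 by (simp add: uminus_l2.abs_eq l2_eq_def)

lemma toL2_scale: "L2_fun f ==> toL2 (%x. c * f x) = c *R toL2 f"
 by (simp add: scaleR_l2.abs_eq l2_eq_def)

lemma inner_toL2: "L2_fun f ==> L2_fun g ==> inner (toL2 f) (toL2 g) = (\<integral>x. f x * g x \<partial>lborel)"
 by (simp add: inner_l2.abs_eq l2_eq_def)

lemma inner_fn: "inner f g = (\<integral>x. fn f x * fn g x \<partial>lborel)"
 using inner_toL2[of "fn f" "fn g"] by simp

lemma norm_toL2_sq: "L2_fun f ==> (norm (toL2 f))^2 = (\<integral>x. (f x)^2 \<partial>lborel)"
 unfolding power2_norm_eq_inner by (simp add: inner_toL2 power2_eq_square)

lemma nn_integral_L2: "L2_fun f ==> (\<integral>\<^sup>+x. ennreal ((f x)^2) \<partial>lborel) = ennreal ((norm (toL2 f))^2)"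
 by (simp add: norm_toL2_sq nn_integral_eq_integral L2_fun_def)

lemma norm_toL2_le:
 assumes "L2_fun f" "L2_fun g" "!!x. \<bar>f x\<bar> <= \<bar>g x\<bar>"
 shows "norm (toL2 f) <= norm (toL2 g)"
proof -
 have "(norm (toL2 f))^2 <= (norm (toL2 g))^2"
  unfolding norm_toL2_sq[OF assms(1)] norm_toL2_sq[OF assms(2)]
  by (rule integral_mono) (use assms in \<open>auto simp: L2_fun_def abs_le_square_iff\<close>)
 then show ?thesis by (rule power2_le_imp_le) simp
qed

lemma L2_fun_nn_integral:
 assumes "f : borel_measurable borel" "(\<integral>\<^sup>+x. ennreal ((f x)^2) \<partial>lborel) <= ennreal C"
 shows "L2_fun f"
proof -
 have "(\<integral>\<^sup>+x. ennreal ((f x)^2) \<partial>lborel) < \<infinity>"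
  using assms(2) le_less_trans by fastforce
 then show ?thesis
  using assms(1) by (simp add: L2_fun_def integrable_iff_bounded)
qed

text \<open>The nonnegative integral makes sense before \<open>f\<close> is known to be in L2, so
  bounds from Fatou or Tonelli give membership and norm at once.\<close>

lemma norm_toL2_le_nn_integral:
 assumes "f : borel_measurable borel" "(\<integral>\<^sup>+x. ennreal ((f x)^2) \<partial>lborel) <= ennreal (C^2)" "0 <= C"
 shows "norm (toL2 f) <= C"
proof -
 have "ennreal ((norm (toL2 f))^2) <= ennreal (C^2)"
  using nn_integral_L2[OF L2_fun_nn_integral[OF assms(1,2)]] assms(2) by simp
 then have "(norm (toL2 f))^2 <= C^2" by (subst (asm) ennreal_le_iff) auto
 then show ?thesis using assms(3) by (rule power2_le_imp_le)
qed

text \<open>Riesz--Fischer: a rapidly Cauchy sequence converges almost everywhere, and Fatou's lemma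
 identifies the pointwise limit as the limit in the mean.\<close>

instance l2 :: banach
proof
 fix X :: "nat => l2" assume "Cauchy X"
 have "\<exists>M. \<forall>n. \<forall>i\<ge>M n. \<forall>j\<ge>M n. dist (X i) (X j) < (1/4)^n"
  using \<open>Cauchy X\<close> unfolding Cauchy_def by (intro choice) (auto simp del: power_one_over)
 then obtain M where M: "!!n i j. i >= M n ==> j >= M n ==> dist (X i) (X j) < (1/4)^n"
  by blast
 \<comment> \<open>Sums of the thresholds are increasing and dominate each single
   \<open>M n\<close>; along them the sequence is Cauchy at rate \<open>(1/4)^n\<close>.\<close>
 define r where "r n = (\<Sum>i\<le>n. M i)" for n
 have rM: "M n <= r m" if "n <= m" for n m
  unfolding r_def using that by (intro member_le_sum) auto
 define f where "f n = fn (X (r n))" for n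
 have L2f [simp]: "L2_fun (f n)" for n by (simp add: f_def)
 have [measurable]: "f n : borel_measurable borel" for n by (simp add: f_def)
 have nrm: "(\<integral>\<^sup>+x. ennreal ((f m x - f n x)^2) \<partial>lborel) <= ennreal (((1/4)^n)^2)" if "n <= m" for m n
 proof -
  have "norm (toL2 (%x. f m x - f n x)) <= (1/4)^n"
   using M[of n "r m" "r n"] rM that by (simp add: toL2_diff f_def dist_norm)
  then show ?thesis
   by (subst nn_integral_L2) (auto intro!: L2_fun_diff ennreal_leI power_mono)
 qed
 \<comment> \<open>The squared increments have integral at most \<open>16^(-n)\<close>. The weight
   \<open>4^n\<close> keeps the sum finite and turns finiteness at a point into increments below
   \<open>2^(-n)\<close> there.\<close>
 have "(\<integral>\<^sup>+x. (\<Sum>n. ennreal (4^n * (f (Suc n) x - f n x)^2)) \<partial>lborel) < \<infinity>"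
 proof -
  have "(\<integral>\<^sup>+x. (\<Sum>n. ennreal (4^n * (f (Suc n) x - f n x)^2)) \<partial>lborel) =
    (\<Sum>n. (\<integral>\<^sup>+x. ennreal (4^n * (f (Suc n) x - f n x)^2) \<partial>lborel))"
   by (rule nn_integral_suminf) simp
  also have "... <= (\<Sum>n. ennreal ((1/4)^n))"
  proof (rule suminf_le)
   fix n
   have "(\<integral>\<^sup>+x. ennreal (4^n * (f (Suc n) x - f n x)^2) \<partial>lborel) =
     ennreal (4^n) * (\<integral>\<^sup>+x. ennreal ((f (Suc n) x - f n x)^2) \<partial>lborel)"
    by (simp add: ennreal_mult nn_integral_cmult)
   also have "... <= ennreal (4^n) * ennreal (((1/4)^n)^2)"
    by (intro mult_left_mono nrm) auto
   also have "... = ennreal ((1/4)^n)"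
    by (simp add: ennreal_mult[symmetric] power2_eq_square power_divide)
   finally show "(\<integral>\<^sup>+x. ennreal (4^n * (f (Suc n) x - f n x)^2) \<partial>lborel) <= ennreal ((1/4)^n)" .
  qed auto
  also have "... = ennreal (\<Sum>n. (1/4)^n)"
   by (rule suminf_ennreal_eq) (auto intro!: summable_sums summable_geometric)
  finally show ?thesis using le_less_trans by fastforce
 qed
 then have "AE x in lborel. (\<Sum>n. ennreal (4^n * (f (Suc n) x - f n x)^2)) ~= \<infinity>"
  by (intro nn_integral_PInf_AE) auto
 then have ae: "AE x in lborel. convergent (%n. f n x)"
 proof eventually_elim
  case (elim x)
  then have sm: "summable (%n. 4^n * (f (Suc n) x - f n x)^2)"
   by (intro summable_suminf_not_top) auto
  then have "(%n. 4^n * (f (Suc n) x - f n x)^2) >>> 0"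
   by (rule summable_LIMSEQ_zero)
  then have ev: "\<forall>\<^sub>F n in sequentially. 4^n * (f (Suc n) x - f n x)^2 < 1"
   by (rule order_tendstoD) simp
  have "summable (%n. f (Suc n) x - f n x)"
  proof (rule summable_comparison_test_ev)
   show "\<forall>\<^sub>F n in sequentially. norm (f (Suc n) x - f n x) <= (1/2)^n"
    using ev
   proof eventually_elim
    case (elim n)
    then have "(2^n * \<bar>f (Suc n) x - f n x\<bar>)^2 <= 1^2"
     by (simp add: power_mult_distrib power2_eq_square[of "2^n"] flip: power_mult_distrib[of 2 2])
    then have "2^n * \<bar>f (Suc n) x - f n x\<bar> <= 1"
     by (rule power2_le_imp_le) simp
    then show ?case by (simp add: field_simps)
   qed
  qed (auto intro!: summable_geometric)
  then have "convergent (%n. \<Sum>i<n. f (Suc i) x - f i x)"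
   by (simp add: summable_iff_convergent)
  then have "convergent (%n. f n x - f 0 x)"
   by (simp add: sum_lessThan_telescope[of "%i. f i x"])
  then have "convergent (%n. (f n x - f 0 x) + f 0 x)"
   by (intro convergent_add convergent_const)
  then show ?case by simp
 qed
 define F where "F x = lim (%n. f n x)" for x
 have [measurable]: "F : borel_measurable borel"
  unfolding F_def by measurable
 have bound: "(\<integral>\<^sup>+x. ennreal ((F x - f n x)^2) \<partial>lborel) <= ennreal (((1/4)^n)^2)" for n
 proof -
  have "(\<integral>\<^sup>+x. ennreal ((F x - f n x)^2) \<partial>lborel) =
    (\<integral>\<^sup>+x. liminf (%m. ennreal ((f m x - f n x)^2)) \<partial>lborel)"
  proof (rule nn_integral_cong_AE, use ae in eventually_elim)
   fix x assume "convergent (%n. f n x)"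
   then have "(%m. f m x) >>> F x"
    by (simp add: F_def convergent_LIMSEQ_iff)
   then have "(%m. ennreal ((f m x - f n x)^2)) >>> ennreal ((F x - f n x)^2)"
    by (intro tendsto_ennrealI tendsto_intros)
   then show "ennreal ((F x - f n x)^2) = liminf (%m. ennreal ((f m x - f n x)^2))"
    by (intro lim_imp_Liminf[symmetric]) auto
  qed
  also have "... <= liminf (%m. \<integral>\<^sup>+x. ennreal ((f m x - f n x)^2) \<partial>lborel)"
   by (rule nn_integral_liminf) simp
  also have "... <= liminf (%m::nat. ennreal (((1/4)^n)^2))"
   by (rule Liminf_mono) (auto simp: eventually_sequentially intro!: exI[of _ n] nrm)
  finally show ?thesis by (simp add: Liminf_const)
 qed
 have LF: "L2_fun F"
 proof -
  have "L2_fun (%x. (F x - f 0 x) + f 0 x)"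
   by (intro L2_fun_add L2_fun_nn_integral[OF _ bound]) auto
  then show ?thesis by simp
 qed
 have close: "norm (toL2 F - X (r n)) <= (1/4)^n" for n
 proof -
  have "norm (toL2 (%x. F x - f n x)) <= (1/4)^n"
   by (rule norm_toL2_le_nn_integral[OF _ bound]) auto
  then show ?thesis by (simp add: toL2_diff LF) (simp add: f_def)
 qed
 have "X >>> toL2 F"
 proof (rule metric_LIMSEQ_I)
  fix e :: real assume "0 < e"
  then obtain n where n: "(1/4)^n < e / 2"
   using real_arch_pow_inv[of "e/2" "1/4"] by auto
  have "dist (X m) (toL2 F) < e" if "m >= M n" for m
  proof -
   have "dist (X m) (toL2 F) <= dist (X m) (X (r n)) + dist (X (r n)) (toL2 F)"
    by (rule dist_triangle)
   also have "... < e"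
    using M[of n m "r n"] rM[of n n] close[of n] n that by (simp add: dist_norm norm_minus_commute)
   finally show ?thesis .
  qed
  then show "\<exists>no. \<forall>m\<ge>no. dist (X m) (toL2 F) < e" by blast
 qed
 then show "convergent X" by (rule convergentI)
qed

section \<open>Smooth functions and test functions\<close>

text \<open>Every iterated derivative stays in the invariant class \<open>P\<close>, so smoothness
  reduces to one differentiation inside a suitably chosen class.\<close>

lemma smooth_fun_coinduct:
 assumes "P f" "!!g. P g ==> (\<forall>x. g differentiable (at x)) & P (deriv g)"
 shows "smooth_fun f"
proof -
 have "P ((deriv ^^ n) f)" for n
  by (induction n) (use assms in auto)
 then show ?thesis
  using assms(2) by (auto simp: smooth_fun_def)
qed

lemma smooth_fun_deriv: "smooth_fun f ==> smooth_fun (deriv f)"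
 unfolding smooth_fun_def by (metis comp_apply funpow_Suc_right)

lemma smooth_fun_differentiable: "smooth_fun f ==> f differentiable (at x)"
 unfolding smooth_fun_def by (metis funpow_0)

lemma smooth_fun_DERIV: "smooth_fun f ==> (f has_real_derivative deriv f x) (at x)"
 by (metis DERIV_deriv_iff_real_differentiable smooth_fun_differentiable)

lemma smooth_fun_isCont: "smooth_fun f ==> isCont f x"
 by (metis DERIV_isCont smooth_fun_DERIV)

lemma smooth_fun_continuous: "smooth_fun f ==> continuous_on A f"
 by (simp add: continuous_at_imp_continuous_on smooth_fun_isCont)

lemma smooth_funI:
 assumes "!!x. (f has_real_derivative g x) (at x)" "smooth_fun g"
 shows "smooth_fun f"
proof (rule smooth_fun_coinduct[of "%h. h = f | smooth_fun h"])
 have "deriv f = g"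
  using assms(1) DERIV_imp_deriv by blast
 then show "(\<forall>x. h differentiable (at x)) & (deriv h = f | smooth_fun (deriv h))"
  if "h = f | smooth_fun h" for h
  using that assms smooth_fun_deriv smooth_fun_differentiable
  by (metis real_differentiable_def)
qed simp

lemma smooth_fun_const: "smooth_fun (%x. c)"
 by (rule smooth_fun_coinduct[of "%h. \<exists>c. h = (%x. c)"]) auto

lemma smooth_fun_ident: "smooth_fun (%x. x)"
 by (rule smooth_funI[of _ "%x. 1"]) (auto simp: smooth_fun_const)

lemma deriv_real_eqI: "(!!x. (f has_real_derivative g x) (at x)) ==> deriv f = (g :: real => real)"
 using DERIV_imp_deriv by blast

lemma smooth_fun_add:
 assumes "smooth_fun f" "smooth_fun g"
 shows "smooth_fun (%x. f x + g x)"
proof (rule smooth_fun_coinduct[of "%h. \<exists>f g. h = (%x. f x + g x) & smooth_fun f & smooth_fun g"])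
 fix h assume "\<exists>f g. h = (%x. f x + g x) & smooth_fun f & smooth_fun g"
 then obtain f g where h: "h = (%x. f x + g x)" and sm: "smooth_fun f" "smooth_fun g" by blast
 have d: "(h has_real_derivative deriv f x + deriv g x) (at x)" for x
  unfolding h by (intro DERIV_add smooth_fun_DERIV sm)
 then show "(\<forall>x. h differentiable (at x)) &
   (\<exists>f g. deriv h = (%x. f x + g x) & smooth_fun f & smooth_fun g)"
  using deriv_real_eqI[OF d] smooth_fun_deriv[OF sm(1)] smooth_fun_deriv[OF sm(2)]
  by (meson real_differentiable_def)
qed (use assms in blast)

text \<open>Single products are not closed under \<open>deriv\<close>, but finite sums of products
  of smooth functions are; this is the invariant class for \<open>smooth_fun_mult\<close>.\<close>

inductive product_sum :: "(real => real) => bool" where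
 "smooth_fun f ==> smooth_fun g ==> product_sum (%x. f x * g x)"
| "product_sum f ==> product_sum g ==> product_sum (%x. f x + g x)"

lemma product_sum_deriv:
 "product_sum h ==> \<exists>h'. (\<forall>x. (h has_real_derivative h' x) (at x)) & product_sum h'"
proof (induction rule: product_sum.induct)
 case (1 f g)
 show ?case
  by (rule exI[of _ "%x. deriv f x * g x + deriv g x * f x"])
   (auto intro!: DERIV_mult smooth_fun_DERIV 1 product_sum.intros smooth_fun_deriv)
next
 case (2 f g)
 then obtain f' g' where "\<forall>x. (f has_real_derivative f' x) (at x)" "product_sum f'"
  "\<forall>x. (g has_real_derivative g' x) (at x)" "product_sum g'" by blast
 then show ?case
  by (intro exI[of _ "%x. f' x + g' x"]) (auto intro!: DERIV_add product_sum.intros)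
qed

lemma smooth_fun_mult:
 assumes "smooth_fun f" "smooth_fun g"
 shows "smooth_fun (%x. f x * g x)"
proof (rule smooth_fun_coinduct[of product_sum])
 fix h assume "product_sum h"
 then obtain h' where h': "\<forall>x. (h has_real_derivative h' x) (at x)" "product_sum h'"
  using product_sum_deriv by blast
 then show "(\<forall>x. h differentiable (at x)) & product_sum (deriv h)"
  using deriv_real_eqI[of h h'] by (auto simp: real_differentiable_def)
qed (use assms product_sum.intros in blast)

lemma smooth_fun_scale: "smooth_fun f ==> smooth_fun (%x. c * f x)"
 using smooth_fun_mult[OF smooth_fun_const] .

lemma smooth_fun_uminus: "smooth_fun f ==> smooth_fun (%x. - f x)"
 using smooth_fun_scale[of f "-1"] by simp

lemma smooth_fun_diff: "smooth_fun f ==> smooth_fun g ==> smooth_fun (%x. f x - g x)"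
 using smooth_fun_add[OF _ smooth_fun_uminus, of f g] by simp

lemma smooth_fun_affine:
 assumes "smooth_fun f"
 shows "smooth_fun (%x. f (k * x + c))"
proof (rule smooth_fun_coinduct[of "%h. \<exists>f r. h = (%x. r * f (k * x + c)) & smooth_fun f"])
 show "\<exists>f' r. (%x. f (k * x + c)) = (%x. r * f' (k * x + c)) & smooth_fun f'"
  by (rule exI[of _ f], rule exI[of _ 1]) (use assms in simp)
next
 fix h assume "\<exists>f r. h = (%x. r * f (k * x + c)) & smooth_fun f"
 then obtain f r where h: "h = (%x. r * f (k * x + c))" and sm: "smooth_fun f" by blast
 have d: "(h has_real_derivative (r * k) * deriv f (k * x + c)) (at x)" for x
  unfolding h
  by (auto intro!: derivative_eq_intros DERIV_chain2[OF smooth_fun_DERIV[OF sm]])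
 then show "(\<forall>x. h differentiable (at x)) &
   (\<exists>f r. deriv h = (%x. r * f (k * x + c)) & smooth_fun f)"
  using deriv_real_eqI[OF d] smooth_fun_deriv[OF sm] by (meson real_differentiable_def)
qed

lemma smooth_fun_power: "smooth_fun (%x. x ^ n)"
 by (induction n) (auto intro: smooth_fun_const smooth_fun_mult smooth_fun_ident)

lemma smooth_fun_sum: "(!!i. i : I ==> smooth_fun (f i)) ==> smooth_fun (%x. \<Sum>i\<in>I. f i x)"
 by (induction I rule: infinite_finite_induct) (auto intro: smooth_fun_const smooth_fun_add)

section \<open>A smooth bump, a smooth step and smooth cut-off functions\<close>

lemma tendsto_poly_exp:
 fixes p :: "real poly"
 shows "((%y. y ^ k * poly p y * exp (- y)) ---> 0) at_top"
proof (induction p arbitrary: k)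
 case 0
 then show ?case by simp
next
 \<comment> \<open>The arbitrary power \<open>y ^ k\<close> absorbs the factor \<open>y\<close> that
   \<open>pCons\<close> contributes.\<close>
 case (pCons c p)
 have "((%y. c * (y ^ k / exp y) + y ^ Suc k * poly p y * exp (- y)) ---> c * 0 + 0) at_top"
  by (intro tendsto_intros tendsto_power_div_exp_0 pCons.IH)
 then show ?case
  by (simp add: algebra_simps exp_minus divide_inverse)
qed

text \<open>The classical function \<open>exp (- 1 / x)\<close>, flat at 0, with a polynomial in
  \<open>1 / x\<close> carried along to make the class closed under differentiation.\<close>

definition exp_flat :: "real poly => real => real" where
 "exp_flat p x = (if 0 < x then poly p (1 / x) * exp (- (1 / x)) else 0)"

text \<open>For \<open>y = 1 / x\<close> one has d/dx = - y^2 d/dy, whence the factor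
  \<open>[:0, 0, 1:]\<close>. At 0 the difference quotient from the right is again a polynomial in
  \<open>y\<close> times \<open>exp (- y)\<close>.\<close>

lemma exp_flat_deriv:
 "(exp_flat p has_real_derivative exp_flat ([:0, 0, 1:] * (p - pderiv p)) x) (at x)"
proof -
 consider "x < 0" | "x = 0" | "0 < x" by linarith
 then show ?thesis
 proof cases
  case 1
  have "(exp_flat p has_real_derivative 0) (at x)"
   by (rule has_field_derivative_transform_within_open[of "%x. 0" _ x "{..<0}"])
    (use 1 in \<open>auto simp: exp_flat_def\<close>)
  then show ?thesis using 1 by (simp add: exp_flat_def)
 next
  case 2
  have "((%h. exp_flat p h / h) ---> 0) (at_right 0)"
  proof -
   have "((%h. (1/h) ^ 1 * poly p (1/h) * exp (- (1/h))) ---> 0) (at_right (0::real))"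
    by (rule filterlim_compose[OF tendsto_poly_exp, where f = "%h. 1/h"])
     (auto simp: filterlim_inverse_at_top_right simp flip: inverse_eq_divide)
   then show ?thesis
    by (rule Lim_transform_eventually) (auto simp: exp_flat_def eventually_at_filter)
  qed
  moreover have "((%h. exp_flat p h / h) ---> 0) (at_left 0)"
   by (rule Lim_transform_eventually[OF tendsto_const]) (auto simp: exp_flat_def eventually_at_filter)
  ultimately have "((%h. exp_flat p h / h) ---> 0) (at 0)"
   by (simp add: filterlim_split_at)
  then show ?thesis
   using 2 by (simp add: DERIV_def exp_flat_def)
 next
  case 3
  have "((%x. poly p (1 / x) * exp (- (1 / x))) has_real_derivative
    exp_flat ([:0, 0, 1:] * (p - pderiv p)) x) (at x)"
   using 3 by (auto simp: exp_flat_def divide_simps power2_eq_square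
     intro!: derivative_eq_intros DERIV_chain2[OF poly_DERIV]) (simp add: algebra_simps)
  then show ?thesis
   by (rule has_field_derivative_transform_within_open[of _ _ x "{0<..}"])
    (use 3 in \<open>auto simp: exp_flat_def\<close>)
 qed
qed

lemma smooth_fun_exp_flat: "smooth_fun (exp_flat p)"
proof (rule smooth_fun_coinduct[of "%h. \<exists>p. h = exp_flat p"])
 fix h assume "\<exists>p. h = exp_flat p"
 then obtain p where "h = exp_flat p" by blast
 then show "(\<forall>x. h differentiable (at x)) & (\<exists>p. deriv h = exp_flat p)"
  using exp_flat_deriv[of p] deriv_real_eqI[of h] by (metis real_differentiable_def)
qed blast

definition bump :: "real => real" where
 "bump x = exp_flat 1 x * exp_flat 1 (- 1 * x + 1)"

lemma smooth_fun_bump: "smooth_fun bump"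
 unfolding bump_def by (intro smooth_fun_mult smooth_fun_exp_flat smooth_fun_affine)

lemma bump_nonneg: "0 <= bump x"
 by (simp add: bump_def exp_flat_def)

lemma bump_eq_0: "x <= 0 | 1 <= x ==> bump x = 0"
 by (auto simp: bump_def exp_flat_def)

lemma bump_continuous: "continuous_on A bump"
 by (rule smooth_fun_continuous[OF smooth_fun_bump])

text \<open>Besides building cut-offs in space, \<open>step\<close> serves in the time variable: its
  rescaled derivative is a smooth probability density on a short interval to the right of a
  point.\<close>

definition step :: "real => real" where
 "step x = (if x <= 0 then 0 else integral {0..x} bump / integral {0..1} bump)"

lemma bump_integrable: "bump integrable_on {a..b}"
 by (rule integrable_continuous_interval[OF bump_continuous])

lemma bump_integral_pos: "0 < integral {0..1} bump"
proof -
 have "integral {0..1} bump ~= 0"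
 proof
  assume *: "integral {0..1} bump = 0"
  then have "(bump has_integral 0) (cbox 0 1)"
   using bump_integrable[of 0 1] by (auto simp: has_integral_integrable_integral)
  then have "bump (1/2) = 0"
   by (rule has_integral_0_cbox_imp_0[OF bump_continuous bump_nonneg]) auto
  then show False by (simp add: bump_def exp_flat_def)
 qed
 moreover have "0 <= integral {0..1} bump"
  by (rule integral_nonneg) (auto simp: bump_integrable bump_nonneg)
 ultimately show ?thesis by simp
qed

lemma step_le_0: "x <= 0 ==> step x = 0"
 by (simp add: step_def)

lemma step_ge_1: "1 <= x ==> step x = 1"
proof -
 assume x: "1 <= x"
 have "integral {0..x} bump = integral {0..1} bump + integral {1..x} bump"
  using x by (intro Henstock_Kurzweil_Integration.integral_combine[symmetric] bump_integrable) auto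
 also have "integral {1..x} bump = integral {1..x} (%_. 0)"
  by (rule integral_cong) (auto simp: bump_eq_0)
 finally show ?thesis
  using x bump_integral_pos by (simp add: step_def)
qed

lemma step_DERIV: "(step has_real_derivative bump x / integral {0..1} bump) (at x)"
proof -
 \<comment> \<open>A base point to the left of both \<open>x\<close> and the support of the bump
   makes \<open>step\<close> a single integral in a full neighbourhood of \<open>x\<close>, so the
   case distinction at 0 disappears.\<close>
 define a where "a = min x 0 - 1"
 have "(bump has_integral 0) {a..0}"
  by (rule has_integral_is_0) (auto simp: bump_eq_0)
 then have z: "integral {a..0} bump = 0" by (rule integral_unique)
 have eq: "step y = integral {a..y} bump / integral {0..1} bump" if "a <= y" for y
 proof (cases "y <= 0")
  case True
  have "(bump has_integral 0) {a..y}"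
   by (rule has_integral_is_0) (use True in \<open>auto simp: bump_eq_0\<close>)
  then show ?thesis using True by (simp add: step_def integral_unique)
 next
  case False
  then have "integral {a..y} bump = integral {a..0} bump + integral {0..y} bump"
   by (intro Henstock_Kurzweil_Integration.integral_combine[symmetric] bump_integrable)
    (auto simp: a_def)
  then show ?thesis using False z by (simp add: step_def)
 qed
 have "((%y. integral {a..y} bump) has_real_derivative bump x) (at x within {a..x+1})"
  by (rule integral_has_real_derivative[OF bump_continuous]) (auto simp: a_def)
 then have "((%y. integral {a..y} bump) has_real_derivative bump x) (at x)"
  by (subst (asm) at_within_interior) (auto simp: a_def)
 then have "((%y. integral {a..y} bump / integral {0..1} bump) has_real_derivative
   bump x / integral {0..1} bump) (at x)"
  by (rule DERIV_cdivide)
 then show ?thesis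
  by (rule has_field_derivative_transform_within_open[of _ _ x "{a<..}"])
   (auto simp: a_def eq)
qed

lemma smooth_fun_step: "smooth_fun step"
 using smooth_funI[OF step_DERIV] smooth_fun_scale[OF smooth_fun_bump, of "1 / integral {0..1} bump"]
 by simp

lemma deriv_step: "deriv step x = bump x / integral {0..1} bump"
 using step_DERIV by (rule DERIV_imp_deriv)

lemma deriv_step_nonneg: "0 <= deriv step x"
 using bump_integral_pos by (simp add: deriv_step bump_nonneg)

lemma step_mono: "x <= y ==> step x <= step y"
 by (rule DERIV_nonneg_imp_nondecreasing)
  (use smooth_fun_DERIV[OF smooth_fun_step] deriv_step_nonneg in blast)+

lemma step_range: "0 <= step x" "step x <= 1"
 using step_mono[of "min x 0" x] step_mono[of x "max x 1"] by (auto simp: step_le_0 step_ge_1)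

definition cutoff :: "real => real => real" where
 "cutoff n x = step (x + n + 1) * step (n + 1 - x)"

lemma smooth_fun_cutoff: "smooth_fun (cutoff n)"
proof -
 have "smooth_fun (%x. step (1 * x + (n + 1)) * step (- 1 * x + (n + 1)))"
  by (intro smooth_fun_mult smooth_fun_affine smooth_fun_step)
 then show ?thesis by (simp add: cutoff_def[abs_def] algebra_simps)
qed

lemma cutoff_eq_1: "\<bar>x\<bar> <= n ==> cutoff n x = 1"
 by (auto simp: cutoff_def step_ge_1)

lemma cutoff_eq_0: "n + 1 <= \<bar>x\<bar> ==> cutoff n x = 0"
 by (auto simp: cutoff_def step_le_0 abs_real_def split: if_splits)

lemma cutoff_range: "0 <= cutoff n x" "cutoff n x <= 1"
 by (auto simp: cutoff_def step_range mult_le_one)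

section \<open>Test functions and their density in L2\<close>

lemma test_fun_cutoff: "test_fun (cutoff n)"
 unfolding test_fun_def using smooth_fun_cutoff cutoff_eq_0 less_imp_le by blast

lemma test_fun_smooth: "test_fun ph ==> smooth_fun ph"
 by (simp add: test_fun_def)

lemma test_fun_zero: "test_fun (%x. 0)"
 by (simp add: test_fun_def smooth_fun_const)

lemma test_fun_add: "test_fun ph ==> test_fun th ==> test_fun (%x. ph x + th x)"
 unfolding test_fun_def by (auto intro!: smooth_fun_add) (metis add.right_neutral max_less_iff_conj)

lemma test_fun_mult: "test_fun ph ==> smooth_fun h ==> test_fun (%x. h x * ph x)"
 unfolding test_fun_def by (auto intro!: smooth_fun_mult)

lemma test_fun_scale: "test_fun ph ==> test_fun (%x. c * ph x)"
 by (rule test_fun_mult[OF _ smooth_fun_const])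

lemma test_fun_uminus: "test_fun ph ==> test_fun (%x. - ph x)"
 using test_fun_scale[of ph "-1"] by simp

lemma test_fun_diff: "test_fun ph ==> test_fun th ==> test_fun (%x. ph x - th x)"
 using test_fun_add[OF _ test_fun_uminus] by force

lemma deriv_eq_0_outside:
 assumes "!!x. R < \<bar>x\<bar> ==> ph x = (0::real)" "R < \<bar>x\<bar>"
 shows "deriv ph x = 0"
proof (rule DERIV_imp_deriv)
 have "open {x. R < \<bar>x\<bar>}"
  by (intro open_Collect_less continuous_intros)
 then show "(ph has_real_derivative 0) (at x)"
  using has_field_derivative_transform_within_open[of "%x. 0" 0 x "{x. R < \<bar>x\<bar>}" ph] assms by auto
qed

lemma test_fun_deriv: "test_fun ph ==> test_fun (deriv ph)"
 unfolding test_fun_def using smooth_fun_deriv deriv_eq_0_outside by metis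

lemma test_fun_translate: "test_fun ph ==> test_fun (%x. ph (x + c))"
proof -
 assume ph: "test_fun ph"
 then obtain R where R: "!!x. R < \<bar>x\<bar> ==> ph x = 0" by (auto simp: test_fun_def)
 have "smooth_fun (%x. ph (1 * x + c))"
  using ph by (intro smooth_fun_affine) (simp add: test_fun_def)
 moreover have "ph (x + c) = 0" if "R + \<bar>c\<bar> < \<bar>x\<bar>" for x
  by (rule R) (use that in linarith)
 ultimately show ?thesis unfolding test_fun_def by auto
qed

lemma continuous_compact_support_integrable:
 fixes f :: "real => real"
 assumes "continuous_on UNIV f" "!!x. R < \<bar>x\<bar> ==> f x = 0"
 shows "integrable lborel f"
proof -
 have "integrable lborel (%x. indicator {-R..R} x *R f x)"
  using borel_integrable_atLeastAtMost'[of "-R" R f] assms(1)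
  by (simp add: set_integrable_def continuous_on_subset)
 also have "(%x. indicator {-R..R} x *R f x) = f"
 proof
  fix x
  show "indicator {-R..R} x *R f x = f x"
   using assms(2)[of x] by (cases "R < \<bar>x\<bar>") (auto simp: indicator_def)
 qed
 finally show ?thesis .
qed

lemma L2_fun_continuous_compact_support:
 assumes "continuous_on UNIV f" "!!x. R < \<bar>x\<bar> ==> f x = 0"
 shows "L2_fun f"
 unfolding L2_fun_def
proof
 show "f : borel_measurable lborel"
  using assms(1) borel_measurable_continuous_onI by auto
 show "integrable lborel (%x. (f x)^2)"
  by (rule continuous_compact_support_integrable[of _ R])
   (use assms in \<open>auto intro!: continuous_intros\<close>)
qed

lemma L2_fun_indicator: "L2_fun (indicator {a..b::real})"
proof -
 have "(%x. (indicator {a..b} x :: real)^2) = indicator {a..b}"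
  by (auto simp: indicator_def fun_eq_iff)
 then show ?thesis
  by (auto simp: L2_fun_def emeasure_lborel_Icc_eq intro!: integrable_real_indicator)
qed

lemma L2_fun_test: "test_fun ph ==> L2_fun ph"
 unfolding test_fun_def using L2_fun_continuous_compact_support smooth_fun_continuous by blast

lemma L2_dominated_convergence:
 assumes "!!n. L2_fun (f n)" "L2_fun g" "L2_fun w"
  and "AE x in lborel. (%n. f n x) >>> g x"
  and "!!n. AE x in lborel. \<bar>f n x - g x\<bar> <= w x"
 shows "(%n. toL2 (f n)) >>> toL2 g"
proof -
 have "(%n. \<integral>x. (f n x - g x)^2 \<partial>lborel) >>> (\<integral>x. 0 \<partial>(lborel :: real measure))"
 proof (rule integral_dominated_convergence[where w = "%x. (w x)^2"])
  show "integrable lborel (%x. (w x)^2)" using assms(3) by (simp add: L2_fun_def)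
  show "AE x in lborel. (%n. (f n x - g x)^2) >>> 0"
   using assms(4)
  proof eventually_elim
   case (elim x)
   then have "(%n. (f n x - g x)^2) >>> (g x - g x)^2" by (intro tendsto_intros)
   then show ?case by simp
  qed
  show "AE x in lborel. norm ((f n x - g x)^2) <= (w x)^2" for n
   using assms(5)[of n] by eventually_elim (metis abs_le_square_iff abs_ge_zero abs_of_nonneg
     norm_power order_trans power2_abs real_norm_def)
 qed (use assms L2_fun_measurable in auto)
 then have "(%n. (norm (toL2 (f n) - toL2 g))^2) >>> 0"
  using assms by (simp add: norm_toL2_sq L2_fun_diff flip: toL2_diff)
 then have "(%n. sqrt ((norm (toL2 (f n) - toL2 g))^2)) >>> sqrt 0"
  by (rule tendsto_real_sqrt)
 then show ?thesis
  by (simp add: tendsto_norm_zero_iff Lim_null[of _ "toL2 g"])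
qed

text \<open>A square integrable function is truncated, then approximated almost everywhere by continuous
 functions, and these uniformly by polynomials times a cut-off.\<close>

lemma test_fun_approx_continuous:
 fixes K :: real
 assumes "continuous_on UNIV h" "!!x. K + 1 <= \<bar>x\<bar> ==> h x = 0" "0 <= K" "0 < e"
 shows "\<exists>ph. test_fun ph & norm (toL2 h - toL2 ph) < e"
proof -
 \<comment> \<open>The error is supported in an interval of length \<open>2 * K + 4\<close>; with
   this uniform accuracy its L2 norm stays below \<open>e\<close>.\<close>
 define d where "d = e / (2 * (2 * K + 4))"
 have d: "0 < d" using assms by (simp add: d_def)
 obtain p where p: "real_polynomial_function p" "!!x. x : {-(K+2)..K+2} ==> \<bar>h x - p x\<bar> < d"
  using Stone_Weierstrass_real_polynomial_function[of "{-(K+2)..K+2}" h d] assms(1) d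
  by (metis compact_Icc continuous_on_subset top_greatest)
 have "smooth_fun p"
  using p(1) by (auto simp: real_polynomial_function_iff_sum
    intro!: smooth_fun_sum smooth_fun_scale smooth_fun_power)
 define ph where "ph x = p x * cutoff (K + 1) x" for x
 have ph: "test_fun ph"
  unfolding ph_def by (rule test_fun_mult[OF test_fun_cutoff \<open>smooth_fun p\<close>])
 have Lh: "L2_fun h"
  by (rule L2_fun_continuous_compact_support[of _ "K+1"]) (use assms in auto)
 have bound: "\<bar>h x - ph x\<bar> <= d * indicator {-(K+2)..K+2} x" for x
 proof (cases "\<bar>x\<bar> <= K + 2")
  case True
  have "h x = h x * cutoff (K + 1) x"
   using assms(2)[of x] cutoff_eq_1[of x "K+1"] by (cases "K + 1 <= \<bar>x\<bar>") auto
  then have "h x - ph x = (h x - p x) * cutoff (K + 1) x"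
   unfolding ph_def left_diff_distrib by linarith
  then have "\<bar>h x - ph x\<bar> = \<bar>h x - p x\<bar> * cutoff (K + 1) x"
   using cutoff_range(1)[of "K+1" x] by (simp add: abs_mult)
  also have "... <= d * 1"
   using p(2)[of x] True cutoff_range d by (intro mult_mono) (auto simp: abs_le_iff)
  finally show ?thesis using True by (auto simp: indicator_def)
 next
  case False
  then show ?thesis using assms(2)[of x] cutoff_eq_0[of "K+1" x] d by (auto simp: ph_def indicator_def)
 qed
 have "(norm (toL2 h - toL2 ph))^2 = (\<integral>x. (h x - ph x)^2 \<partial>lborel)"
  using Lh ph by (simp add: norm_toL2_sq L2_fun_diff L2_fun_test flip: toL2_diff)
 also have "... <= (\<integral>x. d^2 * indicator {-(K+2)..K+2} x \<partial>lborel)"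
 proof (rule integral_mono)
  show "integrable lborel (%x. (h x - ph x)^2)"
   using L2_fun_diff[OF Lh L2_fun_test[OF ph]] by (simp add: L2_fun_def)
  show "(h x - ph x)^2 <= d^2 * indicator {-(K+2)..K+2} x" for x
   using power_mono[OF bound[of x], of 2] by (auto simp: indicator_def split: if_splits)
 qed (use assms in auto)
 also have "... = d^2 * (2 * K + 4)" using assms by simp
 also have "... < e^2"
 proof -
  have "(e / (2 * q))^2 * q = e^2 / (4 * q)" if "0 < q" for q
   using that by (simp add: power2_eq_square field_simps)
  from this[of "2 * K + 4"] have "d^2 * (2 * K + 4) = e^2 / (4 * (2 * K + 4))"
   using assms by (simp add: d_def)
  also have "... < e^2 / 1" using assms by (intro divide_strict_left_mono) auto
  finally show ?thesis by simp
 qed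
 finally have "norm (toL2 h - toL2 ph) < e"
  using assms(4) by (simp add: power_less_imp_less_base)
 then show ?thesis using ph by blast
qed

lemma test_fun_dense:
 assumes "0 < e"
 shows "\<exists>ph. test_fun ph & norm (f - toL2 ph) < e"
proof -
 define clamp' where "clamp' K s = max (-K) (min K s)" for K s :: real
 define F where "F n x = indicator {- real n..real n} x * clamp' (real n) (fn f x)" for n x
 have [measurable]: "F n : borel_measurable borel" for n
  unfolding F_def clamp'_def by measurable
 have Fle: "\<bar>F n x\<bar> <= \<bar>fn f x\<bar>" for n x
  by (auto simp: F_def clamp'_def indicator_def)
 have LF: "L2_fun (F n)" for n
  by (rule L2_fun_bound[of "fn f"]) (use Fle in auto)
 have "(%n. toL2 (F n)) >>> toL2 (fn f)"
 proof (rule L2_dominated_convergence[of _ _ "%x. \<bar>fn f x\<bar>"])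
  show "L2_fun (%x. \<bar>fn f x\<bar>)"
   by (rule L2_fun_bound[of "fn f"]) auto
  show "AE x in lborel. (%n. F n x) >>> fn f x"
  proof (rule AE_I2)
   fix x
   obtain N :: nat where N: "real N >= \<bar>x\<bar> + \<bar>fn f x\<bar>" using real_arch_simple by blast
   have "F n x = fn f x" if "n >= N" for n
    using that N by (auto simp: F_def clamp'_def indicator_def)
   then show "(%n. F n x) >>> fn f x"
    by (intro tendsto_eventually) (auto simp: eventually_sequentially)
  qed
  show "AE x in lborel. \<bar>F n x - fn f x\<bar> <= \<bar>fn f x\<bar>" for n
   by (rule AE_I2) (auto simp: F_def clamp'_def indicator_def)
 qed (use LF in auto)
 then obtain n where n: "norm (toL2 (F n) - f) < e / 3"
  using assms LIMSEQ_D[of "%n. toL2 (F n)" f "e/3"] by auto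
 define K where "K = real n"
 have "(F n) measurable_on UNIV"
  by (rule lebesgue_measurable_imp_measurable_on) (auto intro: measurable_completion)
 then obtain N g where N: "negligible N" and g: "!!k. continuous_on UNIV (g k)"
  and lim: "!!x. x \<notin> N ==> (%k. g k x) >>> F n x"
  unfolding measurable_on_def by auto
 \<comment> \<open>The approximants \<open>g k\<close> come without any bound. Clamping and cutting
   off supplies the dominating function, and does not affect the limit because \<open>F n\<close>
   already has values in \<open>{-K..K}\<close> and support in the same interval.\<close>
 define G where "G k x = clamp' K (g k x) * cutoff K x" for k x
 have contG: "continuous_on UNIV (G k)" for k
  unfolding G_def clamp'_def
  by (intro continuous_intros g smooth_fun_continuous smooth_fun_cutoff)
 have G0: "G k x = 0" if "K + 1 <= \<bar>x\<bar>" for k x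
  using cutoff_eq_0[OF that] by (simp add: G_def)
 have LG: "L2_fun (G k)" for k
  by (rule L2_fun_continuous_compact_support[of _ "K+1"]) (use contG G0 in auto)
 have "(%k. toL2 (G k)) >>> toL2 (F n)"
 proof (rule L2_dominated_convergence[of _ _ "%x. (2 * K) * indicator {-(K+1)..K+1} x"])
  show "L2_fun (%x. (2 * K) * indicator {-(K+1)..K+1} x)"
   by (rule L2_fun_scale[OF L2_fun_indicator])
  have "AE x in lborel. x \<notin> N"
   using AE_not_in[of N lebesgue] N by (simp add: negligible_iff_null_sets AE_completion_iff)
  then show "AE x in lborel. (%k. G k x) >>> F n x"
  proof eventually_elim
   case (elim x)
   have "(%k. G k x) >>> clamp' K (F n x) * cutoff K x"
    unfolding G_def clamp'_def by (intro tendsto_intros lim elim)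
   moreover have "clamp' K (F n x) * cutoff K x = F n x"
    using cutoff_eq_1[of x K] by (auto simp: F_def clamp'_def K_def indicator_def)
   ultimately show ?case by simp
  qed
  show "AE x in lborel. \<bar>G k x - F n x\<bar> <= (2 * K) * indicator {-(K+1)..K+1} x" for k
  proof (rule AE_I2)
   fix x
   have "\<bar>clamp' K (g k x)\<bar> * cutoff K x <= K * 1"
    using cutoff_range[of K x] by (intro mult_mono) (auto simp: clamp'_def K_def)
   then have "\<bar>G k x\<bar> <= K" using cutoff_range[of K x] by (simp add: G_def abs_mult)
   moreover have "\<bar>F n x\<bar> <= K" by (auto simp: F_def clamp'_def indicator_def K_def)
   moreover have "G k x = 0 & F n x = 0" if "\<bar>x\<bar> > K + 1"
    using that G0[of x k] by (auto simp: F_def indicator_def K_def)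
   ultimately show "\<bar>G k x - F n x\<bar> <= (2 * K) * indicator {-(K+1)..K+1} x"
    by (cases "\<bar>x\<bar> > K + 1") (auto simp: indicator_def)
  qed
 qed (use LF LG in auto)
 then obtain k where k: "norm (toL2 (G k) - toL2 (F n)) < e / 3"
  using assms LIMSEQ_D[of "%k. toL2 (G k)" "toL2 (F n)" "e/3"] by auto
 obtain ph where ph: "test_fun ph" "norm (toL2 (G k) - toL2 ph) < e / 3"
  using test_fun_approx_continuous[of "G k" K "e/3"] contG G0 assms by (auto simp: K_def)
 have "norm (f - toL2 ph) < e"
  using n k ph(2) norm_triangle_le[of "f - toL2 (F n)" "toL2 (F n) - toL2 (G k)" "2*e/3"]
   norm_triangle_lt[of "f - toL2 (G k)" "toL2 (G k) - toL2 ph" e]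
  by (simp add: norm_minus_commute)
 then show ?thesis using ph(1) by blast
qed

lemma test_fun_sequence:
 obtains ph where "!!n::nat. test_fun (ph n)" "(%n. toL2 (ph n)) >>> f"
proof -
 have "\<forall>n. \<exists>ph. test_fun ph & norm (f - toL2 ph) < inverse (real (Suc n))"
  using test_fun_dense by simp
 then obtain ph where ph: "!!n. test_fun (ph n)" "!!n. norm (f - toL2 (ph n)) < inverse (real (Suc n))"
  by metis
 have "(%n. toL2 (ph n) - f) >>> 0"
  by (rule Lim_null_comparison[OF _ LIMSEQ_inverse_real_of_nat])
   (use ph(2) in \<open>auto simp: norm_minus_commute intro!: always_eventually less_imp_le\<close>)
 then have "(%n. toL2 (ph n)) >>> f" by (simp add: LIM_zero_iff)
 then show ?thesis using ph(1) that by blast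
qed

lemma test_fun_orthogonal_eq_0:
 assumes "!!ph. test_fun ph ==> inner f (toL2 ph) = 0"
 shows "f = 0"
proof (rule ccontr)
 assume "f ~= 0"
 then obtain ph where ph: "test_fun ph" "norm (f - toL2 ph) < norm f"
  using test_fun_dense[of "norm f" f] by auto
 have "(norm f)^2 = inner f (f - toL2 ph)"
  using assms[OF ph(1)] by (simp add: inner_diff_right power2_norm_eq_inner)
 also have "... <= norm f * norm (f - toL2 ph)" by (rule norm_cauchy_schwarz)
 also have "... < norm f * norm f" using ph \<open>f ~= 0\<close> by (intro mult_strict_left_mono) auto
 finally show False by (simp add: power2_eq_square)
qed

section \<open>Translations, reflections and the resolvent kernel\<close>

lemma L2_fun_affine:
 assumes "L2_fun f" "c ~= 0"
 shows "L2_fun (%x. f (s + c * x))"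
proof -
 have "(%x. f (s + c * x)) : borel_measurable borel"
  using L2_fun_measurable[OF assms(1)] by measurable
 then show ?thesis
  using assms lborel_integrable_real_affine[of "%x. (f x)^2" c s] by (simp add: L2_fun_def)
qed

text \<open>For \<open>c = 0\<close> the composition would evaluate at one point and not respect
  almost everywhere equality; the value 0 makes the lifting total. Translations and reflection are
  the cases \<open>c = 1\<close> and \<open>c = - 1\<close>.\<close>

lift_definition affine_l2 :: "real => real => l2 => l2" is
 "%s c f x. if c = 0 then 0 else f (s + c * x)"
proof -
 fix s c :: real and f g :: "real => real"
 assume fg: "l2_eq f g"
 have [measurable]: "f : borel_measurable borel" "g : borel_measurable borel"
  using fg by (auto simp: l2_eq_def L2_fun_def)
 have "AE x in lborel. f (s + c * x) = g (s + c * x)" if "c ~= 0"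
  using fg by (intro AE_borel_affine[OF that, of "%x. f x = g x"]) (auto simp: l2_eq_def)
 then show "l2_eq (%x. if c = 0 then 0 else f (s + c * x)) (%x. if c = 0 then 0 else g (s + c * x))"
  using fg by (cases "c = 0") (auto simp: l2_eq_def L2_fun_zero L2_fun_affine)
qed

lemma affine_l2_toL2: "L2_fun f ==> c ~= 0 ==> affine_l2 s c (toL2 f) = toL2 (%x. f (s + c * x))"
 by (simp add: affine_l2.abs_eq l2_eq_def)

lemma inner_affine_l2:
 assumes "\<bar>c\<bar> = 1"
 shows "inner (affine_l2 s c f) (affine_l2 s c g) = inner f g"
proof -
 have c: "c ~= 0" using assms by auto
 have "inner (affine_l2 s c (toL2 (fn f))) (affine_l2 s c (toL2 (fn g))) =
   (\<integral>x. fn f (s + c * x) * fn g (s + c * x) \<partial>lborel)"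
  using c by (subst (1 2) affine_l2_toL2) (auto simp: inner_toL2 L2_fun_affine)
 also have "... = (\<integral>x. fn f x * fn g x \<partial>lborel)"
  using assms c lborel_integral_real_affine[of c "%x. fn f x * fn g x" s] by simp
 finally show ?thesis by (simp add: inner_fn)
qed

lemma norm_affine_l2: "\<bar>c\<bar> = 1 ==> norm (affine_l2 s c f) = norm f"
 by (simp add: norm_eq_sqrt_inner inner_affine_l2)

lemma bounded_linear_affine_l2:
 assumes "\<bar>c\<bar> = 1"
 shows "bounded_linear (affine_l2 s c)"
proof -
 have c: "c ~= 0" using assms by auto
 show ?thesis
 proof
  fix f g :: l2 and r :: real
  have "affine_l2 s c (toL2 (fn f) + toL2 (fn g)) =
    affine_l2 s c (toL2 (fn f)) + affine_l2 s c (toL2 (fn g))"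
   using c by (simp add: affine_l2_toL2 L2_fun_add L2_fun_affine flip: toL2_add del: toL2_fn)
  then show "affine_l2 s c (f + g) = affine_l2 s c f + affine_l2 s c g" by simp
  have "affine_l2 s c (r *R toL2 (fn f)) = r *R affine_l2 s c (toL2 (fn f))"
   using c by (simp add: affine_l2_toL2 L2_fun_scale L2_fun_affine flip: toL2_scale del: toL2_fn)
  then show "affine_l2 s c (r *R f) = r *R affine_l2 s c f" by simp
  show "\<exists>K. \<forall>x. norm (affine_l2 s c x) <= norm x * K"
   by (rule exI[of _ 1]) (simp add: norm_affine_l2[OF assms])
 qed
qed

definition tr :: "real => l2 => l2" where "tr s = affine_l2 s 1"
definition rfl :: "l2 => l2" where "rfl = affine_l2 0 (-1)"

lemma tr_toL2: "L2_fun f ==> tr s (toL2 f) = toL2 (%x. f (x + s))"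
 by (simp add: tr_def affine_l2_toL2 add.commute)

lemma rfl_toL2: "L2_fun f ==> rfl (toL2 f) = toL2 (%x. f (- x))"
 by (simp add: rfl_def affine_l2_toL2)

lemma L2_fun_translate: "L2_fun f ==> L2_fun (%x. f (x + s))"
 using L2_fun_affine[of f 1 s] by (simp add: add.commute)

lemma L2_fun_reflect: "L2_fun f ==> L2_fun (%x. f (- x))"
 using L2_fun_affine[of f "-1" 0] by simp

lemma bounded_linear_tr: "bounded_linear (tr s)"
 unfolding tr_def by (rule bounded_linear_affine_l2) simp

lemma bounded_linear_rfl: "bounded_linear rfl"
 unfolding rfl_def by (rule bounded_linear_affine_l2) simp

lemma norm_tr [simp]: "norm (tr s f) = norm f"
 by (simp add: tr_def norm_affine_l2)

lemma inner_tr [simp]: "inner (tr s f) (tr s g) = inner f g"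
 by (simp add: tr_def inner_affine_l2)

lemma inner_rfl [simp]: "inner (rfl f) (rfl g) = inner f g"
 by (simp add: rfl_def inner_affine_l2)

lemma tr_tr: "tr s (tr r f) = tr (s + r) f"
proof -
 have "tr s (tr r (toL2 (fn f))) = tr (s + r) (toL2 (fn f))"
  by (simp add: tr_toL2 L2_fun_translate add.assoc add.commute[of r] del: toL2_fn)
 then show ?thesis by simp
qed

lemma tr_0 [simp]: "tr 0 f = f"
 using tr_toL2[of "fn f" 0] by simp

lemma rfl_rfl [simp]: "rfl (rfl f) = f"
proof -
 have "rfl (rfl (toL2 (fn f))) = toL2 (fn f)"
  by (simp add: rfl_toL2 L2_fun_reflect del: toL2_fn)
 then show ?thesis by simp
qed

lemma inner_tr_left: "inner (tr s f) g = inner f (tr (- s) g)"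
 by (metis add.left_inverse inner_tr tr_0 tr_tr)

lemma inner_rfl_left: "inner (rfl f) g = inner f (rfl g)"
 by (metis inner_rfl rfl_rfl)

text \<open>The Green function of 1 - d/dx that is supported to the right of \<open>x\<close> and
  decays there.\<close>

definition kern :: "real => real => real" where
 "kern x s = indicator {x..} s * exp (x - s)"

lemma kern_measurable [measurable]: "kern x : borel_measurable borel"
 unfolding kern_def by measurable

lemma kern_measurable_pair [measurable]:
 "(%p. kern (fst p) (snd p)) : borel_measurable (lborel \<Otimes>\<^sub>M lborel)"
proof -
 have "(%p::real\<times>real. indicator {p. fst p <= snd p} p * exp (fst p - snd p))
   : borel_measurable (lborel \<Otimes>\<^sub>M lborel)"
  by measurable
 then show ?thesis by (simp add: kern_def indicator_def cong: if_cong)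
qed

lemma nn_integral_exp_half_line:
 assumes "0 < k"
 shows "(\<integral>\<^sup>+s. ennreal (exp (k * (x - s))) * indicator {x..} s \<partial>lborel) = ennreal (1 / k)"
proof -
 have lim: "((%s. - exp (k * (x - s)) / k) ---> - 0 / k) at_top"
 proof (intro tendsto_divide tendsto_minus tendsto_const)
  have "filterlim (%s. k * (s - x)) at_top at_top"
   using filterlim_tendsto_pos_mult_at_top[OF tendsto_const assms
     filterlim_tendsto_add_at_top[OF tendsto_const filterlim_ident], of "- x"] by simp
  then have "((%s. exp (- (k * (s - x)))) ---> 0) at_top"
   by (intro filterlim_compose[OF exp_at_bot] filterlim_uminus_at_top[THEN iffD1]) simp
  then show "((%s. exp (k * (x - s))) ---> 0) at_top"
   by (simp add: algebra_simps)
 qed (use assms in auto)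
 have "(\<integral>\<^sup>+s. ennreal (exp (k * (x - s))) * indicator {x..} s \<partial>lborel) =
   ennreal (- 0 / k - (- exp (k * (x - x)) / k))"
  by (rule nn_integral_FTC_atLeast[OF _ _ _ lim])
   (use assms in \<open>auto intro!: derivative_eq_intros simp: field_simps\<close>)
 then show ?thesis by simp
qed

lemma L2_fun_kern: "L2_fun (kern x)" and norm_kern: "norm (toL2 (kern x)) <= 1"
proof -
 have *: "(\<integral>\<^sup>+s. ennreal ((kern x s)^2) \<partial>lborel) = ennreal (1/2)"
 proof -
  have "(\<integral>\<^sup>+s. ennreal ((kern x s)^2) \<partial>lborel) =
    (\<integral>\<^sup>+s. ennreal (exp (2 * (x - s))) * indicator {x..} s \<partial>lborel)"
   by (rule nn_integral_cong)
    (auto simp: kern_def indicator_def power2_eq_square exp_double algebra_simps simp flip: exp_add)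
  then show ?thesis using nn_integral_exp_half_line[of 2 x] by simp
 qed
 show "L2_fun (kern x)"
  by (rule L2_fun_nn_integral[of _ "1/2"]) (use * in auto)
 show "norm (toL2 (kern x)) <= 1"
 proof (rule norm_toL2_le_nn_integral)
  show "(\<integral>\<^sup>+s. ennreal ((kern x s)^2) \<partial>lborel) <= ennreal (1^2)"
   unfolding * by (rule ennreal_leI) simp
 qed auto
qed

text \<open>\<open>Kp g\<close> is the continuous solution in \<open>L^2\<close> of \<open>v - v' = g\<close>, so that \<open>g \<mapsto> Kp g\<close> identifies
 \<open>L^2\<close> with \<open>H\<^sup>1\<close>; the identification is isometric because \<open>v\<close> and \<open>v'\<close> are orthogonal.\<close>

definition Kp :: "l2 => real => real" where
 "Kp g x = inner (toL2 (kern x)) g"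

lemma Kp_add: "Kp (f + g) x = Kp f x + Kp g x"
 by (simp add: Kp_def inner_add_right)

lemma Kp_diff: "Kp (f - g) x = Kp f x - Kp g x"
 by (simp add: Kp_def inner_diff_right)

lemma Kp_scaleR: "Kp (c *R f) x = c * Kp f x"
 by (simp add: Kp_def)

lemma Kp_zero [simp]: "Kp 0 x = 0"
 by (simp add: Kp_def)

lemma abs_Kp_le: "\<bar>Kp g x\<bar> <= norm g"
proof -
 have "\<bar>Kp g x\<bar> <= norm (toL2 (kern x)) * norm g"
  unfolding Kp_def by (rule Cauchy_Schwarz_ineq2)
 also have "... <= 1 * norm g"
  by (intro mult_right_mono norm_kern) simp
 finally show ?thesis by simp
qed

lemma Kp_eq_integral: "Kp g x = (\<integral>s. kern x s * fn g s \<partial>lborel)"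
 using inner_toL2[OF L2_fun_kern, of "fn g" x] by (simp add: Kp_def)

lemma Kp_toL2: "L2_fun f ==> Kp (toL2 f) x = (\<integral>s. kern x s * f s \<partial>lborel)"
 by (simp add: Kp_def inner_toL2 L2_fun_kern)

lemma Kp_test_DERIV:
 assumes "continuous_on UNIV f" "!!x. R < \<bar>x\<bar> ==> f x = 0"
 shows "(Kp (toL2 f) has_real_derivative Kp (toL2 f) x - f x) (at x)"
proof -
 \<comment> \<open>Beyond the support and beyond \<open>x\<close>: for arguments near
   \<open>x\<close> the integral runs up to the fixed end \<open>b\<close>, and only its lower end
   varies.\<close>
 define b where "b = max R x + 2"
 have Lf: "L2_fun f" by (rule L2_fun_continuous_compact_support[OF assms])
 have eq: "Kp (toL2 f) y = exp y * integral {y..b} (%s. exp (- s) * f s)" if "y <= b" for y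
 proof -
  have "Kp (toL2 f) y = (\<integral>s. indicator {y..b} s *R (exp y * (exp (- s) * f s)) \<partial>lborel)"
   unfolding Kp_toL2[OF Lf]
   by (rule Bochner_Integration.integral_cong)
    (use assms(2) in \<open>auto simp: kern_def indicator_def exp_diff exp_minus divide_inverse b_def\<close>)
  also have "... = integral {y..b} (%s. exp y * (exp (- s) * f s))"
  proof -
   have "set_integrable lborel {y..b} (%s. exp y * (exp (- s) * f s))"
    by (intro borel_integrable_atLeastAtMost' continuous_intros continuous_on_subset[OF assms(1)]) auto
   from set_borel_integral_eq_integral(2)[OF this] show ?thesis
    unfolding set_lebesgue_integral_def .
  qed
  finally show ?thesis by simp
 qed
 have cont: "continuous_on {x-1..b} (%s. exp (- s) * f s)"
  by (intro continuous_intros continuous_on_subset[OF assms(1)]) auto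
 have "((%y. integral {y..b} (%s. exp (- s) * f s)) has_real_derivative - (exp (- x) * f x))
   (at x within {x-1..b})"
  by (rule integral_has_real_derivative'[OF cont]) (auto simp: b_def)
 then have "((%y. integral {y..b} (%s. exp (- s) * f s)) has_real_derivative - (exp (- x) * f x)) (at x)"
  by (subst (asm) at_within_interior) (auto simp: b_def)
 then have "((%y. exp y * integral {y..b} (%s. exp (- s) * f s)) has_real_derivative
   Kp (toL2 f) x - f x) (at x)"
  by (rule DERIV_cong[OF DERIV_mult[OF DERIV_exp]])
   (use eq[of x] in \<open>auto simp: b_def exp_minus\<close>)
 then show ?thesis
  by (rule has_field_derivative_transform_within_open[of _ _ x "{..<b}"])
   (auto simp: b_def eq[unfolded b_def])
qed

text \<open>Images of test functions are differentiable, and \<open>abs_Kp_le\<close> turns L2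
  convergence of the data into uniform convergence of the images.\<close>

lemma Kp_continuous: "continuous_on UNIV (Kp g)"
proof -
 obtain ph where ph: "!!n::nat. test_fun (ph n)" "(%n. toL2 (ph n)) >>> g"
  using test_fun_sequence by blast
 have "continuous_on UNIV (Kp (toL2 (ph n)))" for n
 proof -
  obtain R where "!!x. R < \<bar>x\<bar> ==> ph n x = 0" using ph(1)[of n] by (auto simp: test_fun_def)
  then have "(Kp (toL2 (ph n)) has_real_derivative Kp (toL2 (ph n)) x - ph n x) (at x)" for x
   using ph(1)[of n] by (intro Kp_test_DERIV smooth_fun_continuous test_fun_smooth)
  then show ?thesis
   using DERIV_isCont continuous_at_imp_continuous_on by blast
 qed
 moreover have "uniform_limit UNIV (%n. Kp (toL2 (ph n))) (Kp g) sequentially"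
 proof (rule uniform_limitI)
  fix e :: real assume "0 < e"
  then have "\<forall>\<^sub>F n in sequentially. dist (toL2 (ph n)) g < e"
   using ph(2) by (rule tendstoD[rotated])
  then show "\<forall>\<^sub>F n in sequentially. \<forall>x\<in>UNIV. dist (Kp (toL2 (ph n)) x) (Kp g x) < e"
  proof eventually_elim
   case (elim n)
   then show ?case
    using abs_Kp_le[of "toL2 (ph n) - g"] by (auto simp: dist_norm Kp_diff intro: le_less_trans)
  qed
 qed
 ultimately show ?thesis
  by (intro uniform_limit_theorem[where f = "%n. Kp (toL2 (ph n))" and F = sequentially]) auto
qed

lemma Kp_measurable [measurable]: "Kp g : borel_measurable borel"
 by (rule borel_measurable_continuous_onI[OF Kp_continuous])

text \<open>Cauchy-Schwarz after writing the kernel as the product of two square roots; one of them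
  has L2 norm 1 because the kernel has total mass 1.\<close>

lemma Kp_square_le: "ennreal ((Kp g x)^2) <= (\<integral>\<^sup>+s. ennreal (kern x s * (fn g s)^2) \<partial>lborel)"
proof -
 define a where "a s = sqrt (kern x s)" for s
 define b where "b s = a s * fn g s" for s
 have k0: "0 <= kern x s" and k1: "kern x s <= 1" for s by (auto simp: kern_def indicator_def)
 have [measurable]: "a : borel_measurable borel" unfolding a_def by measurable
 have asq: "(a s)^2 = kern x s" for s using k0 by (simp add: a_def)
 have "(\<integral>\<^sup>+s. ennreal ((a s)^2) \<partial>lborel) = (\<integral>\<^sup>+s. ennreal (exp (1 * (x - s))) * indicator {x..} s \<partial>lborel)"
  by (rule nn_integral_cong) (auto simp: asq kern_def indicator_def)
 then have I: "(\<integral>\<^sup>+s. ennreal ((a s)^2) \<partial>lborel) = ennreal 1"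
  using nn_integral_exp_half_line[of 1 x] by simp
 have La: "L2_fun a" by (rule L2_fun_nn_integral[of _ 1]) (use I in auto)
 have na: "norm (toL2 a) <= 1" by (rule norm_toL2_le_nn_integral) (use I in auto)
 have Lb: "L2_fun b"
  unfolding b_def by (rule L2_fun_bounded_mult[of _ _ 1]) (use k0 k1 in \<open>auto simp: a_def\<close>)
 have "Kp g x = inner (toL2 a) (toL2 b)"
  unfolding Kp_eq_integral inner_toL2[OF La Lb]
  by (rule Bochner_Integration.integral_cong) (auto simp: b_def asq[symmetric] power2_eq_square)
 then have "\<bar>Kp g x\<bar> <= norm (toL2 a) * norm (toL2 b)" using Cauchy_Schwarz_ineq2 by metis
 also have "... <= norm (toL2 b)" using na mult_right_mono[of "norm (toL2 a)" 1 "norm (toL2 b)"] by simp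
 finally have "\<bar>Kp g x\<bar>^2 <= (norm (toL2 b))^2" by (rule power_mono) simp
 then have "(Kp g x)^2 <= (norm (toL2 b))^2" by simp
 then have "ennreal ((Kp g x)^2) <= (\<integral>\<^sup>+s. ennreal ((b s)^2) \<partial>lborel)"
  unfolding nn_integral_L2[OF Lb] by (rule ennreal_leI)
 then show ?thesis by (simp add: b_def power_mult_distrib asq)
qed

text \<open>The second half of a Schur test: Tonelli exchanges the integrals, and the kernel has
  total mass 1 in the variable \<open>x\<close> as well.\<close>

lemma nn_integral_Kp: "(\<integral>\<^sup>+x. ennreal ((Kp g x)^2) \<partial>lborel) <= ennreal ((norm g)^2)"
proof -
 have "(\<integral>\<^sup>+x. ennreal ((Kp g x)^2) \<partial>lborel) <= (\<integral>\<^sup>+x. \<integral>\<^sup>+s. ennreal (kern x s * (fn g s)^2) \<partial>lborel \<partial>lborel)"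
  by (intro nn_integral_mono Kp_square_le)
 also have "... = (\<integral>\<^sup>+s. \<integral>\<^sup>+x. ennreal (kern x s * (fn g s)^2) \<partial>lborel \<partial>lborel)"
  by (rule lborel_pair.Fubini'[symmetric]) (simp add: split_beta)
 also have "... = (\<integral>\<^sup>+s. ennreal ((fn g s)^2) \<partial>lborel)"
 proof (rule nn_integral_cong)
  fix s :: real
  have "(\<integral>\<^sup>+x. ennreal (kern x s) \<partial>lborel) = (\<integral>\<^sup>+r. ennreal (kern (s + (-1) * r) s) \<partial>lborel)"
   using nn_integral_real_affine[of "%x. ennreal (kern x s)" "-1" s]
   by (simp add: kern_def indicator_def cong: if_cong)
  also have "... = (\<integral>\<^sup>+r. ennreal (exp (1 * (0 - r))) * indicator {0..} r \<partial>lborel)"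
   by (rule nn_integral_cong) (auto simp: kern_def indicator_def)
  also have "... = 1" using nn_integral_exp_half_line[of 1 0] by simp
  finally have "(\<integral>\<^sup>+x. ennreal (kern x s) \<partial>lborel) = 1" .
  moreover have "(%x. kern x s) : borel_measurable borel"
   by (simp add: kern_def indicator_def cong: if_cong)
  ultimately show "(\<integral>\<^sup>+x. ennreal (kern x s * (fn g s)^2) \<partial>lborel) = ennreal ((fn g s)^2)"
   by (simp add: ennreal_mult'' nn_integral_multc)
 qed
 also have "... = ennreal ((norm g)^2)" using nn_integral_L2[of "fn g"] by simp
 finally show ?thesis .
qed

lemma L2_fun_Kp [simp]: "L2_fun (Kp g)"
 by (rule L2_fun_nn_integral[OF _ nn_integral_Kp]) simp

definition ka :: "l2 => l2" where "ka g = toL2 (Kp g)"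

lemma norm_ka_le: "norm (ka g) <= norm g"
 unfolding ka_def by (rule norm_toL2_le_nn_integral[OF _ nn_integral_Kp]) auto

lemma bounded_linear_ka: "bounded_linear ka"
proof
 show "ka (f + g) = ka f + ka g" for f g
  using toL2_add[of "Kp f" "Kp g"] by (simp add: ka_def Kp_add[symmetric])
 show "ka (c *R f) = c *R ka f" for c f
  using toL2_scale[of "Kp f" c] by (simp add: ka_def Kp_scaleR[symmetric])
 show "\<exists>K. \<forall>x. norm (ka x) <= norm x * K"
  by (rule exI[of _ 1]) (simp add: norm_ka_le)
qed

lemma ka_add: "ka (f + g) = ka f + ka g"
 and ka_diff: "ka (f - g) = ka f - ka g"
 and ka_scaleR: "ka (c *R f) = c *R ka f"
 using bounded_linear.linear[OF bounded_linear_ka]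
 by (simp_all add: linear_add linear_diff linear_scale)

lemma isCont_Kp: "isCont (%g. Kp g x) g"
 unfolding Kp_def by (intro continuous_intros)

lemma isCont_ka: "isCont ka g"
 by (rule linear_continuous_at[OF bounded_linear_ka])

lemma test_fun_supportE:
 assumes "test_fun ph"
 obtains R where "0 < R" "!!x. R < \<bar>x\<bar> ==> ph x = 0"
proof -
 obtain R where R: "!!x. R < \<bar>x\<bar> ==> ph x = 0" using assms by (auto simp: test_fun_def)
 show ?thesis by (rule that[of "max R 1"]) (use R in auto)
qed

lemma Kp_test_fun_DERIV:
 assumes "test_fun ph"
 shows "(Kp (toL2 ph) has_real_derivative Kp (toL2 ph) x - ph x) (at x)"
 using test_fun_supportE[OF assms] Kp_test_DERIV smooth_fun_continuous[OF test_fun_smooth[OF assms]]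
 by metis

text \<open>A representative of the derivative of \<open>v = Kp g\<close>, read off from v - v' =
  g.\<close>

definition Kd :: "l2 => real => real" where
 "Kd g x = Kp g x - fn g x"

lemma L2_fun_Kd [simp]: "L2_fun (Kd g)"
 unfolding Kd_def by (intro L2_fun_diff) auto

lemma Kd_measurable [measurable]: "Kd g : borel_measurable borel"
 using L2_fun_Kd L2_fun_measurable by blast

lemma toL2_Kd: "toL2 (Kd g) = ka g - g"
 using toL2_diff[of "Kp g" "fn g"] by (simp add: Kd_def[abs_def] ka_def)

lemma continuous_bounded_on_ball:
 fixes G :: "real => real"
 assumes "continuous_on UNIV G"
 obtains C where "0 < C" "!!s. \<bar>s\<bar> <= B ==> \<bar>G s\<bar> <= C"
proof -
 have "bounded (G ` {-B..B})"
  by (rule compact_imp_bounded[OF compact_continuous_image[OF continuous_on_subset[OF assms]]]) auto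
 then obtain C where C: "0 < C" "!!s. s : {-B..B} ==> \<bar>G s\<bar> <= C"
  unfolding bounded_pos by (metis image_eqI real_norm_def)
 show ?thesis by (rule that[OF C(1)], rule C(2)) auto
qed

lemma L2_fun_comp_Kp:
 assumes "continuous_on UNIV G"
 shows "L2_fun (%s. indicator {x..y} s * G (Kp g s))"
proof -
 obtain C where C: "!!s. \<bar>s\<bar> <= norm g ==> \<bar>G s\<bar> <= C"
  using continuous_bounded_on_ball[OF assms] by blast
 have [measurable]: "G : borel_measurable borel"
  by (rule borel_measurable_continuous_onI[OF assms])
 have "L2_fun (%s. G (Kp g s) * indicator {x..y} s)"
  by (rule L2_fun_bounded_mult[OF L2_fun_indicator]) (auto intro!: C abs_Kp_le)
 then show ?thesis by (simp add: mult.commute)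
qed

text \<open>This is the fundamental theorem for \<open>G\<close> composed with
  \<open>v = Kp g\<close>, where v' is only the L2 class \<open>ka g - g\<close>. For test functions
  it is ordinary calculus, and both sides are continuous in \<open>g\<close> with respect to the L2
  norm.\<close>

lemma Kp_chain_rule:
 assumes G: "!!s. (G has_real_derivative G' s) (at s)" and G': "continuous_on UNIV G'" and "x <= y"
 shows "inner (toL2 (%s. indicator {x..y} s * G' (Kp g s))) (ka g - g) = G (Kp g y) - G (Kp g x)"
proof -
 define q where "q g = toL2 (%s. indicator {x..y} s * G' (Kp g s))" for g
 obtain ph where ph: "!!n::nat. test_fun (ph n)" "(%n. toL2 (ph n)) >>> g"
  using test_fun_sequence by blast
 obtain B where B: "!!n. norm (toL2 (ph n)) <= B"
  using ph(2) by (metis Bseq_def convergentI convergent_imp_Bseq)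
 have Bg: "norm g <= B"
  using ph(2) B by (intro LIMSEQ_le_const2[OF tendsto_norm]) auto
 obtain C where C: "0 < C" "!!s. \<bar>s\<bar> <= B ==> \<bar>G' s\<bar> <= C"
  using continuous_bounded_on_ball[OF G'] by blast
 have "(%n. q (toL2 (ph n))) >>> q g"
  unfolding q_def
 proof (rule L2_dominated_convergence[of _ _ "%s. (2 * C) * indicator {x..y} s"])
  show "L2_fun (%s. (2 * C) * indicator {x..y} s)"
   by (intro L2_fun_scale L2_fun_indicator)
  show "AE s in lborel. (%n. indicator {x..y} s * G' (Kp (toL2 (ph n)) s)) >>>
    indicator {x..y} s * G' (Kp g s)"
  proof (intro AE_I2 tendsto_intros)
   fix s
   have "isCont G' (Kp g s)" using G' by (simp add: continuous_on_eq_continuous_at)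
   then show "(%n. G' (Kp (toL2 (ph n)) s)) >>> G' (Kp g s)"
    by (rule isCont_tendsto_compose) (rule isCont_tendsto_compose[OF isCont_Kp ph(2)])
  qed
  show "AE s in lborel. \<bar>indicator {x..y} s * G' (Kp (toL2 (ph n)) s) -
    indicator {x..y} s * G' (Kp g s)\<bar> <= (2 * C) * indicator {x..y} s" for n
  proof (rule AE_I2)
   fix s
   have "\<bar>G' (Kp (toL2 (ph n)) s)\<bar> <= C" "\<bar>G' (Kp g s)\<bar> <= C"
    using abs_Kp_le[of "toL2 (ph n)" s] abs_Kp_le[of g s] B[of n] Bg by (auto intro!: C(2))
   then show "\<bar>indicator {x..y} s * G' (Kp (toL2 (ph n)) s) -
    indicator {x..y} s * G' (Kp g s)\<bar> <= (2 * C) * indicator {x..y} s"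
    by (auto simp: indicator_def)
  qed
 qed (auto intro!: L2_fun_comp_Kp G')
 then have "(%n. inner (q (toL2 (ph n))) (ka (toL2 (ph n)) - toL2 (ph n))) >>> inner (q g) (ka g - g)"
  by (intro tendsto_inner tendsto_diff ph(2) isCont_tendsto_compose[OF isCont_ka ph(2)])
 moreover have "inner (q (toL2 (ph n))) (ka (toL2 (ph n)) - toL2 (ph n)) =
   G (Kp (toL2 (ph n)) y) - G (Kp (toL2 (ph n)) x)" for n
 proof -
  let ?v = "Kp (toL2 (ph n))"
  have Lph: "L2_fun (ph n)" by (rule L2_fun_test[OF ph(1)])
  have "inner (q (toL2 (ph n))) (toL2 ?v - toL2 (ph n)) =
    (\<integral>s. (indicator {x..y} s * G' (?v s)) * (?v s - ph n s) \<partial>lborel)"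
   unfolding q_def toL2_diff[OF L2_fun_Kp Lph, symmetric]
   by (rule inner_toL2) (auto intro!: L2_fun_comp_Kp G' L2_fun_diff Lph)
  also have "... = (\<integral>s. indicator {x..y} s *R (G' (?v s) * (?v s - ph n s)) \<partial>lborel)"
   by (simp add: mult.assoc)
  also have "... = G (?v y) - G (?v x)"
  proof (rule integral_FTC_atLeastAtMost[OF \<open>x <= y\<close>, of "%s. G (?v s)"])
   fix s
   have "((%s. G (?v s)) has_real_derivative G' (?v s) * (?v s - ph n s)) (at s)"
    by (rule DERIV_chain2[OF G Kp_test_fun_DERIV[OF ph(1)]])
   then show "((%s. G (?v s)) has_vector_derivative G' (?v s) * (?v s - ph n s)) (at s within {x..y})"
    by (simp add: has_real_derivative_iff_has_vector_derivative has_vector_derivative_at_within)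
  next
   show "continuous_on {x..y} (%s. G' (?v s) * (?v s - ph n s))"
    by (intro continuous_intros continuous_on_compose2[OF G'] continuous_on_subset[OF Kp_continuous]
      smooth_fun_continuous test_fun_smooth ph(1)) auto
  qed
  finally show ?thesis by (simp add: ka_def)
 qed
 moreover have "isCont G s" for s using G DERIV_isCont by blast
 then have "(%n. G (Kp (toL2 (ph n)) y) - G (Kp (toL2 (ph n)) x)) >>> G (Kp g y) - G (Kp g x)"
  by (intro tendsto_diff isCont_tendsto_compose[of _ G] isCont_tendsto_compose[OF isCont_Kp ph(2)])
 ultimately show ?thesis
  unfolding q_def using LIMSEQ_unique by auto
qed

lemma Kp_ac:
 assumes "x <= y"
 shows "inner (toL2 (indicator {x..y})) (ka g - g) = Kp g y - Kp g x"
 using Kp_chain_rule[of "%s. s" "%_. 1" x y g] assms by simp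

lemma Kp_test_right: "test_fun ph ==> (!!x. R < \<bar>x\<bar> ==> ph x = 0) ==> R < x ==> 0 < R ==> Kp (toL2 ph) x = 0"
 by (auto simp: Kp_toL2 L2_fun_test kern_def indicator_def intro!: integral_eq_zero_AE AE_I2)

lemma Kp_test_left:
 assumes "test_fun ph" "!!x. R < \<bar>x\<bar> ==> ph x = 0" "x < - R"
 shows "Kp (toL2 ph) x = exp x * (\<integral>s. exp (- s) * ph s \<partial>lborel)"
proof -
 have "Kp (toL2 ph) x = (\<integral>s. exp x * (exp (- s) * ph s) \<partial>lborel)"
  unfolding Kp_toL2[OF L2_fun_test[OF assms(1)]]
  by (rule Bochner_Integration.integral_cong)
   (use assms(2,3) in \<open>auto simp: kern_def indicator_def exp_diff exp_minus divide_inverse\<close>)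
 then show ?thesis by simp
qed

text \<open>For test functions the image vanishes far to the right and is a multiple of
  \<open>exp\<close> far to the left; density and the bound \<open>abs_Kp_le\<close>, uniform in
  \<open>x\<close>, carry this over to all data.\<close>

lemma Kp_tendsto_0: "(Kp g ---> 0) at_top" "(Kp g ---> 0) at_bot"
proof -
 have *: "(Kp g ---> 0) F"
  if "!!ph. test_fun ph ==> (Kp (toL2 ph) ---> 0) F" for F
 proof (rule tendstoI)
  fix e :: real assume e: "0 < e"
  obtain ph where ph: "test_fun ph" "norm (g - toL2 ph) < e / 2"
   using test_fun_dense[of "e/2" g] e by auto
  have "\<forall>\<^sub>F x in F. dist (Kp (toL2 ph) x) 0 < e / 2"
   using that[OF ph(1)] e by (intro tendstoD) auto
  then show "\<forall>\<^sub>F x in F. dist (Kp g x) 0 < e"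
  proof eventually_elim
   case (elim x)
   have "\<bar>Kp g x - Kp (toL2 ph) x\<bar> < e / 2"
    using abs_Kp_le[of "g - toL2 ph" x] ph(2) by (simp add: Kp_diff)
   then show ?case using elim unfolding dist_norm real_norm_def by arith
  qed
 qed
 show "(Kp g ---> 0) at_top"
 proof (rule *)
  fix ph assume ph: "test_fun ph"
  obtain R where R: "0 < R" "!!x. R < \<bar>x\<bar> ==> ph x = 0" using test_fun_supportE[OF ph] by blast
  then show "(Kp (toL2 ph) ---> 0) at_top"
   using Kp_test_right[of ph R] ph
   by (intro tendsto_eventually) (auto simp: eventually_at_top_dense)
 qed
 show "(Kp g ---> 0) at_bot"
 proof (rule *)
  fix ph assume ph: "test_fun ph"
  obtain R where R: "0 < R" "!!x. R < \<bar>x\<bar> ==> ph x = 0" using test_fun_supportE[OF ph] by blast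
  have "((%x. exp x * (\<integral>s. exp (- s) * ph s \<partial>lborel)) ---> 0 * (\<integral>s. exp (- s) * ph s \<partial>lborel)) at_bot"
   by (intro tendsto_mult exp_at_bot tendsto_const)
  moreover have "\<forall>\<^sub>F x in at_bot. exp x * (\<integral>s. exp (- s) * ph s \<partial>lborel) = Kp (toL2 ph) x"
   unfolding eventually_at_bot_dense
   by (rule exI[of _ "- R"]) (use Kp_test_left[of ph R] ph R in simp)
  ultimately show "(Kp (toL2 ph) ---> 0) at_bot"
   using Lim_transform_eventually by force
 qed
qed

lemma inner_indicator_tendsto:
 "(%n. inner (toL2 (%s. indicator {- real n..real n} s * fn f s)) g) >>> inner f g"
proof -
 have "(%n. toL2 (%s. indicator {- real n..real n} s * fn f s)) >>> toL2 (fn f)"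
 proof (rule L2_dominated_convergence[of _ _ "%s. \<bar>fn f s\<bar>"])
  show "L2_fun (%s. indicator {- real n..real n} s * fn f s)" for n
   by (rule L2_fun_bounded_mult[of _ _ 1]) (auto simp: indicator_def)
  show "L2_fun (%s. \<bar>fn f s\<bar>)" by (rule L2_fun_bound[of "fn f"]) auto
  show "AE s in lborel. (%n. indicator {- real n..real n} s * fn f s) >>> fn f s"
  proof (rule AE_I2)
   fix s
   obtain N :: nat where N: "real N >= \<bar>s\<bar>" using real_arch_simple by blast
   have "indicator {- real n..real n} s * fn f s = fn f s" if "n >= N" for n
    using that N by (auto simp: indicator_def)
   then show "(%n. indicator {- real n..real n} s * fn f s) >>> fn f s"
    by (intro tendsto_eventually) (auto simp: eventually_sequentially)
  qed
 qed (auto simp: indicator_def)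
 then show ?thesis by (intro tendsto_inner tendsto_const) simp
qed

text \<open>The product v v' is the derivative of v^2 / 2, and \<open>v\<close> vanishes at both
  ends of the line.\<close>

lemma inner_ka_deriv_self: "inner (ka g) (ka g - g) = 0"
proof -
 have "(%n. inner (toL2 (%s. indicator {- real n..real n} s * fn (ka g) s)) (ka g - g)) >>>
   inner (ka g) (ka g - g)"
  by (rule inner_indicator_tendsto)
 moreover have "inner (toL2 (%s. indicator {- real n..real n} s * fn (ka g) s)) (ka g - g) =
   ((Kp g (real n))^2 - (Kp g (- real n))^2) / 2" for n
 proof -
  have "toL2 (%s. indicator {- real n..real n} s * fn (ka g) s) =
    toL2 (%s. indicator {- real n..real n} s * Kp g s)"
  proof (subst toL2_eq_iff)
   show "AE s in lborel. indicator {- real n..real n} s * fn (ka g) s =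
     indicator {- real n..real n} s * Kp g s"
    using AE_fn_toL2[OF L2_fun_Kp[of g]] by eventually_elim (simp add: ka_def)
  qed (auto intro!: L2_fun_bounded_mult[of _ _ 1] simp: indicator_def)
  moreover have "inner (toL2 (%s. indicator {- real n..real n} s * Kp g s)) (ka g - g) =
    (Kp g (real n))^2 / 2 - (Kp g (- real n))^2 / 2"
   by (rule Kp_chain_rule[where G = "%s. s^2 / 2" and G' = "%s. s"])
    (auto intro!: derivative_eq_intros)
  ultimately show ?thesis by (simp add: diff_divide_distrib)
 qed
 moreover have "(%n. ((Kp g (real n))^2 - (Kp g (- real n))^2) / 2) >>> (0^2 - 0^2) / 2"
  by (intro tendsto_intros filterlim_compose[OF Kp_tendsto_0(1)] filterlim_compose[OF Kp_tendsto_0(2)]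
    filterlim_real_sequentially filterlim_uminus_at_top[THEN iffD1]) auto
 ultimately have "inner (ka g) (ka g - g) = (0^2 - 0^2) / 2"
  by (metis (no_types, lifting) LIMSEQ_unique ext)
 then show ?thesis by simp
qed

text \<open>Polarization of \<open>inner_ka_deriv_self\<close>.\<close>

lemma inner_ka_by_parts: "inner (ka g) (ka h - h) = - inner (ka g - g) (ka h)"
 using inner_ka_deriv_self[of "g + h"] inner_ka_deriv_self[of g] inner_ka_deriv_self[of h]
 by (simp add: ka_add inner_simps inner_commute)

lemma norm_ka_sq: "(norm g)^2 = (norm (ka g))^2 + (norm (ka g - g))^2"
 using inner_ka_deriv_self[of g]
 by (simp add: power2_norm_eq_inner inner_simps inner_commute)

text \<open>The difference \<open>d\<close> of \<open>f\<close> and the candidate satisfies d' = d,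
  hence is a multiple of \<open>exp\<close>; boundedness leaves only the multiple 0.\<close>

lemma Kp_represent:
 assumes "continuous_on UNIV f" "!!x. \<bar>f x\<bar> <= B" "L2_fun f" "L2_fun h"
  and ac: "!!x y. x <= y ==> f y - f x = inner (toL2 (indicator {x..y})) (toL2 h)"
 shows "f = Kp (toL2 f - toL2 h)"
proof
 define k where "k = toL2 f - toL2 h"
 define d where "d x = f x - Kp k x" for x
 have cd: "continuous_on A d" for A
  unfolding d_def
  by (intro continuous_intros continuous_on_subset[OF assms(1)] continuous_on_subset[OF Kp_continuous]) auto
 have Ld: "L2_fun d" unfolding d_def by (intro L2_fun_diff assms) auto
 have dint: "d y - d x = integral {x..y} d" if "x <= y" for x y
 proof -
  have "d y - d x = inner (toL2 (indicator {x..y})) (toL2 h - (ka k - k))"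
   using ac[OF that] Kp_ac[OF that, of k] by (simp add: d_def inner_diff_right)
  also have "toL2 h - (ka k - k) = toL2 d"
   unfolding d_def using toL2_diff[OF assms(3) L2_fun_Kp[of k]] by (simp add: k_def ka_def)
  also have "inner (toL2 (indicator {x..y})) (toL2 d) = (\<integral>s. indicator {x..y} s *R d s \<partial>lborel)"
   by (simp add: inner_toL2 L2_fun_indicator Ld)
  also have "... = integral {x..y} d"
   using set_borel_integral_eq_integral(2)[OF borel_integrable_atLeastAtMost'[OF cd]]
   unfolding set_lebesgue_integral_def .
  finally show ?thesis .
 qed
 have dd: "(d has_real_derivative d x) (at x)" for x
 proof -
  have "((%y. integral {x-1..y} d) has_real_derivative d x) (at x within {x-1..x+1})"
   by (rule integral_has_real_derivative[OF cd]) auto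
  then have "((%y. integral {x-1..y} d) has_real_derivative d x) (at x)"
   by (subst (asm) at_within_interior) auto
  then have "((%y. d (x-1) + integral {x-1..y} d) has_real_derivative d x) (at x)"
   by (auto intro!: derivative_eq_intros)
  then show ?thesis
  proof (rule has_field_derivative_transform_within_open[of _ _ x "{x-1<..}"])
   fix y assume "y : {x-1<..}"
   then show "d (x-1) + integral {x-1..y} d = d y" using dint[of "x-1" y] by simp
  qed auto
 qed
 have "((%x. exp (- x) * d x) has_real_derivative 0) (at x)" for x
  by (auto intro!: derivative_eq_intros dd)
 then have "exp (- x) * d x = exp (- 0) * d 0" for x
  using DERIV_isconst_all by blast
 then have "exp (- x) * d x = d 0" for x by (metis exp_zero minus_zero mult_1)
 then have deq: "d x = d 0 * exp x" for x
  by (metis exp_minus_inverse mult.assoc mult.commute mult_1)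
 have db: "\<bar>d x\<bar> <= B + norm k" for x
  using assms(2)[of x] abs_Kp_le[of k x] by (simp add: d_def)
 have "d 0 = 0"
 proof (rule ccontr)
  assume nz: "d 0 ~= 0"
  define x where "x = (B + norm k) / \<bar>d 0\<bar>"
  have "\<bar>d 0\<bar> * (1 + x) <= \<bar>d 0\<bar> * exp x" by (intro mult_left_mono exp_ge_add_one_self) auto
  also have "... <= B + norm k" using db[of x] deq[of x] by (simp add: abs_mult)
  finally have "\<bar>d 0\<bar> * (1 + x) <= B + norm k" .
  moreover have "\<bar>d 0\<bar> * x = B + norm k" using nz by (simp add: x_def)
  ultimately show False using nz by (simp add: distrib_left)
 qed
 then show "f x = Kp (toL2 f - toL2 h) x" for x
  using deq[of x] by (simp add: d_def k_def)
qed

lemma test_fun_ac: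
 assumes "test_fun ph" "x <= y"
 shows "ph y - ph x = inner (toL2 (indicator {x..y})) (toL2 (deriv ph))"
proof -
 have "inner (toL2 (indicator {x..y})) (toL2 (deriv ph)) = (\<integral>s. indicator {x..y} s *R deriv ph s \<partial>lborel)"
  by (simp add: inner_toL2 L2_fun_indicator L2_fun_test test_fun_deriv assms)
 also have "... = ph y - ph x"
  using smooth_fun_DERIV[OF test_fun_smooth[OF assms(1)]] assms
  by (intro integral_FTC_atLeastAtMost smooth_fun_continuous test_fun_smooth test_fun_deriv)
   (auto simp: has_real_derivative_iff_has_vector_derivative has_vector_derivative_at_within)
 finally show ?thesis by simp
qed

lemma Kp_test_represent:
 assumes "test_fun ph"
 shows "ph = Kp (toL2 ph - toL2 (deriv ph))"
proof -
 obtain R where R: "!!x. R < \<bar>x\<bar> ==> ph x = 0" using assms by (auto simp: test_fun_def)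
 have cont: "continuous_on UNIV ph" by (rule smooth_fun_continuous[OF test_fun_smooth[OF assms]])
 obtain C where C: "0 < C" "!!s. \<bar>s\<bar> <= R ==> \<bar>ph s\<bar> <= C"
  using continuous_bounded_on_ball[OF cont] by blast
 have "\<bar>ph x\<bar> <= C" for x using C R[of x] by (cases "R < \<bar>x\<bar>") auto
 then show ?thesis
  by (intro Kp_represent cont L2_fun_test test_fun_deriv test_fun_ac assms) auto
qed

subsection \<open>Weak derivatives\<close>

definition wd :: "l2 => l2 => bool" where
 "wd f h \<longleftrightarrow> (\<forall>ph. test_fun ph --> inner f (toL2 (deriv ph)) = - inner h (toL2 ph))"

lemma wd_add: "wd f h ==> wd f' h' ==> wd (f + f') (h + h')"
 and wd_diff: "wd f h ==> wd f' h' ==> wd (f - f') (h - h')"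
 and wd_uminus: "wd f h ==> wd (- f) (- h)"
 by (auto simp: wd_def inner_simps)

lemma wd_ka: "wd (ka g) (ka g - g)"
 unfolding wd_def
proof (intro allI impI)
 fix ph assume ph: "test_fun ph"
 have "ka (toL2 ph - toL2 (deriv ph)) = toL2 ph"
  unfolding ka_def using Kp_test_represent[OF ph] by simp
 then show "inner (ka g) (toL2 (deriv ph)) = - inner (ka g - g) (toL2 ph)"
  using inner_ka_by_parts[of g "toL2 ph - toL2 (deriv ph)"] by simp
qed

text \<open>Every test function \<open>th\<close> is \<open>ph + ph'\<close> for a smooth \<open>ph\<close> that vanishes far to the left and decays
 exponentially to the right; cutting \<open>ph\<close> off at \<open>n\<close> produces an error of size \<open>e\<^sup>-\<^sup>n\<close>.\<close>

lemma resolvent_test_approx: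
 assumes th: "test_fun th"
 obtains R q where "test_fun q" "!!n::nat. R < real n ==>
  \<exists>ph. test_fun ph & (\<forall>x. ph x + deriv ph x = th x + exp (- real n) * q (x - real n))"
proof -
 obtain R where R: "0 < R" "!!x. R < \<bar>x\<bar> ==> th x = 0" using test_fun_supportE[OF th] by blast
 define th' where "th' x = th (- x)" for x
 have "smooth_fun (%x. th (-1 * x + 0))" by (rule smooth_fun_affine[OF test_fun_smooth[OF th]])
 then have th': "test_fun th'" unfolding test_fun_def th'_def using R(2) by (auto intro!: exI[of _ R])
 have R': "th' x = 0" if "R < \<bar>x\<bar>" for x using R(2) that by (simp add: th'_def)
 \<comment> \<open>Reflection exchanges 1 - d/dx with 1 + d/dx, so that p + p' = th.\<close>
 define p where "p x = Kp (toL2 th') (- x)" for x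
 have dp: "(p has_real_derivative th x - p x) (at x)" for x
  unfolding p_def
  by (rule DERIV_cong[OF DERIV_chain2[OF Kp_test_fun_DERIV[OF th'] DERIV_minus[OF DERIV_ident]]])
   (simp add: th'_def)
 have smp: "smooth_fun p"
 proof (rule smooth_fun_coinduct[of "%h. \<exists>r c. h = (%x. r x + c * p x) & smooth_fun r"])
  show "\<exists>r c. p = (%x. r x + c * p x) & smooth_fun r"
   by (rule exI[of _ "%x. 0"], rule exI[of _ 1]) (simp add: smooth_fun_const)
  fix h assume "\<exists>r c. h = (%x. r x + c * p x) & smooth_fun r"
  then obtain r c where h: "h = (%x. r x + c * p x)" and r: "smooth_fun r" by blast
  have dh: "(h has_real_derivative (deriv r x + c * th x) + (- c) * p x) (at x)" for x
   unfolding h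
   by (auto intro!: derivative_eq_intros dp smooth_fun_DERIV r simp: algebra_simps)
  then show "(\<forall>x. h differentiable (at x)) & (\<exists>r c. deriv h = (%x. r x + c * p x) & smooth_fun r)"
   using deriv_real_eqI[OF dh] smooth_fun_add[OF smooth_fun_deriv[OF r] smooth_fun_scale[OF test_fun_smooth[OF th]], of c]
   by (intro conjI allI exI[of _ "%x. deriv r x + c * th x"] exI[of _ "- c"])
    (auto simp: real_differentiable_def)
 qed
 define C where "C = (\<integral>s. exp (- s) * th' s \<partial>lborel)"
 have pR: "p x = C * exp (- x)" if "R < x" for x
  using Kp_test_left[of th' R "- x"] th' R' that by (simp add: p_def C_def)
 have pL: "p x = 0" if "x < - R" for x
  using Kp_test_right[of th' R "- x"] th' R' that R(1) by (simp add: p_def)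
 \<comment> \<open>The error made by the cut-off, recentred at \<open>n\<close>. There
   \<open>p\<close> equals \<open>C * exp (- x)\<close>, so moving the cut-off by \<open>n\<close>
   only multiplies the error by \<open>exp (- n)\<close>.\<close>
 define q where "q x = (- C * exp (- x)) * deriv step (1 - x)" for x
 have "smooth_fun (%x. exp (- x) :: real)"
 proof (rule smooth_fun_coinduct[of "%h. \<exists>c. h = (%x. c * exp (- x))"])
  show "\<exists>c. (%x. exp (- x)) = (%x. c * exp (- x :: real))" by (rule exI[of _ 1]) simp
  fix h :: "real => real" assume "\<exists>c. h = (%x. c * exp (- x))"
  then obtain c where h: "h = (%x. c * exp (- x))" by blast
  have dh: "(h has_real_derivative (- c) * exp (- x)) (at x)" for x
   unfolding h by (auto intro!: derivative_eq_intros)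
  then show "(\<forall>x. h differentiable (at x)) & (\<exists>c. deriv h = (%x. c * exp (- x)))"
   using deriv_real_eqI[OF dh] by (meson real_differentiable_def)
 qed
 moreover have "test_fun (%x. deriv step (1 - x))"
  unfolding test_fun_def
 proof
  show "smooth_fun (%x. deriv step (1 - x))"
   using smooth_fun_affine[OF smooth_fun_deriv[OF smooth_fun_step], of "-1" 1] by simp
  show "\<exists>R. \<forall>x. R < \<bar>x\<bar> --> deriv step (1 - x) = 0"
   by (rule exI[of _ 1]) (auto simp: deriv_step intro!: bump_eq_0)
 qed
 ultimately have q: "test_fun q"
  unfolding q_def by (intro test_fun_mult smooth_fun_scale)
 show ?thesis
 proof (rule that[OF q])
  fix n :: nat assume n: "R < real n"
  define ph where "ph x = step (real n + 1 - x) * p x" for x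
  have st: "smooth_fun (%x. step (real n + 1 - x))"
   using smooth_fun_affine[OF smooth_fun_step, of "-1" "real n + 1"] by simp
  have "test_fun ph"
   unfolding test_fun_def
  proof
   show "smooth_fun ph" unfolding ph_def by (intro smooth_fun_mult st smp)
   show "\<exists>R. \<forall>x. R < \<bar>x\<bar> --> ph x = 0"
    by (rule exI[of _ "real n + 1"]) (use n pL in \<open>auto simp: ph_def step_le_0 abs_real_def split: if_splits\<close>)
  qed
  moreover have "ph x + deriv ph x = th x + exp (- real n) * q (x - real n)" for x
  proof -
   have "((%x. step (real n + 1 - x)) has_real_derivative - deriv step (real n + 1 - x)) (at x)"
    by (rule DERIV_cong[OF DERIV_chain2[OF smooth_fun_DERIV[OF smooth_fun_step]
       DERIV_diff[OF DERIV_const DERIV_ident]]]) simp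
   then have "(ph has_real_derivative - deriv step (real n + 1 - x) * p x + (th x - p x) * step (real n + 1 - x)) (at x)"
    unfolding ph_def by (rule DERIV_mult) (rule dp)
   then have "ph x + deriv ph x = step (real n + 1 - x) * th x - deriv step (real n + 1 - x) * p x"
    by (simp add: DERIV_imp_deriv ph_def algebra_simps)
   moreover have "step (real n + 1 - x) * th x = th x"
    using R(2)[of x] n by (cases "R < \<bar>x\<bar>") (auto simp: step_ge_1)
   moreover have "- deriv step (real n + 1 - x) * p x = exp (- real n) * q (x - real n)"
   proof (cases "real n <= x")
    case True
    then have "p x = C * exp (- x)" using pR n by simp
    moreover have "exp (- real n) * exp (real n - x) = exp (- x)" by (simp flip: exp_add)
    ultimately show ?thesis by (simp add: q_def algebra_simps)
   next
    case False
    then show ?thesis by (simp add: q_def deriv_step bump_eq_0)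
   qed
   ultimately show ?thesis by simp
  qed
  ultimately show "\<exists>ph. test_fun ph & (\<forall>x. ph x + deriv ph x = th x + exp (- real n) * q (x - real n))"
   by blast
 qed
qed

text \<open>Cancels a factor 1 + d/dx on the side of the test functions. The functions
  \<open>ph + ph'\<close> do not exhaust all test functions, but they miss a given \<open>th\<close>
  only by a translate of a fixed function times \<open>exp (- n)\<close>, and translation preserves
  norms.\<close>

lemma weak_resolvent_inverse:
 assumes "!!ph. test_fun ph ==> inner k (toL2 ph + toL2 (deriv ph)) +
   inner u (toL2 (deriv ph) + toL2 (deriv (deriv ph))) = 0"
  and th: "test_fun th"
 shows "inner k (toL2 th) + inner u (toL2 (deriv th)) = 0"
proof -
 obtain R q where q: "test_fun q" and ap: "!!n::nat. R < real n ==>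
  \<exists>ph. test_fun ph & (\<forall>x. ph x + deriv ph x = th x + exp (- real n) * q (x - real n))"
  using resolvent_test_approx[OF th] by metis
 define M where "M = norm k * norm (toL2 q) + norm u * norm (toL2 (deriv q))"
 have bound: "\<bar>inner k (toL2 th) + inner u (toL2 (deriv th))\<bar> <= exp (- real n) * M" if n: "R < real n" for n :: nat
 proof -
  obtain ph where ph: "test_fun ph" "!!x. ph x + deriv ph x = th x + exp (- real n) * q (x - real n)"
   using ap[OF n] by blast
  note L = L2_fun_test[OF ph(1)] L2_fun_test[OF test_fun_deriv[OF ph(1)]]
   L2_fun_test[OF test_fun_deriv[OF test_fun_deriv[OF ph(1)]]]
   L2_fun_test[OF th] L2_fun_test[OF test_fun_deriv[OF th]] L2_fun_test[OF q] L2_fun_test[OF test_fun_deriv[OF q]]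
  have *: "toL2 (%x. f x + exp (- real n) * r (x + - real n)) = toL2 f + exp (- real n) *R tr (- real n) (toL2 r)"
   if "L2_fun f" "L2_fun r" for f r
   using that by (simp add: tr_toL2 toL2_add toL2_scale L2_fun_scale L2_fun_translate[of r "- real n", simplified])
  have e1: "toL2 ph + toL2 (deriv ph) = toL2 th + exp (- real n) *R tr (- real n) (toL2 q)"
   unfolding *[OF L(4,6), symmetric] toL2_add[OF L(1,2), symmetric] ph(2) by simp
  have "deriv ph x + deriv (deriv ph) x = deriv th x + exp (- real n) * deriv q (x - real n)" for x
  proof -
   have "((%x. ph x + deriv ph x) has_real_derivative deriv ph x + deriv (deriv ph) x) (at x)"
    by (intro DERIV_add smooth_fun_DERIV test_fun_smooth test_fun_deriv ph(1))
   moreover have "((%x. q (x - real n)) has_real_derivative deriv q (x - real n) * 1) (at x)"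
    by (rule DERIV_chain2[OF smooth_fun_DERIV[OF test_fun_smooth[OF q]]])
     (auto intro!: derivative_eq_intros)
   then have "((%x. ph x + deriv ph x) has_real_derivative deriv th x + exp (- real n) * deriv q (x - real n)) (at x)"
    unfolding ph(2)
    by (intro DERIV_add smooth_fun_DERIV test_fun_smooth th DERIV_cmult) simp
   ultimately show ?thesis by (rule DERIV_unique)
  qed
  then have e2: "toL2 (deriv ph) + toL2 (deriv (deriv ph)) =
    toL2 (deriv th) + exp (- real n) *R tr (- real n) (toL2 (deriv q))"
   unfolding *[OF L(5,7), symmetric] toL2_add[OF L(2,3), symmetric] by simp
  have "inner k (toL2 th) + inner u (toL2 (deriv th)) =
    - exp (- real n) * (inner k (tr (- real n) (toL2 q)) + inner u (tr (- real n) (toL2 (deriv q))))"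
   using assms(1)[OF ph(1)] unfolding e1 e2 by (simp add: inner_simps algebra_simps)
  moreover have "\<bar>inner k (tr (- real n) (toL2 q)) + inner u (tr (- real n) (toL2 (deriv q)))\<bar> <= M"
   using Cauchy_Schwarz_ineq2[of k "tr (- real n) (toL2 q)"]
    Cauchy_Schwarz_ineq2[of u "tr (- real n) (toL2 (deriv q))"] by (simp add: M_def)
  ultimately show ?thesis by (simp add: abs_mult)
 qed
 have "(%n. exp (- real n) * M) >>> 0 * M"
  by (intro tendsto_mult tendsto_const filterlim_compose[OF exp_at_bot]
    filterlim_uminus_at_top[THEN iffD1] filterlim_real_sequentially)
 moreover have "\<forall>\<^sub>F n in sequentially. \<bar>inner k (toL2 th) + inner u (toL2 (deriv th))\<bar> <= exp (- real n) * M"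
  using filterlim_real_sequentially unfolding filterlim_at_top_dense
  by (metis (mono_tags, lifting) bound eventually_mono)
 ultimately have "\<bar>inner k (toL2 th) + inner u (toL2 (deriv th))\<bar> <= 0 * M"
  by (rule tendsto_lowerbound) simp
 then show ?thesis by simp
qed

text \<open>The defect \<open>r\<close> satisfies r' = r weakly, so it is orthogonal to all
  \<open>ph + ph'\<close> and by \<open>weak_resolvent_inverse\<close> to all test
  functions.\<close>

lemma wd_imp_ka:
 assumes "wd f h"
 shows "f = ka (f - h)"
proof -
 define r where "r = f - ka (f - h)"
 have "wd r (h - (ka (f - h) - (f - h)))"
  unfolding r_def by (intro wd_diff assms wd_ka)
 then have r: "wd r r" by (simp add: r_def)
 have "r = 0"
 proof (rule test_fun_orthogonal_eq_0)
  fix th assume "test_fun th"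
  then have "inner r (toL2 th) + inner 0 (toL2 (deriv th)) = 0"
   by (rule weak_resolvent_inverse[rotated]) (use r in \<open>auto simp: wd_def inner_add_right\<close>)
  then show "inner r (toL2 th) = 0" by simp
 qed
 then show ?thesis by (simp add: r_def)
qed

lemma wd_unique: "wd f h ==> wd f h' ==> h = h'"
 using test_fun_orthogonal_eq_0[of "h - h'"] by (simp add: wd_def inner_diff_left)

lemma wd_by_parts: "wd f f' ==> wd h h' ==> inner f h' = - inner f' h"
 using inner_ka_by_parts[of "f - f'" "h - h'"] wd_imp_ka[of f f'] wd_imp_ka[of h h'] by simp

lemma wd_inner_self: "wd f f' ==> inner f f' = 0"
 using wd_by_parts[of f f' f f'] by (simp add: inner_commute)

text \<open>The assumption is the weak form of y = u' - u''. Inverting 1 - d/dx identifies u' as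
  \<open>ka y\<close>, so the combination alone already yields the separate derivatives in
  L2.\<close>

lemma wd_second_order_right:
 assumes "!!ph. test_fun ph ==> inner y (toL2 ph) = - inner u (toL2 (deriv ph) + toL2 (deriv (deriv ph)))"
 shows "wd u (ka y)"
proof -
 have "inner (ka y) (toL2 th) + inner u (toL2 (deriv th)) = 0" if "test_fun th" for th
 proof (rule weak_resolvent_inverse[OF _ that])
  fix ph assume ph: "test_fun ph"
  have "inner (ka y) (toL2 (deriv ph)) = - inner (ka y - y) (toL2 ph)"
   using wd_ka[of y] ph unfolding wd_def by blast
  then have "inner (ka y) (toL2 ph + toL2 (deriv ph)) = inner y (toL2 ph)"
   by (simp add: inner_simps)
  then show "inner (ka y) (toL2 ph + toL2 (deriv ph)) + inner u (toL2 (deriv ph) + toL2 (deriv (deriv ph))) = 0"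
   using assms[OF ph] by simp
 qed
 then show ?thesis by (auto simp: wd_def add_eq_0_iff)
qed

lemma test_fun_reflect:
 assumes "test_fun ph"
 shows "test_fun (%x. ph (- x))" "deriv (%x. ph (- x)) = (%x. - deriv ph (- x))"
proof -
 obtain R where R: "!!x. R < \<bar>x\<bar> ==> ph x = 0" using assms by (auto simp: test_fun_def)
 show "test_fun (%x. ph (- x))"
  unfolding test_fun_def
 proof
  show "smooth_fun (%x. ph (- x))"
   using smooth_fun_affine[OF test_fun_smooth[OF assms], of "-1" 0] by simp
  show "\<exists>R. \<forall>x. R < \<bar>x\<bar> --> ph (- x) = 0"
   by (rule exI[of _ R]) (simp add: R)
 qed
 show "deriv (%x. ph (- x)) = (%x. - deriv ph (- x))"
 proof (rule deriv_real_eqI)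
  show "((%x. ph (- x)) has_real_derivative - deriv ph (- x)) (at x)" for x
   using DERIV_chain2[OF smooth_fun_DERIV[OF test_fun_smooth[OF assms]] DERIV_minus[OF DERIV_ident]]
   by simp
 qed
qed

lemma rfl_toL2_test: "test_fun ph ==> rfl (toL2 ph) = toL2 (%x. ph (- x))"
 by (simp add: rfl_toL2 L2_fun_test)

lemma toL2_deriv_reflect: "test_fun ph ==> toL2 (deriv (%x. ph (- x))) = - rfl (toL2 (deriv ph))"
 by (simp add: test_fun_reflect rfl_toL2 L2_fun_test test_fun_deriv toL2_uminus L2_fun_reflect)

lemma wd_rfl: "wd f h ==> wd (rfl f) (- rfl h)"
 unfolding wd_def
proof (intro allI impI)
 fix ph assume wd: "\<forall>ph. test_fun ph --> inner f (toL2 (deriv ph)) = - inner h (toL2 ph)"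
  and ph: "test_fun ph"
 have "inner f (toL2 (deriv (%x. ph (- x)))) = - inner h (toL2 (%x. ph (- x)))"
  by (rule wd[rule_format, OF test_fun_reflect(1)[OF ph]])
 then show "inner (rfl f) (toL2 (deriv ph)) = - inner (- rfl h) (toL2 ph)"
  using ph by (simp add: toL2_deriv_reflect rfl_toL2_test[symmetric] inner_rfl_left)
qed

text \<open>The inverse of 1 + d/dx, obtained from that of 1 - d/dx by reflection.\<close>

definition ka' :: "l2 => l2" where "ka' s = rfl (ka (rfl s))"

lemma bounded_linear_ka': "bounded_linear ka'"
 using bounded_linear_compose[OF bounded_linear_rfl bounded_linear_compose[OF bounded_linear_ka bounded_linear_rfl]]
 by (simp add: ka'_def[abs_def])

lemma wd_ka': "wd (ka' s) (s - ka' s)"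
proof -
 have "wd (rfl (ka (rfl s))) (- rfl (ka (rfl s) - rfl s))" by (rule wd_rfl[OF wd_ka])
 then show ?thesis
  by (simp add: ka'_def linear_diff[OF bounded_linear.linear[OF bounded_linear_rfl]])
qed

lemma wd_second_order_left:
 assumes "!!ph. test_fun ph ==> inner s (toL2 ph) = - inner g (toL2 (deriv ph) - toL2 (deriv (deriv ph)))"
 shows "wd g (ka' s)"
proof -
 have "wd (- rfl g) (ka (rfl s))"
 proof (rule wd_second_order_right)
  fix ph assume ph: "test_fun ph"
  let ?r = "%x. ph (- x)"
  have r: "test_fun ?r" by (rule test_fun_reflect(1)[OF ph])
  have "toL2 (deriv ?r) = - rfl (toL2 (deriv ph))" by (rule toL2_deriv_reflect[OF ph])
  moreover have "toL2 (deriv (deriv ?r)) = rfl (toL2 (deriv (deriv ph)))"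
  proof -
   have "deriv (deriv ?r) = (%x. deriv (deriv ph) (- x))"
   proof (rule deriv_real_eqI)
    show "(deriv ?r has_real_derivative deriv (deriv ph) (- x)) (at x)" for x
     unfolding test_fun_reflect(2)[OF ph]
     using DERIV_minus[OF DERIV_chain2[OF smooth_fun_DERIV[OF test_fun_smooth[OF test_fun_deriv[OF ph]]] DERIV_minus[OF DERIV_ident]]]
     by simp
   qed
   then show ?thesis by (simp add: rfl_toL2 L2_fun_test test_fun_deriv ph)
  qed
  ultimately show "inner (rfl s) (toL2 ph) = - inner (- rfl g) (toL2 (deriv ph) + toL2 (deriv (deriv ph)))"
   using assms[OF r] ph by (simp add: rfl_toL2_test[symmetric] inner_simps inner_rfl_left)
 qed
 then have "wd (rfl (- (- rfl g))) (- rfl (- ka (rfl s)))" by (intro wd_rfl wd_uminus)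
 then show ?thesis
  by (simp add: ka'_def linear_neg[OF bounded_linear.linear[OF bounded_linear_rfl]])
qed

section \<open>Multiplication by functions in the Sobolev space\<close>

text \<open>The multiplier \<open>v = Kp k\<close> enters through its datum
  \<open>k = v - v'\<close>: since \<open>v\<close> is bounded pointwise by \<open>norm k\<close>,
  multiplication becomes a bounded bilinear map on L2, to which calculus in Banach spaces
  applies.\<close>

definition mulK :: "l2 => l2 => l2" where
 "mulK k g = toL2 (%x. Kp k x * fn g x)"

lemma L2_fun_Kp_mult: "L2_fun f ==> L2_fun (%x. Kp k x * f x)"
 by (rule L2_fun_bounded_mult[of _ _ "norm k"]) (auto simp: abs_Kp_le)

lemma mulK_toL2:
 assumes "L2_fun f"
 shows "mulK k (toL2 f) = toL2 (%x. Kp k x * f x)"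
 unfolding mulK_def
proof (subst toL2_eq_iff)
 show "AE x in lborel. Kp k x * fn (toL2 f) x = Kp k x * f x"
  using AE_fn_toL2[OF assms] by eventually_elim simp
qed (auto intro!: L2_fun_Kp_mult assms)

lemma norm_mulK_le: "norm (mulK k g) <= norm k * norm g"
proof -
 have "norm (mulK k g) <= norm (toL2 (%x. norm k * fn g x))"
  unfolding mulK_def
  by (rule norm_toL2_le) (auto intro!: L2_fun_Kp_mult L2_fun_scale mult_right_mono abs_Kp_le simp: abs_mult)
 also have "... = norm k * norm g"
  by (simp add: toL2_scale)
 finally show ?thesis .
qed

lemma bounded_bilinear_mulK: "bounded_bilinear mulK"
proof
 fix k k' g g' :: l2 and r :: real
 show "mulK (k + k') g = mulK k g + mulK k' g"
  using toL2_add[OF L2_fun_Kp_mult[of "fn g" k] L2_fun_Kp_mult[of "fn g" k']]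
  by (simp add: mulK_def Kp_add distrib_right)
 show "mulK k (g + g') = mulK k g + mulK k g'"
 proof -
  have "mulK k (toL2 (%x. fn g x + fn g' x)) = mulK k g + mulK k g'"
   using toL2_add[OF L2_fun_Kp_mult[of "fn g" k] L2_fun_Kp_mult[of "fn g'" k]]
   by (subst mulK_toL2) (auto intro!: L2_fun_add simp: mulK_def distrib_left)
  then show ?thesis by (simp add: toL2_add)
 qed
 show "mulK (r *R k) g = r *R mulK k g"
  using toL2_scale[OF L2_fun_Kp_mult[of "fn g" k], of r] by (simp add: mulK_def Kp_scaleR mult.assoc)
 show "mulK k (r *R g) = r *R mulK k g"
 proof -
  have "mulK k (toL2 (%x. r * fn g x)) = r *R mulK k g"
   using toL2_scale[OF L2_fun_Kp_mult[of "fn g" k], of r]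
   by (subst mulK_toL2) (auto intro!: L2_fun_scale simp: mulK_def mult.left_commute)
  then show ?thesis by (simp add: toL2_scale)
 qed
 show "\<exists>K. \<forall>a b. norm (mulK a b) <= norm a * norm b * K"
  by (rule exI[of _ 1]) (simp add: norm_mulK_le)
qed

interpretation mulK: bounded_bilinear mulK
 by (rule bounded_bilinear_mulK)

lemma mulK_ka: "mulK k (ka g) = toL2 (%x. Kp k x * Kp g x)"
 by (simp add: ka_def mulK_toL2)

lemma mulK_ka_commute: "mulK k (ka g) = mulK g (ka k)"
 by (simp add: mulK_ka mult.commute)

lemma inner_mulK: "inner (mulK k g) h = inner g (mulK k h)"
proof -
 have "inner (mulK k g) (toL2 (fn h)) = (\<integral>x. Kp k x * fn g x * fn h x \<partial>lborel)"
  unfolding mulK_def by (rule inner_toL2) (auto intro: L2_fun_Kp_mult)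
 also have "... = (\<integral>x. fn g x * (Kp k x * fn h x) \<partial>lborel)" by (simp add: mult_ac)
 also have "... = inner (toL2 (fn g)) (mulK k h)"
  unfolding mulK_def by (rule inner_toL2[symmetric]) (auto intro: L2_fun_Kp_mult)
 finally show ?thesis by simp
qed

lemma mulK_commute: "mulK k (mulK k' g) = mulK k' (mulK k g)"
proof -
 have "mulK k (toL2 (%x. Kp k' x * fn g x)) = mulK k' (toL2 (%x. Kp k x * fn g x))"
  by (simp add: mulK_toL2 L2_fun_Kp_mult mult.left_commute)
 then show ?thesis by (simp add: mulK_def[of _ g])
qed

text \<open>The algebra property of the first Sobolev space. With v, w the images of
  \<open>g\<close>, \<open>h\<close>, the datum on the right is v w - v w' - w v', that is v w - (v
  w)'.\<close>

lemma Kp_mult: "Kp g x * Kp h x = Kp (mulK g h - mulK h (ka g - g)) x"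
proof -
 define f where "f x = Kp g x * Kp h x" for x
 define f' where "f' x = Kp g x * Kd h x + Kp h x * Kd g x" for x
 have L': "L2_fun f'" unfolding f'_def by (intro L2_fun_add L2_fun_Kp_mult) auto
 have Lf: "L2_fun f" unfolding f_def by (intro L2_fun_Kp_mult) auto
 have toL2f': "toL2 f' = mulK g (ka h - h) + mulK h (ka g - g)"
  unfolding f'_def by (subst toL2_add) (auto intro!: L2_fun_Kp_mult simp: mulK_toL2 simp flip: toL2_Kd)
 have "f = Kp (toL2 f - toL2 f')"
 proof (rule Kp_represent[OF _ _ Lf L'])
  show "continuous_on UNIV f" unfolding f_def by (intro continuous_intros Kp_continuous)
  show "\<bar>f x\<bar> <= norm g * norm h" for x
   unfolding f_def abs_mult by (intro mult_mono abs_Kp_le) auto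
  fix x y :: real assume "x <= y"
  let ?q = "%g. toL2 (%s. indicator {x..y} s * Kp g s)"
  have Lq: "L2_fun (%s. indicator {x..y} s * Kp g s)" for g
   using L2_fun_comp_Kp[of "%s. s"] by simp
  have chain: "inner (?q g) (ka g - g) = (Kp g y)^2 / 2 - (Kp g x)^2 / 2" for g
   using \<open>x <= y\<close> by (intro Kp_chain_rule[where G = "%s. s^2 / 2" and G' = "%s. s"])
    (auto intro!: derivative_eq_intros)
  \<comment> \<open>Polarization: the chain rule for the square at \<open>g + h\<close>,
    \<open>g\<close> and \<open>h\<close> combines to the product rule.\<close>
  have "?q (g + h) = ?q g + ?q h"
   using toL2_add[OF Lq[of g] Lq[of h]] by (simp add: Kp_add distrib_left)
  then have "inner (?q g) (ka h - h) + inner (?q h) (ka g - g) = f y - f x"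
   using chain[of "g + h"] chain[of g] chain[of h]
   by (simp add: ka_add Kp_add inner_simps f_def power2_eq_square algebra_simps add_divide_distrib)
  moreover have "inner (toL2 (indicator {x..y})) (mulK g (ka h - h)) = inner (?q g) (ka h - h)" for g h
  proof -
   have "mulK g (toL2 (indicator {x..y})) = ?q g"
    by (simp add: mulK_toL2 L2_fun_indicator mult.commute)
   then show ?thesis by (metis inner_mulK)
  qed
  ultimately show "f y - f x = inner (toL2 (indicator {x..y})) (toL2 f')"
   unfolding toL2f' by (simp add: inner_add_right)
 qed
 moreover have "toL2 f = mulK g (ka h)" by (simp add: f_def[abs_def] mulK_ka)
 ultimately have "f = Kp (mulK g (ka h) - (mulK g (ka h - h) + mulK h (ka g - g)))"
  using toL2f' by simp
 then have "f = Kp (mulK g h - mulK h (ka g - g))" by (simp add: mulK.diff_right)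
 then show ?thesis by (metis f_def)
qed

lemma ka_mult: "ka (mulK g h - mulK h (ka g - g)) = mulK g (ka h)"
proof -
 have "Kp (mulK g h - mulK h (ka g - g)) = (%x. Kp g x * Kp h x)" by (simp add: fun_eq_iff Kp_mult)
 then show ?thesis unfolding mulK_ka ka_def[of "mulK g h - mulK h (ka g - g)"] by simp
qed

lemma wd_mulK:
 assumes "f = ka g" "f' = ka h"
 shows "wd (mulK g f') (mulK g (f' - h) + mulK h (f - g))"
proof -
 have "wd (ka (mulK g h - mulK h (ka g - g))) (ka (mulK g h - mulK h (ka g - g)) - (mulK g h - mulK h (ka g - g)))"
  by (rule wd_ka)
 then show ?thesis unfolding ka_mult using assms by (simp add: mulK.diff_right algebra_simps)
qed

section \<open>The generator and its bounded approximations\<close>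

type_synonym state = "l2 \<times> l2"

text \<open>In the unknowns \<open>g = v - v\<^sub>x\<close> and \<open>u\<close> the linear part \<open>v\<^sub>t = u\<^sub>x\<close>, \<open>u\<^sub>t = v\<^sub>x - v\<^sub>x\<^sub>x\<^sub>x\<close> of the system reads
 \<open>g\<^sub>t = u\<^sub>x - u\<^sub>x\<^sub>x\<close>, \<open>u\<^sub>t = g\<^sub>x + g\<^sub>x\<^sub>x\<close>.\<close>

definition genA :: "state => state => bool" where
 "genA x z \<longleftrightarrow> (\<exists>g1 g2 u1 u2. wd (fst x) g1 & wd g1 g2 & wd (snd x) u1 & wd u1 u2 &
  z = (u1 - u2, g1 + g2))"

definition test_pair :: "(real => real) => (real => real) => state" where
 "test_pair ph th = (toL2 ph, toL2 th)"

definition A_test :: "(real => real) => (real => real) => state" where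
 "A_test ph th = (toL2 (deriv th) - toL2 (deriv (deriv th)), toL2 (deriv ph) + toL2 (deriv (deriv ph)))"

lemma wd_test: "test_fun ph ==> wd (toL2 ph) (toL2 (deriv ph))"
proof -
 assume ph: "test_fun ph"
 have "ka (toL2 ph - toL2 (deriv ph)) = toL2 ph"
  unfolding ka_def using Kp_test_represent[OF ph] by simp
 then show ?thesis using wd_ka[of "toL2 ph - toL2 (deriv ph)"] by simp
qed

lemma genA_test: "test_fun ph ==> test_fun th ==> genA (test_pair ph th) (A_test ph th)"
 unfolding genA_def test_pair_def A_test_def using wd_test test_fun_deriv by fastforce

text \<open>With D the weak derivative, the operators D - D^2 and D + D^2 are negative adjoints of
  each other.\<close>

lemma genA_skew:
 assumes "genA x z" "genA x' z'"
 shows "inner z x' = - inner x z'"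
proof -
 obtain g1 g2 u1 u2 where 1: "wd (fst x) g1" "wd g1 g2" "wd (snd x) u1" "wd u1 u2"
  "z = (u1 - u2, g1 + g2)" using assms(1) by (auto simp: genA_def)
 obtain h1 h2 k1 k2 where 2: "wd (fst x') h1" "wd h1 h2" "wd (snd x') k1" "wd k1 k2"
  "z' = (k1 - k2, h1 + h2)" using assms(2) by (auto simp: genA_def)
 have "inner u1 (fst x') = - inner (snd x) h1" "inner u2 (fst x') = inner (snd x) h2"
  "inner g1 (snd x') = - inner (fst x) k1" "inner g2 (snd x') = inner (fst x) k2"
  using wd_by_parts[OF 1(3) 2(1)] wd_by_parts[OF 1(4) 2(1)] wd_by_parts[OF 1(3) 2(2)]
   wd_by_parts[OF 1(1) 2(3)] wd_by_parts[OF 1(2) 2(3)] wd_by_parts[OF 1(1) 2(4)] by linarith+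
 then show ?thesis using 1(5) 2(5) by (simp add: inner_prod_def inner_simps)
qed

text \<open>The generator is minus the adjoint of its own restriction to test pairs: the weak
  equation returns the individual derivatives through \<open>wd_second_order_right\<close> and
  \<open>wd_second_order_left\<close>. Linearity and closedness of the graph follow from this
  description.\<close>

lemma genA_iff_weak:
 "genA x z \<longleftrightarrow> (\<forall>ph th. test_fun ph --> test_fun th --> inner z (test_pair ph th) = - inner x (A_test ph th))"
proof
 assume "genA x z"
 then show "\<forall>ph th. test_fun ph --> test_fun th --> inner z (test_pair ph th) = - inner x (A_test ph th)"
  using genA_skew genA_test by blast
next
 assume weak: "\<forall>ph th. test_fun ph --> test_fun th --> inner z (test_pair ph th) = - inner x (A_test ph th)"
 obtain g u z1 z2 where x: "x = (g, u)" and z: "z = (z1, z2)" by (metis surj_pair)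
 have z0: "toL2 (%x. 0) = 0" by (rule toL2_zero)
 have 1: "inner z1 (toL2 ph) = - inner u (toL2 (deriv ph) + toL2 (deriv (deriv ph)))" if "test_fun ph" for ph
  using weak[rule_format, OF that test_fun_zero] z0
  by (simp add: test_pair_def A_test_def x z inner_prod_def)
 have 2: "inner z2 (toL2 ph) = - inner g (toL2 (deriv ph) - toL2 (deriv (deriv ph)))" if "test_fun ph" for ph
  using weak[rule_format, OF test_fun_zero that] z0
  by (simp add: test_pair_def A_test_def x z inner_prod_def)
 have "wd u (ka z1)" "wd g (ka' z2)"
  using 1 2 by (auto intro!: wd_second_order_right wd_second_order_left)
 then show "genA x z"
  unfolding genA_def x z
  by (intro exI[of _ "ka' z2"] exI[of _ "z2 - ka' z2"] exI[of _ "ka z1"] exI[of _ "ka z1 - z1"])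
   (auto intro: wd_ka wd_ka')
qed

lemma genA_regularity:
 assumes "genA (g, u) (z1, z2)"
 shows "wd u (ka z1)" "wd g (ka' z2)"
proof -
 obtain g1 g2 u1 u2 where 1: "wd g g1" "wd g1 g2" "wd u u1" "wd u1 u2"
  "z1 = u1 - u2" "z2 = g1 + g2" using assms by (auto simp: genA_def)
 have "u1 = ka z1" using wd_imp_ka[OF 1(4)] 1(5) by simp
 then show "wd u (ka z1)" using 1 by simp
 have "wd (g1 - ka' z2) (g2 - (z2 - ka' z2))" by (intro wd_diff 1 wd_ka')
 then have "wd (g1 - ka' z2) (- (g1 - ka' z2))" using 1(6) by simp
 then have "inner (g1 - ka' z2) (- (g1 - ka' z2)) = 0" by (rule wd_inner_self)
 then have "g1 = ka' z2"
  by (simp only: inner_minus_right neg_equal_0_iff_equal inner_eq_zero_iff right_minus_eq)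
 then show "wd g (ka' z2)" using 1 by simp
qed

lemma genA_linear:
 assumes "genA x z" "genA x' z'"
 shows "genA (x + x') (z + z')" "genA (c *R x) (c *R z)"
 using assms unfolding genA_iff_weak by (auto simp: inner_simps)

lemma genA_closed:
 assumes "!!n::nat. genA (X n) (Z n)" "X >>> x" "Z >>> z"
 shows "genA x z"
 unfolding genA_iff_weak
proof (intro allI impI)
 fix ph th assume "test_fun ph" "test_fun th"
 then have "inner (Z n) (test_pair ph th) = - inner (X n) (A_test ph th)" for n
  using assms(1)[of n] by (simp add: genA_iff_weak)
 moreover have "(%n. inner (Z n) (test_pair ph th)) >>> inner z (test_pair ph th)"
  "(%n. - inner (X n) (A_test ph th)) >>> - inner x (A_test ph th)"
  by (intro tendsto_intros assms)+
 ultimately show "inner z (test_pair ph th) = - inner x (A_test ph th)"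
  using LIMSEQ_unique by auto
qed

lemma test_pair_orthogonal_eq_0:
 assumes "!!ph th. test_fun ph ==> test_fun th ==> inner x (test_pair ph th) = 0"
 shows "x = 0"
proof -
 have "inner (fst x) (toL2 ph) = 0" if "test_fun ph" for ph
  using assms[OF that test_fun_zero] by (simp add: test_pair_def inner_prod_def toL2_zero)
 moreover have "inner (snd x) (toL2 ph) = 0" if "test_fun ph" for ph
  using assms[OF test_fun_zero that] by (simp add: test_pair_def inner_prod_def toL2_zero)
 ultimately show ?thesis
  using test_fun_orthogonal_eq_0 by (metis prod.collapse zero_prod_def)
qed

section \<open>Translation invariance and the algebra of the two resolvents\<close>

lemma wd_tr: "wd f h ==> wd (tr s f) (tr s h)"
 unfolding wd_def
proof (intro allI impI)
 fix ph assume wd: "\<forall>ph. test_fun ph --> inner f (toL2 (deriv ph)) = - inner h (toL2 ph)"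
  and ph: "test_fun ph"
 have d: "deriv (%x. ph (x + - s)) = (%x. deriv ph (x + - s))"
 proof (rule deriv_real_eqI)
  show "((%x. ph (x + - s)) has_real_derivative deriv ph (x + - s)) (at x)" for x
   by (rule DERIV_cong[OF DERIV_chain2[OF smooth_fun_DERIV[OF test_fun_smooth[OF ph]]
      DERIV_add[OF DERIV_ident DERIV_const]]]) simp
 qed
 have "inner f (toL2 (deriv (%x. ph (x + - s)))) = - inner h (toL2 (%x. ph (x + - s)))"
  by (rule wd[rule_format, OF test_fun_translate[OF ph]])
 then show "inner (tr s f) (toL2 (deriv ph)) = - inner (tr s h) (toL2 ph)"
  using ph unfolding d by (simp add: inner_tr_left tr_toL2 L2_fun_test test_fun_deriv)
qed

lemma ka_tr: "ka (tr s f) = tr s (ka f)"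
proof -
 have "wd (tr s (ka f)) (tr s (ka f - f))" by (rule wd_tr[OF wd_ka])
 from wd_imp_ka[OF this] show ?thesis
  by (simp add: linear_diff[OF bounded_linear.linear[OF bounded_linear_tr]])
qed

lemma ka'_unique: "wd r (s - r) ==> r = ka' s"
proof -
 assume "wd r (s - r)"
 then have "wd (r - ka' s) ((s - r) - (s - ka' s))" by (intro wd_diff wd_ka')
 moreover have "(s - r) - (s - ka' s) = - (r - ka' s)" by simp
 ultimately have "inner (r - ka' s) (- (r - ka' s)) = 0" using wd_inner_self by metis
 then show ?thesis
  by (simp only: inner_minus_right neg_equal_0_iff_equal inner_eq_zero_iff right_minus_eq)
qed

lemma ka'_tr: "ka' (tr s f) = tr s (ka' f)"
proof -
 have "wd (tr s (ka' f)) (tr s (f - ka' f))" by (rule wd_tr[OF wd_ka'])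
 then have "wd (tr s (ka' f)) (tr s f - tr s (ka' f))"
  by (simp add: linear_diff[OF bounded_linear.linear[OF bounded_linear_tr]])
 from ka'_unique[OF this] show ?thesis by simp
qed

text \<open>Partial fractions for 1 / ((1 - D) (1 + D)).\<close>

lemma ka'_ka: "ka' (ka f) = (1/2) *R (ka f + ka' f)"
proof -
 have wd_half: "wd f h ==> wd ((1/2) *R f) ((1/2) *R h)" for f h by (simp add: wd_def)
 have "wd ((1/2) *R (ka f + ka' f)) ((1/2) *R ((ka f - f) + (f - ka' f)))"
  by (intro wd_half wd_add wd_ka wd_ka')
 moreover have "(1/2) *R ((ka f - f) + (f - ka' f)) = ka f - (1/2) *R (ka f + ka' f)"
 proof -
  have "ka f = (1/2) *R ka f + (1/2) *R ka f" by (simp flip: scaleR_left.add)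
  then show ?thesis by (simp add: algebra_simps)
 qed
 ultimately show ?thesis using ka'_unique by metis
qed

lemma ka_ka': "ka (ka' f) = (1/2) *R (ka f + ka' f)"
proof -
 have wd_half: "wd f h ==> wd ((1/2) *R f) ((1/2) *R h)" for f h by (simp add: wd_def)
 have w: "wd ((1/2) *R (ka f + ka' f)) ((1/2) *R ((ka f - f) + (f - ka' f)))"
  by (intro wd_half wd_add wd_ka wd_ka')
 have "ka' f = (1/2) *R ka' f + (1/2) *R ka' f" by (simp flip: scaleR_left.add)
 then have "(1/2) *R (ka f + ka' f) - (1/2) *R ((ka f - f) + (f - ka' f)) = ka' f"
  by (simp add: algebra_simps)
 then show ?thesis using wd_imp_ka[OF w] by simp
qed

lemma inner_ka_adjoint: "inner (ka f) g = inner f (ka' g)"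
 using wd_by_parts[OF wd_ka[of f] wd_ka'[of g]] by (simp add: inner_simps)

lemma wd_ka_wd: "wd f h ==> wd (ka f) (ka h)"
proof -
 assume "wd f h"
 then have "f = ka f - ka h" using wd_imp_ka by (simp flip: ka_diff)
 from arg_cong[OF this, of "%x. ka f - x"] have "ka f - f = ka h" by simp
 then show ?thesis using wd_ka[of f] by simp
qed

lemma wd_ka'_wd:
 assumes "wd f h"
 shows "wd (ka' f) (ka' h)"
proof -
 have "wd (f - ka' f) (h - (f - ka' f))" by (intro wd_diff assms wd_ka')
 then have "f - ka' f = ka' h" by (intro ka'_unique) simp
 then show ?thesis using wd_ka'[of f] by simp
qed

lemma wd_scaleR: "wd f h ==> wd (c *R f) (c *R h)"
 by (simp add: wd_def)

text \<open>The unitary operator \<open>(1 - \<partial>)(1 + \<partial>)\<^sup>-\<^sup>1\<close> and its inverse.  Symmetrising with them makes the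
 bounded approximations \<open>Ah h\<close> of the generator skew-adjoint and commuting.\<close>

definition cayU :: "l2 => l2" where "cayU f = 2 *R ka' f - f"
definition cayV :: "l2 => l2" where "cayV f = 2 *R ka f - f"

text \<open>The symmetric difference quotient, chosen because it is bounded, skew-adjoint and
  commutes with translations and with both resolvents.\<close>

definition Dh :: "real => l2 => l2" where
 "Dh h f = (1 / (2 * h)) *R (tr h f - tr (- h) f)"

lemma bounded_linear_cayU: "bounded_linear cayU"
 unfolding cayU_def[abs_def]
 by (intro bounded_linear_sub bounded_linear_ident bounded_linear_compose[OF bounded_linear_scaleR_right] bounded_linear_ka')

lemma bounded_linear_cayV: "bounded_linear cayV"
 unfolding cayV_def[abs_def]
 by (intro bounded_linear_sub bounded_linear_ident bounded_linear_compose[OF bounded_linear_scaleR_right] bounded_linear_ka)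

lemma bounded_linear_Dh: "bounded_linear (Dh h)"
 unfolding Dh_def[abs_def]
 by (intro bounded_linear_sub bounded_linear_tr bounded_linear_compose[OF bounded_linear_scaleR_right])

lemma linear_ka': "ka' (f + g) = ka' f + ka' g" "ka' (f - g) = ka' f - ka' g" "ka' (c *R f) = c *R ka' f"
 and linear_tr: "tr s (f + g) = tr s f + tr s g" "tr s (f - g) = tr s f - tr s g" "tr s (c *R f) = c *R tr s f"
 and linear_Dh: "Dh h (f + g) = Dh h f + Dh h g" "Dh h (f - g) = Dh h f - Dh h g" "Dh h (c *R f) = c *R Dh h f"
 and linear_cayU: "cayU (f + g) = cayU f + cayU g" "cayU (f - g) = cayU f - cayU g" "cayU (c *R f) = c *R cayU f"
 and linear_cayV: "cayV (f + g) = cayV f + cayV g" "cayV (f - g) = cayV f - cayV g" "cayV (c *R f) = c *R cayV f"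
 by (simp_all add: linear_add linear_diff linear_scale bounded_linear.linear bounded_linear_ka'
   bounded_linear_tr bounded_linear_Dh bounded_linear_cayU bounded_linear_cayV)

lemma cayU_cayV: "cayU (cayV f) = f" "cayV (cayU f) = f"
 by (simp_all add: cayU_def cayV_def linear_ka' ka_diff ka_scaleR ka'_ka ka_ka' scaleR_right_distrib)

lemma Dh_Dh: "Dh h (Dh k f) = Dh k (Dh h f)"
 by (simp add: Dh_def linear_tr tr_tr scaleR_right_diff_distrib add.commute mult.commute[of k h])

lemma cayU_Dh: "cayU (Dh h f) = Dh h (cayU f)"
 by (simp add: Dh_def linear_cayU) (simp add: cayU_def ka'_tr linear_tr)

lemma cayV_Dh: "cayV (Dh h f) = Dh h (cayV f)"
 by (simp add: Dh_def linear_cayV) (simp add: cayV_def ka_tr linear_tr)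

lemma inner_cayU: "inner (cayU f) g = inner f (cayV g)"
 using inner_ka_adjoint[of g f] by (simp add: cayU_def cayV_def inner_simps inner_commute)

lemma inner_Dh: "inner (Dh h f) g = - inner f (Dh h g)"
 by (simp add: Dh_def inner_simps inner_tr_left algebra_simps)

lemma wd_cayU: "wd f h ==> wd (cayU f) (cayU h)"
 unfolding cayU_def by (intro wd_diff wd_scaleR wd_ka'_wd)

lemma wd_cayV: "wd f h ==> wd (cayV f) (cayV h)"
 unfolding cayV_def by (intro wd_diff wd_scaleR wd_ka_wd)

lemma wd_Dh: "wd f k ==> wd (Dh h f) (Dh h k)"
 unfolding Dh_def by (intro wd_diff wd_scaleR wd_tr)

text \<open>The pair D - D^2, D + D^2 with difference quotients for D is skew, but its versions for
  different steps do not commute. Since \<open>cayU\<close> maps (D + D^2) f to (D - D^2) f, both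
  halves of this average approximate D - D^2; and now the second component of \<open>Ah\<close> is
  \<open>cayV\<close> of the same operator, which gives commutation, while averaging keeps
  skewness.\<close>

definition pA :: "real => l2 => l2" where
 "pA h f = (1/2) *R ((Dh h f - Dh h (Dh h f)) + cayU (Dh h f + Dh h (Dh h f)))"

definition Ah :: "real => state => state" where
 "Ah h w = (pA h (snd w), cayV (pA h (fst w)))"

lemma bounded_linear_pA: "bounded_linear (pA h)"
 unfolding pA_def[abs_def]
 by (intro bounded_linear_compose[OF bounded_linear_scaleR_right] bounded_linear_add bounded_linear_sub
   bounded_linear_compose[OF bounded_linear_cayU] bounded_linear_compose[OF bounded_linear_Dh] bounded_linear_Dh)

lemma bounded_linear_Ah: "bounded_linear (Ah h)"
 unfolding Ah_def[abs_def]
 by (intro bounded_linear_Pair bounded_linear_compose[OF bounded_linear_cayV]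
   bounded_linear_compose[OF bounded_linear_pA] bounded_linear_fst bounded_linear_snd)

lemma pA_cayV: "cayV (pA h f) = pA h (cayV f)"
 by (simp add: pA_def linear_cayV linear_cayU cayV_Dh[symmetric] cayU_cayV)

lemma pA_pA: "pA h (pA k f) = pA k (pA h f)"
 by (simp add: pA_def linear_Dh linear_cayU cayU_Dh Dh_Dh[of h k] scaleR_right_distrib scaleR_right_diff_distrib
   algebra_simps)

lemma Ah_Ah: "Ah h (Ah k w) = Ah k (Ah h w)"
 by (simp add: Ah_def pA_cayV pA_pA)

lemma inner_pA: "inner (pA h f) g = - inner f (cayV (pA h g))"
proof -
 have e: "inner (pA h f) g = (1/2) * (inner f (- Dh h g - Dh h (Dh h g)) + inner f (- Dh h (cayV g) + Dh h (Dh h (cayV g))))"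
  by (simp add: pA_def inner_simps inner_cayU inner_Dh)
 have v: "cayV (pA h g) = (1/2) *R ((Dh h (cayV g) - Dh h (Dh h (cayV g))) + (Dh h g + Dh h (Dh h g)))"
  by (simp add: pA_def linear_cayV cayV_Dh cayU_cayV)
 show ?thesis unfolding e v by (simp add: inner_simps algebra_simps)
qed

lemma Ah_skew: "inner (Ah h w) w = 0"
 using inner_pA[of h "snd w" "fst w"] inner_pA[of h "fst w" "snd w"]
 by (simp add: Ah_def inner_prod_def inner_commute)

lemma wd_pA: "wd f k ==> wd (pA h f) (pA h k)"
 unfolding pA_def by (intro wd_scaleR wd_add wd_diff wd_Dh wd_cayU)

text \<open>The components match because (1 + D) g' equals \<open>cayV\<close> applied to (1 - D)
  g', and \<open>cayV\<close> commutes with \<open>pA h\<close>.\<close>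

lemma genA_Ah: "genA x z ==> genA (Ah h x) (Ah h z)"
proof -
 assume "genA x z"
 then obtain g1 g2 u1 u2 where 1: "wd (fst x) g1" "wd g1 g2" "wd (snd x) u1" "wd u1 u2"
  "z = (u1 - u2, g1 + g2)" by (auto simp: genA_def)
 have lin: "pA h (f + g) = pA h f + pA h g" "pA h (f - g) = pA h f - pA h g" for f g
  by (simp_all add: linear_add linear_diff bounded_linear.linear bounded_linear_pA)
 have "wd (pA h (snd x)) (pA h u1)" "wd (pA h u1) (pA h u2)"
  "wd (cayV (pA h (fst x))) (cayV (pA h g1))" "wd (cayV (pA h g1)) (cayV (pA h g2))"
  using 1 by (auto intro!: wd_pA wd_cayV)
 moreover have "pA h g1 + pA h g2 = cayV (pA h g1) - cayV (pA h g2)" if "wd g g1" "wd g1 g2" for g g1 g2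
 proof -
  have "g1 + g2 = cayV (g1 - g2)"
   using wd_imp_ka[OF that(2)] by (simp add: cayV_def algebra_simps scaleR_2)
  then have "pA h (g1 + g2) = cayV (pA h (g1 - g2))" by (simp add: pA_cayV)
  then show ?thesis by (simp add: lin linear_cayV)
 qed
 from this[OF 1(1,2)] this[OF 1(3,4)] have
  "Ah h z = (cayV (pA h g1) - cayV (pA h g2), cayV (pA h (u1 - u2)))" "pA h u1 + pA h u2 = cayV (pA h (u1 - u2))"
  using 1(5) by (simp_all add: Ah_def lin linear_cayV)
 ultimately show ?thesis
  unfolding genA_def Ah_def
  by (intro exI[of _ "pA h u1"] exI[of _ "pA h u2"] exI[of _ "cayV (pA h g1)"] exI[of _ "cayV (pA h g2)"])
   auto
qed

text \<open>By the mean value theorem a difference quotient is a derivative evaluated nearby; the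
  factor 2 leaves room for a quotient taken twice. Uniform nearness and compact support provide the
  dominating function.\<close>

lemma L2_tendsto_nearby:
 assumes ps: "test_fun ps" and Lq: "!!n. L2_fun (q n)"
  and near: "!!n x. \<exists>s. \<bar>s - x\<bar> <= 2 * inverse (real (Suc n)) & q n x = ps s"
 shows "(%n. toL2 (q n)) >>> toL2 ps"
proof -
 obtain R where R: "0 < R" "!!x. R < \<bar>x\<bar> ==> ps x = 0" using test_fun_supportE[OF ps] by blast
 have cont: "continuous_on UNIV ps" by (rule smooth_fun_continuous[OF test_fun_smooth[OF ps]])
 obtain C where C: "0 < C" "!!s. \<bar>s\<bar> <= R ==> \<bar>ps s\<bar> <= C"
  using continuous_bounded_on_ball[OF cont] by blast
 have C': "\<bar>ps s\<bar> <= C" for s using C R(2)[of s] by (cases "R < \<bar>s\<bar>") auto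
 define si where "si n x = (SOME s. \<bar>s - x\<bar> <= 2 * inverse (real (Suc n)) & q n x = ps s)" for n x
 have si: "\<bar>si n x - x\<bar> <= 2 * inverse (real (Suc n))" "q n x = ps (si n x)" for n x
  using someI_ex[OF near[of x n]] by (simp_all add: si_def)
 show ?thesis
 proof (rule L2_dominated_convergence[of _ _ "%x. (2 * C) * indicator {-(R+2)..R+2} x"])
  show "L2_fun (%x. (2 * C) * indicator {-(R+2)..R+2} x)" by (intro L2_fun_scale L2_fun_indicator)
  show "L2_fun ps" by (rule L2_fun_test[OF ps])
  show "AE x in lborel. (%n. q n x) >>> ps x"
  proof (rule AE_I2)
   fix x
   have "(%n. 2 * inverse (real (Suc n))) >>> 2 * 0"
    by (intro tendsto_intros LIMSEQ_inverse_real_of_nat)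
   then have lim0: "(%n. 2 * inverse (real (Suc n))) >>> 0" by (simp only: mult_zero_right)
   have "\<forall>n. norm (si n x - x) <= 2 * inverse (real (Suc n))"
    unfolding real_norm_def using si(1) by blast
   then have "(%n. si n x - x) >>> 0"
    by (rule Lim_null_comparison[OF always_eventually lim0])
   then have "(%n. si n x) >>> x" by (simp add: LIM_zero_iff)
   then have "(%n. ps (si n x)) >>> ps x"
    by (rule isCont_tendsto_compose[rotated]) (use cont in \<open>simp add: continuous_on_eq_continuous_at\<close>)
   then show "(%n. q n x) >>> ps x" by (simp add: si(2))
  qed
  show "AE x in lborel. \<bar>q n x - ps x\<bar> <= (2 * C) * indicator {-(R+2)..R+2} x" for n
  proof (rule AE_I2)
   fix x
   have "\<bar>q n x - ps x\<bar> <= 2 * C" using C'[of "si n x"] C'[of x] unfolding si(2) by linarith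
   moreover have "q n x = 0 & ps x = 0" if "R + 2 < \<bar>x\<bar>"
   proof -
    have "inverse (real (Suc n)) <= 1" by (simp add: inverse_eq_divide)
    then have "R < \<bar>si n x\<bar>" using that si(1)[of n x] by linarith
    then show ?thesis using R(2) that by (simp add: si(2))
   qed
   ultimately show "\<bar>q n x - ps x\<bar> <= (2 * C) * indicator {-(R+2)..R+2} x"
    by (cases "R + 2 < \<bar>x\<bar>") (auto simp: indicator_def)
  qed
 qed (rule Lq)
qed

definition diffq :: "real => (real => real) => real => real" where
 "diffq h ph x = (1 / (2 * h)) * (ph (x + h) - ph (x + - h))"

lemma Dh_toL2:
 assumes "L2_fun ph"
 shows "Dh h (toL2 ph) = toL2 (diffq h ph)" "L2_fun (diffq h ph)"
proof -
 note LT = L2_fun_translate[OF assms]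
 show "Dh h (toL2 ph) = toL2 (diffq h ph)"
  unfolding diffq_def[abs_def] Dh_def tr_toL2[OF assms]
  by (simp only: toL2_scale[OF L2_fun_diff[OF LT LT]] toL2_diff[OF LT LT])
 show "L2_fun (diffq h ph)"
  unfolding diffq_def[abs_def] by (intro L2_fun_scale L2_fun_diff LT)
qed

lemma diffq_nearby:
 assumes "!!x. (ph has_real_derivative ph' x) (at x)" "0 < h"
 obtains s where "\<bar>s - x\<bar> <= h" "diffq h ph x = ph' s"
proof -
 obtain s where s: "x + - h < s" "s < x + h" "ph (x + h) - ph (x + - h) = (x + h - (x + - h)) * ph' s"
  using MVT2[of "x + - h" "x + h" ph ph'] assms by auto
 show ?thesis by (rule that[of s]) (use s assms(2) in \<open>auto simp: diffq_def\<close>)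
qed

lemma diffq_DERIV:
 assumes "!!x. (ph has_real_derivative ph' x) (at x)"
 shows "(diffq h ph has_real_derivative diffq h ph' x) (at x)"
proof -
 have *: "((%x. ph (x + c)) has_real_derivative ph' (x + c)) (at x)" for c
  by (rule DERIV_cong[OF DERIV_chain2[OF assms DERIV_add[OF DERIV_ident DERIV_const]]]) simp
 show ?thesis
  unfolding diffq_def[abs_def] by (intro DERIV_cmult DERIV_diff *)
qed

lemma Dh_test_tendsto:
 assumes "test_fun ph"
 shows "(%n. Dh (inverse (real (Suc n))) (toL2 ph)) >>> toL2 (deriv ph)"
  and "(%n. Dh (inverse (real (Suc n))) (Dh (inverse (real (Suc n))) (toL2 ph))) >>> toL2 (deriv (deriv ph))"
proof -
 define h where "h n = inverse (real (Suc n))" for n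
 have h: "0 < h n" for n by (simp add: h_def)
 have d: "(ph has_real_derivative deriv ph x) (at x)" for x
  by (rule smooth_fun_DERIV[OF test_fun_smooth[OF assms]])
 have dd: "(deriv ph has_real_derivative deriv (deriv ph) x) (at x)" for x
  by (rule smooth_fun_DERIV[OF test_fun_smooth[OF test_fun_deriv[OF assms]]])
 note L = L2_fun_test[OF assms]
 have "(%n. toL2 (diffq (h n) ph)) >>> toL2 (deriv ph)"
 proof (rule L2_tendsto_nearby[OF test_fun_deriv[OF assms] Dh_toL2(2)[OF L]])
  fix n x
  obtain s where "\<bar>s - x\<bar> <= h n" "diffq (h n) ph x = deriv ph s" using diffq_nearby[OF d h] by metis
  then show "\<exists>s. \<bar>s - x\<bar> <= 2 * inverse (real (Suc n)) & diffq (h n) ph x = deriv ph s"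
   using h[of n] unfolding h_def by (intro exI[of _ s]) linarith
 qed
 then show "(%n. Dh (inverse (real (Suc n))) (toL2 ph)) >>> toL2 (deriv ph)"
  by (simp add: Dh_toL2(1)[OF L] h_def)
 have "(%n. toL2 (diffq (h n) (diffq (h n) ph))) >>> toL2 (deriv (deriv ph))"
 proof (rule L2_tendsto_nearby[OF test_fun_deriv[OF test_fun_deriv[OF assms]] Dh_toL2(2)[OF Dh_toL2(2)[OF L]]])
  fix n x
  obtain r where r: "\<bar>r - x\<bar> <= h n" "diffq (h n) (diffq (h n) ph) x = diffq (h n) (deriv ph) r"
   using diffq_nearby[OF diffq_DERIV[OF d] h] by metis
  obtain s where s: "\<bar>s - r\<bar> <= h n" "diffq (h n) (deriv ph) r = deriv (deriv ph) s"
   using diffq_nearby[OF dd h] by metis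
  have "\<bar>s - x\<bar> <= 2 * h n" using r(1) s(1) by linarith
  then show "\<exists>s. \<bar>s - x\<bar> <= 2 * inverse (real (Suc n)) & diffq (h n) (diffq (h n) ph) x = deriv (deriv ph) s"
   using r(2) s(2) unfolding h_def by auto
 qed
 then show "(%n. Dh (inverse (real (Suc n))) (Dh (inverse (real (Suc n))) (toL2 ph))) >>> toL2 (deriv (deriv ph))"
  by (simp add: Dh_toL2(1)[OF L] Dh_toL2(1)[OF Dh_toL2(2)[OF L]] h_def)
qed

lemma Ah_test_tendsto:
 assumes ph: "test_fun ph" and th: "test_fun th"
 shows "(%n. Ah (inverse (real (Suc n))) (test_pair ph th)) >>> A_test ph th"
proof -
 have U: "cayU (toL2 (deriv ph) + toL2 (deriv (deriv ph))) = toL2 (deriv ph) - toL2 (deriv (deriv ph))"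
  if "test_fun ph" for ph
 proof -
  have "wd (toL2 (deriv ph)) (toL2 (deriv (deriv ph)))" by (rule wd_test[OF test_fun_deriv[OF that]])
  then have "wd (toL2 (deriv ph)) ((toL2 (deriv ph) + toL2 (deriv (deriv ph))) - toL2 (deriv ph))" by simp
  from ka'_unique[OF this] show ?thesis by (simp add: cayU_def scaleR_2)
 qed
 have p: "(%n. pA (inverse (real (Suc n))) (toL2 ph)) >>> toL2 (deriv ph) - toL2 (deriv (deriv ph))"
  if "test_fun ph" for ph
 proof -
  let ?a = "toL2 (deriv ph)" and ?b = "toL2 (deriv (deriv ph))"
  have "(%n. pA (inverse (real (Suc n))) (toL2 ph)) >>> (1/2) *R ((?a - ?b) + cayU (?a + ?b))"
   unfolding pA_def
   by (intro tendsto_intros Dh_test_tendsto[OF that] bounded_linear.tendsto[OF bounded_linear_cayU])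
  then show ?thesis unfolding U[OF that] by (simp flip: scaleR_2)
 qed
 have V: "cayV (toL2 (deriv ph) - toL2 (deriv (deriv ph))) = toL2 (deriv ph) + toL2 (deriv (deriv ph))"
  using U[OF ph] cayU_cayV(2) by metis
 show ?thesis
  unfolding Ah_def test_pair_def A_test_def fst_conv snd_conv V[symmetric]
  by (intro tendsto_Pair p ph th bounded_linear.tendsto[OF bounded_linear_cayV])
qed

subsection \<open>The Banach algebra of bounded operators on the state space\<close>

text \<open>A copy of the bounded operators whose multiplication is composition, so that the
  exponential series and its calculus in Banach algebras become available.\<close>

typedef op = "UNIV :: (state \<Rightarrow>\<^sub>L state) set" morphisms bl Op
 by simp

setup_lifting type_definition_op

text \<open>This is what makes 1 different from 0 and of norm 1 in the operator algebra.\<close>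

lemma state_nontrivial: "\<exists>x::state. x ~= 0"
proof -
 have "(norm (toL2 (indicator {0..1})))^2 = 1"
 proof -
  have "(%x. (indicator {0..1} x :: real)^2) = indicator {0..1::real}"
   by (auto simp: indicator_def fun_eq_iff)
  then show ?thesis by (simp add: norm_toL2_sq[OF L2_fun_indicator])
 qed
 then have "toL2 (indicator {0..1}) ~= 0" by auto
 then have "(toL2 (indicator {0..1}), 0) ~= (0 :: state)" by (simp add: zero_prod_def)
 then show ?thesis by blast
qed

instantiation op :: real_normed_algebra_1
begin

lift_definition zero_op :: op is 0 .
lift_definition one_op :: op is id_blinfun .
lift_definition plus_op :: "op => op => op" is "(+)" .
lift_definition minus_op :: "op => op => op" is "(-)" .
lift_definition uminus_op :: "op => op" is uminus .
lift_definition times_op :: "op => op => op" is blinfun_compose .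
lift_definition scaleR_op :: "real => op => op" is scaleR .
lift_definition norm_op :: "op => real" is norm .
definition dist_op :: "op => op => real" where "dist_op a b = norm (a - b)"
definition sgn_op :: "op => op" where "sgn_op a = inverse (norm a) *R a"
definition uniformity_op :: "(op \<times> op) filter" where
 "uniformity_op = (INF e\<in>{0<..}. principal {(x, y). dist x y < e})"
definition open_op :: "op set => bool" where
 "open_op U \<longleftrightarrow> (\<forall>x\<in>U. \<forall>\<^sub>F (x', y) in uniformity. x' = x --> y : U)"

instance
proof
 fix a b c :: op and r s :: real
 show "a + b + c = a + (b + c)" by transfer simp
 show "a + b = b + a" by transfer simp
 show "0 + a = a" by transfer simp
 show "- a + a = 0" by transfer simp
 show "a - b = a + - b" by transfer simp
 show "r *R (a + b) = r *R a + r *R b" by transfer (simp add: scaleR_right_distrib)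
 show "(r + s) *R a = r *R a + s *R a" by transfer (simp add: scaleR_left_distrib)
 show "r *R s *R a = (r * s) *R a" by transfer simp
 show "1 *R a = a" by transfer simp
 show "a * b * c = a * (b * c)" by transfer (rule blinfun_eqI, simp)
 show "(a + b) * c = a * c + b * c"
  by transfer (rule blinfun_eqI, simp add: blinfun.bilinear_simps)
 show "a * (b + c) = a * b + a * c"
  by transfer (rule blinfun_eqI, simp add: blinfun.bilinear_simps)
 show "r *R a * b = r *R (a * b)"
  by transfer (rule blinfun_eqI, simp add: blinfun.bilinear_simps)
 show "a * r *R b = r *R (a * b)"
  by transfer (rule blinfun_eqI, simp add: blinfun.bilinear_simps)
 show "1 * a = a" by transfer (rule blinfun_eqI, simp)
 show "a * 1 = a" by transfer (rule blinfun_eqI, simp)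
 show "(0::op) ~= 1"
 proof transfer
  obtain x :: state where "x ~= 0" using state_nontrivial by blast
  then have "blinfun_apply 0 x ~= blinfun_apply id_blinfun x" by simp
  then show "(0 :: state \<Rightarrow>\<^sub>L state) ~= id_blinfun" by metis
 qed
 show "dist a b = norm (a - b)" by (rule dist_op_def)
 show "sgn a = inverse (norm a) *R a" by (rule sgn_op_def)
 show "(uniformity :: (op \<times> op) filter) = (INF e\<in>{0<..}. principal {(x, y). dist x y < e})"
  by (rule uniformity_op_def)
 show "open U \<longleftrightarrow> (\<forall>x\<in>U. \<forall>\<^sub>F (x', y) in uniformity. x' = x --> y : U)" for U :: "op set"
  by (rule open_op_def)
 show "norm a = 0 \<longleftrightarrow> a = 0" by transfer simp
 show "norm (a + b) <= norm a + norm b" by transfer (rule norm_triangle_ineq)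
 show "norm (r *R a) = \<bar>r\<bar> * norm a" by transfer simp
 show "norm (a * b) <= norm a * norm b" by transfer (rule norm_blinfun_compose)
 show "norm (1::op) = 1"
 proof transfer
  obtain x :: state where x: "x ~= 0" using state_nontrivial by blast
  have "norm x <= norm (id_blinfun :: state \<Rightarrow>\<^sub>L state) * norm x"
   using norm_blinfun[of "id_blinfun :: state \<Rightarrow>\<^sub>L state" x] by simp
  then have "1 <= norm (id_blinfun :: state \<Rightarrow>\<^sub>L state)" using x by simp
  then show "norm (id_blinfun :: state \<Rightarrow>\<^sub>L state) = 1"
   using norm_blinfun_id_le by (intro antisym)
 qed
qed

end

instance op :: banach
proof
 fix X :: "nat => op" assume X: "Cauchy X"
 have d: "dist (bl a) (bl b) = dist a b" for a b
  unfolding dist_norm by transfer simp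
 have "Cauchy (%n. bl (X n))" using X by (simp add: Cauchy_def d)
 then obtain L where "(%n. bl (X n)) >>> L" using Cauchy_convergent convergent_def by blast
 then have "(%n. bl (X n)) >>> bl (Op L)" by (simp add: Op_inverse)
 then have "X >>> Op L" unfolding tendsto_iff d .
 then show "convergent X" by (rule convergentI)
qed

definition oap :: "op => state => state" where "oap a x = blinfun_apply (bl a) x"

lemma oap_mult: "oap (a * b) x = oap a (oap b x)"
 unfolding oap_def by transfer simp

lemma oap_one: "oap 1 x = x"
 unfolding oap_def by transfer simp

lemma oap_zero: "oap 0 x = 0"
 unfolding oap_def by transfer simp

lemma oap_add: "oap (a + b) x = oap a x + oap b x"
 unfolding oap_def by transfer (simp add: blinfun.bilinear_simps)

lemma oap_diff: "oap (a - b) x = oap a x - oap b x"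
 unfolding oap_def by transfer (simp add: blinfun.bilinear_simps)

lemma oap_scaleR: "oap (r *R a) x = r *R oap a x"
 unfolding oap_def by transfer (simp add: blinfun.bilinear_simps)

lemma bounded_linear_oap_right: "bounded_linear (oap a)"
 unfolding oap_def by (rule blinfun.bounded_linear_right)

lemma norm_oap: "norm (oap a x) <= norm a * norm x"
 unfolding oap_def by transfer (rule norm_blinfun)

lemma bounded_linear_oap_left: "bounded_linear (%a. oap a x)"
 by (rule bounded_linear_intro[of _ "norm x"]) (auto simp: oap_add oap_scaleR norm_oap)

lemma op_eqI: "(!!x. oap a x = oap b x) ==> a = b"
 unfolding oap_def by (metis bl_inject blinfun_eqI)

definition skew_op :: "op => bool" where "skew_op b \<longleftrightarrow> (\<forall>x. inner (oap b x) x = 0)"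

lemma exp_op_deriv:
 "((%t. oap (exp (t *R b)) x) has_vector_derivative oap b (oap (exp (t *R b)) x)) (at t)"
 using bounded_linear.has_vector_derivative[OF bounded_linear_oap_left exp_scaleR_has_vector_derivative_left]
 by (simp add: oap_mult)

lemma exp_op_deriv_right:
 "((%t. oap (exp (t *R b)) x) has_vector_derivative oap (exp (t *R b)) (oap b x)) (at t)"
 using bounded_linear.has_vector_derivative[OF bounded_linear_oap_left exp_scaleR_has_vector_derivative_right]
 by (simp add: oap_mult)

lemma norm_exp_skew:
 assumes "skew_op b"
 shows "norm (oap (exp (t *R b)) x) = norm x"
proof -
 define y where "y t = oap (exp (t *R b)) x" for t
 have dy: "(y has_vector_derivative oap b (y t)) (at t)" for t
  unfolding y_def by (rule exp_op_deriv)
 have "((%t. inner (y t) (y t)) has_real_derivative 0) (at t)" for t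
 proof -
  have "((%t. inner (y t) (y t)) has_vector_derivative
    inner (y t) (oap b (y t)) + inner (oap b (y t)) (y t)) (at t)"
   by (rule bounded_bilinear.has_vector_derivative[OF bounded_bilinear_inner dy dy])
  moreover have "inner (oap b (y t)) (y t) = 0" using assms unfolding skew_op_def by blast
  ultimately show ?thesis
   by (simp add: inner_commute has_real_derivative_iff_has_vector_derivative)
 qed
 then have "inner (y t) (y t) = inner (y 0) (y 0)" using DERIV_isconst_all by blast
 then show ?thesis by (simp add: norm_eq_sqrt_inner y_def oap_one)
qed

lemma vector_derivative_norm_bound:
 fixes y :: "real => 'a::real_normed_vector"
 assumes "!!t. t : {a..b} ==> (y has_vector_derivative y' t) (at t within {a..b})"
  "!!t. t : {a..b} ==> norm (y' t) <= B" "s : {a..b}" "t : {a..b}"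
 shows "norm (y t - y s) <= B * \<bar>t - s\<bar>"
proof -
 have "norm (y t - y s) <= B * norm (t - s)"
 proof (rule differentiable_bound[of "{a..b}" y "%t h. h *R y' t"])
  show "onorm (%h. h *R y' t) <= B" if "t : {a..b}" for t
   using assms(2)[OF that] by (intro onorm_le) (simp add: mult.commute[of B] mult_left_mono)
 qed (use assms in \<open>auto simp: has_vector_derivative_def\<close>)
 then show ?thesis by simp
qed

lemma norm_exp_skew_diff:
 assumes "skew_op b"
 shows "norm (oap (exp (t *R b)) x - x) <= \<bar>t\<bar> * norm (oap b x)"
proof -
 have "norm (oap (exp (t *R b)) x - oap (exp (0 *R b)) x) <= norm (oap b x) * \<bar>t - 0\<bar>"
  by (rule vector_derivative_norm_bound[of "- \<bar>t\<bar>" "\<bar>t\<bar>" _ "%t. oap (exp (t *R b)) (oap b x)"])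
   (auto intro!: has_vector_derivative_at_within[OF exp_op_deriv_right] simp: norm_exp_skew[OF assms])
 then show ?thesis by (simp add: oap_one mult.commute)
qed

subsection \<open>The unitary group of the linear equation\<close>

definition An :: "nat => op" where "An n = Op (Blinfun (Ah (inverse (real (Suc n)))))"

lemma oap_An: "oap (An n) x = Ah (inverse (real (Suc n))) x"
 by (simp add: An_def oap_def Op_inverse bounded_linear_Blinfun_apply[OF bounded_linear_Ah])

lemma An_commute: "An m * An n = An n * An m"
 by (rule op_eqI) (simp add: oap_mult oap_An Ah_Ah)

lemma skew_An: "skew_op (An n)"
 by (simp add: skew_op_def oap_An Ah_skew)

lemma skew_An_diff: "skew_op (An n - An m)"
 by (simp add: skew_op_def oap_diff oap_An inner_diff_left Ah_skew)

definition Sn :: "nat => real => state => state" where "Sn n t x = oap (exp (t *R An n)) x"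

lemma norm_Sn: "norm (Sn n t x) = norm x"
 by (simp add: Sn_def norm_exp_skew skew_An)

lemma Sn_diff: "Sn n t (x - y) = Sn n t x - Sn n t y"
 and Sn_add: "Sn n t (x + y) = Sn n t x + Sn n t y"
 and Sn_scaleR: "Sn n t (c *R x) = c *R Sn n t x"
 using bounded_linear.linear[OF bounded_linear_oap_right]
 by (simp_all add: Sn_def linear_diff linear_add linear_scale)

text \<open>Because the approximations commute, one exponential is the other times the exponential
  of the skew difference. The isometric factor drops out, and the remaining one moves
  \<open>x\<close> by at most \<open>\<bar>t\<bar>\<close> times the difference of the generators at
  \<open>x\<close>.\<close>

lemma Sn_difference: "norm (Sn n t x - Sn m t x) <= \<bar>t\<bar> * norm (oap (An n) x - oap (An m) x)"
proof -
 have comm: "(t *R An m) * (t *R (An n - An m)) = (t *R (An n - An m)) * (t *R An m)"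
  by (simp add: algebra_simps An_commute)
 have "exp (t *R An n) = exp (t *R An m + t *R (An n - An m))" by (simp add: algebra_simps)
 also have "... = exp (t *R An m) * exp (t *R (An n - An m))" by (rule exp_add_commuting[OF comm])
 finally have "Sn n t x - Sn m t x = Sn m t (oap (exp (t *R (An n - An m))) x - x)"
  unfolding Sn_diff by (simp add: Sn_def oap_mult)
 then have "norm (Sn n t x - Sn m t x) = norm (oap (exp (t *R (An n - An m))) x - x)"
  by (simp add: norm_Sn)
 also have "... <= \<bar>t\<bar> * norm (oap (An n - An m) x)" by (rule norm_exp_skew_diff[OF skew_An_diff])
 finally show ?thesis by (simp add: oap_diff)
qed

lemma test_pair_dense:
 assumes "0 < e"
 obtains ph th where "test_fun ph" "test_fun th" "norm (x - test_pair ph th) < e"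
proof -
 obtain ph where ph: "test_fun ph" "norm (fst x - toL2 ph) < e / 2" using test_fun_dense assms half_gt_zero by blast
 obtain th where th: "test_fun th" "norm (snd x - toL2 th) < e / 2" using test_fun_dense assms half_gt_zero by blast
 have "norm (x - test_pair ph th) <= norm (fst x - toL2 ph) + norm (snd x - toL2 th)"
  by (cases x) (simp add: test_pair_def norm_Pair sqrt_sum_squares_le_sum)
 then show ?thesis using that[OF ph(1) th(1)] ph(2) th(2) by linarith
qed

text \<open>On test pairs the approximate generators converge, so \<open>Sn_difference\<close>
  applies; the isometry of all \<open>Sn n t\<close> extends the conclusion to the closure, which is
  the whole space.\<close>

lemma Sn_Cauchy: "Cauchy (%n. Sn n t x)"
proof (rule metric_CauchyI)
 fix e :: real assume e: "0 < e"
 obtain ph th where p: "test_fun ph" "test_fun th" "norm (x - test_pair ph th) < e / 3"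
  using test_pair_dense[of "e/3" x] e by auto
 let ?p = "test_pair ph th"
 have "convergent (%n. oap (An n) ?p)"
  unfolding oap_An using Ah_test_tendsto[OF p(1,2)] by (rule convergentI)
 then have "Cauchy (%n. oap (An n) ?p)" by (rule convergent_Cauchy)
 then obtain M where M: "!!m n. m >= M ==> n >= M ==> dist (oap (An m) ?p) (oap (An n) ?p) < e / (3 * (\<bar>t\<bar> + 1))"
  using e by (metis (no_types, lifting) Cauchy_def abs_ge_zero add_nonneg_pos divide_pos_pos mult_pos_pos
    zero_less_numeral zero_less_one)
 show "\<exists>M. \<forall>m\<ge>M. \<forall>n\<ge>M. dist (Sn m t x) (Sn n t x) < e"
 proof (intro exI[of _ M] allI impI)
  fix m n assume mn: "m >= M" "n >= M"
  have "norm (Sn m t ?p - Sn n t ?p) <= \<bar>t\<bar> * norm (oap (An m) ?p - oap (An n) ?p)" by (rule Sn_difference)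
  also have "... <= (\<bar>t\<bar> + 1) * norm (oap (An m) ?p - oap (An n) ?p)" by (intro mult_right_mono) auto
  also have "... < (\<bar>t\<bar> + 1) * (e / (3 * (\<bar>t\<bar> + 1)))"
   using M[OF mn] by (intro mult_strict_left_mono) (auto simp: dist_norm)
  also have "... = e / 3" using abs_ge_zero[of t] by (simp add: field_simps)
  finally have 1: "norm (Sn m t ?p - Sn n t ?p) < e / 3" .
  have 2: "norm (Sn k t x - Sn k t ?p) < e / 3" for k
   using p(3) norm_Sn[of k t "x - ?p"] by (simp add: Sn_diff)
  show "dist (Sn m t x) (Sn n t x) < e"
   using 1 2[of m] 2[of n] dist_triangle[of "Sn m t x" "Sn n t x" "Sn m t ?p"]
    dist_triangle[of "Sn m t ?p" "Sn n t x" "Sn n t ?p"]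
   by (simp add: dist_norm norm_minus_commute)
 qed
qed

definition S :: "real => state => state" where "S t x = lim (%n. Sn n t x)"

lemma Sn_tendsto: "(%n. Sn n t x) >>> S t x"
 unfolding S_def using Sn_Cauchy Cauchy_convergent convergent_LIMSEQ_iff by blast

lemma norm_S [simp]: "norm (S t x) = norm x"
 using tendsto_norm[OF Sn_tendsto[of t x]] by (simp add: norm_Sn LIMSEQ_const_iff)

lemma S_add: "S t (x + y) = S t x + S t y"
 using LIMSEQ_unique[OF Sn_tendsto[of t "x + y"]] tendsto_add[OF Sn_tendsto[of t x] Sn_tendsto[of t y]]
 by (simp add: Sn_add)

lemma S_scaleR: "S t (c *R x) = c *R S t x"
 using LIMSEQ_unique[OF Sn_tendsto[of t "c *R x"]] tendsto_scaleR[OF tendsto_const Sn_tendsto[of t x], of c]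
 by (simp add: Sn_scaleR)

lemma S_diff: "S t (x - y) = S t x - S t y"
 using S_add[of t x "- y"] S_scaleR[of t "-1" y] by simp

lemma S_0 [simp]: "S 0 x = x"
 using Sn_tendsto[of 0 x] by (simp add: Sn_def oap_one LIMSEQ_const_iff)

lemma Sn_group: "Sn n s (Sn n t x) = Sn n (s + t) x"
proof -
 have "exp (s *R An n) * exp (t *R An n) = exp (s *R An n + t *R An n)"
  by (rule exp_add_commuting[symmetric]) simp
 then show ?thesis by (simp add: Sn_def scaleR_add_left flip: oap_mult)
qed

lemma S_group: "S s (S t x) = S (s + t) x"
proof -
 have "(%n. Sn n s (Sn n t x) - Sn n s (S t x)) >>> 0"
 proof (rule tendsto_norm_zero_cancel)
  have "(%n. norm (Sn n t x - S t x)) >>> 0"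
   using Sn_tendsto[of t x] by (simp add: LIM_zero_iff tendsto_norm_zero_iff)
  then show "(%n. norm (Sn n s (Sn n t x) - Sn n s (S t x))) >>> 0"
   by (simp add: norm_Sn flip: Sn_diff)
 qed
 from tendsto_add[OF this Sn_tendsto[of s "S t x"]]
 have "(%n. Sn n (s + t) x) >>> S s (S t x)" by (simp add: Sn_group)
 then show ?thesis using Sn_tendsto LIMSEQ_unique by blast
qed

lemma S_inverse [simp]: "S t (S (- t) x) = x" "S (- t) (S t x) = x"
 by (simp_all add: S_group)

lemma inner_S [simp]: "inner (S t x) (S t y) = inner x y"
proof -
 have "(norm (S t x + S t y))^2 = (norm (x + y))^2" by (simp flip: S_add)
 moreover have "inner (S t x) (S t x) = inner x x" for x by (simp flip: power2_norm_eq_inner)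
 ultimately show ?thesis by (simp add: power2_norm_eq_inner inner_simps inner_commute)
qed

lemma inner_S_left: "inner (S t x) y = inner x (S (- t) y)"
 by (metis S_inverse(2) inner_S)

lemma S_test_lipschitz:
 assumes "test_fun ph" "test_fun th"
 shows "norm (S t (test_pair ph th) - test_pair ph th) <= \<bar>t\<bar> * norm (A_test ph th)"
proof (rule LIMSEQ_le)
 show "(%n. norm (Sn n t (test_pair ph th) - test_pair ph th)) >>> norm (S t (test_pair ph th) - test_pair ph th)"
  by (intro tendsto_intros Sn_tendsto)
 show "(%n. \<bar>t\<bar> * norm (oap (An n) (test_pair ph th))) >>> \<bar>t\<bar> * norm (A_test ph th)"
  unfolding oap_An by (intro tendsto_intros Ah_test_tendsto assms)
 show "\<exists>N. \<forall>n\<ge>N. norm (Sn n t (test_pair ph th) - test_pair ph th) <= \<bar>t\<bar> * norm (oap (An n) (test_pair ph th))"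
  using norm_exp_skew_diff[OF skew_An] by (auto simp: Sn_def)
qed

lemma S_continuous: "continuous_on UNIV (%t. S t x)"
proof (rule continuous_at_imp_continuous_on, intro ballI)
 fix t :: real
 show "isCont (%t. S t x) t"
  unfolding isCont_def tendsto_iff
 proof (intro allI impI)
  fix e :: real assume e: "0 < e"
  obtain ph th where p: "test_fun ph" "test_fun th" "norm (x - test_pair ph th) < e / 3"
   using test_pair_dense[of "e/3" x] e by auto
  let ?p = "test_pair ph th"
  define d where "d = e / (3 * (norm (A_test ph th) + 1))"
  have nn: "0 < norm (A_test ph th) + 1" by (simp add: add_nonneg_pos)
  have d: "0 < d" using e nn by (simp add: d_def)
  have "dist (S s x) (S t x) < e" if "dist s t < d" for s
  proof -
   have "norm (S s ?p - S t ?p) = norm (S t (S (s - t) ?p - ?p))" by (simp add: S_diff S_group)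
   also have "... <= \<bar>s - t\<bar> * norm (A_test ph th)" using S_test_lipschitz[OF p(1,2)] by simp
   also have "... <= \<bar>s - t\<bar> * (norm (A_test ph th) + 1)" by (intro mult_left_mono) auto
   also have "... < d * (norm (A_test ph th) + 1)"
    using that nn by (intro mult_strict_right_mono) (auto simp: dist_norm)
   also have "... = e / 3"
    unfolding d_def using nn by (metis divide_divide_eq_left mult.commute nonzero_mult_div_cancel_left
      less_irrefl times_divide_eq_right)
   finally have 1: "norm (S s ?p - S t ?p) < e / 3" .
   have 2: "norm (S r x - S r ?p) < e / 3" for r using p(3) norm_S[of r "x - ?p"] by (simp add: S_diff)
   show ?thesis
    using 1 2[of s] 2[of t] dist_triangle[of "S s x" "S t x" "S s ?p"]
     dist_triangle[of "S s ?p" "S t x" "S t ?p"]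
    by (simp add: dist_norm norm_minus_commute)
  qed
  then show "\<forall>\<^sub>F s in at t. dist (S s x) (S t x) < e"
   unfolding eventually_at using d by blast
 qed
qed

lemma S_continuous_joint:
 assumes "continuous_on T f" "continuous_on T g"
 shows "continuous_on T (%t. S (f t) (g t))"
 unfolding continuous_on_def
proof
 fix t assume t: "t : T"
 have "((%s. S (f s) (g s - g t)) ---> 0) (at t within T)"
  by (rule tendsto_norm_zero_cancel)
   (use assms(2) t in \<open>simp add: continuous_on_def LIM_zero_iff tendsto_norm_zero_iff\<close>)
 moreover have "((%s. S (f s) (g t)) ---> S (f t) (g t)) (at t within T)"
 proof -
  have "isCont (%r. S r (g t)) (f t)" using S_continuous by (simp add: continuous_on_eq_continuous_at)
  then show ?thesis
   by (rule isCont_tendsto_compose) (use assms(1) t in \<open>auto simp: continuous_on_def\<close>)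
 qed
 ultimately have "((%s. S (f s) (g s - g t) + S (f s) (g t)) ---> 0 + S (f t) (g t)) (at t within T)"
  by (rule tendsto_add)
 then show "((%s. S (f s) (g s)) ---> S (f t) (g t)) (at t within T)" by (simp add: S_diff)
qed

text \<open>The graph of \<open>genA\<close> is a closed subspace invariant under
  \<open>An n\<close>, hence under the partial sums of the exponential series and under their
  limit.\<close>

lemma genA_Sn:
 assumes "genA x z"
 shows "genA (Sn n t x) (Sn n t z)"
proof -
 have pow: "genA (oap (An n ^ k) x) (oap (An n ^ k) z)" for k
  by (induction k) (auto simp: oap_one oap_mult oap_An assms intro: genA_Ah)
 have trm: "genA (oap ((t *R An n) ^ k /\<^sub>R fact k) x) (oap ((t *R An n) ^ k /\<^sub>R fact k) z)" for k
  using genA_linear(2)[OF pow[of k] pow[of k]] by (simp add: oap_scaleR scaleR_power)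
 have part: "genA (oap (\<Sum>k<N. (t *R An n) ^ k /\<^sub>R fact k) x) (oap (\<Sum>k<N. (t *R An n) ^ k /\<^sub>R fact k) z)" for N
 proof (induction N)
  case 0
  show ?case using genA_linear(2)[OF assms assms, of 0] by (simp add: oap_zero)
 next
  case (Suc N)
  then show ?case using genA_linear(1)[OF Suc trm[of N]] by (simp add: oap_add)
 qed
 have "(%N. \<Sum>k<N. (t *R An n) ^ k /\<^sub>R fact k) >>> exp (t *R An n)"
  using exp_converges[of "t *R An n"] unfolding sums_def .
 then have lim: "(%N. oap (\<Sum>k<N. (t *R An n) ^ k /\<^sub>R fact k) y) >>> Sn n t y" for y
  unfolding Sn_def by (rule bounded_linear.tendsto[OF bounded_linear_oap_left])
 show ?thesis by (rule genA_closed[OF part lim lim])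
qed

lemma genA_S: "genA x z ==> genA (S t x) (S t z)"
 using genA_closed[OF genA_Sn Sn_tendsto Sn_tendsto] .

lemma A_test_test_pair:
 assumes "test_fun ph" "test_fun th"
 obtains ph' th' where "test_fun ph'" "test_fun th'" "A_test ph th = test_pair ph' th'"
proof (rule that)
 note d = test_fun_deriv[OF assms(1)] test_fun_deriv[OF test_fun_deriv[OF assms(1)]]
  test_fun_deriv[OF assms(2)] test_fun_deriv[OF test_fun_deriv[OF assms(2)]]
 show "test_fun (%x. deriv th x - deriv (deriv th) x)" "test_fun (%x. deriv ph x + deriv (deriv ph) x)"
  by (intro test_fun_diff test_fun_add d)+
 show "A_test ph th = test_pair (%x. deriv th x - deriv (deriv th) x) (%x. deriv ph x + deriv (deriv ph) x)"
  by (simp add: A_test_def test_pair_def toL2_add toL2_diff L2_fun_test d)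
qed

text \<open>A quadratic remainder estimate survives the limit in \<open>n\<close>. It is available
  because \<open>A_test ph th\<close> is a test pair again, so that its own orbit is Lipschitz in
  time.\<close>

lemma S_test_taylor:
 assumes "test_fun ph" "test_fun th"
 obtains M where "0 <= M" "!!h. norm (S h (test_pair ph th) - test_pair ph th - h *R A_test ph th) <= M * h^2"
proof -
 let ?p = "test_pair ph th" and ?a = "A_test ph th"
 obtain ph' th' where t': "test_fun ph'" "test_fun th'" and a: "?a = test_pair ph' th'"
  using A_test_test_pair[OF assms] by blast
 have bound: "norm (S h ?p - ?p - h *R ?a) <= norm (A_test ph' th') * h^2" for h
 proof (rule LIMSEQ_le)
  show "(%n. norm (Sn n h ?p - ?p - h *R ?a)) >>> norm (S h ?p - ?p - h *R ?a)"
   by (intro tendsto_intros Sn_tendsto)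
  have "(%n. (norm (oap (An n) ?p - ?a) + \<bar>h\<bar> * norm (oap (An n) ?a)) * \<bar>h\<bar>) >>>
    (norm (?a - ?a) + \<bar>h\<bar> * norm (A_test ph' th')) * \<bar>h\<bar>"
   unfolding oap_An
   by (intro tendsto_intros Ah_test_tendsto assms) (unfold a, rule Ah_test_tendsto[OF t'])
  moreover have "(norm (?a - ?a) + \<bar>h\<bar> * norm (A_test ph' th')) * \<bar>h\<bar> = norm (A_test ph' th') * h^2"
  proof -
   have "(norm (?a - ?a) + \<bar>h\<bar> * N) * \<bar>h\<bar> = N * (\<bar>h\<bar> * \<bar>h\<bar>)" for N by (simp add: mult_ac)
   moreover have "\<bar>h\<bar> * \<bar>h\<bar> = h^2" by (simp add: power2_eq_square)
   ultimately show ?thesis by simp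
  qed
  ultimately show "(%n. (norm (oap (An n) ?p - ?a) + \<bar>h\<bar> * norm (oap (An n) ?a)) * \<bar>h\<bar>) >>>
    norm (A_test ph' th') * h^2"
   by metis
  show "\<exists>N. \<forall>n\<ge>N. norm (Sn n h ?p - ?p - h *R ?a) \<le>
    (norm (oap (An n) ?p - ?a) + \<bar>h\<bar> * norm (oap (An n) ?a)) * \<bar>h\<bar>"
  proof (intro exI allI impI)
   fix n
   define y where "y r = Sn n r ?p - r *R ?a" for r
   have "norm (y h - y 0) <= (norm (oap (An n) ?p - ?a) + \<bar>h\<bar> * norm (oap (An n) ?a)) * \<bar>h - 0\<bar>"
   proof (rule vector_derivative_norm_bound)
    show "(y has_vector_derivative Sn n r (oap (An n) ?p) - ?a) (at r within {-\<bar>h\<bar>..\<bar>h\<bar>})" for r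
     unfolding y_def Sn_def
     by (intro has_vector_derivative_diff has_vector_derivative_at_within[OF exp_op_deriv_right])
      (auto intro!: derivative_eq_intros)
    show "norm (Sn n r (oap (An n) ?p) - ?a) <= norm (oap (An n) ?p - ?a) + \<bar>h\<bar> * norm (oap (An n) ?a)"
     if "r : {-\<bar>h\<bar>..\<bar>h\<bar>}" for r
    proof -
     have "Sn n r (oap (An n) ?p) - ?a = Sn n r (oap (An n) ?p - ?a) + (Sn n r ?a - ?a)"
      by (simp add: Sn_diff)
     then have "norm (Sn n r (oap (An n) ?p) - ?a) \<le>
       norm (Sn n r (oap (An n) ?p - ?a)) + norm (Sn n r ?a - ?a)"
      by (metis norm_triangle_ineq)
     also have "... <= norm (oap (An n) ?p - ?a) + \<bar>r\<bar> * norm (oap (An n) ?a)"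
      using norm_exp_skew_diff[OF skew_An, of r n ?a] by (simp add: norm_Sn) (simp add: Sn_def)
     also have "... <= norm (oap (An n) ?p - ?a) + \<bar>h\<bar> * norm (oap (An n) ?a)"
      using that by (intro add_left_mono mult_right_mono) auto
     finally show ?thesis .
    qed
   qed auto
   then show "norm (Sn n h ?p - ?p - h *R ?a) \<le>
    (norm (oap (An n) ?p - ?a) + \<bar>h\<bar> * norm (oap (An n) ?a)) * \<bar>h\<bar>"
    by (simp add: y_def Sn_def oap_one algebra_simps)
  qed
 qed
 show ?thesis by (rule that[OF _ bound]) simp
qed

lemma S_test_deriv:
 assumes "test_fun ph" "test_fun th"
 shows "((%t. S t (test_pair ph th)) has_vector_derivative S t (A_test ph th)) (at t)"
proof -
 let ?p = "test_pair ph th" and ?a = "A_test ph th"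
 obtain M where M: "0 <= M" "!!h. norm (S h ?p - ?p - h *R ?a) <= M * h^2"
  using S_test_taylor[OF assms] by blast
 have lim: "((%h. norm (S (t + h) ?p - S t ?p - h *R S t ?a) / norm h) ---> 0) (at 0)"
 proof (rule Lim_null_comparison)
  show "\<forall>\<^sub>F h in at 0. norm (norm (S (t + h) ?p - S t ?p - h *R S t ?a) / norm h) <= M * \<bar>h\<bar>"
  proof (rule always_eventually, intro allI)
   fix h :: real
   have "S (t + h) ?p - S t ?p - h *R S t ?a = S t (S h ?p - ?p - h *R ?a)"
    by (simp add: S_diff S_group S_scaleR)
   then have "norm (S (t + h) ?p - S t ?p - h *R S t ?a) <= M * h^2" using M(2)[of h] by simp
   then show "norm (norm (S (t + h) ?p - S t ?p - h *R S t ?a) / norm h) <= M * \<bar>h\<bar>"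
    by (cases "h = 0") (auto simp: divide_le_eq power2_eq_square mult_ac)
  qed
  have "((%h. M * \<bar>h\<bar>) ---> M * \<bar>0\<bar>) (at (0::real))" by (intro tendsto_intros)
  then show "((%h. M * \<bar>h\<bar>) ---> 0) (at (0::real))" by simp
 qed
 then show ?thesis
  unfolding has_vector_derivative_def has_derivative_at
  by (auto intro: bounded_linear_scaleR_left)
qed

section \<open>Ordinary differential equations in Banach spaces\<close>

lemma gronwall:
 fixes f :: "real => real"
 assumes f: "continuous_on {s..T} f" and L: "0 <= L"
  and le: "!!t. t : {s..T} ==> f t <= a + L * integral {s..t} f" and t: "t : {s..T}"
 shows "f t <= a * exp (L * (t - s))"
proof -
 define I where "I t = integral {s..t} f" for t
 \<comment> \<open>Integrating factor: the right-hand side of the assumed inequality, damped by the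
   expected growth, is decreasing.\<close>
 define H where "H t = exp (- (L * (t - s))) * (a + L * I t)" for t
 have dI: "(I has_real_derivative f r) (at r within {s..T})" if "r : {s..T}" for r
  unfolding I_def by (rule integral_has_real_derivative[OF f that])
 have "H t <= H s"
 proof (rule DERIV_nonpos_imp_decreasing_open[of s t H])
  show "s <= t" using t by simp
  show "continuous_on {s..t} H"
  proof -
   have "continuous_on {s..T} I"
    using dI DERIV_continuous continuous_on_eq_continuous_within by blast
   then have "continuous_on {s..t} I" by (rule continuous_on_subset) (use t in auto)
   then show ?thesis unfolding H_def by (intro continuous_intros)
  qed
  fix r assume r: "s < r" "r < t"
  have "(I has_real_derivative f r) (at r)"
   using dI[of r] r t by (simp add: at_within_Icc_at)
  then have "((%t. a + L * I t) has_real_derivative 0 + L * f r) (at r)"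
   by (intro DERIV_add DERIV_const DERIV_cmult)
  moreover have "((%t. exp (- (L * (t - s)))) has_real_derivative exp (- (L * (r - s))) * (- L)) (at r)"
   by (auto intro!: derivative_eq_intros)
  ultimately have "(H has_real_derivative exp (- (L * (r - s))) * (L * (f r - (a + L * I r)))) (at r)"
   unfolding H_def by (intro DERIV_cong[OF DERIV_mult]) (auto simp: algebra_simps)
  moreover have "exp (- (L * (r - s))) * (L * (f r - (a + L * I r))) <= 0"
   using le[of r] r t L by (intro mult_nonneg_nonpos) (auto simp: I_def)
  ultimately show "\<exists>y. (H has_real_derivative y) (at r) & y <= 0" by blast
 qed
 moreover have "H s = a" by (simp add: H_def I_def)
 ultimately have Ha: "exp (- (L * (t - s))) * (a + L * I t) <= a" by (simp only: H_def)
 have "a + L * I t = exp (L * (t - s)) * (exp (- (L * (t - s))) * (a + L * I t))"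
  by (simp add: exp_minus)
 also have "... <= exp (L * (t - s)) * a" by (intro mult_left_mono Ha) simp
 finally have "a + L * I t <= a * exp (L * (t - s))" by (simp add: mult.commute)
 then show ?thesis using le[OF t] by (simp add: I_def)
qed

definition ode_sol :: "(real => 'a::banach => 'a) => 'a => real => (real => 'a) => bool" where
 "ode_sol G x0 T z \<longleftrightarrow> continuous_on {0..T} z &
  (\<forall>t\<in>{0..T}. z t = x0 + integral {0..t} (%s. G s (z s)))"

lemma ode_sol_subset: "ode_sol G x0 T z ==> T' <= T ==> ode_sol G x0 T' z"
 unfolding ode_sol_def by (auto intro: continuous_on_subset)

lemma ode_sol_cong:
 assumes sol: "ode_sol G x0 T z" and eq: "!!t. t : {0..T} ==> z t = z' t"
 shows "ode_sol G x0 T z'"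
 unfolding ode_sol_def
proof (intro conjI ballI)
 have "continuous_on {0..T} z" using sol by (simp add: ode_sol_def)
 then show "continuous_on {0..T} z'" by (rule continuous_on_eq) (rule eq)
 fix t assume t: "t : {0..T}"
 have "integral {0..t} (%s. G s (z s)) = integral {0..t} (%s. G s (z' s))"
 proof (rule integral_cong)
  fix s assume "s : {0..t}"
  then have "z s = z' s" using eq[of s] t by simp
  then show "G s (z s) = G s (z' s)" by simp
 qed
 moreover have "z t = x0 + integral {0..t} (%s. G s (z s))" using sol t by (simp add: ode_sol_def)
 ultimately show "z' t = x0 + integral {0..t} (%s. G s (z' s))" using eq[OF t] by simp
qed

lemma integral_norm_bound_interval:
 fixes f :: "real => 'a::banach"
 assumes "continuous_on {s..t} f" "!!r. r : {s..t} ==> norm (f r) <= g r" "continuous_on {s..t} g"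
 shows "norm (integral {s..t} f) <= integral {s..t} g"
 by (rule integral_norm_bound_integral) (use assms in \<open>auto intro: integrable_continuous_interval\<close>)

lemma ode_sol_deriv:
 assumes "ode_sol G x0 T z" "continuous_on {0..T} (%t. G t (z t))" "t : {0..T}"
 shows "(z has_vector_derivative G t (z t)) (at t within {0..T})"
proof -
 have "((%t. integral {0..t} (%s. G s (z s))) has_vector_derivative G t (z t)) (at t within {0..T})"
  by (rule integral_has_vector_derivative[OF assms(2,3)])
 then have "((%t. x0 + integral {0..t} (%s. G s (z s))) has_vector_derivative G t (z t)) (at t within {0..T})"
  by (auto intro!: derivative_eq_intros)
 then show ?thesis
  by (rule has_vector_derivative_transform[rotated 2]) (use assms in \<open>auto simp: ode_sol_def\<close>)
qed

text \<open>Continuity is demanded only along continuous curves, which is the kind of continuity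
  that a strongly continuous unitary group in the right-hand side provides.\<close>

locale lipschitz_ode =
 fixes G :: "real => 'a::banach => 'a"
 assumes continuous_G: "!!T z. continuous_on {0..T} z ==> continuous_on {0..T} (%t. G t (z t))"
begin

text \<open>Factorial bounds on the increments of the Picard iterates make them converge uniformly
  on \<open>{0..T}\<close>, however long that interval is.\<close>

lemma picard:
 assumes lip: "!!t x y. norm (G t x - G t y) <= L * norm (x - y)" and T: "0 <= T"
 shows "\<exists>z. ode_sol G x0 T z"
proof -
 define L' where "L' = max L 0"
 have L': "0 <= L'" "norm (G t x - G t y) <= L' * norm (x - y)" for t x y
  using lip[of t x y] mult_right_mono[of L L' "norm (x - y)"] by (auto simp: L'_def)
 define P where "P z t = x0 + integral {0..t} (%s. G s (z s))" for z t
 define z where "z n = (P ^^ n) (%t. x0)" for n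
 have z0: "z 0 = (%t. x0)" and zS: "z (Suc n) = P (z n)" for n by (auto simp: z_def)
 have contP: "continuous_on {0..T} (P y)" if "continuous_on {0..T} y" for y
  unfolding P_def
  by (intro continuous_intros indefinite_integral_continuous_1 integrable_continuous_interval continuous_G that)
 have contz: "continuous_on {0..T} (z n)" for n
  by (induction n) (auto simp: z0 zS contP)
 have intG: "(%s. G s (y s)) integrable_on {0..t}" if "continuous_on {0..T} y" "t <= T" for y t
  using that by (intro integrable_continuous_interval continuous_on_subset[OF continuous_G]) auto
 have "continuous_on {0..T} (%t. norm (z 1 t - z 0 t))" by (intro continuous_intros contz)
 then have "bounded ((%t. norm (z 1 t - z 0 t)) ` {0..T})"
  by (intro compact_imp_bounded compact_continuous_image) auto
 then obtain C where C: "!!t. t : {0..T} ==> norm (z 1 t - z 0 t) <= C"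
  by (auto simp: bounded_iff simp del: atLeastAtMost_iff)
 have step: "norm (z (Suc n) t - z n t) <= C * (L' * t) ^ n / fact n" if "t : {0..T}" for n t
  using that
 proof (induction n arbitrary: t)
  case 0
  from C[OF this] show ?case by simp
 next
  case (Suc n)
  have ct: "continuous_on {0..t} (z m)" for m
   by (rule continuous_on_subset[OF contz]) (use Suc.prems in auto)
  have cGt: "continuous_on {0..t} (%s. G s (z m s))" for m by (rule continuous_G[OF ct])
  have "norm (z (Suc (Suc n)) t - z (Suc n) t) = norm (integral {0..t} (%s. G s (z (Suc n) s) - G s (z n s)))"
  proof -
   have zt: "z (Suc m) t = x0 + integral {0..t} (%s. G s (z m s))" for m by (simp add: zS P_def)
   show ?thesis
    using intG[OF contz] Suc.prems
    by (subst Henstock_Kurzweil_Integration.integral_diff) (auto simp: zt[of "Suc n"] zt[of n])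
  qed
  also have "... <= integral {0..t} (%s. L' * (C * (L' * s) ^ n / fact n))"
  proof (rule integral_norm_bound_interval)
   show "continuous_on {0..t} (%s. G s (z (Suc n) s) - G s (z n s))" by (intro continuous_intros cGt)
   show "continuous_on {0..t} (%s. L' * (C * (L' * s) ^ n / fact n))" by (intro continuous_intros) auto
   fix r assume r: "r : {0..t}"
   have "norm (G r (z (Suc n) r) - G r (z n r)) <= L' * norm (z (Suc n) r - z n r)" by (rule L')
   also have "... <= L' * (C * (L' * r) ^ n / fact n)"
    using Suc.IH[of r] r Suc.prems L' by (intro mult_left_mono) auto
   finally show "norm (G r (z (Suc n) r) - G r (z n r)) <= L' * (C * (L' * r) ^ n / fact n)" .
  qed
  also have "... = C * (L' * t) ^ Suc n / fact (Suc n)"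
  proof (rule integral_unique)
   have "((%s. L' * (C * (L' * s) ^ n / fact n)) has_integral
     C * (L' * t) ^ Suc n / fact (Suc n) - C * (L' * 0) ^ Suc n / fact (Suc n)) {0..t}"
   proof (rule fundamental_theorem_of_calculus)
    show "0 <= t" using Suc.prems by simp
    show "((%s. C * (L' * s) ^ Suc n / fact (Suc n)) has_vector_derivative L' * (C * (L' * s) ^ n / fact n))
      (at s within {0..t})" for s
    proof -
     have "((%s. C * (L' * s) ^ Suc n / fact (Suc n)) has_real_derivative
       C * (real (Suc n) * (L' * s) ^ n * L') / fact (Suc n)) (at s)"
      by (intro DERIV_cdivide DERIV_cmult DERIV_cong[OF DERIV_power]) (auto intro!: derivative_eq_intros)
     moreover have "C * (real (Suc n) * (L' * s) ^ n * L') / fact (Suc n) = L' * (C * (L' * s) ^ n / fact n)"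
      by (simp add: field_simps del: of_nat_Suc)
     ultimately show ?thesis
      by (metis has_real_derivative_iff_has_vector_derivative has_vector_derivative_at_within)
    qed
   qed
   then show "((%s. L' * (C * (L' * s) ^ n / fact n)) has_integral C * (L' * t) ^ Suc n / fact (Suc n)) {0..t}"
    by simp
  qed
  finally show ?case .
 qed
 have C0: "0 <= C" using C[of 0] T norm_ge_zero order_trans by (metis atLeastAtMost_iff order_refl)
 define D where "D t n = z (Suc n) t - z n t" for t n
 have "uniform_limit {0..T} (%n t. \<Sum>i<n. D t i) (%t. suminf (D t)) sequentially"
 proof (rule Weierstrass_m_test)
  show "norm (D t n) <= C * ((L' * T) ^ n / fact n)" if "t : {0..T}" for n t
  proof -
   have "norm (D t n) <= C * (L' * t) ^ n / fact n" unfolding D_def by (rule step[OF that])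
   also have "... <= C * (L' * T) ^ n / fact n"
    using that L' C0 by (intro divide_right_mono mult_left_mono power_mono) auto
   finally show ?thesis by simp
  qed
  show "summable (%n. C * ((L' * T) ^ n / fact n))"
   using summable_exp[of "L' * T"] by (intro summable_mult) (simp add: divide_inverse mult.commute)
 qed
 moreover have "(\<Sum>i<n. D t i) = z n t - x0" for n t
  unfolding D_def by (subst sum_lessThan_telescope) (simp add: z0)
 ultimately have ul: "uniform_limit {0..T} (%n t. z n t - x0) (%t. suminf (D t)) sequentially" by simp
 define y where "y t = x0 + suminf (D t)" for t
 have ul': "uniform_limit {0..T} z y sequentially"
  by (rule uniform_limitI) (use uniform_limitD[OF ul] in \<open>simp add: y_def dist_norm diff_diff_eq\<close>)
 have cy: "continuous_on {0..T} y"
  by (rule uniform_limit_theorem[OF _ ul']) (auto simp: contz)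
 have "y t = P y t" if t: "t : {0..T}" for t
 proof -
  have "(%n. P (z n) t) >>> P y t"
  proof -
   have "uniform_limit {0..t} (%n s. G s (z n s)) (%s. G s (y s)) sequentially"
   proof (rule uniform_limitI)
    fix e :: real assume e: "0 < e"
    have "\<forall>\<^sub>F n in sequentially. \<forall>s\<in>{0..T}. dist (z n s) (y s) < e / (L' + 1)"
     using e L' by (intro uniform_limitD[OF ul']) (auto intro!: divide_pos_pos)
    then show "\<forall>\<^sub>F n in sequentially. \<forall>s\<in>{0..t}. dist (G s (z n s)) (G s (y s)) < e"
    proof eventually_elim
     case (elim n)
     show ?case
     proof
      fix s assume s: "s : {0..t}"
      have "dist (G s (z n s)) (G s (y s)) <= L' * dist (z n s) (y s)" using L' by (simp add: dist_norm)
      also have "... <= (L' + 1) * dist (z n s) (y s)" by (intro mult_right_mono) auto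
      also have "... < (L' + 1) * (e / (L' + 1))"
       using elim s t L' by (intro mult_strict_left_mono) auto
      also have "... = e" using L' by simp
      finally show "dist (G s (z n s)) (G s (y s)) < e" .
     qed
    qed
   qed
   moreover have "continuous_on {0..t} (%s. G s (z n s))" for n
    by (rule continuous_on_subset[OF continuous_G[OF contz]]) (use t in auto)
   ultimately obtain I J where IJ: "!!n. ((%s. G s (z n s)) has_integral I n) {0..t}"
    "((%s. G s (y s)) has_integral J) {0..t}" "I >>> J"
    by (rule uniform_limit_integral) auto
   have "(%n. integral {0..t} (%s. G s (z n s))) >>> integral {0..t} (%s. G s (y s))"
    using IJ(3) unfolding integral_unique[OF IJ(1)] integral_unique[OF IJ(2)] .
   then show ?thesis unfolding P_def by (intro tendsto_intros)
  qed
  moreover have "(%n. z (Suc n) t) >>> y t"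
   using tendsto_uniform_limitI[OF ul' t] by (rule LIMSEQ_Suc)
  ultimately show ?thesis unfolding zS using LIMSEQ_unique by blast
 qed
 then show ?thesis using cy unfolding ode_sol_def P_def by blast
qed

lemma unique:
 assumes lip: "!!R. \<exists>L. \<forall>t x y. norm x <= R --> norm y <= R --> norm (G t x - G t y) <= L * norm (x - y)"
  and z: "ode_sol G x0 T z" and z': "ode_sol G x0 T z'" and t: "t : {0..T}"
 shows "z t = z' t"
proof -
 have c: "continuous_on {0..T} z" "continuous_on {0..T} z'" using z z' by (auto simp: ode_sol_def)
 have "bounded (z ` {0..T} \<union> z' ` {0..T})"
  using c by (intro bounded_Un[THEN iffD2] conjI compact_imp_bounded compact_continuous_image) auto
 then obtain R where R: "!!t. t : {0..T} ==> norm (z t) <= R & norm (z' t) <= R"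
  unfolding bounded_iff by (metis UnCI image_eqI)
 obtain L0 where L0: "!!t x y. norm x <= R ==> norm y <= R ==> norm (G t x - G t y) <= L0 * norm (x - y)"
  using lip[of R] by blast
 define L where "L = max L0 0"
 have L: "norm (G t x - G t y) <= L * norm (x - y)" if "norm x <= R" "norm y <= R" for t x y
  using L0[OF that, of t] mult_right_mono[of L0 L "norm (x - y)"] by (auto simp: L_def)
 have "norm (z t - z' t) <= 0 * exp (L * (t - 0))"
 proof (rule gronwall[where f = "%t. norm (z t - z' t)" and T = T])
  show "continuous_on {0..T} (%t. norm (z t - z' t))" by (intro continuous_intros c)
  show "0 <= L" by (simp add: L_def)
  fix r assume r: "r : {0..T}"
  have cr: "continuous_on {0..r} z" "continuous_on {0..r} z'"
   using c r by (auto intro: continuous_on_subset)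
  have "z r - z' r = integral {0..r} (%s. G s (z s) - G s (z' s))"
   using z z' r integrable_continuous_interval[OF continuous_G[OF cr(1)]]
    integrable_continuous_interval[OF continuous_G[OF cr(2)]]
   by (subst Henstock_Kurzweil_Integration.integral_diff) (auto simp: ode_sol_def)
  also have "norm ... <= integral {0..r} (%s. L * norm (z s - z' s))"
   by (rule integral_norm_bound_interval)
    (use r in \<open>auto intro!: continuous_intros continuous_G cr L simp: R\<close>)
  finally show "norm (z r - z' r) <= 0 + L * integral {0..r} (%t. norm (z t - z' t))" by simp
 qed (rule t)
 then show ?thesis by simp
qed

end

definition ball_retract :: "real => 'a::real_normed_vector => 'a" where
 "ball_retract R x = (if norm x <= R then x else (R / norm x) *R x)"

lemma norm_ball_retract: "0 < R ==> norm (ball_retract R x) <= R"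
 by (auto simp: ball_retract_def)

text \<open>One contribution \<open>norm (x - y)\<close> comes from moving along the direction, a
  second from the difference of the lengths. Ordering the two norms leaves three cases.\<close>

lemma ball_retract_lipschitz_aux:
 fixes x y :: "'a::real_normed_vector"
 assumes R: "0 < R" and le: "norm y <= norm x"
 shows "norm (ball_retract R x - ball_retract R y) <= 2 * norm (x - y)"
proof -
 have tri: "norm x - norm y <= norm (x - y)" by (rule norm_triangle_ineq2)
 consider "norm x <= R" | "norm y <= R" "R < norm x" | "R < norm y" using le by linarith
 then show ?thesis
 proof cases
  case 1
  then show ?thesis using le by (simp add: ball_retract_def)
 next
  case 2
  have "ball_retract R x - ball_retract R y = (x - y) - (1 - R / norm x) *R x"
   using 2 by (simp add: ball_retract_def algebra_simps)
  also have "norm ... <= norm (x - y) + norm ((1 - R / norm x) *R x)" by (rule norm_triangle_ineq4)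
  also have "norm ((1 - R / norm x) *R x) = norm x - R"
  proof -
   have "0 < norm x" using 2 R by linarith
   then have "0 <= 1 - R / norm x" using 2 by simp
   then show ?thesis unfolding norm_scaleR using 2 R by (auto simp: left_diff_distrib)
  qed
  finally show ?thesis using 2 tri by linarith
 next
  case 3
  then have x: "R < norm x" using le by simp
  have pos: "0 < norm x" "0 < norm y" using 3 x R by linarith+
  have "ball_retract R x - ball_retract R y = (R / norm x) *R (x - y) - (R / norm y - R / norm x) *R y"
   using 3 x by (simp add: ball_retract_def algebra_simps)
  then have "norm (ball_retract R x - ball_retract R y) \<le>
    norm ((R / norm x) *R (x - y)) + norm ((R / norm y - R / norm x) *R y)"
   by (metis norm_triangle_ineq4)
  also have "... <= 1 * norm (x - y) + 1 * (norm x - norm y)"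
  proof (rule add_mono)
   show "norm ((R / norm x) *R (x - y)) <= 1 * norm (x - y)"
    unfolding norm_scaleR using x R pos by (intro mult_right_mono) auto
   have "R / norm x <= R / norm y" using le pos R by (intro divide_left_mono) auto
   then have "norm ((R / norm y - R / norm x) *R y) = (R / norm x) * (norm x - norm y)"
    unfolding norm_scaleR using pos by (simp add: abs_of_nonneg field_simps)
   also have "... <= 1 * (norm x - norm y)"
    using x R le pos by (intro mult_right_mono) auto
   finally show "norm ((R / norm y - R / norm x) *R y) <= 1 * (norm x - norm y)" .
  qed
  finally show ?thesis using tri by simp
 qed
qed

lemma ball_retract_lipschitz:
 "0 < R ==> norm (ball_retract R x - ball_retract R y) <= 2 * norm (x - y)"
 using ball_retract_lipschitz_aux[of R y x] ball_retract_lipschitz_aux[of R x y]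
 by (metis linear norm_minus_commute)

text \<open>Global existence from an a priori bound: the equation is cut off outside a ball that no solution
 can leave, which makes it globally Lipschitz.\<close>

lemma (in lipschitz_ode) global_solution:
 assumes lip: "!!R. \<exists>L. \<forall>t x y. norm x <= R --> norm y <= R --> norm (G t x - G t y) <= L * norm (x - y)"
  and bound: "!!T z t. ode_sol G x0 T z ==> t : {0..T} ==> norm (z t) <= B t"
  and B: "!!s t. 0 <= s ==> s <= t ==> B s <= B t"
 obtains z where "!!T. 0 <= T ==> ode_sol G x0 T z"
proof -
 have ex: "\<exists>z. ode_sol G x0 T z" if T: "0 <= T" for T
 proof -
  \<comment> \<open>Strictly above the a priori bound, so that reaching the sphere of radius
    \<open>R\<close> is a contradiction.\<close>
  define R where "R = max (B T) 0 + 1"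
  have R: "0 < R" "B T < R" by (auto simp: R_def)
  obtain L where L: "!!t x y. norm x <= R ==> norm y <= R ==> norm (G t x - G t y) <= L * norm (x - y)"
   using lip[of R] by blast
  let ?G = "%t x. G t (ball_retract R x)"
  have contr: "continuous_on A (ball_retract R :: 'a => 'a)" for A
   by (rule lipschitz_on_continuous_on[of 2], rule lipschitz_onI)
    (use ball_retract_lipschitz[OF R(1)] in \<open>auto simp: dist_norm\<close>)
  interpret c: lipschitz_ode ?G
  proof
   fix T :: real and z :: "real => 'a" assume "continuous_on {0..T} z"
   then have "continuous_on {0..T} (%t. ball_retract R (z t))"
    by (rule continuous_on_compose2[OF contr[of UNIV]]) auto
   then show "continuous_on {0..T} (%t. ?G t (z t))" by (rule continuous_G)
  qed
  have "\<exists>z. ode_sol ?G x0 T z"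
  proof (rule c.picard[OF _ T])
   fix t :: real and x y :: 'a
   have "norm (?G t x - ?G t y) <= L * norm (ball_retract R x - ball_retract R y)"
    by (intro L norm_ball_retract R)
   also have "... <= max L 0 * (2 * norm (x - y))"
    by (intro mult_mono ball_retract_lipschitz R) auto
   finally show "norm (?G t x - ?G t y) <= (2 * max L 0) * norm (x - y)" by simp
  qed
  then obtain z where z: "ode_sol ?G x0 T z" by blast
  have cz: "continuous_on {0..T} z" using z by (simp add: ode_sol_def)
  have inside: "ode_sol G x0 T' z" if "T' <= T" "!!t. t : {0..T'} ==> norm (z t) <= R" for T'
   unfolding ode_sol_def
  proof (intro conjI ballI)
   show "continuous_on {0..T'} z" using cz that(1) by (auto intro: continuous_on_subset)
   fix t assume t: "t : {0..T'}"
   have "z t = x0 + integral {0..t} (%s. ?G s (z s))" using z t that(1) by (auto simp: ode_sol_def)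
   also have "integral {0..t} (%s. ?G s (z s)) = integral {0..t} (%s. G s (z s))"
    using that(2) t by (intro integral_cong) (auto simp: ball_retract_def)
   finally show "z t = x0 + integral {0..t} (%s. G s (z s))" .
  qed
  have small: "norm (z t) <= R" if "t : {0..T}" for t
  proof (rule ccontr)
   assume big: "~ norm (z t) <= R"
   \<comment> \<open>The first time \<open>s\<close> in this set: before it the cut-off is inactive,
     so \<open>z\<close> solves the original equation up to \<open>s\<close> and the a priori bound
     applies there.\<close>
   define E where "E = {t : {0..T}. R <= norm (z t)}"
   have "compact E"
   proof -
    have "closed ({0..T} \<inter> (%t. norm (z t)) -` {R..})"
     by (intro continuous_closed_preimage continuous_intros cz)
    moreover have "E = {0..T} \<inter> (%t. norm (z t)) -` {R..}" by (auto simp: E_def)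
    ultimately show ?thesis
     by (metis Int_lower1 bounded_closed_interval bounded_subset compact_eq_bounded_closed)
   qed
   moreover have "E ~= {}" using big that by (auto simp: E_def)
   ultimately obtain s where s: "s : E" "!!t. t : E ==> s <= t" using compact_attains_inf by metis
   have below: "norm (z r) < R" if "r : {0..<s}" for r
    using s(2)[of r] that s(1) by (force simp: E_def)
   have "norm (z s) <= B s"
   proof (cases "s = 0")
    case True
    have "ode_sol G x0 0 z" unfolding ode_sol_def using z T by (auto simp: ode_sol_def)
    then show ?thesis using bound True by auto
   next
    case False
    then have s0: "0 < s" "s <= T" using s(1) by (auto simp: E_def)
    have "norm (z s) <= R"
    proof (rule tendsto_upperbound[of "%r. norm (z r)" _ "at s within {0..<s}"])
     have "continuous_on {0..s} z" using cz s0 by (auto intro: continuous_on_subset)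
     then have "(z ---> z s) (at s within {0..s})" using s0 by (auto simp: continuous_on_def)
     then have "(z ---> z s) (at s within {0..<s})" by (rule tendsto_within_subset) auto
     then show "((%r. norm (z r)) ---> norm (z s)) (at s within {0..<s})" by (rule tendsto_norm)
     show "\<forall>\<^sub>F r in at s within {0..<s}. norm (z r) <= R"
      using below by (auto simp: eventually_at_filter less_imp_le)
     show "at s within {0..<s} ~= bot"
      using s0 by (simp add: trivial_limit_within islimpt_Ico)
    qed
    then have "ode_sol G x0 s z"
     using s0 below by (intro inside) (auto simp: less_imp_le order_le_less)
    then show ?thesis using bound s0 by auto
   qed
   also have "B s <= B T" using s(1) by (intro B) (auto simp: E_def)
   finally show False using s(1) R by (simp add: E_def)
  qed
  then show ?thesis using inside[of T] by blast
 qed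
 then obtain Z where Z: "!!T. 0 <= T ==> ode_sol G x0 T (Z T)" by metis
 \<comment> \<open>Solutions on different intervals agree by uniqueness, so reading the one on
   \<open>{0..t}\<close> at its right end defines a single global solution.\<close>
 have "ode_sol G x0 T (%t. Z t t)" if T: "0 <= T" for T
 proof (rule ode_sol_cong[OF Z[OF T]])
  fix t assume t: "t : {0..T}"
  have "ode_sol G x0 t (Z T)" using Z[OF T] t by (auto intro: ode_sol_subset)
  then show "Z T t = Z t t" using unique[OF lip _ Z[of t]] t by auto
 qed
 then show ?thesis by (rule that)
qed

section \<open>The nonlinear evolution equation\<close>

text \<open>With \<open>v = ka g\<close> and \<open>v\<^sub>x = ka g - g\<close> this is the space
  derivative of a v^2 + b v^3; the linear part of \<open>pfun\<close> belongs to the generator. In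
  terms of \<open>g\<close> it is a polynomial map of L2 into itself.\<close>

definition N2 :: "real => real => l2 => l2" where
 "N2 a b g = (2 * a) *R mulK g (ka g - g) + (3 * b) *R mulK g (mulK g (ka g - g))"

definition DN2 :: "real => real => l2 => l2 => l2" where
 "DN2 a b g h = (2 * a) *R (mulK g (ka h - h) + mulK h (ka g - g)) +
  (3 * b) *R (mulK g (mulK g (ka h - h) + mulK h (ka g - g)) + mulK h (mulK g (ka g - g)))"

definition Nl :: "real => real => state => state" where
 "Nl a b w = (0, - N2 a b (fst w))"

definition DNl :: "real => real => state => state => state" where
 "DNl a b w y = (0, - DN2 a b (fst w) (fst y))"

text \<open>The trajectory in the moving frame of the linear group: with \<open>y = w\<^sub>t = S t xi\<close> the evolution
 equation becomes an ordinary differential equation for \<open>(w, xi)\<close> with a locally Lipschitz right-hand side.\<close>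

definition ode_rhs :: "real => real => real => state \<times> state => state \<times> state" where
 "ode_rhs a b t z = (S t (snd z), S (- t) (DNl a b (fst z) (S t (snd z))))"

text \<open>Here \<open>y\<close> is the time derivative of \<open>w\<close>. The evolution equation
  is stated as membership in the graph of the generator, which includes that \<open>w t\<close> lies
  in its domain.\<close>

definition traj :: "real => real => real => (real => state) => (real => state) => bool" where
 "traj a b T w y \<longleftrightarrow> continuous_on {0..T} w & continuous_on {0..T} y &
  (\<forall>t\<in>{0..T}. w t = w 0 + integral {0..t} y & genA (w t) (y t - Nl a b (w t)))"

lemma Nl_deriv:
 assumes "(w has_vector_derivative y) (at t within A)"
 shows "((%t. Nl a b (w t)) has_vector_derivative DNl a b (w t) y) (at t within A)"
proof -
 define g where "g t = fst (w t)" for t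
 have g: "(g has_vector_derivative fst y) (at t within A)"
  unfolding g_def using bounded_linear.has_vector_derivative[OF bounded_linear_fst assms] .
 have k: "((%t. ka (g t) - g t) has_vector_derivative ka (fst y) - fst y) (at t within A)"
  by (intro has_vector_derivative_diff bounded_linear.has_vector_derivative[OF bounded_linear_ka] g)
 note m = bounded_bilinear.has_vector_derivative[OF bounded_bilinear_mulK g]
 have "((%t. - N2 a b (g t)) has_vector_derivative - DN2 a b (g t) (fst y)) (at t within A)"
  unfolding N2_def DN2_def
  by (intro has_vector_derivative_minus has_vector_derivative_add
    bounded_linear.has_vector_derivative[OF bounded_linear_scaleR_right] m k)
 then have "((%t. (0, - N2 a b (g t))) has_vector_derivative (0, - DN2 a b (g t) (fst y))) (at t within A)"
  by (intro has_vector_derivative_Pair has_vector_derivative_const)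
 then show ?thesis by (simp add: Nl_def DNl_def g_def)
qed

lemma continuous_on_ka: "continuous_on A f ==> continuous_on A (%t. ka (f t))"
 by (rule bounded_linear.continuous_on[OF bounded_linear_ka])

lemma continuous_on_ka': "continuous_on A f ==> continuous_on A (%t. ka' (f t))"
 by (rule bounded_linear.continuous_on[OF bounded_linear_ka'])

lemma continuous_on_N2: "continuous_on A f ==> continuous_on A (%t. N2 a b (f t))"
 unfolding N2_def by (intro continuous_intros mulK.continuous_on continuous_on_ka)

lemma continuous_on_DNl:
 "continuous_on A f ==> continuous_on A h ==> continuous_on A (%t. DNl a b (f t) (h t))"
 unfolding DNl_def DN2_def by (intro continuous_intros mulK.continuous_on continuous_on_ka)

interpretation pde: lipschitz_ode "ode_rhs a b" for a b
proof
 fix T :: real and z :: "real => state \<times> state" assume z: "continuous_on {0..T} z"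
 have f: "continuous_on {0..T} (%t. fst (z t))" "continuous_on {0..T} (%t. snd (z t))"
  by (intro continuous_intros z)+
 have y: "continuous_on {0..T} (%t. S t (snd (z t)))"
  by (intro S_continuous_joint f continuous_intros)
 show "continuous_on {0..T} (%t. ode_rhs a b t (z t))"
  unfolding ode_rhs_def
  by (intro continuous_on_Pair y S_continuous_joint continuous_on_DNl f continuous_intros)
qed

section \<open>Lipschitz bounds on balls for the nonlinearity\<close>

definition blip :: "('a::real_normed_vector => 'b::real_normed_vector) => bool" where
 "blip f \<longleftrightarrow> (\<forall>R. \<exists>L\<ge>0. \<forall>x y. norm x <= R --> norm y <= R --> norm (f x - f y) <= L * norm (x - y))"

lemma blipE:
 assumes "blip f"
 obtains L where "0 <= L" "!!x y. norm x <= R ==> norm y <= R ==> norm (f x - f y) <= L * norm (x - y)"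
 using assms unfolding blip_def by blast

lemma blip_bounded_linear: "bounded_linear f ==> blip f"
proof -
 assume f: "bounded_linear f"
 obtain K where "0 <= K" "!!x. norm (f x) <= norm x * K" using bounded_linear.nonneg_bounded[OF f] by blast
 then show ?thesis
  unfolding blip_def using linear_diff[OF bounded_linear.linear[OF f]]
  by (metis mult.commute)
qed

lemma blip_add:
 assumes "blip f" "blip g"
 shows "blip (%x. f x + g x)"
 unfolding blip_def
proof
 fix R
 obtain L where L: "0 <= L" "!!x y. norm x <= R ==> norm y <= R ==> norm (f x - f y) <= L * norm (x - y)"
  using blipE[OF assms(1)] by metis
 obtain M where M: "0 <= M" "!!x y. norm x <= R ==> norm y <= R ==> norm (g x - g y) <= M * norm (x - y)"
  using blipE[OF assms(2)] by metis
 have "norm (f x + g x - (f y + g y)) <= (L + M) * norm (x - y)" if "norm x <= R" "norm y <= R" for x y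
  using norm_triangle_ineq[of "f x - f y" "g x - g y"] L(2)[OF that] M(2)[OF that]
  by (simp add: algebra_simps)
 then show "\<exists>L\<ge>0. \<forall>x y. norm x <= R --> norm y <= R --> norm (f x + g x - (f y + g y)) <= L * norm (x - y)"
  using L(1) M(1) by (intro exI[of _ "L + M"]) auto
qed

lemma blip_scaleR: "blip f ==> blip (%x. c *R f x)"
 unfolding blip_def
proof
 fix R assume *: "\<forall>R. \<exists>L\<ge>0. \<forall>x y. norm x <= R --> norm y <= R --> norm (f x - f y) <= L * norm (x - y)"
 obtain L where L: "0 <= L" "!!x y. norm x <= R ==> norm y <= R ==> norm (f x - f y) <= L * norm (x - y)"
  using * by meson
 have "norm (c *R f x - c *R f y) <= (\<bar>c\<bar> * L) * norm (x - y)" if "norm x <= R" "norm y <= R" for x y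
  using mult_left_mono[OF L(2)[OF that], of "\<bar>c\<bar>"] by (simp flip: scaleR_diff_right)
 then show "\<exists>L\<ge>0. \<forall>x y. norm x <= R --> norm y <= R --> norm (c *R f x - c *R f y) <= L * norm (x - y)"
  using L(1) by (intro exI[of _ "\<bar>c\<bar> * L"]) auto
qed

lemma blip_bilinear:
 assumes B: "bounded_bilinear B" and "blip f" "blip g"
 shows "blip (%x. B (f x) (g x))"
 unfolding blip_def
proof
 fix R0 :: real
 define R where "R = max R0 0"
 obtain K where K: "0 <= K" "!!x y. norm (B x y) <= norm x * norm y * K"
  using bounded_bilinear.nonneg_bounded[OF B] by blast
 obtain L where L: "0 <= L" "!!x y. norm x <= R ==> norm y <= R ==> norm (f x - f y) <= L * norm (x - y)"
  using blipE[OF assms(2)] by metis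
 obtain M where M: "0 <= M" "!!x y. norm x <= R ==> norm y <= R ==> norm (g x - g y) <= M * norm (x - y)"
  using blipE[OF assms(3)] by metis
 define P where "P = norm (f 0) + L * R"
 define Q where "Q = norm (g 0) + M * R"
 have P: "norm (f x) <= P" if "norm x <= R" for x
 proof -
  have "norm (f x) <= norm (f 0) + norm (f x - f 0)" by (metis add.commute diff_add_cancel norm_triangle_ineq)
  also have "norm (f x - f 0) <= L * norm x" using L(2)[of x 0] that by (simp add: R_def)
  also have "L * norm x <= L * R" using that L(1) by (rule mult_left_mono)
  finally show ?thesis by (simp add: P_def)
 qed
 have Q: "norm (g x) <= Q" if "norm x <= R" for x
 proof -
  have "norm (g x) <= norm (g 0) + norm (g x - g 0)" by (metis add.commute diff_add_cancel norm_triangle_ineq)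
  also have "norm (g x - g 0) <= M * norm x" using M(2)[of x 0] that by (simp add: R_def)
  also have "M * norm x <= M * R" using that M(1) by (rule mult_left_mono)
  finally show ?thesis by (simp add: Q_def)
 qed
 have P0: "0 <= P" and Q0: "0 <= Q" using L(1) M(1) by (simp_all add: P_def Q_def R_def)
 have "norm (B (f x) (g x) - B (f y) (g y)) <= ((L * Q + P * M) * K) * norm (x - y)"
  if "norm x <= R0" "norm y <= R0" for x y
 proof -
  have xy: "norm x <= R" "norm y <= R" using that by (auto simp: R_def)
  have "B (f x) (g x) - B (f y) (g y) = B (f x - f y) (g x) + B (f y) (g x - g y)"
   by (simp add: bounded_bilinear.diff_left[OF B] bounded_bilinear.diff_right[OF B])
  then have "norm (B (f x) (g x) - B (f y) (g y)) \<le>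
    norm (f x - f y) * norm (g x) * K + norm (f y) * norm (g x - g y) * K"
   using norm_triangle_ineq[of "B (f x - f y) (g x)" "B (f y) (g x - g y)"] K(2)[of "f x - f y" "g x"]
    K(2)[of "f y" "g x - g y"] by simp
  also have "... <= (L * norm (x - y)) * Q * K + P * (M * norm (x - y)) * K"
   by (intro add_mono mult_right_mono mult_mono L M P Q xy K(1) P0 Q0) (auto simp: L M)
  finally show ?thesis by (simp add: algebra_simps)
 qed
 then show "\<exists>L\<ge>0. \<forall>x y. norm x <= R0 --> norm y <= R0 --> norm (B (f x) (g x) - B (f y) (g y)) <= L * norm (x - y)"
  using L(1) M(1) P0 Q0 K(1) by (intro exI[of _ "(L * Q + P * M) * K"]) auto
qed

lemma blip_DN2: "blip (%p. DN2 a b (fst p) (snd p))"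
proof -
 have l: "bounded_linear (%p::l2\<times>l2. ka (fst p) - fst p)" "bounded_linear (%p::l2\<times>l2. ka (snd p) - snd p)"
  by (intro bounded_linear_sub bounded_linear_compose[OF bounded_linear_ka] bounded_linear_fst bounded_linear_snd)+
 show ?thesis
  unfolding DN2_def
  by (intro blip_add blip_scaleR blip_bilinear[OF bounded_bilinear_mulK]
    blip_bounded_linear l bounded_linear_fst bounded_linear_snd)
qed

lemma norm_fst_snd_le: "norm (fst p) <= norm p" "norm (snd p) <= norm p"
 by (cases p, simp add: norm_fst_le norm_snd_le)+

text \<open>The constant is independent of \<open>t\<close> because the group acts by
  isometries.\<close>

lemma ode_rhs_lipschitz:
 "\<exists>L. \<forall>t x y. norm x <= R --> norm y <= R --> norm (ode_rhs a b t x - ode_rhs a b t y) <= L * norm (x - y)"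
proof -
 obtain L where L: "0 <= L" "!!x y. norm x <= 2 * R ==> norm y <= 2 * R ==>
   norm (DN2 a b (fst x) (snd x) - DN2 a b (fst y) (snd y)) <= L * norm (x - y)"
  using blipE[OF blip_DN2] by metis
 have "norm (ode_rhs a b t x - ode_rhs a b t y) <= (1 + 2 * L) * norm (x - y)"
  if xy: "norm x <= R" "norm y <= R" for t x y
 proof -
  define p where "p x = (fst (fst x), fst (S t (snd x)))" for x :: "state \<times> state"
  have pn: "norm (p x) <= 2 * norm x" for x
  proof -
   have "norm (p x) <= norm (fst (fst x)) + norm (fst (S t (snd x)))"
    by (simp add: p_def norm_Pair sqrt_sum_squares_le_sum)
   also have "... <= norm (fst x) + norm (S t (snd x))" by (intro add_mono norm_fst_snd_le)
   also have "... <= 2 * norm x" using norm_fst_snd_le[of x] by simp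
   finally show ?thesis .
  qed
  have pd: "p x - p y = p (x - y)" by (simp add: p_def S_diff)
  have "norm (DN2 a b (fst (p x)) (snd (p x)) - DN2 a b (fst (p y)) (snd (p y))) <= L * norm (p x - p y)"
   using pn[of x] pn[of y] xy by (intro L) auto
  also have "... <= L * (2 * norm (x - y))" unfolding pd by (intro mult_left_mono pn L)
  finally have d: "norm (DN2 a b (fst (p x)) (snd (p x)) - DN2 a b (fst (p y)) (snd (p y))) <= 2 * L * norm (x - y)"
   by simp
  have "norm (ode_rhs a b t x - ode_rhs a b t y) <= norm (S t (snd (x - y))) +
    norm (S (- t) (DNl a b (fst x) (S t (snd x)) - DNl a b (fst y) (S t (snd y))))"
   by (simp add: ode_rhs_def S_diff norm_Pair sqrt_sum_squares_le_sum del: norm_S)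
  also have "norm (S t (snd (x - y))) <= norm (x - y)" using norm_fst_snd_le(2)[of "x - y"] by simp
  also have "norm (S (- t) (DNl a b (fst x) (S t (snd x)) - DNl a b (fst y) (S t (snd y)))) <= 2 * L * norm (x - y)"
   using d by (simp add: DNl_def p_def norm_Pair norm_minus_commute)
  finally show ?thesis by (simp add: algebra_simps)
 qed
 then show ?thesis by blast
qed

section \<open>Equivalence of trajectories with solutions of the ordinary differential
  equation\<close>

lemma integral_Pair:
 fixes f g :: "real => 'a::banach"
 assumes "continuous_on {s..t} f" "continuous_on {s..t} g"
 shows "integral {s..t} (%r. (f r, g r)) = (integral {s..t} f, integral {s..t} g)"
proof -
 have i: "(%r. (f r, g r)) integrable_on {s..t}"
  by (intro integrable_continuous_interval continuous_intros assms)
 show ?thesis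
  using integral_linear[OF i bounded_linear_fst] integral_linear[OF i bounded_linear_snd]
  by (intro prod_eqI) (auto simp: o_def)
qed

lemma traj_deriv:
 assumes "traj a b T w y" "t : {0..T}"
 shows "(w has_vector_derivative y t) (at t within {0..T})"
proof -
 have "continuous_on {0..T} y" using assms by (simp add: traj_def)
 then have "((%t. integral {0..t} y) has_vector_derivative y t) (at t within {0..T})"
  by (rule integral_has_vector_derivative[OF _ assms(2)])
 then have D: "((%t. w 0 + integral {0..t} y) has_vector_derivative y t) (at t within {0..T})"
  by (auto intro!: derivative_eq_intros)
 have e: "w r = w 0 + integral {0..r} y" if "r : {0..T}" for r
  using assms(1) that unfolding traj_def by blast
 show ?thesis by (rule has_vector_derivative_transform[OF assms(2) e D])
qed

lemma traj_genA: "traj a b T w y ==> t : {0..T} ==> genA (w t) (y t - Nl a b (w t))"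
 unfolding traj_def by blast

lemma inner_has_real_derivative:
 assumes "(f has_vector_derivative f') (at t within A)" "(g has_vector_derivative g') (at t within A)"
 shows "((%t. inner (f t) (g t)) has_real_derivative inner (f t) g' + inner f' (g t)) (at t within A)"
 using bounded_bilinear.has_vector_derivative[OF bounded_bilinear_inner assms]
 by (simp add: has_real_derivative_iff_has_vector_derivative)

lemma zero_derivative_interval:
 fixes q :: "real => real"
 assumes "!!s. s : {0..T} ==> (q has_real_derivative 0) (at s within {0..T})" "t : {0..T}"
 shows "q t = q 0"
proof -
 obtain c where "\<forall>x\<in>{0..T}. q x = c"
  using has_field_derivative_zero_constant[of "{0..T}" q] assms(1) by auto
 then show ?thesis using assms(2) by simp
qed

text \<open>The velocity \<open>y\<close> is only continuous, so the evolution equation cannot be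
  differentiated in time directly. Paired with the moving test state \<open>S s p\<close>, skewness
  shifts the generator from \<open>w\<close> to the test pair, and the resulting expression in
  \<open>w\<close> is differentiable.\<close>

lemma traj_imp_ode_sol:
 assumes tr: "traj a b T w y"
 shows "ode_sol (ode_rhs a b) (w 0, y 0) T (%t. (w t, S (- t) (y t)))"
proof -
 have cw: "continuous_on {0..T} w" and cy: "continuous_on {0..T} y" using tr by (auto simp: traj_def)
 have c: "continuous_on {0..T} (%s. S (- s) (DNl a b (w s) (y s)))"
  by (intro S_continuous_joint continuous_on_DNl cw cy continuous_intros)
 have weak: "inner (S (- t) (y t)) p - inner (y 0) p = inner (integral {0..t} (%s. S (- s) (DNl a b (w s) (y s)))) p"
  if t: "t : {0..T}" and ph: "test_fun ph" "test_fun th" and p: "p = test_pair ph th" for t ph th p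
 proof -
  obtain ph' th' where ph': "test_fun ph'" "test_fun th'" and p': "A_test ph th = test_pair ph' th'"
   using A_test_test_pair[OF ph] by blast
  have sk: "inner (y s - Nl a b (w s)) (S s (test_pair f h)) = - inner (w s) (S s (A_test f h))"
   if "s : {0..T}" "test_fun f" "test_fun h" for s f h
   by (rule genA_skew[OF traj_genA[OF tr that(1)] genA_S[OF genA_test[OF that(2,3)]]])
  have "((%s. inner (S (- s) (y s)) p) has_real_derivative inner (S (- s) (DNl a b (w s) (y s))) p) (at s within {0..t})"
   if s: "s : {0..t}" for s
  proof -
   have sT: "s : {0..T}" using s t by auto
   have dw: "(w has_vector_derivative y s) (at s within {0..t})"
    using traj_deriv[OF tr sT] by (rule has_vector_derivative_within_subset) (use t in auto)
   have dN: "((%s. Nl a b (w s)) has_vector_derivative DNl a b (w s) (y s)) (at s within {0..t})"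
    by (rule Nl_deriv[OF dw])
   have dS: "((%s. S s (test_pair f h)) has_vector_derivative S s (A_test f h)) (at s within {0..t})"
    if "test_fun f" "test_fun h" for f h
    using S_test_deriv[OF that] by (rule has_vector_derivative_at_within)
   have D: "((%s. inner (Nl a b (w s)) (S s p) - inner (w s) (S s (A_test ph th))) has_real_derivative
     (inner (Nl a b (w s)) (S s (A_test ph th)) + inner (DNl a b (w s) (y s)) (S s p)) -
     (inner (w s) (S s (A_test ph' th')) + inner (y s) (S s (A_test ph th)))) (at s within {0..t})"
    unfolding p p' by (intro DERIV_diff inner_has_real_derivative dw dN) (use dS[OF ph'] dS[OF ph] p' in auto)
   \<comment> \<open>\<open>A_test ph th\<close> is a test pair as well, so skewness applies a
     second time and all terms containing the generator cancel.\<close>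
   have E: "inner (y s) (S s (A_test ph th)) - inner (Nl a b (w s)) (S s (A_test ph th)) =
     - inner (w s) (S s (A_test ph' th'))"
    using sk[OF sT ph'] unfolding p' by (simp add: inner_diff_left)
   have F: "((%s. inner (Nl a b (w s)) (S s p) - inner (w s) (S s (A_test ph th))) has_vector_derivative
     inner (S (- s) (DNl a b (w s) (y s))) p) (at s within {0..t})"
    unfolding has_real_derivative_iff_has_vector_derivative[symmetric]
    by (rule DERIV_cong[OF D]) (use E in \<open>simp add: inner_S_left\<close>)
   have eq: "inner (S (- r) (y r)) p = inner (Nl a b (w r)) (S r p) - inner (w r) (S r (A_test ph th))"
    if "r : {0..t}" for r
   proof -
    have "r : {0..T}" using that t by auto
    from sk[OF this ph] show ?thesis by (simp add: inner_S_left p inner_diff_left)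
   qed
   show ?thesis
    unfolding has_real_derivative_iff_has_vector_derivative
    by (rule has_vector_derivative_transform[OF s eq F])
  qed
  then have I1: "((%s. inner (S (- s) (DNl a b (w s) (y s))) p) has_integral
    inner (S (- t) (y t)) p - inner (S (- 0) (y 0)) p) {0..t}"
   using t by (intro fundamental_theorem_of_calculus)
    (auto simp: has_real_derivative_iff_has_vector_derivative)
  have I2: "((%s. inner (S (- s) (DNl a b (w s) (y s))) p) has_integral
    inner (integral {0..t} (%s. S (- s) (DNl a b (w s) (y s)))) p) {0..t}"
  proof -
   have "(%s. S (- s) (DNl a b (w s) (y s))) integrable_on {0..t}"
    using t by (intro integrable_continuous_interval continuous_on_subset[OF c]) auto
   from has_integral_linear[OF integrable_integral[OF this] bounded_linear_inner_left]
   show ?thesis by (simp add: o_def)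
  qed
  show ?thesis using has_integral_unique[OF I1 I2] by simp
 qed
 have xi: "S (- t) (y t) = y 0 + integral {0..t} (%s. S (- s) (DNl a b (w s) (y s)))" if "t : {0..T}" for t
 proof -
  have "S (- t) (y t) - y 0 - integral {0..t} (%s. S (- s) (DNl a b (w s) (y s))) = 0"
   by (rule test_pair_orthogonal_eq_0) (use weak[OF that] in \<open>simp add: inner_diff_left\<close>)
  then show ?thesis by (simp add: algebra_simps)
 qed
 show ?thesis
  unfolding ode_sol_def
 proof (intro conjI ballI)
  show "continuous_on {0..T} (%t. (w t, S (- t) (y t)))"
   by (intro continuous_on_Pair cw S_continuous_joint cy continuous_intros)
  fix t assume t: "t : {0..T}"
  have I: "integral {0..t} (%s. ode_rhs a b s (w s, S (- s) (y s))) =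
    (integral {0..t} y, integral {0..t} (%s. S (- s) (DNl a b (w s) (y s))))"
   unfolding ode_rhs_def using t
   by (subst integral_Pair[symmetric]) (auto intro: continuous_on_subset[OF cy] continuous_on_subset[OF c])
  have wt: "w t = w 0 + integral {0..t} y" using tr t unfolding traj_def by blast
  show "(w t, S (- t) (y t)) = (w 0, y 0) + integral {0..t} (%s. ode_rhs a b s (w s, S (- s) (y s)))"
   unfolding I add_Pair wt[symmetric] xi[OF t, symmetric] by (rule HOL.refl)
 qed
qed

text \<open>The relation between \<open>w\<close>, \<open>y\<close> and the generator is not part of
  the ordinary differential equation. It holds at time 0 by assumption and its weak form is
  preserved by the flow.\<close>

lemma ode_sol_imp_traj:
 assumes sol: "ode_sol (ode_rhs a b) (w0, y0) T z" and init: "genA w0 (y0 - Nl a b w0)"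
 shows "traj a b T (%t. fst (z t)) (%t. S t (snd (z t)))"
proof (cases "0 <= T")
 case False
 then show ?thesis by (simp add: traj_def)
next
 case T: True
 have cz: "continuous_on {0..T} z" using sol by (simp add: ode_sol_def)
 define w where "w t = fst (z t)" for t
 define xi where "xi t = snd (z t)" for t
 define y where "y t = S t (xi t)" for t
 have cw: "continuous_on {0..T} w" and cxi: "continuous_on {0..T} xi"
  unfolding w_def xi_def by (intro continuous_intros cz)+
 have cy: "continuous_on {0..T} y"
  unfolding y_def by (intro S_continuous_joint cxi continuous_intros)
 have dz: "(z has_vector_derivative (y t, S (- t) (DNl a b (w t) (y t)))) (at t within {0..T})" if "t : {0..T}" for t
  using ode_sol_deriv[OF sol pde.continuous_G[OF cz] that] by (simp add: ode_rhs_def y_def w_def xi_def)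
 have dw: "(w has_vector_derivative y t) (at t within {0..T})"
  and dxi: "(xi has_vector_derivative S (- t) (DNl a b (w t) (y t))) (at t within {0..T})" if "t : {0..T}" for t
  using bounded_linear.has_vector_derivative[OF bounded_linear_fst dz[OF that]]
   bounded_linear.has_vector_derivative[OF bounded_linear_snd dz[OF that]]
  by (simp_all add: w_def[abs_def] xi_def[abs_def])
 have z0: "w 0 = w0" "y 0 = y0"
  using sol T by (auto simp: ode_sol_def w_def y_def xi_def)
 have gen: "genA (w t) (y t - Nl a b (w t))" if t: "t : {0..T}" for t
  unfolding genA_iff_weak
 proof (intro allI impI)
  fix ph th assume ph: "test_fun ph" "test_fun th"
  let ?p = "test_pair ph th" and ?a = "A_test ph th"
  \<comment> \<open>The defect of the evolution equation tested with \<open>?p\<close>, in the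
    moving frame so that every term is differentiable.\<close>
  define q where "q t = inner (xi t) (S (- t) ?p) - inner (Nl a b (w t)) ?p + inner (w t) ?a" for t
  have "(q has_real_derivative 0) (at s within {0..T})" if s: "s : {0..T}" for s
  proof -
   have dS: "((%t. S (- t) ?p) has_vector_derivative - S (- s) ?a) (at s within {0..T})"
   proof (rule has_vector_derivative_at_within)
    show "((%t. S (- t) ?p) has_vector_derivative - S (- s) ?a) (at s)"
     using vector_diff_chain_at[OF has_vector_derivative_minus[OF has_vector_derivative_id] S_test_deriv[OF ph, of "- s"]]
     by (simp add: o_def)
   qed
   have "(q has_real_derivative
     (inner (xi s) (- S (- s) ?a) + inner (S (- s) (DNl a b (w s) (y s))) (S (- s) ?p)) -
     (inner (Nl a b (w s)) 0 + inner (DNl a b (w s) (y s)) ?p) +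
     (inner (w s) 0 + inner (y s) ?a)) (at s within {0..T})"
    unfolding q_def
    by (intro DERIV_add DERIV_diff inner_has_real_derivative dxi[OF s] dS Nl_deriv dw[OF s] has_vector_derivative_const)
   then show ?thesis by (rule DERIV_cong) (simp add: y_def inner_S_left)
  qed
  then have "q t = q 0" using t by (rule zero_derivative_interval)
  moreover have "q 0 = 0"
   using init ph unfolding genA_iff_weak q_def by (simp add: z0[symmetric] y_def inner_diff_left)
  ultimately show "inner (y t - Nl a b (w t)) ?p = - inner (w t) ?a"
   by (simp add: q_def y_def inner_S_left inner_diff_left)
 qed
 have "w t = w 0 + integral {0..t} y" if t: "t : {0..T}" for t
 proof -
  have "(y has_integral w t - w 0) {0..t}"
  proof (rule fundamental_theorem_of_calculus)
   show "0 <= t" using t by simp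
   fix s assume "s : {0..t}"
   then show "(w has_vector_derivative y s) (at s within {0..t})"
    using dw[of s] t by (auto intro: has_vector_derivative_within_subset)
  qed
  then show ?thesis by (simp add: integral_unique)
 qed
 then have "traj a b T w y" unfolding traj_def using cw cy gen by blast
 then show ?thesis by (simp add: w_def[abs_def] y_def[abs_def] xi_def[abs_def])
qed

section \<open>Conservation laws\<close>

text \<open>In terms of \<open>v = ka (fst w)\<close> and \<open>u = snd w\<close> this is half the
  squared L2 norms of v, v' and u minus the integral of a v^3 / 3 + b v^4 / 4;
  \<open>norm_ka_sq\<close> merges the norms of v and v' into that of \<open>fst w\<close>.\<close>

definition energy :: "real => real => state => real" where
 "energy a b w = inner w w / 2 - (a / 3) * inner (ka (fst w)) (mulK (fst w) (ka (fst w))) -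
  (b / 4) * inner (ka (fst w)) (mulK (fst w) (mulK (fst w) (ka (fst w))))"

definition momentum :: "state => real" where
 "momentum w = inner (ka (fst w)) (snd w)"

lemma wd_square: "wd (mulK g (ka g)) (2 *R mulK g (ka g - g))"
 using wd_mulK[OF refl refl, of g g] by (simp add: scaleR_2)

lemma wd_cube: "wd (mulK g (mulK g (ka g))) (3 *R mulK g (mulK g (ka g - g)))"
proof -
 define h where "h = mulK g g - mulK g (ka g - g)"
 have h: "ka h = mulK g (ka g)" unfolding h_def by (rule ka_mult)
 have Kh: "Kp h x = Kp g x * Kp g x" for x unfolding h_def by (rule Kp_mult[symmetric])
 have mh: "mulK h f = mulK g (mulK g f)" for f
 proof -
  have "mulK g (toL2 (%x. Kp g x * fn f x)) = toL2 (%x. Kp g x * (Kp g x * fn f x))"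
   by (rule mulK_toL2) (auto intro: L2_fun_Kp_mult)
  then show ?thesis by (simp add: mulK_def[of _ f] Kh mult.assoc)
 qed
 have dh: "ka h - h = 2 *R mulK g (ka g - g)"
  unfolding h by (simp add: h_def mulK.diff_right scaleR_2)
 have "wd (mulK g (ka h)) (mulK g (ka h - h) + mulK h (ka g - g))"
  by (rule wd_mulK[OF refl refl])
 moreover have "mulK g (ka h - h) + mulK h (ka g - g) = 3 *R mulK g (mulK g (ka g - g))"
  unfolding dh mh mulK.scaleR_right using scaleR_left_distrib[of 2 1 "mulK g (mulK g (ka g - g))"] by simp
 ultimately show ?thesis unfolding h by simp
qed

text \<open>Integration by parts gives X = - 2 X for the integral X of v^2 v'.\<close>

lemma inner_ka_square_deriv: "inner (ka g) (mulK g (ka g - g)) = 0"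
proof -
 define d where "d = mulK g (ka g - g)"
 have "inner (mulK g (ka g)) (ka g - g) = - inner (2 *R d) (ka g)"
  unfolding d_def by (rule wd_by_parts[OF wd_square wd_ka])
 moreover have "inner (mulK g (ka g)) (ka g - g) = inner (ka g) d"
  unfolding d_def by (simp only: inner_mulK)
 moreover have "inner (2 *R d) (ka g) = 2 * inner (ka g) d"
  by (simp only: inner_scaleR_left inner_commute[of d])
 ultimately have "inner (ka g) d = - (2 * inner (ka g) d)" by simp
 then show ?thesis by (simp add: d_def)
qed

lemma inner_ka_cube_deriv: "inner (ka g) (mulK g (mulK g (ka g - g))) = 0"
proof -
 define d where "d = mulK g (mulK g (ka g - g))"
 have "inner (mulK g (mulK g (ka g))) (ka g - g) = - inner (3 *R d) (ka g)"
  unfolding d_def by (rule wd_by_parts[OF wd_cube wd_ka])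
 moreover have "inner (mulK g (mulK g (ka g))) (ka g - g) = inner (ka g) d"
  unfolding d_def by (simp only: inner_mulK)
 moreover have "inner (3 *R d) (ka g) = 3 * inner (ka g) d"
  by (simp only: inner_scaleR_left inner_commute[of d])
 ultimately have "inner (ka g) d = - (3 * inner (ka g) d)" by simp
 then show ?thesis by (simp add: d_def)
qed

lemma traj_components:
 assumes "traj a b T w y" "t : {0..T}"
 shows "wd (snd (w t)) (ka (fst (y t)))" "wd (fst (w t)) (ka' (snd (y t) + N2 a b (fst (w t))))"
  "inner (w t) (y t - Nl a b (w t)) = 0"
proof -
 note gen = traj_genA[OF assms]
 have "y t - Nl a b (w t) = (fst (y t), snd (y t) + N2 a b (fst (w t)))"
  by (simp add: Nl_def prod_eq_iff)
 then have 1: "genA (fst (w t), snd (w t)) (fst (y t), snd (y t) + N2 a b (fst (w t)))"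
  using gen by simp
 show "wd (snd (w t)) (ka (fst (y t)))" "wd (fst (w t)) (ka' (snd (y t) + N2 a b (fst (w t))))"
  using genA_regularity[OF 1] by auto
 show "inner (w t) (y t - Nl a b (w t)) = 0"
  using genA_skew[OF gen gen]
  by (simp add: inner_commute)
qed

text \<open>The generator contributes nothing to the derivative by skewness. What remains is u
  paired with the derivative of a v^2 + b v^3, and that function paired with v_t = u_x; integration
  by parts cancels the two.\<close>

lemma traj_energy:
 assumes tr: "traj a b T w y" and t: "t : {0..T}"
 shows "energy a b (w t) = energy a b (w 0)"
proof -
 have "((%t. energy a b (w t)) has_real_derivative 0) (at s within {0..T})" if s: "s : {0..T}" for s
 proof -
  define g where "g t = fst (w t)" for t
  define h where "h = fst (y s)"
  note dw = traj_deriv[OF tr s]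
  have dg: "(g has_vector_derivative h) (at s within {0..T})"
   unfolding g_def h_def by (rule bounded_linear.has_vector_derivative[OF bounded_linear_fst dw])
  note dk = bounded_linear.has_vector_derivative[OF bounded_linear_ka dg]
  note dm = bounded_bilinear.has_vector_derivative[OF bounded_bilinear_mulK dg]
  let ?g = "g s" and ?v = "ka (g s)"
  have "((%t. energy a b (w t)) has_real_derivative
    (inner (w s) (y s) + inner (y s) (w s)) / 2 -
    (a / 3) * (inner ?v (mulK ?g (ka h) + mulK h ?v) + inner (ka h) (mulK ?g ?v)) -
    (b / 4) * (inner ?v (mulK ?g (mulK ?g (ka h) + mulK h ?v) + mulK h (mulK ?g ?v)) + inner (ka h) (mulK ?g (mulK ?g ?v))))
    (at s within {0..T})"
   unfolding energy_def g_def[symmetric]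
   by (intro DERIV_diff DERIV_cmult DERIV_cdivide inner_has_real_derivative dw dk dm)
  moreover have "mulK h ?v = mulK ?g (ka h)" by (rule mulK_ka_commute)
  moreover have "mulK h (mulK ?g ?v) = mulK ?g (mulK ?g (ka h))" by (metis mulK_commute mulK_ka_commute)
  moreover have "inner ?v (mulK ?g (ka h)) = inner (ka h) (mulK ?g ?v)"
   "inner ?v (mulK ?g (mulK ?g (ka h))) = inner (ka h) (mulK ?g (mulK ?g ?v))"
   by (metis inner_mulK inner_commute)+
  ultimately have D: "((%t. energy a b (w t)) has_real_derivative
    inner (w s) (y s) - inner (ka h) (a *R mulK ?g ?v + b *R mulK ?g (mulK ?g ?v))) (at s within {0..T})"
   by (elim DERIV_cong) (simp add: inner_add_right mulK.add_right inner_commute[of "y s"] algebra_simps)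
  have "wd (a *R mulK ?g ?v + b *R mulK ?g (mulK ?g ?v)) (N2 a b ?g)"
   using wd_add[OF wd_scaleR[OF wd_square[of ?g], of a] wd_scaleR[OF wd_cube[of ?g], of b]]
   by (simp add: N2_def mult.commute)
  from wd_by_parts[OF this traj_components(1)[OF tr s]]
  have "inner (ka h) (a *R mulK ?g ?v + b *R mulK ?g (mulK ?g ?v)) = - inner (snd (w s)) (N2 a b ?g)"
   unfolding h_def by (metis inner_commute)
  moreover have "inner (w s) (y s) = - inner (snd (w s)) (N2 a b ?g)"
   using traj_components(3)[OF tr s] by (simp add: inner_diff_right Nl_def inner_prod_def g_def inner_add_right)
  ultimately show ?thesis using D by simp
 qed
 then show ?thesis using t by (rule zero_derivative_interval)
qed

text \<open>The derivative is the integral of u_x u + v u_t, and after inserting the equation each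
  term integrates a space derivative of a decaying expression.\<close>

lemma traj_momentum:
 assumes tr: "traj a b T w y" and t: "t : {0..T}"
 shows "momentum (w t) = momentum (w 0)"
proof -
 have "((%t. momentum (w t)) has_real_derivative 0) (at s within {0..T})" if s: "s : {0..T}" for s
 proof -
  define g where "g = fst (w s)"
  note dw = traj_deriv[OF tr s]
  have D: "((%t. momentum (w t)) has_real_derivative
    inner (ka g) (snd (y s)) + inner (ka (fst (y s))) (snd (w s))) (at s within {0..T})"
   unfolding momentum_def g_def
   by (intro inner_has_real_derivative bounded_linear.has_vector_derivative[OF bounded_linear_ka]
     bounded_linear.has_vector_derivative[OF bounded_linear_fst] bounded_linear.has_vector_derivative[OF bounded_linear_snd] dw)
  have 1: "inner (ka (fst (y s))) (snd (w s)) = 0"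
   using wd_inner_self[OF traj_components(1)[OF tr s]] by (simp add: inner_commute)
  define z where "z = snd (y s) + N2 a b g"
  have wg: "wd g (ka' z)" using traj_components(2)[OF tr s] by (simp add: z_def g_def)
  have "inner (ka g) (ka' z) = - inner (ka g - g) g" using wd_by_parts[OF wd_ka wg] .
  moreover have "inner (ka g) (z - ka' z) = - inner (ka g - g) (ka' z)" using wd_by_parts[OF wd_ka wd_ka'] .
  moreover have "inner (ka g - g) (ka' z) = inner (ka g) (ka' z)"
   using wd_inner_self[OF wg] by (simp add: inner_diff_left)
  ultimately have "inner (ka g) z = 0"
   by (simp add: inner_diff_right)
  moreover have "inner (ka g) (N2 a b g) = 0"
   by (simp add: N2_def inner_simps inner_ka_square_deriv inner_ka_cube_deriv)
  ultimately have "inner (ka g) (snd (y s)) = 0" by (simp add: z_def inner_simps)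
  then show ?thesis using D 1 by simp
 qed
 then show ?thesis using t by (rule zero_derivative_interval)
qed

section \<open>Weak solutions as trajectories\<close>

lemma weak_deriv_iff_wd:
 assumes "L2_fun f" "L2_fun h"
 shows "weak_deriv f h \<longleftrightarrow> wd (toL2 f) (toL2 h)"
 unfolding weak_deriv_def wd_def
 using assms by (auto simp: inner_toL2 L2_fun_test test_fun_deriv L2_fun_mult_integrable)

lemma Hk_chain_wd: "Hk_chain k f ds ==> j < k ==> wd (toL2 (ds j)) (toL2 (ds (Suc j)))"
 unfolding Hk_chain_def by (metis Suc_leI less_imp_le weak_deriv_iff_wd)

lemma Hk_chain_unique:
 assumes "Hk_chain k f ds" "Hk_chain k f ds'" "j <= k"
 shows "toL2 (ds j) = toL2 (ds' j)"
 using assms(3)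
proof (induction j)
 case 0
 then show ?case using assms by (simp add: Hk_chain_def)
next
 case (Suc j)
 then have "wd (toL2 (ds j)) (toL2 (ds (Suc j)))" "wd (toL2 (ds j)) (toL2 (ds' (Suc j)))"
  using Hk_chain_wd[OF assms(1), of j] Hk_chain_wd[OF assms(2), of j] by auto
 then show ?case by (rule wd_unique)
qed

text \<open>The derivative classes behind the choice made in \<open>H_norm\<close>; uniqueness of
  weak derivatives makes them independent of that choice.\<close>

definition hder :: "nat => (real => real) => nat => l2" where
 "hder k f j = toL2 ((SOME ds. Hk_chain k f ds) j)"

lemma hder_chain: "Hk_chain k f ds ==> j <= k ==> hder k f j = toL2 (ds j)"
 unfolding hder_def using Hk_chain_unique[OF someI[of "Hk_chain k f"]] by blast

lemma hder_0: "in_H k f ==> hder k f 0 = toL2 f"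
 unfolding in_H_def using hder_chain[of k f _ 0] by (auto simp: Hk_chain_def)

lemma in_H_L2: "in_H k f ==> L2_fun f"
 by (auto simp: in_H_def Hk_chain_def)

lemma wd_hder: "in_H k f ==> j < k ==> wd (hder k f j) (hder k f (Suc j))"
 unfolding in_H_def using hder_chain[of k f _ j] hder_chain[of k f _ "Suc j"] Hk_chain_wd[of k f _ j] by auto

lemma H_norm_hder:
 assumes "in_H k f"
 shows "H_norm k f = sqrt (\<Sum>j\<le>k. (norm (hder k f j))^2)"
proof -
 define ds where "ds = (SOME ds. Hk_chain k f ds)"
 have "Hk_chain k f ds" using assms unfolding in_H_def ds_def by (rule someI_ex)
 then have L: "L2_fun (ds j)" if "j <= k" for j using that by (simp add: Hk_chain_def)
 have "hder k f j = toL2 (ds j)" for j by (simp add: hder_def ds_def)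
 then have "(\<Sum>j\<le>k. \<integral>x. (ds j x)^2 \<partial>lborel) = (\<Sum>j\<le>k. (norm (hder k f j))^2)"
  by (intro sum.cong) (auto simp: norm_toL2_sq L)
 then show ?thesis by (simp add: H_norm_def Let_def flip: ds_def)
qed

lemma norm_hder_le: "in_H k f ==> j <= k ==> norm (hder k f j) <= H_norm k f"
 unfolding H_norm_hder
 by (intro real_le_rsqrt member_le_sum[of j "{..k}" "%j. (norm (hder k f j))^2"]) auto

lemma in_H_if_wd:
 assumes "L2_fun f" "d 0 = toL2 f" "!!j. j < k ==> wd (d j) (d (Suc j))"
 shows "in_H k f" "j <= k ==> hder k f j = d j"
proof -
 define ds where "ds j = (if j = 0 then f else fn (d j))" for j
 have t: "toL2 (ds j) = d j" for j using assms(2) by (simp add: ds_def)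
 have L: "L2_fun (ds j)" for j using assms(1) by (simp add: ds_def)
 have chain: "Hk_chain k f ds"
  unfolding Hk_chain_def using L assms(3) by (auto simp: weak_deriv_iff_wd t) (simp add: ds_def)
 then show "in_H k f" by (auto simp: in_H_def)
 show "j <= k ==> hder k f j = d j" using hder_chain[OF chain] t by simp
qed

lemma in_H_diff:
 assumes "in_H k f" "in_H k h"
 shows "in_H k (%x. f x - h x)" "j <= k ==> hder k (%x. f x - h x) j = hder k f j - hder k h j"
proof -
 have "(%j. hder k f j - hder k h j) 0 = toL2 (%x. f x - h x)"
  using assms by (simp add: hder_0 toL2_diff in_H_L2)
 note * = in_H_if_wd[OF L2_fun_diff[OF in_H_L2[OF assms(1)] in_H_L2[OF assms(2)]] this wd_diff[OF wd_hder[OF assms(1)] wd_hder[OF assms(2)]]]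
 show "in_H k (%x. f x - h x)" by (rule *(1))
 show "j <= k ==> hder k (%x. f x - h x) j = hder k f j - hder k h j" by (rule *(2))
qed

lemma in_H_uminus: "in_H k f ==> in_H k (%x. - f x)"
 using in_H_if_wd(1)[of "%x. - f x" "%j. - hder k f j" k]
 by (simp add: hder_0 toL2_uminus in_H_L2 L2_fun_uminus wd_uminus wd_hder)

lemma in_H_add: "in_H k f ==> in_H k h ==> in_H k (%x. f x + h x)"
 using in_H_diff(1)[of k f "%x. - h x"] in_H_uminus[of k h] by simp

lemma H_norm_0: "L2_fun f ==> H_norm 0 f = norm (toL2 f)"
proof -
 assume f: "L2_fun f"
 have "in_H 0 f" by (rule in_H_if_wd(1)[of f "%_. toL2 f"]) (use f in auto)
 then show ?thesis by (simp add: H_norm_hder hder_0)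
qed

lemma H_norm_1:
 assumes "in_H 1 f"
 shows "H_norm 1 f = norm (hder 1 f 0 - hder 1 f 1)"
proof -
 have wd: "wd (hder 1 f 0) (hder 1 f 1)" using wd_hder[OF assms, of 0] by simp
 have k: "ka (hder 1 f 0 - hder 1 f 1) = hder 1 f 0" using wd_imp_ka[OF wd] by simp
 have "(norm (hder 1 f 0 - hder 1 f 1))^2 = (norm (hder 1 f 0))^2 + (norm (hder 1 f 1))^2"
  using norm_ka_sq[of "hder 1 f 0 - hder 1 f 1"] unfolding k by simp
 then have "norm (hder 1 f 0 - hder 1 f 1) = sqrt ((norm (hder 1 f 0))^2 + (norm (hder 1 f 1))^2)"
  by (metis norm_ge_zero real_sqrt_unique)
 then show ?thesis using H_norm_hder[OF assms] by simp
qed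

lemma in_H_mono:
 assumes "in_H k f" "j <= k"
 shows "in_H j f"
proof -
 obtain ds where "Hk_chain k f ds" using assms(1) by (auto simp: in_H_def)
 then have "Hk_chain j f ds" using assms(2) unfolding Hk_chain_def by (meson le_trans less_le_trans)
 then show ?thesis by (auto simp: in_H_def)
qed

lemma hder_mono: "in_H k f ==> i <= j ==> j <= k ==> hder j f i = hder k f i"
proof -
 assume f: "in_H k f" and ij: "i <= j" "j <= k"
 then obtain ds where ds: "Hk_chain k f ds" by (auto simp: in_H_def)
 then have "Hk_chain j f ds" using ij unfolding Hk_chain_def by (meson le_trans less_le_trans)
 then show ?thesis using hder_chain[OF ds, of i] hder_chain[of j f ds i] ij by simp
qed

text \<open>A du Bois-Reymond argument: \<open>G\<close> plus the integral of \<open>H\<close> has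
  weak derivative 0. Testing with the difference of two steep smooth steps compares its averages
  just after two times, so it takes the same value at both.\<close>

lemma weak_time_derivative:
 fixes G H :: "real => real"
 assumes G: "continuous_on {0..T} G" and H: "continuous_on {0..T} H" and T: "0 < T"
  and weak: "!!ps. smooth_fun ps ==> (\<exists>t0 t1. 0 < t0 & t1 < T & (\<forall>t. t \<notin> {t0..t1} --> ps t = 0)) ==>
   integral {0..T} (%t. - G t * deriv ps t + H t * ps t) = 0"
  and t: "t : {0..T}"
 shows "G t = G 0 - integral {0..t} H"
proof -
 define Ga where "Ga t = G t + integral {0..t} H" for t
 have cI: "continuous_on {0..T} (%t. integral {0..t} H)"
  by (intro indefinite_integral_continuous_1 integrable_continuous_interval H)
 have cGa: "continuous_on {0..T} Ga" unfolding Ga_def by (intro continuous_intros G cI)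
 have weakGa: "integral {0..T} (%t. Ga t * deriv ps t) = 0"
  if ps: "smooth_fun ps" "0 < t0" "t1 < T" "!!t. t \<notin> {t0..t1} ==> ps t = 0" for ps t0 t1
 proof -
  have cps: "continuous_on A ps" "continuous_on A (deriv ps)" for A
   using ps(1) smooth_fun_deriv smooth_fun_continuous by blast+
  have "((%t. integral {0..t} H * deriv ps t + H t * ps t) has_integral
    integral {0..T} H * ps T - integral {0..0} H * ps 0) {0..T}"
  proof (rule fundamental_theorem_of_calculus)
   show "0 <= T" using T by simp
   fix s assume s: "s : {0..T}"
   have "((%t. integral {0..t} H) has_real_derivative H s) (at s within {0..T})"
    by (rule integral_has_real_derivative[OF H s])
   moreover have "(ps has_real_derivative deriv ps s) (at s within {0..T})"
    using smooth_fun_DERIV[OF ps(1)] by (rule has_field_derivative_at_within)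
   ultimately have "((%t. integral {0..t} H * ps t) has_real_derivative
     H s * ps s + deriv ps s * integral {0..s} H) (at s within {0..T})" by (rule DERIV_mult)
   then show "((%t. integral {0..t} H * ps t) has_vector_derivative
     integral {0..s} H * deriv ps s + H s * ps s) (at s within {0..T})"
    by (simp add: has_real_derivative_iff_has_vector_derivative mult.commute add.commute)
  qed
  moreover have "ps T = 0" using ps by auto
  ultimately have I1: "integral {0..T} (%t. integral {0..t} H * deriv ps t + H t * ps t) = 0"
   by (simp add: integral_unique)
  have I2: "integral {0..T} (%t. - G t * deriv ps t + H t * ps t) = 0"
   using weak[OF ps(1)] ps(2-4) by blast
  have "integral {0..T} (%t. Ga t * deriv ps t) =
    integral {0..T} (%t. (integral {0..t} H * deriv ps t + H t * ps t) - (- G t * deriv ps t + H t * ps t))"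
   by (simp add: Ga_def algebra_simps)
  also have "... = integral {0..T} (%t. integral {0..t} H * deriv ps t + H t * ps t) -
    integral {0..T} (%t. - G t * deriv ps t + H t * ps t)"
   by (rule Henstock_Kurzweil_Integration.integral_diff)
    (intro integrable_continuous_interval continuous_intros cI cps G H)+
  finally show ?thesis unfolding I1 I2 by simp
 qed
 \<comment> \<open>The factor next to \<open>Ga\<close> is a probability density on
   \<open>{s..s+ep}\<close>, so the integral is an average of values close to
   \<open>Ga s\<close>.\<close>
 have mean: "\<bar>integral {0..T} (%ta. Ga ta * (deriv step ((ta - s) / ep) / ep)) - Ga s\<bar> <= e"
  if s: "0 < s" "s + ep < T" "0 < ep" and e: "!!ta. ta : {s..s+ep} ==> \<bar>Ga ta - Ga s\<bar> <= e" for s ep e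
 proof -
  define rh where "rh ta = deriv step ((ta - s) / ep) / ep" for ta
  have crh: "continuous_on A rh" for A
   unfolding rh_def using s
   by (intro continuous_intros continuous_on_compose2[OF smooth_fun_continuous[OF smooth_fun_deriv[OF smooth_fun_step], of UNIV]]) auto
  have "(rh has_integral step ((T - s) / ep) - step ((0 - s) / ep)) {0..T}"
  proof (rule fundamental_theorem_of_calculus)
   show "0 <= T" using T by simp
   fix ta assume "ta : {0..T}"
   have "((%ta. step ((ta - s) / ep)) has_real_derivative deriv step ((ta - s) / ep) * (1 / ep)) (at ta)"
    by (rule DERIV_chain2[OF smooth_fun_DERIV[OF smooth_fun_step]])
     (use s(3) in \<open>auto intro!: derivative_eq_intros\<close>)
   then show "((%ta. step ((ta - s) / ep)) has_vector_derivative rh ta) (at ta within {0..T})"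
    by (simp add: rh_def has_real_derivative_iff_has_vector_derivative has_vector_derivative_at_within)
  qed
  moreover have "1 <= (T - s) / ep" "(0 - s) / ep <= 0" using s by (auto simp: field_simps)
  ultimately have Irh: "(rh has_integral 1) {0..T}" by (simp add: step_ge_1 step_le_0)
  have "\<bar>integral {0..T} (%ta. (Ga ta - Ga s) * rh ta)\<bar> <= integral {0..T} (%ta. e * rh ta)"
  proof (rule integral_norm_bound_integral[of "%ta. (Ga ta - Ga s) * rh ta", simplified real_norm_def])
   show "(%ta. (Ga ta - Ga s) * rh ta) integrable_on {0..T}" "(%ta. e * rh ta) integrable_on {0..T}"
    by (intro integrable_continuous_interval continuous_intros cGa crh)+
   fix ta assume "ta : {0..T}"
   show "\<bar>(Ga ta - Ga s) * rh ta\<bar> <= e * rh ta"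
   proof (cases "ta : {s..s+ep}")
    case True
    have "0 <= rh ta" using s deriv_step_nonneg by (simp add: rh_def)
    then show ?thesis using e[OF True] by (simp add: abs_mult mult_right_mono)
   next
    case False
    then have "(ta - s) / ep <= 0 | 1 <= (ta - s) / ep" using s by (auto simp: field_simps)
    then have "rh ta = 0" by (simp add: rh_def deriv_step bump_eq_0)
    then show ?thesis by simp
   qed
  qed
  also have "integral {0..T} (%ta. e * rh ta) = e" by (simp add: integral_unique[OF Irh])
  also have "integral {0..T} (%ta. (Ga ta - Ga s) * rh ta) = integral {0..T} (%ta. Ga ta * rh ta) - Ga s"
  proof -
   have "integral {0..T} (%ta. (Ga ta - Ga s) * rh ta) = integral {0..T} (%ta. Ga ta * rh ta - Ga s * rh ta)"
    by (simp add: left_diff_distrib)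
   also have "... = integral {0..T} (%ta. Ga ta * rh ta) - integral {0..T} (%ta. Ga s * rh ta)"
    by (intro Henstock_Kurzweil_Integration.integral_diff integrable_continuous_interval continuous_intros cGa crh)
   also have "integral {0..T} (%ta. Ga s * rh ta) = Ga s"
    by (simp add: integral_unique[OF Irh])
   finally show ?thesis .
  qed
  finally show ?thesis by (simp add: rh_def)
 qed
 have const: "Ga s = Ga t" if st: "0 < s" "s < t" "t < T" for s t
 proof (rule ccontr)
  assume ne: "Ga s ~= Ga t"
  define e where "e = \<bar>Ga s - Ga t\<bar> / 3"
  have e: "0 < e" using ne by (simp add: e_def)
  have near: "\<exists>d>0. \<forall>ta. ta : {s..s+d} --> \<bar>Ga ta - Ga s\<bar> <= e" if s: "0 < s" "s < T" for s
  proof -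
   have "isCont Ga s" using cGa s by (simp add: continuous_on_interior)
   then have "\<exists>d>0. \<forall>ta. dist ta s < d --> dist (Ga ta) (Ga s) < e"
    using e unfolding continuous_at_eps_delta by blast
   then obtain d where d: "0 < d" "\<forall>ta. dist ta s < d --> dist (Ga ta) (Ga s) < e" by blast
   have "\<bar>Ga ta - Ga s\<bar> <= e" if "ta : {s..s + d/2}" for ta
   proof -
    have "dist ta s < d" using that d(1) by (simp add: dist_real_def)
    then show ?thesis using d(2) by (auto simp: dist_real_def intro: less_imp_le)
   qed
   then show ?thesis using d(1) by (intro exI[of _ "d/2"]) auto
  qed
  obtain d1 where d1: "0 < d1" "!!ta. ta : {s..s+d1} ==> \<bar>Ga ta - Ga s\<bar> <= e" using near[of s] st by auto
  obtain d2 where d2: "0 < d2" "!!ta. ta : {t..t+d2} ==> \<bar>Ga ta - Ga t\<bar> <= e" using near[of t] st by auto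
  \<comment> \<open>The last entry keeps both transition intervals before \<open>T\<close>, as an
    admissible test function requires.\<close>
  define ep where "ep = min (min d1 d2) ((T - t) / 2)"
  have "ep <= (T - t) / 2" unfolding ep_def by (rule min.cobounded2)
  then have ep45: "t + ep < T" "s + ep < T" using st by argo+
  have "0 < ep" "ep <= d1" "ep <= d2" using d1(1) d2(1) st by (simp_all add: ep_def min_le_iff_disj)
  note ep = this ep45
  define ps where "ps ta = step ((ta - s) / ep) - step ((ta - t) / ep)" for ta
  have sm: "smooth_fun (%ta. step ((ta - s) / ep))" for s
  proof -
   have "smooth_fun (%ta. step ((1 / ep) * ta + (- s / ep)))" by (rule smooth_fun_affine[OF smooth_fun_step])
   moreover have "(1 / ep) * ta + (- s / ep) = (ta - s) / ep" for ta by (simp add: diff_divide_distrib)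
   ultimately show ?thesis by simp
  qed
  have ps: "smooth_fun ps" unfolding ps_def by (intro smooth_fun_diff sm)
  have dst: "((%ta. step ((ta - s) / ep)) has_real_derivative deriv step ((ta - s) / ep) / ep) (at ta)" for s ta
  proof -
   have "((%ta. step ((ta - s) / ep)) has_real_derivative deriv step ((ta - s) / ep) * (1 / ep)) (at ta)"
    by (rule DERIV_chain2[OF smooth_fun_DERIV[OF smooth_fun_step]])
     (use ep(1) in \<open>auto intro!: derivative_eq_intros\<close>)
   then show ?thesis by simp
  qed
  have dps: "deriv ps ta = deriv step ((ta - s) / ep) / ep - deriv step ((ta - t) / ep) / ep" for ta
   unfolding ps_def by (intro DERIV_imp_deriv DERIV_diff dst)
  have "integral {0..T} (%ta. Ga ta * deriv ps ta) = 0"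
  proof (rule weakGa[OF ps st(1) ep(4)])
   fix ta assume "ta \<notin> {s..t+ep}"
   then have "(ta - s) / ep <= 0 & (ta - t) / ep <= 0 | 1 <= (ta - s) / ep & 1 <= (ta - t) / ep"
    using st ep(1) by (auto simp: field_simps)
   then show "ps ta = 0" by (auto simp: ps_def step_le_0 step_ge_1)
  qed
  moreover have "integral {0..T} (%ta. Ga ta * deriv ps ta) =
    integral {0..T} (%ta. Ga ta * (deriv step ((ta - s) / ep) / ep)) - integral {0..T} (%ta. Ga ta * (deriv step ((ta - t) / ep) / ep))"
  proof -
   have c: "continuous_on {0..T} (%ta. deriv step ((ta - s) / ep) / ep)" for s
    using ep(1) by (intro continuous_intros continuous_on_compose2[OF smooth_fun_continuous[OF smooth_fun_deriv[OF smooth_fun_step], of UNIV]]) auto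
   show ?thesis
    unfolding dps right_diff_distrib
    by (intro Henstock_Kurzweil_Integration.integral_diff integrable_continuous_interval continuous_on_mult cGa c)
  qed
  moreover have "\<bar>integral {0..T} (%ta. Ga ta * (deriv step ((ta - s) / ep) / ep)) - Ga s\<bar> <= e"
   using ep st d1(2) by (intro mean) auto
  moreover have "\<bar>integral {0..T} (%ta. Ga ta * (deriv step ((ta - t) / ep) / ep)) - Ga t\<bar> <= e"
   using ep st d2(2) by (intro mean) auto
  ultimately have "\<bar>Ga s - Ga t\<bar> <= 2 * e" by linarith
  then show False using e by (simp add: e_def)
 qed
 have "Ga x = Ga (T / 2)" if "x : {0..T}" for x
 proof (rule continuous_constant_on_closure[of "{0<..<T}" Ga "Ga (T/2)" x])
  show "continuous_on (closure {0<..<T}) Ga" using cGa T by simp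
  show "Ga y = Ga (T / 2)" if "y : {0<..<T}" for y
  proof (cases y "T/2" rule: linorder_cases)
   case less
   show ?thesis by (rule const) (use less that T in auto)
  next
   case greater
   show ?thesis by (rule const[symmetric]) (use greater that T in auto)
  qed (simp only:)
  show "x : closure {0<..<T}" using that T by simp
 qed
 from this[OF t] this[of 0] show ?thesis using T by (simp add: Ga_def)
qed

lemma deriv_eq_0_open:
 assumes "open A" "!!t. t : A ==> ps t = (0::real)" "t : A"
 shows "deriv ps t = 0"
 using has_field_derivative_transform_within_open[of "%x. 0" 0 t A ps] assms
 by (intro DERIV_imp_deriv) auto

lemma L2_fun_AE:
 assumes "L2_fun f" "h : borel_measurable borel" "AE x in lborel. f x = h x"
 shows "L2_fun h"
proof -
 have "integrable lborel (%x. (f x)^2) = integrable lborel (%x. (h x)^2)"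
  by (rule integrable_cong_AE) (use assms in \<open>auto simp: L2_fun_def\<close>)
 then show ?thesis using assms by (simp add: L2_fun_def)
qed

definition pK :: "real => real => l2 => l2" where
 "pK a b g = - ka g + a *R mulK g (ka g) + b *R mulK g (mulK g (ka g))"

lemma pfun_toL2:
 assumes f: "L2_fun f" "toL2 f = ka g"
 shows "L2_fun (%x. pfun a b (f x))" "toL2 (%x. pfun a b (f x)) = pK a b g"
proof -
 have ae: "AE x in lborel. Kp g x = f x"
  using assms toL2_eq_iff[of "Kp g" f] by (simp add: ka_def)
 have L2: "L2_fun (%x. Kp g x * Kp g x)" by (intro L2_fun_Kp_mult) simp
 have L3: "L2_fun (%x. Kp g x * (Kp g x * Kp g x))" by (intro L2_fun_Kp_mult) simp
 have Lp: "L2_fun (%x. - Kp g x + a * (Kp g x * Kp g x) + b * (Kp g x * (Kp g x * Kp g x)))"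
  by (intro L2_fun_add L2_fun_scale L2_fun_uminus L2 L3) simp
 have eq: "(%x. - Kp g x + a * (Kp g x * Kp g x) + b * (Kp g x * (Kp g x * Kp g x))) = (%x. pfun a b (Kp g x))"
  by (simp add: pfun_def power2_eq_square power3_eq_cube mult.assoc)
 have m: "(%x. pfun a b (f x)) : borel_measurable borel"
  unfolding pfun_def using L2_fun_measurable[OF f(1)] by measurable
 have ae': "AE x in lborel. pfun a b (Kp g x) = pfun a b (f x)"
  using ae by eventually_elim simp
 show L: "L2_fun (%x. pfun a b (f x))"
  by (rule L2_fun_AE[OF _ m ae']) (use Lp eq in simp)
 have "toL2 (%x. pfun a b (f x)) = toL2 (%x. pfun a b (Kp g x))"
  using L Lp ae' eq by (subst toL2_eq_iff) auto
 also have "... = pK a b g"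
  unfolding eq[symmetric] pK_def
  by (simp only: toL2_add[OF L2_fun_add[OF L2_fun_uminus[OF L2_fun_Kp] L2_fun_scale[OF L2]] L2_fun_scale[OF L3]]
    toL2_add[OF L2_fun_uminus[OF L2_fun_Kp] L2_fun_scale[OF L2]] toL2_scale[OF L2] toL2_scale[OF L3]
    toL2_uminus[OF L2_fun_Kp] mulK_toL2[OF L2_fun_Kp] mulK_toL2[OF L2] ka_def)
 finally show "toL2 (%x. pfun a b (f x)) = pK a b g" .
qed

lemma wd_pK: "wd (pK a b g) (- (ka g - g) + N2 a b g)"
proof -
 have "wd (- ka g + a *R mulK g (ka g) + b *R mulK g (mulK g (ka g)))
   (- (ka g - g) + a *R 2 *R mulK g (ka g - g) + b *R 3 *R mulK g (mulK g (ka g - g)))"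
  by (intro wd_add wd_scaleR wd_uminus wd_ka wd_square wd_cube)
 then show ?thesis by (simp add: pK_def N2_def mult.commute add.assoc)
qed

text \<open>With the spatial test function fixed inside \<open>A\<close> and \<open>B\<close>,
  Fubini leaves an identity in time alone, to which \<open>weak_time_derivative\<close>
  applies.\<close>

lemma time_weak_reduce:
 fixes A B :: "real => real => real"
 assumes weak: "!!ps. time_test_fun T ps ==>
   integrable (lborel \<Otimes>\<^sub>M lborel) (%(x, t). A x t * deriv ps t + B x t * ps t) &
   integral\<^sup>L (lborel \<Otimes>\<^sub>M lborel) (%(x, t). A x t * deriv ps t + B x t * ps t) = 0"
  and T': "0 < T'" "ereal T' < T"
  and A: "!!t. t : {0..T'} ==> integrable lborel (%x. A x t) & (\<integral>x. A x t \<partial>lborel) = - G t"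
  and B: "!!t. t : {0..T'} ==> integrable lborel (%x. B x t) & (\<integral>x. B x t \<partial>lborel) = H t"
  and G: "continuous_on {0..T'} G" and H: "continuous_on {0..T'} H" and t: "t : {0..T'}"
 shows "G t = G 0 - integral {0..t} H"
proof (rule weak_time_derivative[OF G H T'(1) _ t])
 fix ps assume ps: "smooth_fun ps" and "\<exists>t0 t1. 0 < t0 & t1 < T' & (\<forall>t. t \<notin> {t0..t1} --> ps t = 0)"
 then obtain t0 t1 where t01: "0 < t0" "t1 < T'" "!!t. t \<notin> {t0..t1} ==> ps t = 0" by blast
 have "ereal t1 < T" using t01(2) T'(2) by (metis ereal_less_eq(3) less_imp_le less_le_trans not_less)
 then have tt: "time_test_fun T ps" unfolding time_test_fun_def using ps t01 by blast
 have dps: "deriv ps s = 0" if "s \<notin> {t0..t1}" for s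
  by (rule deriv_eq_0_open[of "- {t0..t1}"]) (use t01(3) that in auto)
 have inner: "(\<integral>x. A x s * deriv ps s + B x s * ps s \<partial>lborel) =
   indicator {0..T'} s *R (- G s * deriv ps s + H s * ps s)" for s
 proof (cases "s : {t0..t1}")
  case True
  then have s: "s : {0..T'}" using t01 by auto
  have "(\<integral>x. A x s * deriv ps s + B x s * ps s \<partial>lborel) = (\<integral>x. A x s \<partial>lborel) * deriv ps s + (\<integral>x. B x s \<partial>lborel) * ps s"
   using A[OF s] B[OF s] by (subst Bochner_Integration.integral_add) auto
  then show ?thesis using A[OF s] B[OF s] s by simp
 next
  case False
  then show ?thesis by (simp add: dps t01(3))
 qed
 have c: "continuous_on {0..T'} (%s. - G s * deriv ps s + H s * ps s)"
  by (intro continuous_intros G H smooth_fun_continuous ps smooth_fun_deriv)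
 have "integral {0..T'} (%s. - G s * deriv ps s + H s * ps s) =
   (\<integral>s. indicator {0..T'} s *R (- G s * deriv ps s + H s * ps s) \<partial>lborel)"
  using set_borel_integral_eq_integral(2)[OF borel_integrable_atLeastAtMost'[OF c]]
  unfolding set_lebesgue_integral_def by simp
 also have "... = (\<integral>s. (\<integral>x. A x s * deriv ps s + B x s * ps s \<partial>lborel) \<partial>lborel)"
  unfolding inner ..
 also have "... = integral\<^sup>L (lborel \<Otimes>\<^sub>M lborel) (%(x, t). A x t * deriv ps t + B x t * ps t)"
  by (rule lborel_pair.integral_snd) (use weak[OF tt] in simp)
 also have "... = 0" using weak[OF tt] by simp
 finally show "integral {0..T'} (%s. - G s * deriv ps s + H s * ps s) = 0" .
qed

section \<open>From weak solutions to trajectories\<close>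

definition sol_state :: "(real => real => real) => (real => real => real) => real => state" where
 "sol_state v u t = (hder 3 (%x. v x t) 0 - hder 3 (%x. v x t) 1, hder 2 (%x. u x t) 0)"

text \<open>The right-hand side of the system in the unknowns v - v_x and u. It uses two derivatives
  of \<open>u\<close> and three of \<open>v\<close>, exactly those that the solution space
  provides.\<close>

definition sol_velocity :: "real => real => (real => real => real) => (real => real => real) => real => state" where
 "sol_velocity a b v u t = (hder 2 (%x. u x t) 1 - hder 2 (%x. u x t) 2,
  hder 3 (%x. v x t) 1 - hder 3 (%x. v x t) 3 - N2 a b (fst (sol_state v u t)))"

lemma is_solution_in_H:
 assumes "is_solution a b V U T v u" "in_H 3 V" "in_H 2 U" "0 <= t" "ereal t < T"
 shows "in_H 3 (%x. v x t)" "in_H 2 (%x. u x t)"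
proof -
 have "in_H 3 (%x. v x t - V x)" "in_H 2 (%x. u x t - U x)"
  using assms unfolding is_solution_def by blast+
 from in_H_add[OF this(1) assms(2)] in_H_add[OF this(2) assms(3)]
 show "in_H 3 (%x. v x t)" "in_H 2 (%x. u x t)" by simp_all
qed

lemma continuous_on_hder:
 assumes inH: "!!t. t : J ==> in_H k (%x. v x t)" and J: "J \<subseteq> A"
  and lim: "!!t. t : J ==> ((%s. H_norm k (%x. v x s - v x t)) ---> 0) (at t within A)" and j: "j <= k"
 shows "continuous_on J (%t. hder k (%x. v x t) j)"
 unfolding continuous_on_def
proof
 fix t assume t: "t : J"
 have "((%s. hder k (%x. v x s) j - hder k (%x. v x t) j) ---> 0) (at t within J)"
 proof (rule Lim_null_comparison)
  show "((%s. H_norm k (%x. v x s - v x t)) ---> 0) (at t within J)"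
   using lim[OF t] J by (rule tendsto_within_subset)
  show "\<forall>\<^sub>F s in at t within J. norm (hder k (%x. v x s) j - hder k (%x. v x t) j) <= H_norm k (%x. v x s - v x t)"
   unfolding eventually_at_filter
  proof (rule always_eventually, intro allI impI)
   fix s assume "s : J"
   then have "hder k (%x. v x s - v x t) j = hder k (%x. v x s) j - hder k (%x. v x t) j"
    "in_H k (%x. v x s - v x t)" using in_H_diff inH t j by blast+
   then show "norm (hder k (%x. v x s) j - hder k (%x. v x t) j) <= H_norm k (%x. v x s - v x t)"
    using norm_hder_le[of k "%x. v x s - v x t" j] j by simp
  qed
 qed
 then show "((%t. hder k (%x. v x t) j) ---> hder k (%x. v x t) j) (at t within J)"
  by (rule LIM_zero_cancel)
qed

text \<open>For \<open>v\<close> in the third and \<open>u\<close> in the second Sobolev space the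
  state lies in the domain of the generator, and continuity in these norms makes the velocity
  continuous. The weak equations then say that it is the time derivative.\<close>

lemma is_solution_imp_traj:
 assumes sol: "is_solution a b V U T v u" and VU: "in_H 3 V" "in_H 2 U"
  and T': "0 < T'" "ereal T' < T"
 shows "traj a b T' (sol_state v u) (sol_velocity a b v u)"
proof -
 define d where "d j t = hder 3 (%x. v x t) j" for j t
 define e where "e j t = hder 2 (%x. u x t) j" for j t
 define A where "A = {s. 0 <= s & ereal s < T}"
 have JA: "{0..T'} \<subseteq> A"
  using T' by (auto simp: A_def) (metis ereal_less_eq(3) le_less_trans)
 have inH: "in_H 3 (%x. v x t)" "in_H 2 (%x. u x t)" if "t : A" for t
  using is_solution_in_H[OF sol VU, of t] that by (auto simp: A_def)
 have lim: "((%s. H_norm 3 (%x. v x s - v x t)) ---> 0) (at t within A)"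
  "((%s. H_norm 2 (%x. u x s - u x t)) ---> 0) (at t within A)" if "t : A" for t
  using sol that unfolding is_solution_def A_def by blast+
 have cd: "continuous_on {0..T'} (d j)" if "j <= 3" for j
  unfolding d_def by (rule continuous_on_hder[OF _ JA]) (use inH lim JA that in auto)
 have ce: "continuous_on {0..T'} (e j)" if "j <= 2" for j
  unfolding e_def by (rule continuous_on_hder[OF _ JA]) (use inH lim JA that in auto)
 have wdd: "wd (d 0 t) (d 1 t)" "wd (d 1 t) (d 2 t)" "wd (d 2 t) (d 3 t)"
  and wde: "wd (e 0 t) (e 1 t)" "wd (e 1 t) (e 2 t)" if "t : {0..T'}" for t
  using wd_hder[OF inH(1)[of t], of 0] wd_hder[OF inH(1)[of t], of 1] wd_hder[OF inH(1)[of t], of 2]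
   wd_hder[OF inH(2)[of t], of 0] wd_hder[OF inH(2)[of t], of 1] that JA
  by (auto simp: d_def e_def numeral_2_eq_2 numeral_3_eq_3)
 have d0: "L2_fun (%x. v x t)" "toL2 (%x. v x t) = d 0 t"
  and e0: "L2_fun (%x. u x t)" "toL2 (%x. u x t) = e 0 t" if "t : {0..T'}" for t
  using inH[of t] that JA by (auto simp: in_H_L2 hder_0 d_def e_def)
 define g where "g t = d 0 t - d 1 t" for t
 have kag: "ka (g t) = d 0 t" if "t : {0..T'}" for t
  unfolding g_def using wd_imp_ka[OF wdd(1)[OF that]] by simp
 have cg: "continuous_on {0..T'} g" unfolding g_def by (intro continuous_intros cd) auto
 define y2 where "y2 t = d 1 t - d 3 t - N2 a b (g t)" for t
 have cy2: "continuous_on {0..T'} y2" unfolding y2_def by (intro continuous_intros cd continuous_on_N2 cg) auto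
 have weak1: "inner (d 0 t) (toL2 ph) = inner (d 0 0) (toL2 ph) - integral {0..t} (%s. - inner (e 1 s) (toL2 ph))"
  if ph: "test_fun ph" and t: "t : {0..T'}" for ph t
 proof (rule time_weak_reduce[OF _ T' _ _ _ _ t])
  note Lph = L2_fun_test[OF ph] L2_fun_test[OF test_fun_deriv[OF ph]]
  show "integrable (lborel \<Otimes>\<^sub>M lborel) (%(x, t). (- v x t * ph x) * deriv ps t + (u x t * deriv ph x) * ps t) &
    integral\<^sup>L (lborel \<Otimes>\<^sub>M lborel) (%(x, t). (- v x t * ph x) * deriv ps t + (u x t * deriv ph x) * ps t) = 0"
   if "time_test_fun T ps" for ps
   using sol ph that unfolding is_solution_def Let_def by blast
  fix s assume s: "s : {0..T'}"
  show "integrable lborel (%x. - v x s * ph x) & (\<integral>x. - v x s * ph x \<partial>lborel) = - inner (d 0 s) (toL2 ph)"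
   using L2_fun_mult_integrable[OF d0(1)[OF s] Lph(1)] inner_toL2[OF d0(1)[OF s] Lph(1)] d0(2)[OF s] by simp
  have "inner (e 0 s) (toL2 (deriv ph)) = - inner (e 1 s) (toL2 ph)"
   using wde(1)[OF s] ph unfolding wd_def by blast
  then show "integrable lborel (%x. u x s * deriv ph x) & (\<integral>x. u x s * deriv ph x \<partial>lborel) = - inner (e 1 s) (toL2 ph)"
   using L2_fun_mult_integrable[OF e0(1)[OF s] Lph(2)] inner_toL2[OF e0(1)[OF s] Lph(2)] e0(2)[OF s] by simp
 qed (intro continuous_intros cd ce, simp)+
 have weak2: "inner (e 0 t) (toL2 ph) = inner (e 0 0) (toL2 ph) - integral {0..t} (%s. - inner (y2 s) (toL2 ph))"
  if ph: "test_fun ph" and t: "t : {0..T'}" for ph t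
 proof (rule time_weak_reduce[OF _ T' _ _ _ _ t])
  have ph3: "(deriv ^^ 3) ph = deriv (deriv (deriv ph))" by (simp add: numeral_3_eq_3)
  have tph: "test_fun (deriv ph)" "test_fun (deriv (deriv ph))" "test_fun (deriv (deriv (deriv ph)))"
   using ph test_fun_deriv by blast+
  note Lph = L2_fun_test[OF ph] L2_fun_test[OF tph(1)] L2_fun_test[OF tph(3)]
  show "integrable (lborel \<Otimes>\<^sub>M lborel) (%(x, t). (- u x t * ph x) * deriv ps t +
     (- pfun a b (v x t) * deriv ph x - v x t * (deriv ^^ 3) ph x) * ps t) &
    integral\<^sup>L (lborel \<Otimes>\<^sub>M lborel) (%(x, t). (- u x t * ph x) * deriv ps t +
     (- pfun a b (v x t) * deriv ph x - v x t * (deriv ^^ 3) ph x) * ps t) = 0"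
   if "time_test_fun T ps" for ps
  proof -
   have eq: "(%(x, t). - u x t * ph x * deriv ps t - pfun a b (v x t) * deriv ph x * ps t - v x t * (deriv ^^ 3) ph x * ps t) =
     (%(x, t). (- u x t * ph x) * deriv ps t + (- pfun a b (v x t) * deriv ph x - v x t * (deriv ^^ 3) ph x) * ps t)"
    by (auto simp: fun_eq_iff algebra_simps)
   show ?thesis using sol ph that unfolding is_solution_def Let_def eq[symmetric] by blast
  qed
  fix s assume s: "s : {0..T'}"
  show "integrable lborel (%x. - u x s * ph x) & (\<integral>x. - u x s * ph x \<partial>lborel) = - inner (e 0 s) (toL2 ph)"
   using L2_fun_mult_integrable[OF e0(1)[OF s] Lph(1)] inner_toL2[OF e0(1)[OF s] Lph(1)] e0(2)[OF s] by simp
  have vk: "toL2 (%x. v x s) = ka (g s)" using d0(2)[OF s] kag[OF s] by simp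
  note p = pfun_toL2[OF d0(1)[OF s] vk, of a b]
  have 1: "inner (pK a b (g s)) (toL2 (deriv ph)) = - inner (- (ka (g s) - g s) + N2 a b (g s)) (toL2 ph)"
   using wd_pK ph unfolding wd_def by blast
  have 2: "inner (d 0 s) (toL2 (deriv (deriv (deriv ph)))) = - inner (d 3 s) (toL2 ph)"
   using wdd[OF s] ph tph unfolding wd_def by simp
  have "integrable lborel (%x. - pfun a b (v x s) * deriv ph x - v x s * (deriv ^^ 3) ph x)"
   unfolding ph3 using L2_fun_mult_integrable[OF p(1) Lph(2)] L2_fun_mult_integrable[OF d0(1)[OF s] Lph(3)]
   by (intro Bochner_Integration.integrable_diff) auto
  moreover have "(\<integral>x. - pfun a b (v x s) * deriv ph x - v x s * (deriv ^^ 3) ph x \<partial>lborel) =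
    - inner (pK a b (g s)) (toL2 (deriv ph)) - inner (d 0 s) (toL2 (deriv (deriv (deriv ph))))"
   unfolding ph3 using L2_fun_mult_integrable[OF p(1) Lph(2)] L2_fun_mult_integrable[OF d0(1)[OF s] Lph(3)]
    inner_toL2[OF p(1) Lph(2)] inner_toL2[OF d0(1)[OF s] Lph(3)] p(2) d0(2)[OF s]
   by (subst Bochner_Integration.integral_diff) auto
  moreover have "ka (g s) - g s = d 1 s" using kag[OF s] by (simp add: g_def)
  ultimately show "integrable lborel (%x. - pfun a b (v x s) * deriv ph x - v x s * (deriv ^^ 3) ph x) &
    (\<integral>x. - pfun a b (v x s) * deriv ph x - v x s * (deriv ^^ 3) ph x \<partial>lborel) = - inner (y2 s) (toL2 ph)"
   unfolding 1 2 by (simp add: y2_def inner_simps)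
 qed (auto intro!: continuous_intros ce cy2)
 have vec: "f t = f 0 + integral {0..t} h"
  if h: "continuous_on {0..T'} h" and t: "t : {0..T'}"
   and weak: "!!ph. test_fun ph ==> inner (f t) (toL2 ph) = inner (f 0) (toL2 ph) + integral {0..t} (%s. inner (h s) (toL2 ph))"
  for f h :: "real => l2" and t
 proof -
  have "h integrable_on {0..t}"
   using t by (intro integrable_continuous_interval continuous_on_subset[OF h]) auto
  from integral_linear[OF this bounded_linear_inner_left]
  have "integral {0..t} (%s. inner (h s) p) = inner (integral {0..t} h) p" for p by (simp add: o_def)
  then have "f t - f 0 - integral {0..t} h = 0"
   by (intro test_fun_orthogonal_eq_0) (simp add: inner_diff_left weak)
  then show ?thesis by (simp add: algebra_simps)
 qed
 have w1: "g t = g 0 + integral {0..t} (%s. e 1 s - e 2 s)" if t: "t : {0..T'}" for t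
 proof (rule vec[OF _ t])
  show "continuous_on {0..T'} (%s. e 1 s - e 2 s)" by (intro continuous_intros ce) auto
  fix ph assume ph: "test_fun ph"
  \<comment> \<open>Testing the equation for \<open>v\<close> with \<open>ph + ph'\<close> amounts
    to testing the one for g = v - v_x with \<open>ph\<close>.\<close>
  have phph: "test_fun (%x. ph x + deriv ph x)" by (intro test_fun_add ph test_fun_deriv)
  have tL: "toL2 (%x. ph x + deriv ph x) = toL2 ph + toL2 (deriv ph)"
   by (intro toL2_add L2_fun_test ph test_fun_deriv)
  have gs: "inner (g s) (toL2 ph) = inner (d 0 s) (toL2 (%x. ph x + deriv ph x))" if "s : {0..T'}" for s
   using wdd(1)[OF that] ph unfolding tL wd_def g_def by (simp add: inner_simps)
  have es: "inner (e 1 s) (toL2 (%x. ph x + deriv ph x)) = inner (e 1 s - e 2 s) (toL2 ph)" if "s : {0..T'}" for s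
   using wde(2)[OF that] ph unfolding tL wd_def by (simp add: inner_simps)
  have "integral {0..t} (%s. - inner (e 1 s) (toL2 (%x. ph x + deriv ph x))) =
    - integral {0..t} (%s. inner (e 1 s - e 2 s) (toL2 ph))"
   unfolding Henstock_Kurzweil_Integration.integral_neg
   using t by (intro arg_cong[where f = uminus] integral_cong es) auto
  then show "inner (g t) (toL2 ph) = inner (g 0) (toL2 ph) + integral {0..t} (%s. inner (e 1 s - e 2 s) (toL2 ph))"
   using weak1[OF phph t] gs[OF t] gs[of 0] t by simp
 qed
 have w2: "e 0 t = e 0 0 + integral {0..t} y2" if t: "t : {0..T'}" for t
  by (rule vec[OF cy2 t]) (use weak2[OF _ t] in simp)
 have st: "sol_state v u = (%t. (g t, e 0 t))"
  by (simp add: sol_state_def[abs_def] g_def d_def e_def)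
 have ve: "sol_velocity a b v u = (%t. (e 1 t - e 2 t, y2 t))"
  by (simp add: sol_velocity_def[abs_def] st y2_def d_def e_def)
 show ?thesis
  unfolding traj_def st ve
 proof (intro conjI ballI)
  show "continuous_on {0..T'} (%t. (g t, e 0 t))" by (intro continuous_intros cg ce) simp
  have c1: "continuous_on {0..T'} (%t. e 1 t - e 2 t)" by (intro continuous_intros ce) auto
  show "continuous_on {0..T'} (%t. (e 1 t - e 2 t, y2 t))" by (intro continuous_on_Pair c1 cy2)
  fix t assume t: "t : {0..T'}"
  have "integral {0..t} (%t. (e 1 t - e 2 t, y2 t)) = (integral {0..t} (%t. e 1 t - e 2 t), integral {0..t} y2)"
   using t by (intro integral_Pair continuous_on_subset[OF c1] continuous_on_subset[OF cy2]) auto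
  then show "(g t, e 0 t) = (g 0, e 0 0) + integral {0..t} (%t. (e 1 t - e 2 t, y2 t))"
   using w1[OF t] w2[OF t] by (metis add_Pair)
  have "(e 1 t - e 2 t, y2 t) - Nl a b (g t, e 0 t) = (e 1 t - e 2 t, (d 1 t - d 2 t) + (d 2 t - d 3 t))"
   by (simp add: Nl_def y2_def)
  then show "genA (g t, e 0 t) ((e 1 t - e 2 t, y2 t) - Nl a b (g t, e 0 t))"
   unfolding genA_def using wd_diff[OF wdd(1)[OF t] wdd(2)[OF t]] wd_diff[OF wdd(2)[OF t] wdd(3)[OF t]] wde[OF t]
   by (metis fst_conv snd_conv g_def)
 qed
qed

section \<open>From trajectories back to weak solutions that extend given functions\<close>

lemma integral_time_test_zero:
 fixes G H :: "real => real"
 assumes ps: "smooth_fun ps" "0 < t0" "!!t. t \<notin> {t0..t1} ==> ps t = 0"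
  and G: "!!T t. t : {0..T} ==> (G has_real_derivative - H t) (at t within {0..T})"
  and H: "continuous_on {0..} H"
 shows "(\<integral>t. indicator {0..t1 + 1} t *R (- G t * deriv ps t + H t * ps t) \<partial>lborel) = 0"
proof (cases "0 <= t1 + 1")
 case True
 \<comment> \<open>One unit beyond the support, so that the boundary term at the right end
   vanishes.\<close>
 let ?T = "t1 + 1"
 have "((%t. - G t * deriv ps t + H t * ps t) has_integral - G ?T * ps ?T - (- G 0 * ps 0)) {0..?T}"
 proof (rule fundamental_theorem_of_calculus[OF True])
  fix t assume t: "t : {0..?T}"
  have "((%t. - G t) has_real_derivative - (- H t)) (at t within {0..?T})" by (intro DERIV_minus G t)
  moreover have "(ps has_real_derivative deriv ps t) (at t within {0..?T})"
   using smooth_fun_DERIV[OF ps(1)] by (rule has_field_derivative_at_within)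
  ultimately have "((%t. - G t * ps t) has_real_derivative - (- H t) * ps t + deriv ps t * - G t) (at t within {0..?T})"
   by (rule DERIV_mult)
  then show "((%t. - G t * ps t) has_vector_derivative - G t * deriv ps t + H t * ps t) (at t within {0..?T})"
   by (simp add: has_real_derivative_iff_has_vector_derivative algebra_simps)
 qed
 moreover have "ps ?T = 0" "ps 0 = 0" using ps(2,3) by auto
 ultimately have "integral {0..?T} (%t. - G t * deriv ps t + H t * ps t) = 0" by (simp add: integral_unique)
 moreover have "continuous_on {0..?T} (%t. - G t * deriv ps t + H t * ps t)"
 proof (intro continuous_intros)
  show "continuous_on {0..?T} G" by (rule DERIV_continuous_on) (rule G)
  show "continuous_on {0..?T} H" by (rule continuous_on_subset[OF H]) auto
 qed (intro smooth_fun_continuous ps smooth_fun_deriv)+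
 ultimately show ?thesis
  using set_borel_integral_eq_integral(2)[OF borel_integrable_atLeastAtMost']
  unfolding set_lebesgue_integral_def by metis
next
 case False
 then have "(indicator {0..t1 + 1} t :: real) = 0" for t by auto
 then show ?thesis by simp
qed

text \<open>On each time slice the glued integrand differs from the continuous one
  \<open>Ac\<close>, \<open>Bc\<close> by a null set only, so by Fubini just joint measurability is
  at stake. It cannot be seen slice by slice and is taken from the integrability contained in the
  weak formulation on \<open>[0, T0)\<close>.\<close>

lemma weak_glue:
 fixes A B Ac Bc :: "real => real => real"
 assumes T0: "0 < T0"
  and weak: "!!ps. time_test_fun T0 ps ==>
   integrable (lborel \<Otimes>\<^sub>M lborel) (%(x, t). A x t * deriv ps t + B x t * ps t) &
   integral\<^sup>L (lborel \<Otimes>\<^sub>M lborel) (%(x, t). A x t * deriv ps t + B x t * ps t) = 0"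
  and A': "!!x t. A' x t = (if 0 <= t & ereal t < T0 then A x t else Ac x t)"
  and B': "!!x t. B' x t = (if 0 <= t & ereal t < T0 then B x t else Bc x t)"
  and cA: "continuous_on UNIV (%p. Ac (fst p) (snd p))" and cB: "continuous_on UNIV (%p. Bc (fst p) (snd p))"
  and sA: "!!x t. R < \<bar>x\<bar> ==> Ac x t = 0" and sB: "!!x t. R < \<bar>x\<bar> ==> Bc x t = 0"
  and ae: "!!t. 0 <= t ==> ereal t < T0 ==> AE x in lborel. A x t = Ac x t & B x t = Bc x t"
  and iA: "!!t. 0 <= t ==> (\<integral>x. Ac x t \<partial>lborel) = - G t"
  and iB: "!!t. 0 <= t ==> (\<integral>x. Bc x t \<partial>lborel) = H t"
  and G: "!!T t. t : {0..T} ==> (G has_real_derivative - H t) (at t within {0..T})"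
  and H: "continuous_on {0..} H"
  and ps: "time_test_fun \<infinity> ps"
 shows "integrable (lborel \<Otimes>\<^sub>M lborel) (%(x, t). A' x t * deriv ps t + B' x t * ps t) &
   integral\<^sup>L (lborel \<Otimes>\<^sub>M lborel) (%(x, t). A' x t * deriv ps t + B' x t * ps t) = 0"
proof -
 obtain t0 t1 where sm: "smooth_fun ps" and t01: "0 < t0" "!!t. t \<notin> {t0..t1} ==> ps t = 0"
  using ps by (auto simp: time_test_fun_def)
 have dps: "deriv ps s = 0" if "s \<notin> {t0..t1}" for s
  by (rule deriv_eq_0_open[of "- {t0..t1}"]) (use t01(2) that in auto)
 define F where "F th = (%(x, t). A x t * deriv th t + B x t * th t)" for th :: "real => real"
 define F' where "F' = (%(x, t). A' x t * deriv ps t + B' x t * ps t)"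
 define Fc where "Fc = (%(x, t). Ac x t * deriv ps t + Bc x t * ps t)"
 have cFc: "continuous_on UNIV Fc"
  unfolding Fc_def split_beta
  by (intro continuous_intros cA cB continuous_on_compose2[OF smooth_fun_continuous[OF sm, of UNIV]]
    continuous_on_compose2[OF smooth_fun_continuous[OF smooth_fun_deriv[OF sm], of UNIV]]) auto
 have "integrable lborel (%p. indicator ({-R..R} \<times> {t0..t1}) p *R Fc p)"
  by (intro borel_integrable_compact compact_Times compact_Icc continuous_on_subset[OF cFc]) auto
 also have "(%p. indicator ({-R..R} \<times> {t0..t1}) p *R Fc p) = Fc"
 proof
  fix p :: "real \<times> real"
  show "indicator ({-R..R} \<times> {t0..t1}) p *R Fc p = Fc p"
  proof (cases "snd p : {t0..t1} & \<bar>fst p\<bar> <= R")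
   case True
   then show ?thesis by (cases p) (auto simp: indicator_def)
  next
   case False
   then have "Fc p = 0"
    using dps[of "snd p"] t01(2)[of "snd p"] sA[of "fst p" "snd p"] sB[of "fst p" "snd p"]
    by (cases p) (auto simp: Fc_def)
   then show ?thesis by simp
  qed
 qed
 finally have intFc: "integrable (lborel \<Otimes>\<^sub>M lborel) Fc" unfolding lborel_prod .
 have Fc0: "integral\<^sup>L (lborel \<Otimes>\<^sub>M lborel) Fc = 0"
 proof -
  have intA: "integrable lborel (%x. Ac x t)" "integrable lborel (%x. Bc x t)" for t
  proof -
   have c: "continuous_on UNIV (%x::real. (x, t))" by (intro continuous_intros)
   show "integrable lborel (%x. Ac x t)"
    using continuous_on_compose2[OF cA c] by (intro continuous_compact_support_integrable[of _ R] sA) auto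
   show "integrable lborel (%x. Bc x t)"
    using continuous_on_compose2[OF cB c] by (intro continuous_compact_support_integrable[of _ R] sB) auto
  qed
  have "(\<integral>x. Ac x t * deriv ps t + Bc x t * ps t \<partial>lborel) =
    indicator {0..t1 + 1} t *R (- G t * deriv ps t + H t * ps t)" for t
  proof (cases "t : {t0..t1}")
   case True
   then have t: "0 <= t" "t <= t1 + 1" using t01(1) by auto
   then show ?thesis
    using intA[of t] iA[of t] iB[of t] by (subst Bochner_Integration.integral_add) auto
  next
   case False
   then show ?thesis by (simp add: dps t01(2))
  qed
  then have "(\<integral>t. (\<integral>x. Ac x t * deriv ps t + Bc x t * ps t \<partial>lborel) \<partial>lborel) = 0"
   using integral_time_test_zero[OF sm t01 G H] by simp
  moreover have "(\<integral>t. (\<integral>x. Ac x t * deriv ps t + Bc x t * ps t \<partial>lborel) \<partial>lborel) = integral\<^sup>L (lborel \<Otimes>\<^sub>M lborel) Fc"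
   unfolding Fc_def by (rule lborel_pair.integral_snd) (use intFc in \<open>simp add: Fc_def\<close>)
  ultimately show ?thesis by simp
 qed
 have meas: "F' : borel_measurable (lborel \<Otimes>\<^sub>M lborel)"
 proof (cases "ereal t1 < T0")
  case True
  have "time_test_fun T0 ps" unfolding time_test_fun_def using sm t01 True by blast
  then have "F ps : borel_measurable (lborel \<Otimes>\<^sub>M lborel)" using weak unfolding F_def by blast
  moreover have "F ps = F'"
  proof
   fix p :: "real \<times> real"
   obtain x t where p: "p = (x, t)" by (cases p)
   show "F ps p = F' p"
   proof (cases "t : {t0..t1}")
    case in': True
    then have "0 <= t" "ereal t < T0" using t01(1) True by (auto intro: le_less_trans[of "ereal t" "ereal t1"])
    then show ?thesis by (simp add: p F_def F'_def A' B')
   next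
    case False
    then show ?thesis by (simp add: p F_def F'_def dps t01(2))
   qed
  qed
  ultimately show ?thesis by simp
 next
  case False
  then obtain ta where ta: "T0 = ereal ta" using T0 by (cases T0) auto
  \<comment> \<open>Smooth cut-offs in time that vanish from \<open>ta - 1 / (n + 1)\<close> on and
    equal 1 before \<open>ta - 2 / (n + 1)\<close>. The products with \<open>ps\<close> are
    admissible on \<open>[0, T0)\<close> and eventually agree with \<open>ps\<close> near each
    earlier time, so the glued integrand is a pointwise limit of measurable ones.\<close>
  define c where "c n t = step (real (Suc n) * (ta - t) - 1)" for n :: nat and t
  have smc: "smooth_fun (c n)" for n
  proof -
   have "smooth_fun (%t. step (- real (Suc n) * t + (real (Suc n) * ta - 1)))"
    by (rule smooth_fun_affine[OF smooth_fun_step])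
   moreover have "(%t. step (- real (Suc n) * t + (real (Suc n) * ta - 1))) = c n"
    by (auto simp: c_def fun_eq_iff algebra_simps)
   ultimately show ?thesis by simp
  qed
  define psn where "psn n t = ps t * c n t" for n t
  have ttn: "time_test_fun T0 (psn n)" for n
  proof -
   have "smooth_fun (psn n)" unfolding psn_def by (intro smooth_fun_mult sm smc)
   moreover have "ereal (ta - 1 / real (Suc n)) < T0" by (simp add: ta)
   moreover have "psn n t = 0" if t: "t \<notin> {t0..ta - 1 / real (Suc n)}" for t
   proof (cases "t < t0")
    case True
    then show ?thesis using t01(2)[of t] by (simp add: psn_def)
   next
    case False
    then have "ta - t < 1 / real (Suc n)" using t by auto
    then have "real (Suc n) * (ta - t) - 1 <= 0" by (simp add: field_simps del: of_nat_Suc)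
    then have "c n t = 0" unfolding c_def by (rule step_le_0)
    then show ?thesis by (simp add: psn_def)
   qed
   ultimately show ?thesis unfolding time_test_fun_def using t01(1) by blast
  qed
  have mn: "F (psn n) : borel_measurable (lborel \<Otimes>\<^sub>M lborel)" for n
   using weak[OF ttn[of n]] unfolding F_def by blast
  have lim: "(%n. F (psn n) p) >>> F' p" if "snd p < ta" for p
  proof -
   obtain x t where p: "p = (x, t)" by (cases p)
   obtain N :: nat where N: "2 / (ta - t) < real N" using reals_Archimedean2 by blast
   have "F (psn n) p = F' p" if n: "n >= N" for n
   proof -
    have "2 / (ta - t) < real (Suc n)" using N n by linarith
    then have tn: "2 < real (Suc n) * (ta - t)" using \<open>snd p < ta\<close> p by (simp add: divide_less_eq del: of_nat_Suc)
    define U where "U = {s. 2 < real (Suc n) * (ta - s)}"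
    have U: "open U" unfolding U_def by (intro open_Collect_less continuous_intros)
    have eq: "psn n s = ps s" if "s : U" for s
     using that by (simp add: psn_def c_def step_ge_1 U_def del: of_nat_Suc)
    have "(psn n has_real_derivative deriv ps t) (at t)"
     using has_field_derivative_transform_within_open[OF smooth_fun_DERIV[OF sm] U, of t "psn n"] tn eq
     by (simp add: U_def del: of_nat_Suc)
    then have "deriv (psn n) t = deriv ps t" by (rule DERIV_imp_deriv)
    moreover have "psn n t = ps t" using eq[of t] tn by (simp add: U_def)
    moreover have "A' x t * deriv ps t + B' x t * ps t = A x t * deriv ps t + B x t * ps t"
     using \<open>snd p < ta\<close> p dps[of t] t01 by (cases "0 <= t") (auto simp: A' B' ta)
    ultimately show ?thesis by (simp add: p F_def F'_def)
   qed
   then show ?thesis by (intro tendsto_eventually) (auto simp: eventually_sequentially)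
  qed
  have "F' = (%p. if snd p < ta then lim (%n. F (psn n) p) else Fc p)"
  proof
   fix p :: "real \<times> real"
   show "F' p = (if snd p < ta then lim (%n. F (psn n) p) else Fc p)"
    using limI[OF lim, of p] by (cases p) (auto simp: F'_def Fc_def A' B' ta)
  qed
  moreover have "(%p. if snd p < ta then lim (%n. F (psn n) p) else Fc p) : borel_measurable (lborel \<Otimes>\<^sub>M lborel)"
   using mn intFc by measurable
  ultimately show ?thesis by simp
 qed
 have "AE p in lborel \<Otimes>\<^sub>M lborel. F' p = Fc p"
 proof -
  have [measurable]: "F' : borel_measurable (lborel \<Otimes>\<^sub>M lborel)" "Fc : borel_measurable (lborel \<Otimes>\<^sub>M lborel)"
   using meas intFc by auto
  have set: "{p : space (lborel \<Otimes>\<^sub>M lborel). F' (fst p, snd p) = Fc (fst p, snd p)} : sets (lborel \<Otimes>\<^sub>M lborel)"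
   by measurable
  have "AE t in lborel. AE x in lborel. F' (x, t) = Fc (x, t)"
  proof (rule AE_I2)
   fix t :: real
   show "AE x in lborel. F' (x, t) = Fc (x, t)"
   proof (cases "0 <= t & ereal t < T0")
    case True
    then have "AE x in lborel. A x t = Ac x t & B x t = Bc x t" using ae by blast
    then show ?thesis by eventually_elim (use True in \<open>simp add: F'_def Fc_def A' B'\<close>)
   next
    case False
    then have "A' x t = Ac x t" "B' x t = Bc x t" for x by (auto simp: A' B')
    then show ?thesis by (simp add: F'_def Fc_def)
   qed
  qed
  then have "AE x in lborel. AE t in lborel. F' (x, t) = Fc (x, t)"
   using lborel_pair.AE_commute[OF set] by simp
  then show ?thesis
   using lborel_pair.AE_pair_iff[OF set] by simp
 qed
 then have "integrable (lborel \<Otimes>\<^sub>M lborel) F' = integrable (lborel \<Otimes>\<^sub>M lborel) Fc"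
  "integral\<^sup>L (lborel \<Otimes>\<^sub>M lborel) F' = integral\<^sup>L (lborel \<Otimes>\<^sub>M lborel) Fc"
  using integrable_cong_AE[OF meas borel_measurable_integrable[OF intFc]]
   integral_cong_AE[OF meas borel_measurable_integrable[OF intFc]] by auto
 then show ?thesis using intFc Fc0 by (simp add: F'_def)
qed

lemma Kp_continuous_joint:
 assumes h: "continuous_on UNIV (h :: real => l2)"
 shows "continuous_on UNIV (%p. Kp (h (snd p)) (fst p))"
 unfolding continuous_on_def
proof
 fix p :: "real \<times> real"
 obtain x t where p: "p = (x, t)" by (cases p)
 have "((%q. Kp (h (snd q) - h t) (fst q)) ---> 0) (at p)"
 proof (rule Lim_null_comparison)
  show "\<forall>\<^sub>F q in at p. norm (Kp (h (snd q) - h t) (fst q)) <= norm (h (snd q) - h t)"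
   by (rule always_eventually) (simp add: abs_Kp_le)
  have "continuous_on UNIV (%q::real\<times>real. norm (h (snd q) - h t))"
   by (intro continuous_intros continuous_on_compose2[OF h]) auto
  then have "((%q::real\<times>real. norm (h (snd q) - h t)) ---> norm (h (snd p) - h t)) (at p)"
   unfolding continuous_on_def by blast
  then show "((%q. norm (h (snd q) - h t)) ---> 0) (at p)" by (simp add: p)
 qed
 moreover have "((%q. Kp (h t) (fst q)) ---> Kp (h t) (fst p)) (at p)"
 proof -
  have "continuous_on UNIV (%q::real\<times>real. Kp (h t) (fst q))"
   by (rule continuous_on_compose2[OF Kp_continuous]) (auto intro: continuous_intros)
  then show ?thesis unfolding continuous_on_def by blast
 qed
 ultimately have "((%q. Kp (h (snd q) - h t) (fst q) + Kp (h t) (fst q)) ---> 0 + Kp (h t) (fst p)) (at p)"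
  by (rule tendsto_add)
 then show "((%p. Kp (h (snd p)) (fst p)) ---> Kp (h (snd p)) (fst p)) (at p within UNIV)"
  by (simp add: Kp_diff p)
qed

text \<open>The old functions have to be continued literally, not up to null sets: they are kept on
  \<open>[0, T0)\<close> and followed by continuous representatives of the trajectory.\<close>

lemma traj_imp_is_solution:
 assumes sol: "is_solution a b V U T0 v u" and VU: "in_H 3 V" "in_H 2 U" and T0: "0 < T0"
  and tr: "!!T. 0 <= T ==> traj a b T w y"
  and agree: "!!t. 0 <= t ==> ereal t < T0 ==> w t = sol_state v u t"
 obtains v' u' where "is_solution a b V U \<infinity> v' u'"
  "!!x t. 0 <= t ==> ereal t < T0 ==> v' x t = v x t & u' x t = u x t"
  "!!t. 0 <= t ==> sol_state v' u' t = w t"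
proof -
 define g where "g t = fst (w t)" for t
 define q where "q t = snd (w t)" for t
 define y1 where "y1 t = fst (y t)" for t
 define y2 where "y2 t = snd (y t)" for t
 define s where "s t = y2 t + N2 a b (g t)" for t
 have contI: "continuous_on {0..} f" if "!!T. 0 <= T ==> continuous_on {0..T} f" for f :: "real => state"
  unfolding continuous_on_def
 proof
  fix t :: real assume t: "t : {0..}"
  have "continuous_on {0..t+1} f" by (rule that) (use t in simp)
  then have "(f ---> f t) (at t within {0..t+1})" using t by (simp add: continuous_on_def)
  moreover have "at t within {0..t+1} = at t within {0..}"
   by (rule at_within_nhd[of _ "{..<t+1}"]) auto
  ultimately show "(f ---> f t) (at t within {0..})" by simp
 qed
 have cw: "continuous_on {0..} w" and cy: "continuous_on {0..} y"
  by (rule contI, use tr in \<open>simp add: traj_def\<close>)+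
 have cg: "continuous_on {0..} g" and cq: "continuous_on {0..} q" and cy1: "continuous_on {0..} y1"
  and cy2: "continuous_on {0..} y2"
  unfolding g_def q_def y1_def y2_def by (intro continuous_intros cw cy)+
 have cs: "continuous_on {0..} s" unfolding s_def by (intro continuous_intros cy2 continuous_on_N2 cg)
 have wdq: "wd (q t) (ka (y1 t))" and wdg: "wd (g t) (ka' (s t))" if "0 <= t" for t
  using traj_components(1,2)[OF tr[OF that], of t] that by (auto simp: q_def g_def y1_def y2_def s_def)
 have dw: "(w has_vector_derivative y t) (at t within {0..T})" if "t : {0..T}" for t T
  using traj_deriv[OF tr that] that by simp
 have dg: "(g has_vector_derivative y1 t) (at t within {0..T})" and dq: "(q has_vector_derivative y2 t) (at t within {0..T})"
  if "t : {0..T}" for t T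
  unfolding g_def q_def y1_def y2_def
  by (rule bounded_linear.has_vector_derivative[OF bounded_linear_fst dw[OF that]]
    bounded_linear.has_vector_derivative[OF bounded_linear_snd dw[OF that]])+
 \<comment> \<open>Freezing the data at negative times gives representatives that are continuous on
   the whole plane. The datum of \<open>u\<close> is u - u_x, with u_x =
   \<open>ka (y1 t)\<close>.\<close>
 define hv where "hv t = g (max 0 t)" for t
 define hu where "hu t = q (max 0 t) - ka (y1 (max 0 t))" for t
 have cm: "continuous_on UNIV (%t. f (max 0 t))" if "continuous_on {0..} f" for f :: "real => l2"
  by (rule continuous_on_compose2[OF that]) (auto intro!: continuous_intros)
 have chv: "continuous_on UNIV hv" unfolding hv_def by (rule cm[OF cg])
 have chu: "continuous_on UNIV hu"
  unfolding hu_def by (intro continuous_intros cm cq continuous_on_ka cy1)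
 define v' where "v' x t = (if 0 <= t & ereal t < T0 then v x t else Kp (hv t) x)" for x t
 define u' where "u' x t = (if 0 <= t & ereal t < T0 then u x t else Kp (hu t) x)" for x t
 have kahv: "ka (hv t) = ka (g t)" and kahu: "ka (hu t) = q t" if "0 <= t" for t
  using wd_imp_ka[OF wdq[OF that]] that by (auto simp: hv_def hu_def max_def)
 have inH: "in_H 3 (%x. v x t)" "in_H 2 (%x. u x t)" if "0 <= t" "ereal t < T0" for t
  by (rule is_solution_in_H[OF sol VU that])+
 have vt: "L2_fun (%x. v x t)" "toL2 (%x. v x t) = ka (g t)"
  and ut: "L2_fun (%x. u x t)" "toL2 (%x. u x t) = q t" if t: "0 <= t" "ereal t < T0" for t
 proof -
  show "L2_fun (%x. v x t)" "L2_fun (%x. u x t)" using inH[OF t] in_H_L2 by blast+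
  have gt: "g t = hder 3 (%x. v x t) 0 - hder 3 (%x. v x t) 1" and qt: "q t = hder 2 (%x. u x t) 0"
   using agree[OF t] by (simp_all add: g_def q_def sol_state_def)
  have "wd (hder 3 (%x. v x t) 0) (hder 3 (%x. v x t) 1)" using wd_hder[OF inH(1)[OF t], of 0] by simp
  from wd_imp_ka[OF this] show "toL2 (%x. v x t) = ka (g t)" unfolding gt using hder_0[OF inH(1)[OF t]] by simp
  show "toL2 (%x. u x t) = q t" unfolding qt using hder_0[OF inH(2)[OF t]] by simp
 qed
 have v': "L2_fun (%x. v' x t)" "toL2 (%x. v' x t) = ka (g t)"
  and u': "L2_fun (%x. u' x t)" "toL2 (%x. u' x t) = q t" if "0 <= t" for t
  using vt[of t] ut[of t] kahv[OF that] kahu[OF that] that by (cases "ereal t < T0"; simp add: v'_def u'_def ka_def)+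
 \<comment> \<open>The derivatives of \<open>v\<close> follow from v_x = v - g by repeatedly
   differentiating, with g_x = \<open>ka' (s t)\<close> and g_xx =
   \<open>s t - ka' (s t)\<close>.\<close>
 define D where "D j t = (if j = 0 then ka (g t) else if j = 1 then ka (g t) - g t
  else if j = 2 then ka (g t) - g t - ka' (s t) else ka (g t) - g t - ka' (s t) - (s t - ka' (s t)))" for j :: nat and t
 define E where "E j t = (if j = 0 then q t else if j = 1 then ka (y1 t) else ka (y1 t) - y1 t)" for j :: nat and t
 have wdD: "wd (D j t) (D (Suc j) t)" if "j < 3" "0 <= t" for j t
 proof -
  have "j = 0 | j = 1 | j = 2" using that by auto
  then show ?thesis
   using wd_ka[of "g t"] wd_diff[OF wd_ka[of "g t"] wdg[OF that(2)]]
    wd_diff[OF wd_diff[OF wd_ka[of "g t"] wdg[OF that(2)]] wd_ka'[of "s t"]]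
   by (auto simp: D_def)
 qed
 have wdE: "wd (E j t) (E (Suc j) t)" if "j < 2" "0 <= t" for j t
 proof -
  have "j = 0 | j = 1" using that by auto
  then show ?thesis using wdq[OF that(2)] wd_ka[of "y1 t"] by (auto simp: E_def)
 qed
 have Hv: "in_H 3 (%x. v' x t)" "j <= 3 ==> hder 3 (%x. v' x t) j = D j t"
  and Hu: "in_H 2 (%x. u' x t)" "j <= 2 ==> hder 2 (%x. u' x t) j = E j t" if t: "0 <= t" for t j
  using in_H_if_wd[OF v'(1)[OF t], of "%j. D j t" 3] in_H_if_wd[OF u'(1)[OF t], of "%j. E j t" 2]
   v'(2)[OF t] u'(2)[OF t] wdD[OF _ t] wdE[OF _ t] by (auto simp: D_def E_def)
 have cD: "continuous_on {0..} (D j)" and cE: "continuous_on {0..} (E j)" for j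
 proof -
  have "continuous_on {0..} (%t. ka (g t))" "continuous_on {0..} (%t. ka' (s t))" "continuous_on {0..} (%t. ka (y1 t))"
   by (intro continuous_on_ka continuous_on_ka' cg cs cy1)+
  then show "continuous_on {0..} (D j)" "continuous_on {0..} (E j)"
   unfolding D_def[abs_def] E_def[abs_def] using cg cs cq cy1
   by (cases "j = 0"; cases "j = 1"; cases "j = 2"; simp add: continuous_on_diff)+
 qed
 have Hlim: "((%r. H_norm k (%x. f x r - f x t)) ---> 0) (at t within {0..})"
  if t: "0 <= t" and f: "!!t. 0 <= t ==> in_H k (%x. f x t)" "!!t j. 0 <= t ==> j <= k ==> hder k (%x. f x t) j = C j t"
   and C: "!!j. continuous_on {0..} (C j)" for f :: "real => real => real" and C t k
 proof -
  have lim: "(C j ---> C j t) (at t within {0..})" for j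
   using C[of j] t unfolding continuous_on_def by simp
  have "((%r. sqrt (\<Sum>j\<le>k. (norm (C j r - C j t))^2)) ---> sqrt (\<Sum>j\<le>k. (norm (C j t - C j t))^2)) (at t within {0..})"
   by (intro tendsto_intros lim)
  moreover have "\<forall>\<^sub>F r in at t within {0..}. sqrt (\<Sum>j\<le>k. (norm (C j r - C j t))^2) = H_norm k (%x. f x r - f x t)"
   unfolding eventually_at_filter
  proof (rule always_eventually, intro allI impI)
   fix r :: real assume "r : {0..}"
   then have r: "0 <= r" by simp
   show "sqrt (\<Sum>j\<le>k. (norm (C j r - C j t))^2) = H_norm k (%x. f x r - f x t)"
    unfolding H_norm_hder[OF in_H_diff(1)[OF f(1)[OF r] f(1)[OF t]]]
    by (intro arg_cong[where f = sqrt] sum.cong)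
     (auto simp: in_H_diff(2)[OF f(1)[OF r] f(1)[OF t]] f(2)[OF r] f(2)[OF t])
  qed
  ultimately have "((%r. H_norm k (%x. f x r - f x t)) ---> sqrt (\<Sum>j\<le>k. (norm (C j t - C j t))^2)) (at t within {0..})"
   by (rule Lim_transform_eventually)
  then show ?thesis by simp
 qed
 have ic: "(\<integral>x. Kp h x * ph x \<partial>lborel) = inner (ka h) (toL2 ph)" if "L2_fun ph" for h ph
  using that by (simp add: ka_def inner_toL2)
 have aev: "AE x in lborel. v x t = Kp (hv t) x" and aeu: "AE x in lborel. u x t = Kp (hu t) x"
  if t: "0 <= t" "ereal t < T0" for t
  using vt[OF t] ut[OF t] kahv[OF t(1)] kahu[OF t(1)] by (auto simp: ka_def simp flip: toL2_eq_iff)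
 have weak: "integrable (lborel \<Otimes>\<^sub>M lborel) f1 & integral\<^sup>L (lborel \<Otimes>\<^sub>M lborel) f1 = 0 &
   integrable (lborel \<Otimes>\<^sub>M lborel) f2 & integral\<^sup>L (lborel \<Otimes>\<^sub>M lborel) f2 = 0"
  if ph: "test_fun ph" and ps: "time_test_fun \<infinity> ps"
   and f1: "f1 = (%(x, t). - v' x t * ph x * deriv ps t + u' x t * deriv ph x * ps t)"
   and f2: "f2 = (%(x, t). - u' x t * ph x * deriv ps t - pfun a b (v' x t) * deriv ph x * ps t
        - v' x t * (deriv ^^ 3) ph x * ps t)" for ph ps f1 f2
 proof -
  have ph3: "(deriv ^^ 3) ph = deriv (deriv (deriv ph))" by (simp add: numeral_3_eq_3)
  have tph: "test_fun (deriv ph)" "test_fun (deriv (deriv ph))" "test_fun (deriv (deriv (deriv ph)))"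
   using ph test_fun_deriv by blast+
  note Lph = L2_fun_test[OF ph] L2_fun_test[OF tph(1)] L2_fun_test[OF tph(3)]
  obtain R where R: "!!x. R < \<bar>x\<bar> ==> ph x = 0" using ph by (auto simp: test_fun_def)
  have R1: "deriv ph x = 0" if "R < \<bar>x\<bar>" for x by (rule deriv_eq_0_outside[OF R that])
  have R2: "deriv (deriv ph) x = 0" if "R < \<bar>x\<bar>" for x by (rule deriv_eq_0_outside[OF R1 that])
  have R3: "deriv (deriv (deriv ph)) x = 0" if "R < \<bar>x\<bar>" for x by (rule deriv_eq_0_outside[OF R2 that])
  have cph: "continuous_on UNIV (%p::real\<times>real. th (fst p))" if "test_fun th" for th
   by (rule continuous_on_compose2[OF smooth_fun_continuous[OF test_fun_smooth[OF that], of UNIV]])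
    (auto intro: continuous_intros)
  note cK = Kp_continuous_joint[OF chv] Kp_continuous_joint[OF chu]
  have eq1: "f1 = (%(x, t). (- v' x t * ph x) * deriv ps t + (u' x t * deriv ph x) * ps t)"
   unfolding f1 ..
  have eq2: "(%(x, t). - u x t * ph x * deriv ps t - pfun a b (v x t) * deriv ph x * ps t - v x t * (deriv ^^ 3) ph x * ps t) =
    (%(x, t). (- u x t * ph x) * deriv ps t + (- pfun a b (v x t) * deriv ph x - v x t * (deriv ^^ 3) ph x) * ps t)"
   for u v :: "real => real => real" and ps
   by (auto simp: fun_eq_iff algebra_simps)
  have 1: "integrable (lborel \<Otimes>\<^sub>M lborel) f1 & integral\<^sup>L (lborel \<Otimes>\<^sub>M lborel) f1 = 0"
   unfolding eq1
  proof (rule weak_glue[OF T0, where A = "%x t. - v x t * ph x" and B = "%x t. u x t * deriv ph x"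
     and Ac = "%x t. - Kp (hv t) x * ph x" and Bc = "%x t. Kp (hu t) x * deriv ph x" and R = R
     and G = "%t. inner (ka (g t)) (toL2 ph)" and H = "%t. - inner (ka (y1 t)) (toL2 ph)", OF _ _ _ _ _ _ _ _ _ _ _ _ ps])
   show "integrable (lborel \<Otimes>\<^sub>M lborel) (%(x, t). - v x t * ph x * deriv ps t + u x t * deriv ph x * ps t) &
     integral\<^sup>L (lborel \<Otimes>\<^sub>M lborel) (%(x, t). - v x t * ph x * deriv ps t + u x t * deriv ph x * ps t) = 0"
    if "time_test_fun T0 ps" for ps
    using sol[unfolded is_solution_def Let_def, THEN conjunct2, rule_format, OF conjI[OF ph that]] by blast
   show "continuous_on UNIV (%p. - Kp (hv (snd p)) (fst p) * ph (fst p))"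
    "continuous_on UNIV (%p. Kp (hu (snd p)) (fst p) * deriv ph (fst p))"
    by (intro continuous_intros cK cph ph tph)+
   show "AE x in lborel. - v x t * ph x = - Kp (hv t) x * ph x & u x t * deriv ph x = Kp (hu t) x * deriv ph x"
    if "0 <= t" "ereal t < T0" for t
    using aev[OF that] aeu[OF that] by eventually_elim simp
   show "(\<integral>x. - Kp (hv t) x * ph x \<partial>lborel) = - inner (ka (g t)) (toL2 ph)" if "0 <= t" for t
    using ic[OF Lph(1)] kahv[OF that] by simp
   show "(\<integral>x. Kp (hu t) x * deriv ph x \<partial>lborel) = - inner (ka (y1 t)) (toL2 ph)" if "0 <= t" for t
    using ic[OF Lph(2)] kahu[OF that] wdq[OF that] ph unfolding wd_def by simp
   show "((%t. inner (ka (g t)) (toL2 ph)) has_real_derivative - (- inner (ka (y1 t)) (toL2 ph))) (at t within {0..T})"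
    if "t : {0..T}" for t T
    using inner_has_real_derivative[OF bounded_linear.has_vector_derivative[OF bounded_linear_ka dg[OF that]]
      has_vector_derivative_const[of "toL2 ph"]] by simp
   show "continuous_on {0..} (%t. - inner (ka (y1 t)) (toL2 ph))"
    by (intro continuous_intros continuous_on_ka cy1)
  qed (auto simp: v'_def u'_def R R1)
  have 2: "integrable (lborel \<Otimes>\<^sub>M lborel) f2 & integral\<^sup>L (lborel \<Otimes>\<^sub>M lborel) f2 = 0"
   unfolding f2 eq2
  proof (rule weak_glue[OF T0, where A = "%x t. - u x t * ph x"
     and B = "%x t. - pfun a b (v x t) * deriv ph x - v x t * (deriv ^^ 3) ph x"
     and Ac = "%x t. - Kp (hu t) x * ph x"
     and Bc = "%x t. - pfun a b (Kp (hv t) x) * deriv ph x - Kp (hv t) x * (deriv ^^ 3) ph x" and R = R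
     and G = "%t. inner (q t) (toL2 ph)" and H = "%t. - inner (y2 t) (toL2 ph)", OF _ _ _ _ _ _ _ _ _ _ _ _ ps])
   show "integrable (lborel \<Otimes>\<^sub>M lborel) (%(x, t). - u x t * ph x * deriv ps t +
      (- pfun a b (v x t) * deriv ph x - v x t * (deriv ^^ 3) ph x) * ps t) &
     integral\<^sup>L (lborel \<Otimes>\<^sub>M lborel) (%(x, t). - u x t * ph x * deriv ps t +
      (- pfun a b (v x t) * deriv ph x - v x t * (deriv ^^ 3) ph x) * ps t) = 0"
    if "time_test_fun T0 ps" for ps
    using sol[unfolded is_solution_def Let_def, THEN conjunct2, rule_format, OF conjI[OF ph that],
      THEN conjunct2, THEN conjunct2]
    unfolding eq2 .
   show "continuous_on UNIV (%p. - Kp (hu (snd p)) (fst p) * ph (fst p))"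
    "continuous_on UNIV (%p. - pfun a b (Kp (hv (snd p)) (fst p)) * deriv ph (fst p) - Kp (hv (snd p)) (fst p) * (deriv ^^ 3) ph (fst p))"
    unfolding ph3 pfun_def by (intro continuous_intros cK cph ph tph)+
   show "AE x in lborel. - u x t * ph x = - Kp (hu t) x * ph x &
     - pfun a b (v x t) * deriv ph x - v x t * (deriv ^^ 3) ph x =
     - pfun a b (Kp (hv t) x) * deriv ph x - Kp (hv t) x * (deriv ^^ 3) ph x"
    if "0 <= t" "ereal t < T0" for t
    using aev[OF that] aeu[OF that] by eventually_elim simp
   show "(\<integral>x. - Kp (hu t) x * ph x \<partial>lborel) = - inner (q t) (toL2 ph)" if "0 <= t" for t
    using ic[OF Lph(1)] kahu[OF that] by simp
   show "(\<integral>x. - pfun a b (Kp (hv t) x) * deriv ph x - Kp (hv t) x * (deriv ^^ 3) ph x \<partial>lborel) = - inner (y2 t) (toL2 ph)"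
    if t: "0 <= t" for t
   proof -
    have hvg: "hv t = g t" using t by (simp add: hv_def)
    note p = pfun_toL2[OF L2_fun_Kp[of "g t"] ka_def[symmetric], of a b]
    have "(\<integral>x. - pfun a b (Kp (g t) x) * deriv ph x - Kp (g t) x * (deriv ^^ 3) ph x \<partial>lborel) =
      - inner (pK a b (g t)) (toL2 (deriv ph)) - inner (ka (g t)) (toL2 (deriv (deriv (deriv ph))))"
     unfolding ph3
     using L2_fun_mult_integrable[OF p(1) Lph(2)] L2_fun_mult_integrable[OF L2_fun_Kp[of "g t"] Lph(3)]
      inner_toL2[OF p(1) Lph(2)] ic[OF Lph(3), of "g t"] p(2)
     by (subst Bochner_Integration.integral_diff) auto
    moreover have "inner (pK a b (g t)) (toL2 (deriv ph)) = - inner (- (ka (g t) - g t) + N2 a b (g t)) (toL2 ph)"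
     using wd_pK ph unfolding wd_def by blast
    moreover have "inner (ka (g t)) (toL2 (deriv (deriv (deriv ph)))) = - inner (D 3 t) (toL2 ph)"
    proof -
     have "wd (D 0 t) (D 1 t)" "wd (D 1 t) (D 2 t)" "wd (D 2 t) (D 3 t)"
      using wdD[of 0 t] wdD[of 1 t] wdD[of 2 t] t by (auto simp: numeral_2_eq_2 numeral_3_eq_3)
     then have "inner (D 0 t) (toL2 (deriv (deriv (deriv ph)))) = - inner (D 3 t) (toL2 ph)"
      using ph tph unfolding wd_def by simp
     then show ?thesis by (simp add: D_def)
    qed
    moreover have "D 3 t = ka (g t) - g t - y2 t - N2 a b (g t)" by (simp add: D_def s_def)
    ultimately show ?thesis unfolding hvg by (simp add: inner_simps)
   qed
   show "((%t. inner (q t) (toL2 ph)) has_real_derivative - (- inner (y2 t) (toL2 ph))) (at t within {0..T})"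
    if "t : {0..T}" for t T
    using inner_has_real_derivative[OF dq[OF that] has_vector_derivative_const[of "toL2 ph"]] by simp
   show "continuous_on {0..} (%t. - inner (y2 t) (toL2 ph))"
    by (intro continuous_intros cy2)
  qed (auto simp: v'_def u'_def R R1 ph3 R3)
  show ?thesis using 1 2 by blast
 qed
 have set: "{s. 0 <= s & ereal s < \<infinity>} = {0..}" by auto
 have "is_solution a b V U \<infinity> v' u'"
  unfolding is_solution_def Let_def set
 proof (intro conjI allI impI)
  fix t :: real assume "0 <= t & ereal t < \<infinity>"
  then have t: "0 <= t" by simp
  show "in_H 3 (%x. v' x t - V x)" "in_H 2 (%x. u' x t - U x)"
   using in_H_diff(1) Hv(1)[OF t] Hu(1)[OF t] VU by blast+
  show "((%s. H_norm 3 (%x. v' x s - v' x t)) ---> 0) (at t within {0..})"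
   by (rule Hlim[OF t, where C = D]) (use Hv cD in auto)
  show "((%s. H_norm 2 (%x. u' x s - u' x t)) ---> 0) (at t within {0..})"
   by (rule Hlim[OF t, where C = E]) (use Hu cE in auto)
 qed (use weak in blast)+
 moreover have "v' x t = v x t & u' x t = u x t" if "0 <= t" "ereal t < T0" for x t
  using that by (simp add: v'_def u'_def)
 moreover have "sol_state v' u' t = w t" if "0 <= t" for t
  using Hv(2)[OF that, of 0] Hv(2)[OF that, of 1] Hu(2)[OF that, of 0]
  by (simp add: sol_state_def D_def E_def g_def q_def)
 ultimately show ?thesis using that by blast
qed

subsection \<open>The profile of a solitary wave\<close>

text \<open>The square of \<open>f\<close>, damped by an exponential of rate \<open>2 * K\<close> in
  the direction away from the zero, cannot grow in that direction.\<close>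

lemma eq_0_if_deriv_bounded:
 fixes f :: "real => real"
 assumes f: "!!x. (f has_real_derivative f' x) (at x)" and le: "!!x. \<bar>f' x\<bar> <= K * \<bar>f x\<bar>" and x0: "f x0 = 0"
 shows "f x = 0"
proof -
 have ff: "\<bar>f y * f' y\<bar> <= K * (f y)^2" for y
 proof -
  have "\<bar>f y * f' y\<bar> <= \<bar>f y\<bar> * (K * \<bar>f y\<bar>)" unfolding abs_mult by (intro mult_left_mono le) simp
  also have "... = K * (f y)^2" by (metis abs_mult_self_eq mult.left_commute power2_eq_square)
  finally show ?thesis .
 qed
 have d: "((%y. (f y)^2 * exp (k * y)) has_real_derivative (2 * (f y * f' y) + k * (f y)^2) * exp (k * y)) (at y)" for k y
  by (rule derivative_eq_intros f refl)+ (simp add: algebra_simps power2_eq_square)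
 have "(f x)^2 <= 0"
 proof (cases "x0 <= x")
  case True
  have "(f x)^2 * exp (- (2 * K) * x) <= (f x0)^2 * exp (- (2 * K) * x0)"
  proof (rule DERIV_nonpos_imp_nonincreasing[OF True])
   fix y
   have "(2 * (f y * f' y) + - (2 * K) * (f y)^2) * exp (- (2 * K) * y) <= 0"
    using ff[of y] by (intro mult_nonpos_nonneg) auto
   then show "\<exists>z. ((%y. (f y)^2 * exp (- (2 * K) * y)) has_real_derivative z) (at y) & z <= 0"
    using d[of "- (2 * K)" y] by blast
  qed
  then show ?thesis by (simp add: x0 mult_le_0_iff)
 next
  case False
  have "(f x)^2 * exp ((2 * K) * x) <= (f x0)^2 * exp ((2 * K) * x0)"
  proof (rule DERIV_nonneg_imp_nondecreasing[of x x0 "%y. (f y)^2 * exp ((2 * K) * y)"])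
   fix y
   have "(2 * (f y * f' y) + (2 * K) * (f y)^2) * exp ((2 * K) * y) >= 0"
    using ff[of y] by (intro mult_nonneg_nonneg) auto
   then show "\<exists>z. ((%y. (f y)^2 * exp ((2 * K) * y)) has_real_derivative z) (at y) & 0 <= z"
    using d[of "2 * K" y] by blast
  qed (use False in simp)
  then show ?thesis by (simp add: x0 mult_le_0_iff)
 qed
 then show ?thesis by simp
qed

lemma attains_sup_vanishing:
 fixes f :: "real => real"
 assumes cont: "continuous_on UNIV f" and lim: "(f ---> 0) at_top" "(f ---> 0) at_bot" and y: "0 < f y"
 obtains x0 where "!!x. f x <= f x0"
proof -
 obtain A where A: "!!x. A <= x ==> f x < f y"
  using order_tendstoD(2)[OF lim(1) y] by (auto simp: eventually_at_top_linorder)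
 obtain B where B: "!!x. x <= B ==> f x < f y"
  using order_tendstoD(2)[OF lim(2) y] by (auto simp: eventually_at_bot_linorder)
 let ?I = "{min B y..max A y}"
 have "y : ?I" by auto
 then obtain x0 where x0: "x0 : ?I" "!!x. x : ?I ==> f x <= f x0"
  using continuous_attains_sup[of ?I f] continuous_on_subset[OF cont, of ?I] by blast
 have "f y <= f x0" by (rule x0(2)) auto
 moreover have "f x <= f x0 | f x < f y" for x
  using A[of x] B[of x] x0(2)[of x] by (cases "x : ?I") (auto simp: min_le_iff_disj le_max_iff_disj)
 ultimately have "f x <= f x0" for x by (meson less_imp_le order_trans)
 then show ?thesis by (rule that)
qed

lemma bounded_vanishing:
 fixes f :: "real => real"
 assumes cont: "continuous_on UNIV f" and lim: "(f ---> 0) at_top" "(f ---> 0) at_bot"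
 obtains B where "0 <= B" "!!x. \<bar>f x\<bar> <= B"
proof (cases "\<exists>y. f y ~= 0")
 case True
 then obtain y where y: "0 < \<bar>f y\<bar>" by auto
 have "continuous_on UNIV (%x. \<bar>f x\<bar>)" by (intro continuous_intros cont)
 from attains_sup_vanishing[OF this tendsto_rabs_zero[OF lim(1)] tendsto_rabs_zero[OF lim(2)] y]
 show ?thesis using that by (metis abs_ge_zero)
next
 case False
 then show ?thesis using that[of 0] by auto
qed

text \<open>The profile equation makes \<open>W = c\<^sup>2 V + p(V) + V''\<close> an affine
  function. Only \<open>V\<close> is known to decay, not its derivatives, so the integration
  constants are evaluated along points tending to infinity where mean value theorems express the
  derivatives by differences of \<open>V\<close>.\<close>

lemma solitary_wave_ode:
 assumes sw: "solitary_wave a b c V"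
 shows "deriv (deriv V) x = (1 - c^2) * V x - a * (V x)^2 - b * (V x) ^ 3"
  and "(deriv V x)^2 = (V x)^2 * (1 - c^2 - 2 * a * V x / 3 - b * (V x)^2 / 2)"
proof -
 have sm: "smooth_fun V" and top: "(V ---> 0) at_top" and cs: "classical_sol a b (%x t. V (x - c * t))"
  using sw by (auto simp: solitary_wave_def)
 note d1 = smooth_fun_DERIV[OF sm]
 note sm1 = smooth_fun_deriv[OF sm]
 note d2 = smooth_fun_DERIV[OF sm1]
 note sm2 = smooth_fun_deriv[OF sm1]
 note d3 = smooth_fun_DERIV[OF sm2]
 note d4 = smooth_fun_DERIV[OF smooth_fun_deriv[OF sm2]]
 define q where "q x = c^2 * V x + pfun a b (V x)" for x
 define p1 where "p1 x = (- 1 + 2 * a * V x + 3 * b * (V x)^2) * deriv V x" for x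
 define p2 where "p2 x = (2 * a * deriv V x + 6 * b * V x * deriv V x) * deriv V x +
  (- 1 + 2 * a * V x + 3 * b * (V x)^2) * deriv (deriv V) x" for x
 define W where "W x = q x + deriv (deriv V) x" for x
 define W1 where "W1 x = c^2 * deriv V x + p1 x + deriv (deriv (deriv V)) x" for x
 have dp: "((%x. pfun a b (V x)) has_real_derivative p1 x) (at x)" for x
  unfolding pfun_def p1_def by (rule derivative_eq_intros d1 refl)+ (simp add: algebra_simps power2_eq_square)
 have dp1: "(p1 has_real_derivative p2 x) (at x)" for x
  unfolding p1_def[abs_def] p2_def
  by (rule derivative_eq_intros d1 d2 refl)+ (simp add: algebra_simps power2_eq_square)
 have dW: "(W has_real_derivative W1 x) (at x)" for x
  unfolding W_def[abs_def] q_def W1_def by (rule derivative_eq_intros d1 d3 dp refl)+ simp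
 have eq0: "c^2 * deriv (deriv V) x + p2 x + deriv (deriv (deriv (deriv V))) x = 0" for x
 proof -
  have t1: "deriv (%r. V (x - c * r)) = (%s. - c * deriv V (x - c * s))"
  proof (rule deriv_real_eqI)
   fix s
   have "((%r. V (x - c * r)) has_real_derivative deriv V (x - c * s) * - c) (at s)"
    by (rule DERIV_chain2[OF d1]) (auto intro!: derivative_eq_intros)
   then show "((%r. V (x - c * r)) has_real_derivative - c * deriv V (x - c * s)) (at s)" by (simp only: mult.commute)
  qed
  have t2: "deriv (%s. - c * deriv V (x - c * s)) = (%s. c^2 * deriv (deriv V) (x - c * s))"
  proof (rule deriv_real_eqI)
   fix s
   have "((%r. deriv V (x - c * r)) has_real_derivative deriv (deriv V) (x - c * s) * - c) (at s)"
    by (rule DERIV_chain2[OF d2]) (auto intro!: derivative_eq_intros)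
   from DERIV_cmult[OF this, of "- c"]
   show "((%s. - c * deriv V (x - c * s)) has_real_derivative c\<^sup>2 * deriv (deriv V) (x - c * s)) (at s)"
    by (simp add: power2_eq_square mult_ac)
  qed
  have t3: "deriv (%z. pfun a b (V z)) = p1" "deriv p1 = p2"
   by (rule deriv_real_eqI, rule dp dp1)+
  have "deriv (%s. deriv (%r. V (x - c * r)) s) 0 + deriv (%y. deriv (%z. pfun a b (V (z - c * 0))) y) x +
    (deriv ^^ 4) (%y. V (y - c * 0)) x = 0"
   using cs unfolding classical_sol_def by blast
  then show ?thesis unfolding t1 t2 by (simp add: t3 eval_nat_numeral)
 qed
 have dW1: "(W1 has_real_derivative 0) (at x)" for x
  unfolding W1_def[abs_def] by (rule derivative_eq_intros d2 d4 dp1 refl)+ (use eq0[of x] in \<open>simp add: mult.commute\<close>)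
 have W1: "W1 x = W1 0" for x using DERIV_isconst_all[of W1 x 0] dW1 by blast
 have "((%x. W x - W1 0 * x) has_real_derivative 0) (at x)" for x
  by (rule derivative_eq_intros dW refl)+ (use W1[of x] in simp)
 then have W: "W x - W1 0 * x = W 0" for x using DERIV_isconst_all[of "%x. W x - W1 0 * x" x 0] by simp
 \<comment> \<open>Two applications of the mean value theorem to a second difference; along these
   points V'' tends to 0.\<close>
 have "\<exists>xi. real n <= xi & deriv (deriv V) xi = V (real n + 2) - 2 * V (real n + 1) + V (real n)" for n :: nat
 proof -
  have "((%s. V (s + 1) - V s) has_real_derivative deriv V (s + 1) - deriv V s) (at s)" for s
   by (rule derivative_eq_intros DERIV_chain2[OF d1] d1 refl | simp)+
  from MVT2[of "real n" "real n + 1" "%s. V (s + 1) - V s", OF _ this]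
  obtain et where et: "real n < et" "V (real n + 2) - 2 * V (real n + 1) + V (real n) = deriv V (et + 1) - deriv V et"
   by (auto simp: add.assoc)
  obtain xi where "et < xi" "deriv V (et + 1) - deriv V et = deriv (deriv V) xi"
   using MVT2[of et "et + 1" "deriv V", OF _ d2] by auto
  then show ?thesis using et by (intro exI[of _ xi]) auto
 qed
 then obtain xi where xi: "!!n::nat. real n <= xi n" "!!n. deriv (deriv V) (xi n) = V (real n + 2) - 2 * V (real n + 1) + V (real n)"
  by metis
 have inf: "filterlim xi at_top sequentially"
  by (rule filterlim_at_top_mono[OF filterlim_real_sequentially]) (simp add: xi)
 have V0: "(%n. V (f n)) >>> 0" if "filterlim f at_top sequentially" for f
  by (rule filterlim_compose[OF top that])
 have shift: "filterlim (%n. real n + k) at_top sequentially" for k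
  using filterlim_tendsto_add_at_top[OF tendsto_const filterlim_real_sequentially, of k] by (simp add: add.commute)
 have "(%n. W (xi n)) >>> (c^2 * 0 + (- 0 + a * 0 ^ 2 + b * 0 ^ 3)) + (0 - 2 * 0 + 0)"
  unfolding W_def q_def pfun_def xi(2)
  by (intro tendsto_intros V0 inf shift filterlim_real_sequentially)
 moreover have "(%n. W (xi n)) = (%n. W 0 + W1 0 * xi n)" using W by (intro ext) (metis add.commute diff_add_cancel)
 ultimately have lim: "(%n. W 0 + W1 0 * xi n) >>> 0" by simp
 have W10: "W1 0 = 0"
 proof (rule ccontr)
  assume ne: "W1 0 ~= 0"
  have "(%n. ((W 0 + W1 0 * xi n) - W 0) / W1 0) >>> (0 - W 0) / W1 0"
   by (rule tendsto_divide[OF tendsto_diff[OF lim tendsto_const] tendsto_const ne])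
  then have "xi >>> (0 - W 0) / W1 0" using ne by simp
  then show False
   using not_tendsto_and_filterlim_at_infinity[OF _ _ filterlim_at_top_imp_at_infinity[OF inf]] by auto
 qed
 then have "W 0 = 0" using lim LIMSEQ_unique[of "%n. W 0" "W 0" 0] by simp
 then have "W x = 0" for x using W[of x] W10 by simp
 then have ode: "deriv (deriv V) x = (1 - c^2) * V x - a * (V x)^2 - b * (V x) ^ 3" for x
  unfolding W_def q_def pfun_def by (simp add: algebra_simps)
 then show "deriv (deriv V) x = (1 - c^2) * V x - a * (V x)^2 - b * (V x) ^ 3" .
 define k1 where "k1 = 2 * a / 3"
 define k2 where "k2 = b / 2"
 \<comment> \<open>The first integral of the second order equation. It is constant, and its value 0
   is again found along points where V' is a difference of values of \<open>V\<close>.\<close>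
 define P where "P x = (deriv V x)^2 - (V x)^2 * (1 - c^2 - k1 * V x - k2 * (V x)^2)" for x
 have P_eq: "P x = (deriv V x)^2 - (V x)^2 * (1 - c^2 - 2 * a * V x / 3 - b * (V x)^2 / 2)" for x
  by (simp add: P_def k1_def k2_def)
 have "(P has_real_derivative 0) (at x)" for x
 proof -
  have "(P has_real_derivative 2 * deriv V x * (deriv (deriv V) x - V x * (1 - c^2 - k1 * V x - k2 * (V x)^2)
    + (V x)^2 * (k1 / 2 + k2 * V x))) (at x)"
   unfolding P_def[abs_def]
   by (rule derivative_eq_intros d1 d2 refl)+ (simp add: algebra_simps power2_eq_square)
  moreover have "deriv (deriv V) x - V x * (1 - c^2 - k1 * V x - k2 * (V x)^2) + (V x)^2 * (k1 / 2 + k2 * V x) = 0"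
   unfolding ode k1_def k2_def by (simp add: field_simps power2_eq_square power3_eq_cube)
  ultimately show ?thesis by simp
 qed
 then have P: "P x = P y" for x y using DERIV_isconst_all[of P x y] by blast
 have "\<exists>ze. real n <= ze & deriv V ze = V (real n + 1) - V (real n)" for n :: nat
 proof -
  obtain z where "real n < z" "V (real n + 1) - V (real n) = (real n + 1 - real n) * deriv V z"
   using MVT2[of "real n" "real n + 1" V, OF _ d1] by auto
  then show ?thesis by (intro exI[of _ z]) auto
 qed
 then obtain ze where ze: "!!n::nat. real n <= ze n" "!!n. deriv V (ze n) = V (real n + 1) - V (real n)" by metis
 have infze: "filterlim ze at_top sequentially"
  by (rule filterlim_at_top_mono[OF filterlim_real_sequentially]) (simp add: ze)
 have "(%n. P (ze n)) >>> (0 - 0)^2 - 0^2 * (1 - c^2 - 2 * a * 0 / 3 - b * 0^2 / 2)"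
  unfolding P_eq ze(2) by (intro tendsto_intros V0 infze shift filterlim_real_sequentially) auto
 moreover have "(%n. P (ze n)) = (%n. P x)" using P by blast
 ultimately have "(%n::nat. P x) >>> 0" by simp
 then have "P x = 0" using LIMSEQ_unique[OF tendsto_const] by blast
 then show "(deriv V x)^2 = (V x)^2 * (1 - c^2 - 2 * a * V x / 3 - b * (V x)^2 / 2)" by (simp add: P_eq)
qed

text \<open>Normal form after sign changes. The second order equation is accompanied by its first
  integral, which carries all information on the shape of the profile.\<close>

locale pulse =
 fixes a b c :: real and V V1 :: "real => real"
 assumes ab: "b <= - (a^2) / 3" and c_nonneg: "0 <= c"
  and pos: "0 < V x"
  and dV: "(V has_real_derivative V1 x) (at x)"
  and dV1: "(V1 has_real_derivative (1 - c^2) * V x - a * (V x)^2 - b * (V x) ^ 3) (at x)"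
  and V1_sq: "(V1 x)^2 = (V x)^2 * (1 - c^2 - 2 * a * V x / 3 - b * (V x)^2 / 2)"
  and lim: "(V ---> 0) at_top" "(V ---> 0) at_bot"

text \<open>By the first integral |V'| is bounded by a multiple of |V|, so a zero anywhere would
  make \<open>V\<close> vanish identically; hence \<open>V\<close> has a constant sign
  \<open>s\<close>, and multiplying by \<open>s\<close> changes only the sign of
  \<open>a\<close>.\<close>

lemma solitary_wave_pulse:
 assumes ab: "b <= - (a^2) / 3" and sw: "solitary_wave a b c V"
 obtains s where "s = 1 | s = - 1" "pulse (s * a) b \<bar>c\<bar> (%x. s * V x) (%x. s * deriv V x)"
proof -
 have sm: "smooth_fun V" and ex: "\<exists>x. V x ~= 0" and top: "(V ---> 0) at_top" and bot: "(V ---> 0) at_bot"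
  using sw by (auto simp: solitary_wave_def)
 note d1 = smooth_fun_DERIV[OF sm]
 note d2 = smooth_fun_DERIV[OF smooth_fun_deriv[OF sm]]
 note ode = solitary_wave_ode[OF sw]
 have cont: "continuous_on UNIV V" by (rule smooth_fun_continuous[OF sm])
 obtain B where B: "0 <= B" "!!x. \<bar>V x\<bar> <= B" using bounded_vanishing[OF cont top bot] by blast
 \<comment> \<open>The other summands bound the quotient (V')^2 / V^2; the leading 1 gives
   \<open>1 <= K\<close>, so that \<open>K\<close> may be replaced by its square.\<close>
 define K where "K = 1 + \<bar>1 - c^2\<bar> + 2 * \<bar>a\<bar> * B / 3 + \<bar>b\<bar> * B^2 / 2"
 have K1: "1 <= K" using B by (simp add: K_def)
 have le: "\<bar>deriv V x\<bar> <= K * \<bar>V x\<bar>" for x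
 proof -
  have "- (2 * a * V x / 3) <= 2 * \<bar>a\<bar> * B / 3"
  proof -
   have "- (a * V x) <= \<bar>a\<bar> * \<bar>V x\<bar>" by (metis abs_ge_minus_self abs_mult)
   also have "... <= \<bar>a\<bar> * B" by (intro mult_left_mono B) auto
   finally show ?thesis by (simp add: mult.commute)
  qed
  moreover have "- (b * (V x)^2 / 2) <= \<bar>b\<bar> * B^2 / 2"
  proof -
   have "- b * (V x)^2 <= \<bar>b\<bar> * (V x)^2" by (intro mult_right_mono) auto
   also have "... <= \<bar>b\<bar> * B^2" using B(2)[of x] by (intro mult_left_mono) (auto simp: abs_le_square_iff[symmetric])
   finally show ?thesis by simp
  qed
  ultimately have "1 - c^2 - 2 * a * V x / 3 - b * (V x)^2 / 2 <= K" unfolding K_def by linarith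
  also have "K <= K^2" using K1 by (simp add: power2_eq_square)
  finally have "(deriv V x)^2 <= (V x)^2 * K^2" unfolding ode(2)[of x] by (intro mult_left_mono) auto
  then have "(deriv V x)^2 <= (K * V x)^2" by (simp add: power_mult_distrib mult.commute)
  then have "\<bar>deriv V x\<bar> <= \<bar>K * V x\<bar>" by (simp only: abs_le_square_iff)
  then show ?thesis using K1 by (simp add: abs_mult)
 qed
 have nz: "V x ~= 0" for x using eq_0_if_deriv_bounded[OF d1 le, of x] ex by blast
 have "(\<forall>x. 0 < V x) | (\<forall>x. V x < 0)"
 proof (rule ccontr)
  assume "~ ?thesis"
  then obtain x y where "V x < 0" "0 < V y" using nz by (metis linorder_less_linear)
  then have "0 : V ` UNIV"
   using connectedD_interval[OF connected_continuous_image[OF cont connected_UNIV], of "V x" "V y" 0] by auto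
  then show False using nz by auto
 qed
 then obtain s where s: "s = 1 | s = - 1" "!!x. 0 < s * V x" by (metis mult_1 mult_minus1 neg_0_less_iff_less)
 have "pulse (s * a) b \<bar>c\<bar> (%x. s * V x) (%x. s * deriv V x)"
 proof
  show "b <= - ((s * a)^2) / 3" using ab s by (auto simp: power_mult_distrib)
  show "0 < s * V x" for x by (rule s)
  show "((%x. s * V x) has_real_derivative s * deriv V x) (at x)" for x by (intro DERIV_cmult d1)
  show "((%x. s * deriv V x) has_real_derivative (1 - \<bar>c\<bar>^2) * (s * V x) - s * a * (s * V x)^2 - b * (s * V x) ^ 3) (at x)" for x
   by (rule DERIV_cong[OF DERIV_cmult[OF d2]]) (use s(1) ode(1)[of x] in auto)
  show "(s * deriv V x)^2 = (s * V x)^2 * (1 - \<bar>c\<bar>^2 - 2 * (s * a) * (s * V x) / 3 - b * (s * V x)^2 / 2)" for x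
   using s(1) ode(2)[of x] by auto
  show "((%x. s * V x) ---> 0) at_top" "((%x. s * V x) ---> 0) at_bot"
   by (rule tendsto_mult_right_zero, fact)+
 qed simp
 then show ?thesis using s that by blast
qed

subsection \<open>The action of the family of pulses\<close>

text \<open>With \<open>m = 2a/(3be)\<close>, \<open>be = -b\<close>, a pulse of height \<open>m - Y\<close> has squared \<open>L^2\<close> norm \<open>pnorm be m Y\<close>,
 action \<open>pact be m Y\<close> and speed \<open>pspeed be m Y\<close>.\<close>

definition pL :: "real => real => real" where "pL m Y = sqrt (m^2 - Y^2)"
text \<open>This is arcosh (m / Y) written with logarithms.\<close>

definition plam :: "real => real => real" where "plam m Y = ln (m + pL m Y) - ln Y"
definition pk :: "real => real => real" where "pk m Y = m * plam m Y - pL m Y"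
definition pnorm :: "real => real => real => real" where "pnorm be m Y = 2 * sqrt (2 / be) * pk m Y"
definition pact :: "real => real => real => real" where
 "pact be m Y = sqrt (2 * be) * (m^2 * pL m Y / 2 - m * Y^2 * plam m Y / 2 - (pL m Y) ^ 3 / 3)"
definition pspeed :: "real => real => real => real" where
 "pspeed be m Y = sqrt (1 - be * m^2 / 2 + be * Y^2 / 2)"

lemma pL_pos: "0 < Y ==> Y < m ==> 0 < pL m Y"
 by (simp add: pL_def power_strict_mono)

lemma pL_sq: "0 < Y ==> Y < m ==> (pL m Y)^2 = m^2 - Y^2"
 using power_mono[of Y m 2] by (simp add: pL_def)

lemma pL_deriv:
 assumes "0 < Y" "Y < m"
 shows "(pL m has_real_derivative - Y / pL m Y) (at Y)"
proof -
 have p: "0 < m^2 - Y^2" using assms by (simp add: power_strict_mono)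
 have "((%Y. m^2 - Y^2) has_real_derivative - (2 * Y)) (at Y)"
  by (rule derivative_eq_intros refl)+ simp
 from DERIV_chain2[OF DERIV_real_sqrt[OF p] this]
 show ?thesis
  unfolding pL_def[abs_def] by (rule DERIV_cong) (use p in \<open>simp add: field_simps\<close>)
qed

lemma plam_deriv:
 assumes "0 < Y" "Y < m"
 shows "(plam m has_real_derivative - m / (Y * pL m Y)) (at Y)"
proof -
 note L = pL_pos[OF assms] pL_sq[OF assms]
 have p: "0 < m + pL m Y" using L(1) assms by simp
 have "((%Y. ln (m + pL m Y)) has_real_derivative (1 / (m + pL m Y)) * (0 + - Y / pL m Y)) (at Y)"
  by (rule DERIV_chain2[OF DERIV_ln_divide[OF p] DERIV_add[OF DERIV_const pL_deriv[OF assms]]])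
 from DERIV_diff[OF this DERIV_ln_divide[OF assms(1)]]
 have "(plam m has_real_derivative (1 / (m + pL m Y)) * (0 + - Y / pL m Y) - 1 / Y) (at Y)"
  unfolding plam_def[abs_def] .
 moreover have "(1 / (m + pL m Y)) * (0 + - Y / pL m Y) - 1 / Y = - m / (Y * pL m Y)"
 proof -
  have "Y * Y = m * m - pL m Y * pL m Y" using L(2) by (simp add: power2_eq_square)
  moreover have "m + pL m Y ~= 0" using L(1) assms by simp
  ultimately show ?thesis using L(1) assms by (simp add: divide_simps) (simp add: algebra_simps)
 qed
 ultimately show ?thesis by simp
qed

lemma pk_deriv:
 assumes "0 < Y" "Y < m"
 shows "(pk m has_real_derivative - pL m Y / Y) (at Y)"
proof -
 note L = pL_pos[OF assms] pL_sq[OF assms]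
 have "(pk m has_real_derivative m * (- m / (Y * pL m Y)) - - Y / pL m Y) (at Y)"
  unfolding pk_def[abs_def] by (intro DERIV_diff DERIV_cmult plam_deriv pL_deriv assms)
 moreover have "m * (- m / (Y * pL m Y)) - - Y / pL m Y = - pL m Y / Y"
 proof -
  have "Y * Y = m * m - pL m Y * pL m Y" using L(2) by (simp add: power2_eq_square)
  then show ?thesis using L(1) assms by (simp add: divide_simps)
 qed
 ultimately show ?thesis by simp
qed

lemma continuous_on_pL: "continuous_on A (pL m)"
 unfolding pL_def[abs_def] by (intro continuous_intros)

lemma continuous_on_plam: "0 < m ==> A \<subseteq> {0<..m} ==> continuous_on A (plam m)"
proof -
 assume m: "0 < m" "A \<subseteq> {0<..m}"
 have "m + pL m Y ~= 0" if "Y : A" for Y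
 proof -
  have "0 <= m^2 - Y^2" using m that power_mono[of Y m 2] by auto
  then have "0 <= pL m Y" by (simp add: pL_def)
  then show ?thesis using m by simp
 qed
 then show ?thesis unfolding plam_def[abs_def] using m
  by (intro continuous_on_diff continuous_on_ln continuous_on_add continuous_on_const continuous_on_pL continuous_on_id) auto
qed

text \<open>Both sides vanish at \<open>Y = m\<close>, and right minus left has derivative - (2/3)
  L^3 / Y^3 with L = \<open>pL m Y\<close>, so it is positive to the left of
  \<open>m\<close>.\<close>

lemma pk_le:
 assumes Y: "0 < Y" "Y < m"
 shows "pk m Y <= (pL m Y) ^ 3 / (3 * Y^2)"
proof -
 define f where "f Y = (pL m Y) ^ 3 * (1 / 3 * inverse (Y^2)) - pk m Y" for Y
 have m: "0 < m" using Y by simp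
 have "f m <= f Y"
 proof (rule DERIV_nonpos_imp_decreasing_open[OF less_imp_le[OF Y(2)]])
  fix Z assume "Y < Z" "Z < m"
  then have Z: "0 < Z" "Z < m" using Y by auto
  note L = pL_pos[OF Z]
  have "((%Y. (pL m Y) ^ 3) has_real_derivative - 3 * pL m Z * Z) (at Z)"
   by (rule DERIV_cong[OF DERIV_power[OF pL_deriv[OF Z], of 3]]) (use L in \<open>simp add: power2_eq_square\<close>)
  moreover have "((%Y. 1 / 3 * inverse (Y^2)) has_real_derivative - 2 / (3 * Z ^ 3)) (at Z)"
   using Z by (auto intro!: derivative_eq_intros simp: field_simps power2_eq_square power3_eq_cube)
  ultimately have "(f has_real_derivative ((- 3 * pL m Z * Z) * (1 / 3 * inverse (Z^2)) +
    (- 2 / (3 * Z ^ 3)) * (pL m Z) ^ 3) - - pL m Z / Z) (at Z)"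
   unfolding f_def[abs_def] by (intro DERIV_diff DERIV_mult pk_deriv Z)
  moreover have "((- 3 * pL m Z * Z) * (1 / 3 * inverse (Z^2)) + (- 2 / (3 * Z ^ 3)) * (pL m Z) ^ 3) - - pL m Z / Z =
    - (2 / 3 * (pL m Z) ^ 3 / Z ^ 3)"
   using Z by (simp add: field_simps power2_eq_square power3_eq_cube)
  moreover have "- (2 / 3 * (pL m Z) ^ 3 / Z ^ 3) <= 0" using L Z by simp
  ultimately show "\<exists>y. (f has_real_derivative y) (at Z) & y <= 0" by metis
 next
  show "continuous_on {Y..m} f"
   unfolding f_def[abs_def] pk_def[abs_def] using Y m
   by (intro continuous_intros continuous_on_pL continuous_on_plam) auto
 qed
 moreover have "f m = 0" by (simp add: f_def pk_def plam_def pL_def)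
 ultimately show ?thesis by (simp add: f_def field_simps)
qed

lemma pspeed_pos:
 assumes "0 < be" "be * m^2 <= 4 / 3"
 shows "0 < 1 - be * m^2 / 2 + be * Y^2 / 2" "0 < pspeed be m Y"
  "(pspeed be m Y)^2 = 1 - be * m^2 / 2 + be * Y^2 / 2"
proof -
 have "0 <= be * Y^2" using assms by simp
 then show *: "0 < 1 - be * m^2 / 2 + be * Y^2 / 2" using assms by linarith
 then show "0 < pspeed be m Y" "(pspeed be m Y)^2 = 1 - be * m^2 / 2 + be * Y^2 / 2"
  by (simp_all add: pspeed_def)
qed

lemma pspeed_deriv:
 assumes "0 < be" "be * m^2 <= 4 / 3"
 shows "(pspeed be m has_real_derivative be * Y / (2 * pspeed be m Y)) (at Y)"
proof -
 have "((%Y. 1 - be * m^2 / 2 + (be / 2) * Y^2) has_real_derivative be * Y) (at Y)"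
  by (rule derivative_eq_intros refl | simp)+
 then have "((%Y. 1 - be * m^2 / 2 + be * Y^2 / 2) has_real_derivative be * Y) (at Y)" by simp
 from DERIV_chain2[OF DERIV_real_sqrt[OF pspeed_pos(1)[OF assms, of Y]] this]
 show ?thesis
  unfolding pspeed_def[abs_def] by (rule DERIV_cong) (use pspeed_pos(1)[OF assms, of Y] in \<open>simp add: field_simps\<close>)
qed

text \<open>The convexity condition behind stability, since this product is the size of the momentum
  up to a constant. With c, k, L the values at X of \<open>pspeed\<close>, \<open>pk\<close>,
  \<open>pL\<close>, the sign of the derivative is that of be X^2 k / 2 - L c^2;
  \<open>pk_le\<close> reduces negativity to be L^2 / 6 < c^2, where be m^2 <= 4/3 makes the left
  side less than 2/9 and the right side greater than 1/3.\<close>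

lemma pspeed_pk_decreasing:
 assumes be: "0 < be" "be * m^2 <= 4 / 3" and Y: "0 < Y" "Y < Z" "Z < m"
 shows "pspeed be m Z * pk m Z < pspeed be m Y * pk m Y"
proof (rule DERIV_neg_imp_decreasing[OF Y(2)])
 fix X assume "Y <= X" "X <= Z"
 then have X: "0 < X" "X < m" using Y by auto
 let ?c = "pspeed be m X" and ?L = "pL m X" and ?k = "pk m X"
 note L = pL_pos[OF X] pL_sq[OF X]
 note c = pspeed_pos[OF be, of X]
 have "((%Y. pspeed be m Y * pk m Y) has_real_derivative be * X / (2 * ?c) * ?k + - ?L / X * ?c) (at X)"
  by (intro DERIV_mult pspeed_deriv pk_deriv be X)
 moreover have "be * X / (2 * ?c) * ?k + - ?L / X * ?c < 0"
 proof -
  have "?k * X^2 <= ?L ^ 3 / 3" using pk_le[OF X] X by (simp add: field_simps)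
  then have "be / 2 * (?k * X^2) <= be / 2 * (?L ^ 3 / 3)" using be by (intro mult_left_mono) auto
  also have "... = ?L * (be * ?L^2 / 6)" by (simp add: power2_eq_square power3_eq_cube)
  also have "... < ?L * ?c^2"
  proof (rule mult_strict_left_mono[OF _ L(1)])
   have "be * ?L^2 = be * m^2 - be * X^2" unfolding L(2) by (simp add: algebra_simps)
   moreover have "0 < be * X^2" using be X by simp
   ultimately show "be * ?L^2 / 6 < ?c^2" unfolding c(3) using be(2) by simp
  qed
  finally have "be / 2 * (?k * X^2) - ?L * ?c^2 < 0" by simp
  moreover have "be * X / (2 * ?c) * ?k + - ?L / X * ?c = (be / 2 * (?k * X^2) - ?L * ?c^2) / (X * ?c)"
   using X c(2) by (simp add: field_simps power2_eq_square)
  ultimately show ?thesis using X c(2) by (simp add: divide_neg_pos)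
 qed
 ultimately show "\<exists>y. ((%Y. pspeed be m Y * pk m Y) has_real_derivative y) (at X) & y < 0" by blast
qed

text \<open>This equals - c c' times \<open>pnorm\<close>, the usual law that along the family the
  action changes by the momentum times the change of speed.\<close>

lemma pact_deriv:
 assumes Y: "0 < Y" "Y < m"
 shows "(pact be m has_real_derivative - sqrt (2 * be) * Y * pk m Y) (at Y)"
proof -
 note L = pL_pos[OF Y] pL_sq[OF Y]
 have 1: "((%Y. m^2 * pL m Y / 2) has_real_derivative m\<^sup>2 * (- Y / pL m Y) / 2) (at Y)"
  by (intro DERIV_cdivide DERIV_cmult pL_deriv Y)
 have "((%Y. m * Y^2) has_real_derivative m * (2 * Y)) (at Y)"
  by (rule derivative_eq_intros refl | simp)+
 note 2 = DERIV_cdivide[OF DERIV_mult[OF this plam_deriv[OF Y]], of 2]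
 have "((%Y. (pL m Y) ^ 3) has_real_derivative - 3 * pL m Y * Y) (at Y)"
  by (rule DERIV_cong[OF DERIV_power[OF pL_deriv[OF Y], of 3]]) (use L(1) in \<open>simp add: power2_eq_square\<close>)
 note 3 = DERIV_cdivide[OF this, of 3]
 note DERIV_cmult[OF DERIV_diff[OF DERIV_diff[OF 1 2] 3], of "sqrt (2 * be)"]
 moreover have "m^2 * (- Y / pL m Y) / 2 - (m * (2 * Y) * plam m Y + - m / (Y * pL m Y) * (m * Y^2)) / 2 -
   (- 3 * pL m Y * Y) / 3 = - Y * pk m Y"
  using L(1) Y by (simp add: pk_def field_simps power2_eq_square)
 ultimately show ?thesis unfolding pact_def[abs_def] by (simp add: mult.assoc)
qed

text \<open>By \<open>pact_deriv\<close> the derivative in \<open>Y\<close> is a positive factor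
  times P(Y0) - P(Y), where P is speed times \<open>pk\<close>; as P is strictly decreasing, the
  sign changes from negative to positive at \<open>Y0\<close>.\<close>

lemma pact_strict_min:
 assumes be: "0 < be" "be * m^2 <= 4 / 3" and Y: "0 < Y" "Y < m" and Y0: "0 < Y0" "Y0 < m" and ne: "Y ~= Y0"
  and q: "q = pspeed be m Y0 * pnorm be m Y0"
 shows "pact be m Y0 + pspeed be m Y0 * q < pact be m Y + pspeed be m Y * q"
proof -
 define h where "h Y = pact be m Y + pspeed be m Y * q" for Y
 define P where "P Y = pspeed be m Y * pk m Y" for Y
 have dh: "(h has_real_derivative be * X / pspeed be m X * sqrt (2 / be) * (P Y0 - P X)) (at X)" if X: "0 < X" "X < m" for X
 proof -
  note c = pspeed_pos(2)[OF be, of X]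
  have s: "sqrt (2 * be) = be * sqrt (2 / be)"
  proof -
   have "2 * be = be^2 * (2 / be)" using be by (simp add: power2_eq_square)
   then have "sqrt (2 * be) = sqrt (be^2) * sqrt (2 / be)" by (metis real_sqrt_mult)
   then show ?thesis using be by simp
  qed
  have "(h has_real_derivative - sqrt (2 * be) * X * pk m X + be * X / (2 * pspeed be m X) * q) (at X)"
   unfolding h_def[abs_def] by (intro DERIV_add DERIV_cmult_right pact_deriv pspeed_deriv X be)
  moreover have "- sqrt (2 * be) * X * pk m X + be * X / (2 * pspeed be m X) * q =
    be * X / pspeed be m X * sqrt (2 / be) * (P Y0 - P X)"
   unfolding s q pnorm_def P_def using c by (simp add: field_simps)
  ultimately show ?thesis by simp
 qed
 have pos: "0 < be * X / pspeed be m X * sqrt (2 / be)" if "0 < X" for X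
  using that be pspeed_pos(2)[OF be, of X] by simp
 have cont: "continuous_on {s..t} h" if "0 < s" "t < m" for s t
 proof (rule DERIV_continuous_on)
  fix x assume "x : {s..t}"
  then have x: "0 < x" "x < m" using that by auto
  show "(h has_real_derivative be * x / pspeed be m x * sqrt (2 / be) * (P Y0 - P x)) (at x within {s..t})"
   by (rule has_field_derivative_at_within[OF dh[OF x]])
 qed
 have "h Y0 < h Y"
 proof (cases "Y < Y0")
  case True
  show ?thesis
  proof (rule DERIV_neg_imp_decreasing_open[OF True])
   fix X assume X: "Y < X" "X < Y0"
   then have "P Y0 < P X" unfolding P_def using Y Y0 by (intro pspeed_pk_decreasing be) auto
   then have "be * X / pspeed be m X * sqrt (2 / be) * (P Y0 - P X) < 0"
    using pos[of X] X Y by (intro mult_pos_neg) auto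
   then show "\<exists>y. (h has_real_derivative y) (at X) & y < 0" using dh[of X] X Y Y0 by auto
  qed (use cont Y Y0 in auto)
 next
  case False
  then have lt: "Y0 < Y" using ne by simp
  show ?thesis
  proof (rule DERIV_pos_imp_increasing_open[OF lt])
   fix X assume X: "Y0 < X" "X < Y"
   then have "P X < P Y0" unfolding P_def using Y Y0 by (intro pspeed_pk_decreasing be) auto
   then have "0 < be * X / pspeed be m X * sqrt (2 / be) * (P Y0 - P X)"
    using X Y0 by (intro mult_pos_pos[OF pos]) auto
   then show "\<exists>y. (h has_real_derivative y) (at X) & 0 < y" using dh[of X] X Y Y0 by auto
  qed (use cont Y Y0 in auto)
 qed
 then show ?thesis by (simp add: h_def)
qed

subsection \<open>Pulses as elements of the state space\<close>

lemma wd_C1: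
 assumes f: "!!x. (f has_real_derivative f' x) (at x)" and f': "continuous_on UNIV f'"
  and L: "L2_fun f" "L2_fun f'" and B: "!!x. \<bar>f x\<bar> <= B"
 shows "f = Kp (toL2 f - toL2 f')" "wd (toL2 f) (toL2 f')"
proof -
 have cont: "continuous_on UNIV f" by (rule DERIV_continuous_on, rule has_field_derivative_at_within, rule f)
 show K: "f = Kp (toL2 f - toL2 f')"
 proof (rule Kp_represent[OF cont B L])
  fix x y :: real assume xy: "x <= y"
  have "inner (toL2 (indicator {x..y})) (toL2 f') = (\<integral>s. indicator {x..y} s *R f' s \<partial>lborel)"
   by (simp add: inner_toL2 L2_fun_indicator L)
  also have "... = f y - f x"
   using f xy continuous_on_subset[OF f']
   by (intro integral_FTC_atLeastAtMost)
    (auto simp: has_real_derivative_iff_has_vector_derivative has_vector_derivative_at_within)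
  finally show "f y - f x = inner (toL2 (indicator {x..y})) (toL2 f')" by simp
 qed
 have "toL2 f = ka (toL2 f - toL2 f')" unfolding ka_def K[symmetric] ..
 then show "wd (toL2 f) (toL2 f')" using wd_ka[of "toL2 f - toL2 f'"] by simp
qed

context pulse
begin

definition be where "be = - b"
definition ms where "ms = 2 * a / (3 * be)"
definition x0 where "x0 = (SOME z. \<forall>x. V x <= V z)"
definition M where "M = V x0"
text \<open>The quadratic factor \<open>R\<close> of the first integral is symmetric about
  \<open>ms\<close>; its roots are \<open>ms - Y\<close>, the height of the pulse, and
  \<open>ms + Y\<close>.\<close>

definition Y where "Y = ms - M"
definition R where "R s = 1 - c^2 - 2 * a * s / 3 - b * s^2 / 2" for s
definition V2 where "V2 x = (1 - c^2) * V x - a * (V x)^2 - b * (V x) ^ 3" for x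
definition V3 where "V3 x = (1 - c^2 - 2 * a * V x - 3 * b * (V x)^2) * V1 x" for x

lemma cont_V: "continuous_on A V"
 by (rule DERIV_continuous_on, rule has_field_derivative_at_within, rule dV)

lemma cont_V1: "continuous_on A V1"
 by (rule DERIV_continuous_on, rule has_field_derivative_at_within, rule dV1)

lemma V_le: "V x <= M"
proof -
 have "\<exists>z. \<forall>x. V x <= V z" using attains_sup_vanishing[OF cont_V lim pos] by metis
 then show ?thesis unfolding M_def x0_def by (rule someI2_ex) blast
qed

lemma M_pos: "0 < M" using pos by (simp add: M_def)

lemma V1_x0: "V1 x0 = 0"
 using DERIV_local_max[OF dV zero_less_one, of x0] V_le by (simp add: M_def)

lemma V1_R: "(V1 x)^2 = (V x)^2 * R (V x)"
 by (simp add: V1_sq R_def)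

lemma R_V_nonneg: "0 <= R (V x)"
proof -
 have "0 <= (V x)^2 * R (V x)" using V1_R[of x] zero_le_power2[of "V1 x"] by simp
 then show ?thesis using pos[of x] by (simp add: zero_le_mult_iff)
qed

lemma R_M: "R M = 0"
 using V1_R[of x0] V1_x0 M_pos by (simp add: M_def)

lemma V_nonconst: "\<exists>x. V x ~= M"
proof (rule ccontr)
 assume "~ ?thesis"
 then have "V = (%x. M)" by auto
 then have "((%x::real. M) ---> 0) at_top" using lim(1) by simp
 then show False using M_pos by (simp add: tendsto_const_iff)
qed

lemma R_factor: "R s = (M - s) * (2 * a / 3 + b * (M + s) / 2)"
proof -
 have "R s = R s - R M" using R_M by simp
 also have "... = (M - s) * (2 * a / 3 + b * (M + s) / 2)"
  by (simp add: R_def field_simps power2_eq_square)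
 finally show ?thesis .
qed

text \<open>Otherwise \<open>a\<close> and \<open>b\<close> both vanish, then \<open>R\<close>
  vanishes with its root \<open>M\<close>, and a nonzero constant profile contradicts decay.\<close>

lemma be_pos: "0 < be"
proof (rule ccontr)
 assume "~ 0 < be"
 then have "a^2 = 0" "b = 0" using ab zero_le_power2[of a] unfolding be_def by linarith+
 then have "a = 0" "b = 0" by auto
 then have "V1 x = 0" for x using V1_R[of x] R_factor[of "V x"] by simp
 then have "V x = V x0" for x using DERIV_isconst_all[of V x x0] dV by metis
 then show False using V_nonconst by (simp add: M_def)
qed

lemma V_onto:
 assumes "0 < s" "s <= M"
 shows "\<exists>x. V x = s"
proof -
 obtain y where "V y < s"
  using order_tendstoD(2)[OF lim(1) assms(1)] by (auto simp: eventually_at_top_linorder)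
 then have "s : V ` UNIV"
  using connectedD_interval[OF connected_continuous_image[OF cont_V connected_UNIV], of "V y" "V x0" s] assms
  by (auto simp: M_def)
 then show ?thesis by auto
qed

text \<open>The profile takes all values in (0, M], where \<open>R\<close> must be nonnegative; so
  the other root \<open>2 * ms - M\<close> cannot lie below \<open>M\<close>.\<close>

lemma M_le_ms: "M <= ms"
proof -
 have "M <= 2 * ms - M"
 proof (rule dense_le_bounded[OF M_pos])
  fix s assume s: "0 < s" "s < M"
  then have "0 <= (M - s) * (2 * a / 3 + b * (M + s) / 2)"
   using V_onto[of s] R_V_nonneg R_factor[of s] by (metis less_imp_le)
  then have "0 <= 2 * a / 3 + b * (M + s) / 2" using s by (simp add: zero_le_mult_iff)
  then have "- (b * (M + s)) <= 4 * a / 3" by linarith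
  then have "be * (M + s) <= 4 * a / 3" by (simp only: be_def mult_minus_left)
  then have "M + s <= 2 * ms" using be_pos by (simp add: ms_def field_simps)
  then show "s <= 2 * ms - M" by simp
 qed
 then show ?thesis by simp
qed

lemma ms_pos: "0 < ms" using M_le_ms M_pos by simp

lemma be_mult_ms: "be * ms = 2 * a / 3" using be_pos by (simp add: ms_def)

text \<open>The hypothesis on \<open>b\<close> in the form needed for the family: be^2 ms^2 = 4 a^2
  / 9 and a^2 <= 3 be.\<close>

lemma be_ms: "be * ms^2 <= 4 / 3"
proof -
 have "a^2 <= 3 * be" using ab by (simp add: be_def)
 moreover have "be * (be * ms^2) = (2 * a / 3)^2" unfolding be_mult_ms[symmetric] by (simp add: power2_eq_square)
 ultimately have "be * (be * ms^2) <= be * (4 / 3)" by (simp add: power2_eq_square)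
 then show ?thesis using be_pos by simp
qed

lemma R_eq: "R s = be / 2 * ((ms - s)^2 - Y^2)"
proof -
 have "(M - s) * (2 * a / 3 + b * (M + s) / 2) = (M - s) * (be * ms - be * (M + s) / 2)"
  unfolding be_mult_ms[symmetric] by (simp add: be_def)
 also have "... = be / 2 * ((ms - s)^2 - (ms - M)^2)" by (simp add: field_simps power2_eq_square)
 finally show ?thesis unfolding R_factor Y_def .
qed

text \<open>For \<open>Y = 0\<close> the height would be a double root of \<open>R\<close>. Then
  |V'| is bounded by a multiple of \<open>ms - V\<close>, and a profile touching \<open>ms\<close>
  at its peak would be constant.\<close>

lemma Y_pos: "0 < Y"
proof (rule ccontr)
 assume "~ 0 < Y"
 then have M: "M = ms" using M_le_ms by (simp add: Y_def)
 have "ms - V x = 0" for x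
 proof (rule eq_0_if_deriv_bounded[of "%x. ms - V x" "%x. - V1 x" "M * sqrt (be / 2)" x0])
  show "((%x. ms - V x) has_real_derivative - V1 x) (at x)" for x
   using DERIV_diff[OF DERIV_const dV, of ms x] by simp
  show "\<bar>- V1 x\<bar> <= M * sqrt (be / 2) * \<bar>ms - V x\<bar>" for x
  proof -
   have "(V1 x)^2 = (V x)^2 * (be / 2) * (ms - V x)^2" by (simp add: V1_R R_eq Y_def M)
   then have "\<bar>V1 x\<bar> = sqrt ((V x)^2 * (be / 2) * (ms - V x)^2)" by (metis real_sqrt_abs)
   also have "... = V x * sqrt (be / 2) * \<bar>ms - V x\<bar>"
    by (simp only: real_sqrt_mult real_sqrt_abs abs_of_pos[OF pos])
   also have "... <= M * sqrt (be / 2) * \<bar>ms - V x\<bar>"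
    using V_le[of x] be_pos by (intro mult_right_mono) auto
   finally show ?thesis by simp
  qed
  show "ms - V x0 = 0" using M by (simp add: M_def)
 qed
 then show False using V_nonconst M by simp
qed

lemma Y_less: "Y < ms" using M_pos by (simp add: Y_def)

lemma c_eq: "c = pspeed be ms Y" and c_pos: "0 < c"
proof -
 have "1 - c^2 = be / 2 * (ms^2 - Y^2)" using R_eq[of 0] by (simp add: R_def)
 then have "c^2 = 1 - be * ms^2 / 2 + be * Y^2 / 2" by (simp add: algebra_simps)
 then show "c = pspeed be ms Y" unfolding pspeed_def using c_nonneg by (metis real_sqrt_unique)
 then show "0 < c" using pspeed_pos(2)[OF be_pos be_ms] by simp
qed

text \<open>The strictly decreasing logarithmic derivative yields both the sign of V' on either side
  of the peak and the uniqueness of the peak.\<close>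

lemma rh_deriv: "((%x. V1 x / V x) has_real_derivative - (be / 2 * V x * (ms - V x))) (at x)"
proof -
 have "((%x. V1 x / V x) has_real_derivative (V2 x * V x - V1 x * V1 x) / (V x * V x)) (at x)"
  unfolding V2_def by (rule DERIV_divide[OF dV1 dV]) (use pos[of x] in simp)
 moreover have "V1 x * V1 x = (V x)^2 * R (V x)" using V1_R[of x] by (simp add: power2_eq_square)
 moreover have "V2 x * V x - (V x)^2 * R (V x) = - (be / 2 * V x * (ms - V x)) * (V x * V x)"
 proof -
  have "be / 2 * V x * (ms - V x) = V x * ((be * ms) / 2 + b * V x / 2)" by (simp add: be_def field_simps)
  from this[unfolded be_mult_ms] show ?thesis
   unfolding V2_def R_def by (simp only:) (simp add: field_simps power2_eq_square power3_eq_cube)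
 qed
 ultimately show ?thesis using pos[of x] by simp
qed

lemma V_lt_ms: "V x < ms" using V_le[of x] Y_pos by (simp add: Y_def)

lemma rh_decreasing: "x < y ==> V1 y / V y < V1 x / V x"
proof (rule DERIV_neg_imp_decreasing[of x y "%x. V1 x / V x"])
 fix z
 have "- (be / 2 * V z * (ms - V z)) < 0" using be_pos pos[of z] V_lt_ms[of z] by simp
 then show "\<exists>y. ((%x. V1 x / V x) has_real_derivative y) (at z) & y < 0" using rh_deriv by blast
qed simp

lemma V1_sign: "x0 <= x ==> V1 x <= 0" "x <= x0 ==> 0 <= V1 x"
proof -
 show "V1 x <= 0" if "x0 <= x"
  using rh_decreasing[of x0 x] that pos[of x] V1_x0 by (cases "x = x0") (auto simp: divide_less_0_iff)
 show "0 <= V1 x" if "x <= x0"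
  using rh_decreasing[of x x0] that pos[of x] V1_x0 by (cases "x = x0") (auto simp: zero_less_divide_iff)
qed

lemma abs_V1: "\<bar>V1 x\<bar> = V x * sqrt (R (V x))"
proof -
 have "\<bar>V1 x\<bar> = sqrt ((V x)^2 * R (V x))" by (metis V1_R real_sqrt_abs)
 then show ?thesis using pos[of x] by (simp add: real_sqrt_mult)
qed

text \<open>V^2 has an explicit primitive in terms of \<open>V\<close> and the rescaled logarithmic
  derivative \<open>r\<close>, which satisfies r^2 = (ms - V)^2 - Y^2. Hence \<open>r\<close> tends
  to \<open>pL ms Y\<close> on the left and to its negative on the right, and the difference of the
  limits of the primitive is \<open>pnorm\<close>.\<close>

lemma V_norm: "L2_fun V" "(norm (toL2 V))^2 = pnorm be ms Y"
proof -
 define k where "k = sqrt (2 / be)"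
 have k2: "0 < k" "k * k = 2 / be" using be_pos by (simp_all add: k_def)
 then have k: "0 < k" "k * k = 2 / be" "be * k * k = 2" using be_pos by (simp_all add: mult.assoc)
 define r where "r x = k * (V1 x / V x)" for x
 have r_sq: "(r x)^2 = (ms - V x)^2 - Y^2" for x
 proof -
  have "(r x)^2 = (k * k) * ((V1 x)^2 / (V x)^2)" by (simp add: r_def power2_eq_square)
  also have "(V1 x)^2 / (V x)^2 = R (V x)" using pos[of x] by (simp add: V1_R)
  finally show ?thesis using be_pos by (simp add: k R_eq)
 qed
 have arg: "0 < ms - V x - r x" for x
 proof -
  have "(r x)^2 < (ms - V x)^2" unfolding r_sq using Y_pos by simp
  then have "\<bar>r x\<bar> < \<bar>ms - V x\<bar>" by (metis abs_ge_zero power2_abs power2_less_imp_less)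
  then show ?thesis using V_lt_ms[of x] by linarith
 qed
 have dr: "(r has_real_derivative - (V x * (ms - V x) / k)) (at x)" for x
 proof -
  have "(r has_real_derivative k * - (be / 2 * V x * (ms - V x))) (at x)"
   unfolding r_def[abs_def] by (intro DERIV_cmult rh_deriv)
  moreover have "k * - (be / 2 * V x * (ms - V x)) = - (V x * (ms - V x) / k)"
  proof -
   have "k * (be / 2) = 1 / k" using k by (simp add: field_simps)
   then show ?thesis by (metis (no_types, lifting) minus_mult_right mult.assoc mult.left_neutral times_divide_eq_left)
  qed
  ultimately show ?thesis by simp
 qed
 \<comment> \<open>\<open>ms - V - r\<close> has logarithmic derivative V / k, and k r has
   derivative - V (ms - V); in this combination only V^2 survives.\<close>
 define P where "P x = k * r x + (ms * k) * ln (ms - V x - r x)" for x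
 have dP: "(P has_real_derivative (V x)\<^sup>2) (at x)" for x
 proof -
  have "((%x. ms - V x - r x) has_real_derivative 0 - V1 x - - (V x * (ms - V x) / k)) (at x)"
   by (intro DERIV_diff DERIV_const dV dr)
  from DERIV_chain2[OF DERIV_ln_divide[OF arg] this]
  have "(P has_real_derivative k * - (V x * (ms - V x) / k) +
    (ms * k) * (1 / (ms - V x - r x) * (0 - V1 x - - (V x * (ms - V x) / k)))) (at x)"
   unfolding P_def[abs_def] by (intro DERIV_add DERIV_cmult dr)
  moreover have "0 - V1 x - - (V x * (ms - V x) / k) = V x / k * (ms - V x - r x)"
   using k pos[of x] by (simp add: r_def field_simps)
  moreover have "(ms * k) * (1 / A * (V x / k * A)) = ms * V x" if "0 < A" for A
   using k that by simp
  note e1 = this[OF arg[of x]]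
  have e2: "k * - (V x * (ms - V x) / k) = - (V x * (ms - V x))" using k by simp
  moreover have "k * - (V x * (ms - V x) / k) + (ms * k) * (1 / (ms - V x - r x) * (V x / k * (ms - V x - r x))) = (V x)^2"
   unfolding e1 e2 by (simp add: algebra_simps power2_eq_square)
  ultimately show ?thesis by (simp only:)
 qed
 let ?L = "pL ms Y"
 note L = pL_pos[OF Y_pos Y_less] pL_sq[OF Y_pos Y_less]
 have Lm: "?L < ms"
 proof -
  have "?L^2 < ms^2" using L(2) Y_pos by simp
  then show ?thesis using ms_pos by (simp add: power2_less_imp_less)
 qed
 have r_right: "r x = - sqrt ((ms - V x)^2 - Y^2)" if "x0 <= x" for x
 proof -
  have "r x <= 0" using V1_sign(1)[OF that] pos[of x] k(1) by (simp add: r_def mult_le_0_iff divide_le_0_iff)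
  then show ?thesis using r_sq[of x] by (metis abs_of_nonpos minus_minus real_sqrt_abs)
 qed
 have r_left: "r x = sqrt ((ms - V x)^2 - Y^2)" if "x <= x0" for x
 proof -
  have "0 <= r x" using V1_sign(2)[OF that] pos[of x] k(1) by (simp add: r_def)
  then show ?thesis using r_sq[of x] by (metis abs_of_nonneg real_sqrt_abs)
 qed
 have "((%x. - sqrt ((ms - V x)^2 - Y^2)) ---> - sqrt ((ms - 0)^2 - Y^2)) at_top"
  by (intro tendsto_intros lim)
 moreover have "\<forall>\<^sub>F x in at_top. - sqrt ((ms - V x)^2 - Y^2) = r x"
  using eventually_ge_at_top[of x0] by eventually_elim (simp add: r_right)
 ultimately have "(r ---> - sqrt ((ms - 0)^2 - Y^2)) at_top" by (rule Lim_transform_eventually)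
 then have rt: "(r ---> - ?L) at_top" by (simp add: pL_def)
 have "((%x. sqrt ((ms - V x)^2 - Y^2)) ---> sqrt ((ms - 0)^2 - Y^2)) at_bot"
  by (intro tendsto_intros lim)
 moreover have "\<forall>\<^sub>F x in at_bot. sqrt ((ms - V x)^2 - Y^2) = r x"
  using eventually_le_at_bot[of x0] by eventually_elim (simp add: r_left)
 ultimately have "(r ---> sqrt ((ms - 0)^2 - Y^2)) at_bot" by (rule Lim_transform_eventually)
 then have rb: "(r ---> ?L) at_bot" by (simp add: pL_def)
 have Pt: "(P ---> k * - ?L + (ms * k) * ln (ms - 0 - - ?L)) at_top"
  unfolding P_def[abs_def] using L(1) ms_pos by (intro tendsto_intros lim rt) simp
 have Pb: "(P ---> k * ?L + (ms * k) * ln (ms - 0 - ?L)) at_bot"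
  unfolding P_def[abs_def] using Lm by (intro tendsto_intros lim rb) simp
 have cont: "isCont (%x. (V x)^2) x" for x
  using cont_V[of UNIV] by (intro continuous_intros) (auto simp: continuous_on_eq_continuous_at)
 have tb: "((P \<circ> real_of_ereal) ---> k * ?L + (ms * k) * ln (ms - 0 - ?L)) (at_right (- \<infinity>))"
  using Pb by (simp add: ereal_tendsto_simps)
 have tt: "((P \<circ> real_of_ereal) ---> k * - ?L + (ms * k) * ln (ms - 0 - - ?L)) (at_left \<infinity>)"
  using Pt by (simp add: ereal_tendsto_simps)
 note FTC = interval_integral_FTC_nonneg[of "- \<infinity>" \<infinity> P "%x. (V x)^2", OF _ dP cont _ tb tt]
 have "set_integrable lborel (einterval (- \<infinity>) \<infinity>) (%x. (V x)^2)" using FTC(1) by simp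
 then have int: "integrable lborel (%x. (V x)^2)" by (simp add: set_integrable_def einterval_def)
 then show LV: "L2_fun V" unfolding L2_fun_def
  using borel_measurable_continuous_onI[OF cont_V] by simp
 have "(LBINT x=-\<infinity>..\<infinity>. (V x)^2) = (k * - ?L + (ms * k) * ln (ms - 0 - - ?L)) - (k * ?L + (ms * k) * ln (ms - 0 - ?L))"
  using FTC(2) by simp
 then have "(\<integral>x. (V x)^2 \<partial>lborel) = ms * k * (ln (ms + ?L) - ln (ms - ?L)) - 2 * (k * ?L)"
  by (simp add: interval_lebesgue_integral_def set_lebesgue_integral_def einterval_def algebra_simps)
 moreover have "ln (ms - ?L) = 2 * ln Y - ln (ms + ?L)"
 proof -
  have "ln ((ms - ?L) * (ms + ?L)) = ln (ms - ?L) + ln (ms + ?L)"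
   using Lm L(1) ms_pos by (intro ln_mult_pos) auto
  moreover have "(ms - ?L) * (ms + ?L) = Y^2" using L(2) by (simp add: algebra_simps power2_eq_square)
  ultimately show ?thesis using Y_pos by (simp add: ln_realpow)
 qed
 ultimately have "(\<integral>x. (V x)^2 \<partial>lborel) = pnorm be ms Y"
  by (simp add: pnorm_def pk_def plam_def k_def algebra_simps)
 then show "(norm (toL2 V))^2 = pnorm be ms Y" using LV by (simp add: norm_toL2_sq)
qed

lemma dV2: "(V1 has_real_derivative V2 x) (at x)" unfolding V2_def by (rule dV1)

lemma dV3: "(V2 has_real_derivative V3 x) (at x)"
proof -
 have "(V2 has_real_derivative (1 - c^2) * V1 x - a * (2 * V x * V1 x) - b * (3 * (V x)^2 * V1 x)) (at x)"
  unfolding V2_def[abs_def] by (rule derivative_eq_intros dV refl | simp)+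
 then show ?thesis by (simp add: V3_def algebra_simps)
qed

lemma cont_V2: "continuous_on A V2" and cont_V3: "continuous_on A V3"
 unfolding V2_def[abs_def] V3_def[abs_def] by (intro continuous_intros cont_V cont_V1)+

lemma poly_V_bounded:
 assumes "continuous_on UNIV (q :: real => real)"
 obtains C where "0 < C" "!!x. \<bar>q (V x)\<bar> <= C"
 using continuous_bounded_on_ball[OF assms, of M] V_le pos by (metis abs_of_pos)

lemma V_Hk: "L2_fun V1" "L2_fun V2" "L2_fun V3" "\<exists>B. \<forall>x. \<bar>V1 x\<bar> <= B" "\<exists>B. \<forall>x. \<bar>V2 x\<bar> <= B"
proof -
 have bd: "L2_fun (%x. q (V x) * f x)" if q: "continuous_on UNIV q" and f: "L2_fun f" for q f
 proof -
  obtain C where C: "!!x. \<bar>q (V x)\<bar> <= C" using poly_V_bounded[OF q] by blast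
  have "continuous_on UNIV (%x. q (V x))" by (rule continuous_on_compose2[OF q cont_V]) auto
  from L2_fun_bounded_mult[OF f borel_measurable_continuous_onI[OF this] C] show ?thesis .
 qed
 have cR: "continuous_on UNIV (%s. sqrt (R s))" unfolding R_def by (intro continuous_intros) auto
 have abs: "\<bar>V1 x\<bar> <= \<bar>sqrt (R (V x)) * V x\<bar>" for x
  using abs_V1[of x] by (simp add: mult.commute)
 show L1: "L2_fun V1"
  by (rule L2_fun_bound[OF bd[OF cR V_norm(1)] borel_measurable_continuous_onI[OF cont_V1] abs])
 have V2e: "V2 x = (1 - c^2 - a * V x - b * (V x)^2) * V x" for x
  by (simp add: V2_def algebra_simps power2_eq_square power3_eq_cube)
 have "continuous_on UNIV (%s::real. 1 - c^2 - a * s - b * s^2)" by (intro continuous_intros)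
 from bd[OF this V_norm(1)] show "L2_fun V2" unfolding V2e[abs_def] .
 have "continuous_on UNIV (%s::real. 1 - c^2 - 2 * a * s - 3 * b * s^2)" by (intro continuous_intros)
 from bd[OF this L1] show "L2_fun V3" unfolding V3_def[abs_def] .
 have "continuous_on UNIV (%s. s * sqrt (R s))" by (intro continuous_intros cR)
 from poly_V_bounded[OF this] show "\<exists>B. \<forall>x. \<bar>V1 x\<bar> <= B" using abs_V1 by (metis abs_abs)
 have "continuous_on UNIV (%s::real. (1 - c^2) * s - a * s^2 - b * s ^ 3)" by (intro continuous_intros)
 from poly_V_bounded[OF this] show "\<exists>B. \<forall>x. \<bar>V2 x\<bar> <= B" unfolding V2_def by metis
qed

definition G where "G = toL2 V - toL2 V1"

lemma wd_V: "wd (toL2 V) (toL2 V1)" "wd (toL2 V1) (toL2 V2)" "wd (toL2 V2) (toL2 V3)" and Kp_G: "Kp G = V"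
proof -
 have "\<bar>V x\<bar> <= M" for x using V_le pos[of x] by simp
 note 1 = wd_C1[OF dV cont_V1 V_norm(1) V_Hk(1) this]
 show "wd (toL2 V) (toL2 V1)" "Kp G = V" using 1 by (simp_all add: G_def)
 show "wd (toL2 V1) (toL2 V2)" using wd_C1(2)[OF dV2 cont_V2 V_Hk(1,2)] V_Hk(4) by blast
 show "wd (toL2 V2) (toL2 V3)" using wd_C1(2)[OF dV3 cont_V3 V_Hk(2,3)] V_Hk(5) by blast
qed

lemma ka_G: "ka G = toL2 V" by (simp add: ka_def Kp_G)

lemma in_H_V: "in_H 3 V" "hder 3 V 1 = toL2 V1"
proof -
 define d where "d j = (if j = 0 then toL2 V else if j = 1 then toL2 V1 else if j = 2 then toL2 V2 else toL2 V3)" for j :: nat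
 have "wd (d j) (d (Suc j))" if "j < 3" for j
 proof -
  have "j = 0 | j = 1 | j = 2" using that by auto
  then show ?thesis using wd_V by (auto simp: d_def)
 qed
 then have "in_H 3 V" "hder 3 V 1 = d 1"
  using in_H_if_wd(1)[of V d 3] in_H_if_wd(2)[of V d 3 1] V_norm(1) by (simp_all add: d_def)
 then show "in_H 3 V" "hder 3 V 1 = toL2 V1" by (simp_all add: d_def)
qed

end

subsection \<open>Calibration of the action\<close>

lemma antiderivative_exists:
 fixes f :: "real => real"
 assumes f: "continuous_on UNIV f"
 obtains F where "!!x. (F has_real_derivative f x) (at x)"
proof -
 define F where "F x = integral {0..x} f - integral {x..0} f" for x
 have "(F has_real_derivative f x) (at x)" for x
 proof -
  define N where "N = \<bar>x\<bar> + 1"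
  have i: "f integrable_on {s..t}" for s t
   by (rule integrable_continuous_interval[OF continuous_on_subset[OF f]]) auto
  have eq: "F u = integral {- N..u} f - integral {- N..0} f" if "u : {- N..N}" for u
  proof (cases "0 <= u")
   case True
   have "integral {- N..0} f + integral {0..u} f = integral {- N..u} f"
    by (rule Henstock_Kurzweil_Integration.integral_combine) (use True i N_def in auto)
   moreover have "integral {u..0} f = 0" using True by (cases "u = 0") auto
   ultimately show ?thesis by (simp add: F_def)
  next
   case False
   have "integral {- N..u} f + integral {u..0} f = integral {- N..0} f"
    by (rule Henstock_Kurzweil_Integration.integral_combine) (use False that i in auto)
   then show ?thesis using False by (simp add: F_def)
  qed
  have x: "x : {- N..N}" "- N < x" "x < N" by (auto simp: N_def)
  have "((%u. integral {- N..u} f) has_real_derivative f x) (at x within {- N..N})"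
   by (rule integral_has_real_derivative[OF continuous_on_subset[OF f] x(1)]) simp
  from DERIV_diff[OF this DERIV_const[of "integral {- N..0} f"]]
  have "((%u. integral {- N..u} f - integral {- N..0} f) has_real_derivative f x) (at x within {- N..N})" by simp
  then have "(F has_real_derivative f x) (at x within {- N..N})"
   by (rule has_field_derivative_transform_within[OF _ zero_less_one x(1)]) (simp add: eq)
  then show ?thesis using x by (simp add: at_within_Icc_at)
 qed
 then show ?thesis by (rule that)
qed

lemma FTC_DERIV:
 fixes F f :: "real => real"
 assumes "!!x. (F has_real_derivative f x) (at x)" "s <= t"
 shows "integral {s..t} f = F t - F s"
 by (rule integral_unique, rule fundamental_theorem_of_calculus[OF assms(2)])
  (simp add: has_real_derivative_iff_has_vector_derivative[symmetric] has_field_derivative_at_within[OF assms(1)])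

text \<open>\<open>v\<^sub>x = - psi v\<close> is the equation of the decreasing half of the pulse of height \<open>m - Y\<close>.\<close>

definition psi :: "real => real => real => real => real" where
 "psi be m Y s = s * sqrt (max 0 (be / 2 * ((m - s)^2 - Y^2)))"

lemma continuous_on_psi: "continuous_on A (psi be m Y)"
 unfolding psi_def[abs_def] by (intro continuous_intros)

text \<open>With y = m - s the integrand is a multiple of (m - y) sqrt (y^2 - Y^2), whose elementary
  primitive is \<open>A\<close>. It is half the action because a pulse passes each height
  twice.\<close>

lemma psi_integral:
 assumes be: "0 < be" and Y: "0 < Y" "Y < m"
 shows "integral {0..m - Y} (psi be m Y) = pact be m Y / 2"
proof -
 define q where "q y = sqrt (y^2 - Y^2)" for y
 define A where "A y = m / 2 * (y * q y - Y^2 * ln (y + q y)) - (1 / 3) * (q y) ^ 3" for y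
 define F where "F s = - sqrt (be / 2) * A (m - s)" for s
 have dA: "(A has_real_derivative (m - y) * q y) (at y)" if y: "Y < y" for y
 proof -
  have p: "0 < y^2 - Y^2" using Y y by (simp add: power_strict_mono)
  then have q0: "0 < q y" and q2: "q y * q y = y * y - Y * Y" by (auto simp: q_def power2_eq_square)
  have "((%y. y^2 - Y^2) has_real_derivative 2 * y) (at y)" by (rule derivative_eq_intros refl | simp)+
  from DERIV_chain2[OF DERIV_real_sqrt[OF p] this]
  have dq: "(q has_real_derivative y / q y) (at y)"
   unfolding q_def[abs_def] by (rule DERIV_cong) (use p in \<open>simp add: field_simps\<close>)
  have yq: "0 < y + q y" using q0 Y y by simp
  have dln: "((%y. ln (y + q y)) has_real_derivative 1 / q y) (at y)"
   by (rule DERIV_cong[OF DERIV_chain2[OF DERIV_ln_divide[OF yq] DERIV_add[OF DERIV_ident dq]]])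
    (use q0 yq in \<open>simp add: field_simps\<close>)
  have d3: "((%y. (q y) ^ 3) has_real_derivative 3 * (q y * y)) (at y)"
   by (rule DERIV_cong[OF DERIV_power[OF dq, of 3]]) (use q0 in \<open>simp add: power2_eq_square\<close>)
  have "(A has_real_derivative m / 2 * (1 * q y + y / q y * y - Y^2 * (1 / q y)) - (1 / 3) * (3 * (q y * y))) (at y)"
   unfolding A_def[abs_def]
   by (rule DERIV_diff[OF DERIV_cmult[OF DERIV_diff[OF DERIV_mult[OF DERIV_ident dq] DERIV_cmult[OF dln]]] DERIV_cmult[OF d3]])
  moreover have "y / q y * y - Y^2 * (1 / q y) = q y"
  proof -
   have "y / q y * y - Y^2 * (1 / q y) = (y * y - Y * Y) / q y" by (simp add: diff_divide_distrib power2_eq_square)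
   also have "... = q y" unfolding q2[symmetric] using q0 by simp
   finally show ?thesis .
  qed
  then have "m / 2 * (1 * q y + y / q y * y - Y^2 * (1 / q y)) - (1 / 3) * (3 * (q y * y)) = (m - y) * q y"
   by (simp add: algebra_simps add_diff_eq[symmetric])
  ultimately show ?thesis by simp
 qed
 have "(psi be m Y has_integral F (m - Y) - F 0) {0..m - Y}"
 proof (rule fundamental_theorem_of_calculus_interior)
  show "0 <= m - Y" using Y by simp
  have "m - s + q (m - s) ~= 0" if "s : {0..m - Y}" for s
  proof -
   have "0 <= (m - s)^2 - Y^2" using that Y power_mono[of Y "m - s" 2] by auto
   then have "0 <= q (m - s)" by (simp add: q_def)
   moreover have "0 < m - s" using that Y by auto
   ultimately show ?thesis by linarith
  qed
  moreover have "continuous_on {0..m - Y} (%s. q (m - s))" unfolding q_def by (intro continuous_intros)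
  ultimately show "continuous_on {0..m - Y} F"
   unfolding F_def[abs_def] A_def by (intro continuous_intros) auto
  fix s assume "s : {0<..<m - Y}"
  then have y: "Y < m - s" by simp
  have "((%s. m - s) has_real_derivative - 1) (at s)" by (rule derivative_eq_intros refl | simp)+
  from DERIV_cmult[OF DERIV_chain2[OF dA[OF y] this], of "- sqrt (be / 2)"]
  have "(F has_real_derivative - sqrt (be / 2) * ((m - (m - s)) * q (m - s) * - 1)) (at s)"
   unfolding F_def[abs_def] .
  moreover have "- sqrt (be / 2) * ((m - (m - s)) * q (m - s) * - 1) = psi be m Y s"
  proof -
   have "0 <= (m - s)^2 - Y^2" using y Y power_mono[of Y "m - s" 2] by auto
   then have "max 0 (be / 2 * ((m - s)^2 - Y^2)) = be / 2 * ((m - s)^2 - Y^2)"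
    using be by (intro max_absorb2 mult_nonneg_nonneg) auto
   then show ?thesis by (simp only: psi_def real_sqrt_mult q_def) simp
  qed
  ultimately show "(F has_vector_derivative psi be m Y s) (at s)"
   by (simp add: has_real_derivative_iff_has_vector_derivative)
 qed
 moreover have "F (m - Y) - F 0 = pact be m Y / 2"
 proof -
  have qY: "q Y = 0" "q m = pL m Y" by (auto simp: q_def pL_def)
  have "sqrt (be / 2) = sqrt (2 * be) / 2"
  proof -
   have "be / 2 = (2 * be) / 2^2" by simp
   then have "sqrt (be / 2) = sqrt (2 * be) / sqrt (2^2)" by (metis real_sqrt_divide)
   then show ?thesis by simp
  qed
  then have s2: "sqrt (2 * be) = 2 * sqrt (be / 2)" by simp
  show ?thesis
   unfolding F_def A_def pact_def plam_def s2 by (simp add: qY field_simps power2_eq_square)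
 qed
 ultimately show ?thesis by (simp add: integral_unique)
qed

definition sg :: "real => real" where "sg x = (if 0 <= x then 1 else - 1)"

text \<open>The pulse with peak \<open>x1\<close> satisfies v' = - calF, the sign change at
  \<open>x1\<close> distinguishing its rising from its falling half; \<open>resid\<close> measures
  by how much a state fails this equation.\<close>

definition calF :: "real => real => real => real => l2 => real => real" where
 "calF be m Y x1 g x = sg (x - x1) * psi be m Y (Kp g x)"

lemma psi_bound:
 obtains C where "0 <= C" "!!s. \<bar>s\<bar> <= B ==> \<bar>psi be m Y s\<bar> <= C * \<bar>s\<bar>"
proof -
 have "continuous_on UNIV (%s. sqrt (max 0 (be / 2 * ((m - s)^2 - Y^2))))" by (intro continuous_intros)
 from continuous_bounded_on_ball[OF this, of B]
 obtain C where C: "0 < C" "!!s. \<bar>s\<bar> <= B ==> \<bar>sqrt (max 0 (be / 2 * ((m - s)^2 - Y^2)))\<bar> <= C" by blast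
 have "\<bar>psi be m Y s\<bar> <= C * \<bar>s\<bar>" if "\<bar>s\<bar> <= B" for s
  unfolding psi_def abs_mult using mult_left_mono[OF C(2)[OF that], of "\<bar>s\<bar>"] by (simp add: mult.commute)
 then show ?thesis using C(1) that[of C] by simp
qed

lemma sg_measurable [measurable]: "sg : borel_measurable borel"
 unfolding sg_def[abs_def] by measurable

lemma L2_fun_calF: "L2_fun (calF be m Y x1 g)"
proof -
 obtain C where C: "0 <= C" "!!s. \<bar>s\<bar> <= norm g ==> \<bar>psi be m Y s\<bar> <= C * \<bar>s\<bar>" using psi_bound by blast
 have [measurable]: "psi be m Y : borel_measurable borel"
  by (rule borel_measurable_continuous_onI[OF continuous_on_psi])
 show ?thesis
 proof (rule L2_fun_bound[of "%x. C * Kp g x"])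
  show "L2_fun (%x. C * Kp g x)" by (intro L2_fun_scale) simp
  show "calF be m Y x1 g : borel_measurable borel" unfolding calF_def[abs_def] by measurable
  show "\<bar>calF be m Y x1 g x\<bar> <= \<bar>C * Kp g x\<bar>" for x
   using C(1) C(2)[OF abs_Kp_le, of x] by (simp add: calF_def sg_def abs_mult)
 qed
qed

definition resid :: "real => real => real => real => l2 => l2" where
 "resid be m Y x1 g = ka g - g + toL2 (calF be m Y x1 g)"

lemma psi_top: "psi be m Y (m - Y) = 0" by (simp add: psi_def)

text \<open>On each side of \<open>x1\<close> the integrand is, up to sign, the derivative of
  \<open>Ph\<close> composed with v, where \<open>Ph\<close> is a primitive of \<open>psi\<close>.
  The boundary values are those at 0 and at the height \<open>m - Y\<close>, each counted
  twice.\<close>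

lemma inner_calF:
 assumes be: "0 < be" and Y: "0 < Y" "Y < m" and x1: "Kp g x1 = m - Y"
 shows "inner (toL2 (calF be m Y x1 g)) (ka g - g) = - pact be m Y"
proof -
 let ?f = "calF be m Y x1 g" and ?v = "Kp g" and ?ps = "psi be m Y"
 obtain Ph where Ph: "!!s. (Ph has_real_derivative ?ps s) (at s)"
  using antiderivative_exists[OF continuous_on_psi] by blast
 have cPh: "isCont Ph s" for s by (rule DERIV_isCont[OF Ph])
 have eq: "toL2 (%s. indicator {- real n..real n} s * fn (toL2 ?f) s) =
   toL2 (%s. indicator {x1..real n} s * ?ps (?v s)) - toL2 (%s. indicator {- real n..x1} s * ?ps (?v s))"
  if n: "\<bar>x1\<bar> <= real n" for n :: nat
 proof -
  note L = L2_fun_comp_Kp[OF continuous_on_psi]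
  have bd: "L2_fun (%s. indicator {- real n..real n} s * h s)" if "L2_fun h" for h
   by (rule L2_fun_bounded_mult[OF that, of _ 1]) (auto simp: indicator_def)
  have ae: "AE s in lborel. fn (toL2 ?f) s = ?f s"
   using toL2_eq_iff[OF L2_fun_fn[of "toL2 ?f"] L2_fun_calF[of be m Y x1 g]] by simp
  have "AE s in lborel. indicator {- real n..real n} s * fn (toL2 ?f) s =
    indicator {x1..real n} s * ?ps (?v s) - indicator {- real n..x1} s * ?ps (?v s)"
   using ae
  proof eventually_elim
   case (elim s)
   have "indicator {- real n..real n} s * ?f s = indicator {x1..real n} s * ?ps (?v s) - indicator {- real n..x1} s * ?ps (?v s)"
    using n by (cases "s = x1") (auto simp: calF_def sg_def indicator_def x1 psi_top)
   then show ?case using elim by simp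
  qed
  then have "toL2 (%s. indicator {- real n..real n} s * fn (toL2 ?f) s) =
    toL2 (%s. indicator {x1..real n} s * ?ps (?v s) - indicator {- real n..x1} s * ?ps (?v s))"
   by (subst toL2_eq_iff[OF bd[OF L2_fun_fn] L2_fun_diff[OF L L]])
  then show ?thesis by (simp add: toL2_diff[OF L L])
 qed
 have val: "inner (toL2 (%s. indicator {- real n..real n} s * fn (toL2 ?f) s)) (ka g - g) =
   Ph (?v (real n)) + Ph (?v (- real n)) - 2 * Ph (m - Y)" if n: "\<bar>x1\<bar> <= real n" for n :: nat
 proof -
  have "inner (toL2 (%s. indicator {x1..real n} s * ?ps (?v s))) (ka g - g) = Ph (?v (real n)) - Ph (?v x1)"
   by (rule Kp_chain_rule[OF Ph continuous_on_psi]) (use n in auto)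
  moreover have "inner (toL2 (%s. indicator {- real n..x1} s * ?ps (?v s))) (ka g - g) = Ph (?v x1) - Ph (?v (- real n))"
   by (rule Kp_chain_rule[OF Ph continuous_on_psi]) (use n in auto)
  ultimately show ?thesis unfolding eq[OF n] by (simp add: inner_diff_left x1)
 qed
 have "(%n. ?v (real n)) >>> 0" by (rule filterlim_compose[OF Kp_tendsto_0(1) filterlim_real_sequentially])
 moreover have "(%n. ?v (- real n)) >>> 0"
  by (rule filterlim_compose[OF Kp_tendsto_0(2) filterlim_compose[OF filterlim_uminus_at_bot_at_top filterlim_real_sequentially]])
 ultimately have "(%n. Ph (?v (real n)) + Ph (?v (- real n)) - 2 * Ph (m - Y)) >>> Ph 0 + Ph 0 - 2 * Ph (m - Y)"
  by (intro tendsto_diff tendsto_add tendsto_const isCont_tendsto_compose[OF cPh])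
 moreover have "\<forall>\<^sub>F n in sequentially. Ph (?v (real n)) + Ph (?v (- real n)) - 2 * Ph (m - Y) =
   inner (toL2 (%s. indicator {- real n..real n} s * fn (toL2 ?f) s)) (ka g - g)"
 proof -
  obtain N :: nat where N: "\<bar>x1\<bar> <= real N" using real_arch_simple by blast
  show ?thesis
   by (rule eventually_sequentiallyI[of N]) (rule val[symmetric], use N in linarith)
 qed
 ultimately have "(%n. inner (toL2 (%s. indicator {- real n..real n} s * fn (toL2 ?f) s)) (ka g - g)) >>>
   Ph 0 + Ph 0 - 2 * Ph (m - Y)"
  by (rule Lim_transform_eventually)
 from LIMSEQ_unique[OF inner_indicator_tendsto this]
 have "inner (toL2 ?f) (ka g - g) = - 2 * (Ph (m - Y) - Ph 0)" by simp
 also have "Ph (m - Y) - Ph 0 = pact be m Y / 2"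
  using FTC_DERIV[OF Ph, of 0 "m - Y"] psi_integral[OF assms(1-3)] Y by simp
 finally show ?thesis by simp
qed

lemma norm_calF:
 assumes b: "be = - b" and be: "0 < be" "be * m^2 <= 4 / 3" "be * m = 2 * a / 3" and Y: "0 < Y"
  and le: "!!x. Kp g x <= m - Y" and c: "c = pspeed be m Y"
 shows "(norm (toL2 (calF be m Y x1 g)))^2 = (1 - c^2) * (norm (ka g))^2 - (2 * a / 3) * inner (ka g) (mulK g (ka g)) -
  (b / 2) * inner (ka g) (mulK g (mulK g (ka g)))"
proof -
 let ?f = "calF be m Y x1 g"
 \<comment> \<open>The square of \<open>calF\<close> is v times this cubic in v. Writing it with
   \<open>pfun\<close> makes \<open>pfun_toL2\<close> applicable; the summand
   \<open>2 - c\<^sup>2\<close> turns the linear coefficient - 1 of \<open>pfun\<close> into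
   \<open>1 - c\<^sup>2\<close>.\<close>
 define p where "p x = pfun (- (2 * a / 3)) (be / 2) (Kp g x) + (2 - c^2) * Kp g x" for x
 note P = pfun_toL2[OF L2_fun_Kp[of g] ka_def[symmetric], of "- (2 * a / 3)" "be / 2"]
 have Lp: "L2_fun p" unfolding p_def[abs_def] by (intro L2_fun_add P L2_fun_scale) simp
 have tp: "toL2 p = pK (- (2 * a / 3)) (be / 2) g + (2 - c^2) *R ka g"
  unfolding p_def[abs_def] by (simp add: toL2_add[OF P(1) L2_fun_scale[OF L2_fun_Kp]] P(2) toL2_scale[OF L2_fun_Kp] ka_def)
 have pt: "(?f x)^2 = Kp g x * p x" for x
 proof -
  let ?v = "Kp g x"
  have "Y^2 <= (m - ?v)^2" using le[of x] Y by (intro power_mono) auto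
  then have "0 <= be / 2 * ((m - ?v)^2 - Y^2)" using be by simp
  then have "(?f x)^2 = ?v^2 * (be / 2 * ((m - ?v)^2 - Y^2))"
   by (simp add: calF_def sg_def psi_def power_mult_distrib)
  also have "be / 2 * ((m - ?v)^2 - Y^2) = (1 - c^2) - (2 * a / 3) * ?v + be / 2 * ?v^2"
   unfolding c pspeed_pos(3)[OF be(1,2)] be(3)[symmetric] by (simp add: field_simps power2_eq_square)
  also have "?v^2 * ... = ?v * p x"
   by (simp add: p_def pfun_def algebra_simps power2_eq_square power3_eq_cube)
  finally show ?thesis .
 qed
 have "(norm (toL2 ?f))^2 = (\<integral>x. Kp g x * p x \<partial>lborel)" by (simp add: norm_toL2_sq[OF L2_fun_calF] pt)
 also have "... = inner (ka g) (toL2 p)" by (simp add: ka_def inner_toL2[OF L2_fun_Kp Lp])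
 also have "... = (1 - c^2) * (norm (ka g))^2 - (2 * a / 3) * inner (ka g) (mulK g (ka g)) -
   (b / 2) * inner (ka g) (mulK g (mulK g (ka g)))"
  unfolding tp pK_def b power2_norm_eq_inner by (simp add: inner_simps algebra_simps)
 finally show ?thesis .
qed

text \<open>A Bogomolny square completion. In the square of v' + calF, the square of
  \<open>calF\<close> reproduces the terms of the energy in v alone and the cross term is the
  constant action; the square of u + c v absorbs the momentum. The maximum of v must be exactly
  \<open>m - Y\<close>: then \<open>psi\<close> needs no truncation along v, and it vanishes at the
  peak.\<close>

lemma calibration:
 assumes b: "be = - b" and be: "0 < be" "be * m^2 <= 4 / 3" "be * m = 2 * a / 3" and Y: "0 < Y" "Y < m"
  and le: "!!x. Kp (fst w) x <= m - Y" and x1: "Kp (fst w) x1 = m - Y" and c: "c = pspeed be m Y"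
 shows "energy a b w + c * momentum w =
  (norm (snd w + c *R ka (fst w)))^2 / 2 + pact be m Y + (norm (resid be m Y x1 (fst w)))^2 / 2"
proof -
 obtain g u where w: "w = (g, u)" by (cases w)
 let ?F = "toL2 (calF be m Y x1 g)"
 have 1: "(norm (resid be m Y x1 g))^2 = (norm (ka g - g))^2 + (norm ?F)^2 - 2 * pact be m Y"
  using inner_calF[OF be(1) Y, of g x1] x1 unfolding resid_def w power2_norm_eq_inner
  by (simp add: inner_simps inner_commute)
 have 2: "(norm ?F)^2 = (1 - c^2) * (norm (ka g))^2 - (2 * a / 3) * inner (ka g) (mulK g (ka g)) -
   (b / 2) * inner (ka g) (mulK g (mulK g (ka g)))"
  using norm_calF[OF b be Y(1) _ c, of g x1] le by (simp add: w)
 have 3: "(norm (u + c *R ka g))^2 = (norm u)^2 + 2 * c * inner (ka g) u + c^2 * (norm (ka g))^2"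
  unfolding power2_norm_eq_inner by (simp add: inner_simps inner_commute power2_eq_square algebra_simps)
 have 4: "energy a b (g, u) = ((norm (ka g))^2 + (norm (ka g - g))^2 + (norm u)^2) / 2 -
   (a / 3) * inner (ka g) (mulK g (ka g)) - (b / 4) * inner (ka g) (mulK g (mulK g (ka g)))"
  unfolding energy_def norm_ka_sq[of g, symmetric] by (simp add: power2_norm_eq_inner)
 show ?thesis
  unfolding w 4 momentum_def fst_conv snd_conv 1 2 3 by (simp add: field_simps)
qed

subsection \<open>One-sided comparison with the pulse\<close>

text \<open>A lower barrier \<open>Z\<close> for a function \<open>f\<close> that follows its
  equation up to a total error \<open>e1\<close> and with a field off by \<open>e2\<close>. The
  Lipschitz bound is available only where \<open>f\<close> is below \<open>Z\<close>, so Gronwall is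
  started at the last crossing before \<open>y\<close>.\<close>

lemma comparison:
 fixes f Z :: "real => real"
 assumes f: "continuous_on {0..X} f" and Z: "continuous_on {0..X} Z"
  and ps: "continuous_on UNIV ps1" "continuous_on UNIV ps0"
  and dZ: "!!x y. 0 <= x ==> x <= y ==> y <= X ==> Z y - Z x <= - integral {x..y} (%s. ps0 (Z s))"
  and df: "!!x y. 0 <= x ==> x <= y ==> y <= X ==> - integral {x..y} (%s. ps1 (f s)) - e1 <= f y - f x"
  and init: "Z 0 <= f 0" and near: "!!x. x : {0..X} ==> \<bar>ps1 (f x) - ps0 (f x)\<bar> <= e2"
  and lip: "!!x. x : {0..X} ==> f x <= Z x ==> ps0 (f x) - ps0 (Z x) <= K * (Z x - f x)"
  and K: "0 <= K" and e: "0 <= e1" "0 <= e2" and y: "y : {0..X}"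
 shows "Z y - (e1 + e2 * X) * exp (K * X) <= f y"
proof (cases "Z y <= f y")
 case True
 moreover have "0 <= (e1 + e2 * X) * exp (K * X)" using e y by simp
 ultimately show ?thesis by linarith
next
 case False
 define p where "p x = Z x - f x" for x
 have cp: "continuous_on {0..X} p" unfolding p_def by (intro continuous_intros f Z)
 have py: "0 < p y" and p0: "p 0 <= 0" using False init by (auto simp: p_def)
 \<comment> \<open>The largest element of this set is the last crossing; from there to
   \<open>y\<close> the barrier stays above \<open>f\<close>.\<close>
 define A where "A = {x : {0..y}. p x = 0}"
 have cpy: "continuous_on {0..y} p" by (rule continuous_on_subset[OF cp]) (use y in auto)
 have "A ~= {}" using IVT'[of p 0 0 y] p0 py y cpy by (auto simp: A_def)
 moreover have "compact A"
 proof -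
  have "closed A" unfolding A_def by (rule continuous_closed_preimage_constant[OF cpy]) simp
  moreover have "bounded A" by (rule bounded_subset[of "{0..y}"]) (auto simp: A_def)
  ultimately show ?thesis by (simp add: compact_eq_bounded_closed)
 qed
 ultimately obtain x where x: "x : A" "!!s. s : A ==> s <= x" using compact_attains_sup[of A] by blast
 then have x': "0 <= x" "x <= y" "p x = 0" by (auto simp: A_def)
 have pos: "0 <= p s" if s: "s : {x..y}" for s
 proof (rule ccontr)
  assume "~ 0 <= p s"
  then have "p s <= 0" "x < s" using s x' by (auto simp: order.order_iff_strict)
  moreover have "continuous_on {s..y} p" by (rule continuous_on_subset[OF cpy]) (use s x' in auto)
  ultimately obtain z where "s <= z" "z <= y" "p z = 0" using IVT'[of p s 0 y] py s by auto
  then show False using x(2)[of z] s x' \<open>x < s\<close> by (auto simp: A_def)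
 qed
 have "p y <= (e1 + e2 * X) * exp (K * (y - x))"
 proof (rule gronwall[of x y p K "e1 + e2 * X" y])
  show "continuous_on {x..y} p" by (rule continuous_on_subset[OF cpy]) (use x' in auto)
  fix s assume s: "s : {x..y}"
  have sub: "{x..s} \<subseteq> {0..X}" using s x' y by auto
  have i1: "(%r. ps1 (f r)) integrable_on {x..s}" and i0: "(%r. ps0 (Z r)) integrable_on {x..s}"
   and ip: "p integrable_on {x..s}"
   by (intro integrable_continuous_interval continuous_on_compose2[OF ps(1) continuous_on_subset[OF f sub]]
     continuous_on_compose2[OF ps(2) continuous_on_subset[OF Z sub]] continuous_on_subset[OF cp sub] subset_UNIV)+
  have "p s = (Z s - Z x) - (f s - f x)" using x' by (simp add: p_def)
  also have "... <= integral {x..s} (%r. ps1 (f r)) - integral {x..s} (%r. ps0 (Z r)) + e1"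
   using dZ[of x s] df[of x s] s x' y by auto
  also have "integral {x..s} (%r. ps1 (f r)) - integral {x..s} (%r. ps0 (Z r)) = integral {x..s} (%r. ps1 (f r) - ps0 (Z r))"
   by (rule integral_diff[OF i1 i0, symmetric])
  also have "... <= integral {x..s} (%r. e2 + K * p r)"
  proof (rule integral_le[OF integrable_diff[OF i1 i0]])
   show "(%r. e2 + K * p r) integrable_on {x..s}"
    by (intro integrable_add integrable_on_mult_right ip integrable_const_ivl)
   fix r assume r: "r : {x..s}"
   then have "r : {0..X}" using sub by blast
   moreover have "f r <= Z r" using pos[of r] r s by (auto simp: p_def)
   ultimately show "ps1 (f r) - ps0 (Z r) <= e2 + K * p r"
    using near[of r] lip[of r] unfolding p_def by linarith
  qed
  also have "... = e2 * (s - x) + K * integral {x..s} p"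
   using s ip by (subst integral_add) (auto intro!: integrable_on_mult_right integrable_const_ivl)
  also have "e2 * (s - x) <= e2 * X" using e s x' y by (intro mult_left_mono) auto
  finally show "p s <= e1 + e2 * X + K * integral {x..s} p" by simp
 qed (use K x' in auto)
 also have "... <= (e1 + e2 * X) * exp (K * X)"
  using e x' y K by (intro mult_left_mono) (auto intro!: mult_left_mono)
 finally show ?thesis by (simp add: p_def)
qed

lemma norm_indicator: "x <= y ==> norm (toL2 (indicator {x..y})) = sqrt (y - x)"
proof -
 assume xy: "x <= y"
 have "(norm (toL2 (indicator {x..y})))^2 = (\<integral>s. indicator {x..y} s \<partial>lborel)"
  unfolding norm_toL2_sq[OF L2_fun_indicator] by (intro Bochner_Integration.integral_cong) (auto simp: indicator_def)
 also have "... = y - x" using xy by simp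
 finally show ?thesis by (metis norm_ge_zero real_sqrt_unique)
qed

text \<open>Cauchy-Schwarz against an indicator bounds the accumulated residual by the square root
  of the length. The sign \<open>si\<close> selects the half-line, so that both halves are read
  outwards from the peak.\<close>

lemma resid_ac:
 assumes si: "si = 1 | si = - 1" and top: "Kp g x1 = m - Y" and xy: "0 <= x" "x <= y"
 shows "- integral {x..y} (%s. psi be m Y (Kp g (x1 + si * s))) - sqrt (y - x) * norm (resid be m Y x1 g) \<le>
  Kp g (x1 + si * y) - Kp g (x1 + si * x)"
proof -
 let ?ps = "psi be m Y" and ?v = "Kp g" and ?r = "resid be m Y x1 g" and ?f = "calF be m Y x1 g"
 have c: "continuous_on UNIV (%z. ?ps (?v z))" by (rule continuous_on_compose2[OF continuous_on_psi Kp_continuous]) auto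
 obtain H where H: "!!z. (H has_real_derivative ?ps (?v z)) (at z)" using antiderivative_exists[OF c] by blast
 have "((%s. si * H (x1 + si * s)) has_real_derivative ?ps (?v (x1 + si * s))) (at s)" for s
 proof -
  have "((%s. x1 + si * s) has_real_derivative si) (at s)" by (rule derivative_eq_intros refl | simp)+
  from DERIV_cmult[OF DERIV_chain2[OF H this], of si]
  show ?thesis by (rule DERIV_cong) (use si in auto)
 qed
 from FTC_DERIV[OF this xy(2)]
 have int: "integral {x..y} (%s. ?ps (?v (x1 + si * s))) = si * (H (x1 + si * y) - H (x1 + si * x))"
  by (simp add: algebra_simps)
 have inn: "inner (toL2 (indicator {z1..z2})) (toL2 ?f) = k * (H z2 - H z1)"
  if z: "z1 <= z2" and k: "!!z. z : {z1..z2} ==> ?f z = k * ?ps (?v z)" for z1 z2 k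
 proof -
  have "inner (toL2 (indicator {z1..z2})) (toL2 ?f) = (\<integral>s. indicator {z1..z2} s *R ?f s \<partial>lborel)"
   by (simp add: inner_toL2[OF L2_fun_indicator L2_fun_calF])
  also have "... = (\<integral>s. indicator {z1..z2} s *R (k * ?ps (?v s)) \<partial>lborel)"
   by (intro Bochner_Integration.integral_cong) (auto simp: indicator_def k)
  also have "... = k * H z2 - k * H z1"
  proof (rule integral_FTC_atLeastAtMost[OF z])
   show "((%s. k * H s) has_vector_derivative k * ?ps (?v s)) (at s within {z1..z2})" for s
    using has_field_derivative_at_within[OF DERIV_cmult[OF H]]
    by (simp add: has_real_derivative_iff_has_vector_derivative)
   show "continuous_on {z1..z2} (%s. k * ?ps (?v s))"
    by (intro continuous_intros continuous_on_subset[OF c]) auto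
  qed
  finally show ?thesis by (simp add: algebra_simps)
 qed
 have cs: "\<bar>inner (toL2 (indicator {z1..z2})) ?r\<bar> <= sqrt (z2 - z1) * norm ?r" if "z1 <= z2" for z1 z2
  using Cauchy_Schwarz_ineq2[of "toL2 (indicator {z1..z2})" ?r] norm_indicator[OF that] by simp
 have ac: "?v z2 - ?v z1 = inner (toL2 (indicator {z1..z2})) ?r - inner (toL2 (indicator {z1..z2})) (toL2 ?f)"
  if "z1 <= z2" for z1 z2
  using Kp_ac[OF that, of g] by (simp add: resid_def inner_simps)
 show ?thesis
  using si
 proof
  assume s: "si = 1"
  have le: "x1 + x <= x1 + y" using xy by simp
  have "inner (toL2 (indicator {x1 + x..x1 + y})) (toL2 ?f) = 1 * (H (x1 + y) - H (x1 + x))"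
   by (rule inn[OF le]) (use xy in \<open>auto simp: calF_def sg_def\<close>)
  then show ?thesis using ac[OF le] cs[OF le] int by (simp add: s)
 next
  assume s: "si = - 1"
  have le: "x1 - y <= x1 - x" using xy by simp
  have "inner (toL2 (indicator {x1 - y..x1 - x})) (toL2 ?f) = - 1 * (H (x1 - x) - H (x1 - y))"
  proof (rule inn[OF le])
   fix z assume "z : {x1 - y..x1 - x}"
   then have "z <= x1" using xy by auto
   \<comment> \<open>At \<open>x1\<close> itself \<open>sg\<close> has the sign of the right half,
     but there \<open>psi\<close> is 0.\<close>
   then show "?f z = - 1 * ?ps (?v z)"
    using psi_top[of be m Y] top by (cases "z = x1") (auto simp: calF_def sg_def)
  qed
  then show ?thesis using ac[OF le] cs[OF le] int by (simp add: s)
 qed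
qed

lemma sqrt_max_diff: "\<bar>sqrt (max 0 x) - sqrt (max 0 y)\<bar> <= sqrt \<bar>x - y\<bar>"
proof -
 have *: "sqrt (max 0 s) - sqrt (max 0 t) <= sqrt \<bar>s - t\<bar>" for s t :: real
 proof -
  have "sqrt (max 0 s) <= sqrt (max 0 t + \<bar>s - t\<bar>)" by (intro real_sqrt_le_mono) linarith
  also have "... <= sqrt (max 0 t) + sqrt \<bar>s - t\<bar>" by (intro sqrt_add_le_add_sqrt) auto
  finally show ?thesis by simp
 qed
 show ?thesis by (rule abs_leI) (use *[of x y] *[of y x] in \<open>simp_all add: abs_minus_commute\<close>)
qed

lemma psi_diff:
 assumes "0 < be"
 shows "\<bar>psi be m Y s - psi be m Y' s\<bar> <= \<bar>s\<bar> * sqrt (be / 2 * \<bar>Y^2 - Y'^2\<bar>)"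
proof -
 have "\<bar>psi be m Y s - psi be m Y' s\<bar> = \<bar>s\<bar> * \<bar>sqrt (max 0 (be / 2 * ((m - s)^2 - Y^2))) - sqrt (max 0 (be / 2 * ((m - s)^2 - Y'^2)))\<bar>"
  by (simp add: psi_def abs_mult right_diff_distrib[symmetric])
 also have "... <= \<bar>s\<bar> * sqrt \<bar>be / 2 * ((m - s)^2 - Y^2) - be / 2 * ((m - s)^2 - Y'^2)\<bar>"
  by (intro mult_left_mono sqrt_max_diff) simp
 also have "\<bar>be / 2 * ((m - s)^2 - Y^2) - be / 2 * ((m - s)^2 - Y'^2)\<bar> = be / 2 * \<bar>Y^2 - Y'^2\<bar>"
 proof -
  have "be / 2 * ((m - s)^2 - Y^2) - be / 2 * ((m - s)^2 - Y'^2) = - (be / 2) * (Y^2 - Y'^2)" by (simp add: algebra_simps)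
  then show ?thesis using assms by (simp only: abs_mult; simp)
 qed
 finally show ?thesis .
qed

text \<open>At the top \<open>m - Y\<close> the argument of the square root has a zero and the
  Lipschitz property breaks down; hence the bound only up to some \<open>mu\<close> strictly
  below.\<close>

lemma psi_lipschitz:
 assumes be: "0 < be" and Y: "0 < Y" and mu: "mu < m - Y"
 obtains K where "0 <= K" "!!s t. s : {- B..mu} ==> t : {- B..mu} ==> \<bar>psi be m Y s - psi be m Y t\<bar> <= K * \<bar>s - t\<bar>"
proof -
 define R where "R s = be / 2 * ((m - s)^2 - Y^2)" for s
 define D where "D s = sqrt (R s) + s * (inverse (sqrt (R s)) / 2 * (- be * (m - s)))" for s
 let ?S = "{- B..mu}"
 have pos: "0 < R s" if "s < m - Y" for s
 proof -
  have "Y^2 < (m - s)^2" using that Y by (intro power_strict_mono) auto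
  then show ?thesis using be by (simp add: R_def)
 qed
 have dR: "(R has_real_derivative - be * (m - s)) (at s)" for s
  unfolding R_def[abs_def] by (rule derivative_eq_intros refl)+ (simp add: algebra_simps)
 have d: "(psi be m Y has_real_derivative D s) (at s within ?S)" if s: "s : ?S" for s
 proof -
  have s': "s < m - Y" using s mu by simp
  have "((%s. s * sqrt (R s)) has_real_derivative 1 * sqrt (R s) + inverse (sqrt (R s)) / 2 * (- be * (m - s)) * s) (at s)"
   by (rule DERIV_mult[OF DERIV_ident DERIV_chain2[OF DERIV_real_sqrt[OF pos[OF s']] dR]])
  then have "((%s. s * sqrt (R s)) has_real_derivative D s) (at s)" by (simp add: D_def mult.commute)
  then have "(psi be m Y has_real_derivative D s) (at s)"
  proof (rule has_field_derivative_transform_within_open[of _ _ _ "{..<m - Y}"])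
   fix t assume "t : {..<m - Y}"
   then have "max 0 (R t) = R t" using pos[of t] by simp
   then show "t * sqrt (R t) = psi be m Y t" by (simp add: psi_def R_def)
  qed (use s' in auto)
  then show ?thesis by (rule has_field_derivative_at_within)
 qed
 have cR: "continuous_on ?S R" unfolding R_def[abs_def] by (intro continuous_intros)
 have "sqrt (R s) ~= 0" if "s : ?S" for s using pos[of s] that mu by simp
 then have "continuous_on ?S D" unfolding D_def[abs_def] by (intro continuous_intros cR) auto
 then have "bounded (D ` ?S)" by (intro compact_imp_bounded compact_continuous_image) auto
 then obtain K where K: "!!s. s : ?S ==> norm (D s) <= K" unfolding bounded_iff by blast
 have "\<bar>psi be m Y s - psi be m Y t\<bar> <= max K 0 * \<bar>s - t\<bar>" if "s : ?S" "t : ?S" for s t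
  using field_differentiable_bound[of ?S "psi be m Y" D "max K 0" s t] d K that by (auto simp: le_max_iff_disj)
 then show ?thesis using that[of "max K 0"] by simp
qed

subsection \<open>Translations, peaks and coercivity\<close>

lemma Kp_tr: "Kp (tr s g) x = Kp g (x + s)"
proof -
 have "(%t. kern x (t + - s)) = kern (x + s)" by (auto simp: kern_def indicator_def fun_eq_iff algebra_simps)
 then have "tr (- s) (toL2 (kern x)) = toL2 (kern (x + s))" using tr_toL2[OF L2_fun_kern, of "- s" x] by simp
 then show ?thesis unfolding Kp_def using inner_tr_left[of s g "toL2 (kern x)"] by (simp add: inner_commute)
qed

lemma mulK_tr: "mulK (tr s k) (tr s g) = tr s (mulK k g)"
proof -
 have "tr s g = toL2 (%x. fn g (x + s))" using tr_toL2[OF L2_fun_fn, of s g] by simp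
 then have "mulK (tr s k) (tr s g) = toL2 (%x. Kp k (x + s) * fn g (x + s))"
  using mulK_toL2[OF L2_fun_translate[OF L2_fun_fn], of "tr s k" g s] by (simp add: Kp_tr)
 also have "... = tr s (mulK k g)"
  unfolding mulK_def using tr_toL2[OF L2_fun_Kp_mult[OF L2_fun_fn], of s k g] by simp
 finally show ?thesis .
qed

definition trS :: "real => state => state" where "trS s w = (tr s (fst w), tr s (snd w))"

lemma norm_trS: "norm (trS s w) = norm w" by (simp add: trS_def norm_prod_def)

lemma trS_diff: "trS s (w - w') = trS s w - trS s w'" by (simp add: trS_def linear_tr)

lemma trS_trS: "trS s (trS r w) = trS (s + r) w" by (simp add: trS_def tr_tr)

lemma trS_0: "trS 0 w = w" by (simp add: trS_def)

lemma energy_trS: "energy a b (trS s w) = energy a b w"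
 by (simp add: energy_def trS_def ka_tr mulK_tr inner_prod_def)

lemma momentum_trS: "momentum (trS s w) = momentum w" by (simp add: momentum_def trS_def ka_tr)

lemma continuous_on_energy: "continuous_on UNIV (energy a b)"
 unfolding energy_def[abs_def]
 by (intro continuous_intros mulK.continuous_on continuous_on_ka) auto

lemma continuous_on_momentum: "continuous_on UNIV momentum"
 unfolding momentum_def[abs_def] by (intro continuous_intros continuous_on_ka)

lemma quartic_eq: "inner (ka g) (mulK g (mulK g (ka g))) = (norm (mulK g (ka g)))^2"
 using inner_mulK[of g "ka g" "mulK g (ka g)"] by (simp add: power2_norm_eq_inner)

text \<open>The square of v - (a / 2) v^2 trades the cubic term for v^2 and a^2 v^4 / 4. After
  division by 3 the quartic part is covered by - b / 4 >= a^2 / 12, and one half minus one third of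
  the squared norm remains.\<close>

lemma energy_coercive:
 assumes ab: "b <= - (a^2) / 3"
 shows "(norm w)^2 <= 6 * energy a b w"
proof -
 obtain g u where w: "w = (g, u)" by (cases w)
 let ?X = "mulK g (ka g)"
 have "0 <= (norm (ka g - (a / 2) *R ?X))^2" by simp
 also have "... = (norm (ka g))^2 - a * inner (ka g) ?X + a^2 / 4 * (norm ?X)^2"
  unfolding power2_norm_eq_inner by (simp add: inner_simps inner_commute power2_eq_square)
 finally have 1: "a * inner (ka g) ?X <= (norm (ka g))^2 + (a^2 * (norm ?X)^2) / 4" by simp
 have "(a^2 / 3) * (norm ?X)^2 <= - b * (norm ?X)^2" using ab by (intro mult_right_mono) auto
 then have 2: "(a^2 * (norm ?X)^2) / 3 <= - (b * (norm ?X)^2)" by simp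
 have 3: "(norm (ka g))^2 <= (norm w)^2"
  using norm_ka_le[of g] norm_fst_snd_le(1)[of w] by (intro power_mono) (auto simp: w)
 have "energy a b w = (norm w)^2 / 2 - (a * inner (ka g) ?X) / 3 - (b * (norm ?X)^2) / 4"
  by (simp add: energy_def w quartic_eq power2_norm_eq_inner)
 then show ?thesis using 1 2 3 by linarith
qed

section \<open>The maximum of the profile as a functional of the state\<close>

definition mx :: "l2 => real" where "mx g = (SUP x. Kp g x)"

lemma Kp_le_mx: "Kp g x <= mx g"
proof -
 have "bdd_above (range (Kp g))" using abs_Kp_le[of g] by (intro bdd_aboveI[of _ "norm g"]) (auto simp: abs_le_iff)
 then show ?thesis unfolding mx_def by (intro cSUP_upper) auto
qed

lemma mx_eqI: "(!!x. Kp g x <= m) ==> Kp g y = m ==> mx g = m"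
 using Kp_le_mx[of g y] cSUP_least[of UNIV "Kp g" m] by (simp add: mx_def)

lemma mx_lipschitz: "\<bar>mx g - mx h\<bar> <= norm (g - h)"
proof -
 have *: "mx g <= mx h + norm (g - h)" for g h
  unfolding mx_def[of g]
 proof (rule cSUP_least)
  fix x
  show "Kp g x <= mx h + norm (g - h)"
   using abs_Kp_le[of "g - h" x] Kp_le_mx[of h x] by (simp add: Kp_diff)
 qed simp
 show ?thesis using *[of g h] *[of h g] by (simp add: norm_minus_commute abs_le_iff)
qed

lemma continuous_on_mx: "continuous_on A f ==> continuous_on A (%t. mx (f t))"
proof -
 assume f: "continuous_on A f"
 show ?thesis
  unfolding continuous_on_def
 proof
  fix x assume "x : A"
  then have "(f ---> f x) (at x within A)" using f by (simp add: continuous_on_def)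
  then have lim: "((%t. norm (f t - f x)) ---> 0) (at x within A)" by (intro tendsto_norm_zero LIM_zero)
  have "((%t. mx (f t) - mx (f x)) ---> 0) (at x within A)"
   by (rule Lim_null_comparison[OF _ lim]) (simp add: mx_lipschitz)
  then show "((%t. mx (f t)) ---> mx (f x)) (at x within A)" by (rule LIM_zero_cancel)
 qed
qed

lemma mx_attained:
 assumes "0 < mx g"
 obtains x1 where "Kp g x1 = mx g"
proof -
 obtain y where "0 < Kp g y"
 proof (rule ccontr)
  assume "~ thesis"
  then have "Kp g x <= 0" for x using that by (meson not_le)
  then have "mx g <= 0" unfolding mx_def by (intro cSUP_least) auto
  then show False using assms by simp
 qed
 then obtain x1 where "!!x. Kp g x <= Kp g x1"
  using attains_sup_vanishing[OF Kp_continuous Kp_tendsto_0] by blast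
 then have "mx g = Kp g x1" by (intro mx_eqI) auto
 then show ?thesis using that by simp
qed

lemma tendsto_0_if_square:
 fixes f :: "nat => 'a::real_normed_vector"
 assumes "!!n. (norm (f n))^2 <= h n" "h >>> 0"
 shows "f >>> 0"
proof -
 have "(%n. (norm (f n))^2) >>> 0"
  by (rule tendsto_sandwich[OF _ _ tendsto_const assms(2)]) (use assms(1) in auto)
 then have "(%n. sqrt ((norm (f n))^2)) >>> sqrt 0" by (rule tendsto_real_sqrt)
 then show ?thesis by (simp add: tendsto_norm_zero_iff)
qed

subsection \<open>Orbital stability of a positive pulse\<close>

context pulse
begin

definition W :: state where "W = (G, - c *R toL2 V)"

lemma psi_V: "psi be ms Y (V x) = \<bar>V1 x\<bar>"
 unfolding psi_def R_eq[symmetric] using R_V_nonneg[of x] by (simp add: abs_V1)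

lemma calF_G: "calF be ms Y x0 G = (%x. - V1 x)"
 using V1_sign by (auto simp: fun_eq_iff calF_def Kp_G psi_V sg_def abs_of_nonpos abs_of_nonneg)

lemma resid_G: "resid be ms Y x0 G = 0"
 unfolding resid_def calF_G ka_G by (simp add: G_def toL2_uminus[OF V_Hk(1)])

lemma M_eq: "M = ms - Y" by (simp add: Y_def)

lemma momentum_W: "momentum W = - (c * pnorm be ms Y)"
 using V_norm(2) by (simp add: momentum_def W_def ka_G power2_norm_eq_inner)

text \<open>Both squares in \<open>calibration\<close> vanish at the wave itself.\<close>

lemma action_W: "energy a b W + c * momentum W = pact be ms Y"
proof -
 have "Kp (fst W) x <= ms - Y" "Kp (fst W) x0 = ms - Y" for x
  using V_le by (simp_all add: W_def Kp_G M_eq[symmetric] M_def)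
 from calibration[OF be_def be_pos be_ms be_mult_ms Y_pos Y_less this c_eq]
 show ?thesis by (simp add: W_def resid_G ka_G)
qed

lemma mx_W: "mx (fst W) = M"
proof (rule mx_eqI)
 show "Kp (fst W) x <= M" for x by (simp add: W_def Kp_G V_le)
 show "Kp (fst W) x0 = M" by (simp add: W_def Kp_G M_def)
qed

lemma V_less_M: "x ~= x0 ==> V x < M"
proof -
 assume ne: "x ~= x0"
 have "V x ~= M"
 proof
  assume "V x = M"
  then have "V1 x = 0" using V1_R[of x] R_M by simp
  then show False using rh_decreasing[of x x0] rh_decreasing[of x0 x] ne V1_x0 by (cases "x < x0") auto
 qed
 then show ?thesis using V_le[of x] by simp
qed

lemma half_pulse:
 assumes si: "si = 1 | si = - 1" and ta: "0 <= ta" and "0 <= x" "x <= y"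
 shows "V (x0 + si * (y + ta)) - V (x0 + si * (x + ta)) = - integral {x..y} (%s. psi be ms Y (V (x0 + si * (s + ta))))"
  and "V (x0 + si * (y + ta)) <= V (x0 + si * (x + ta))"
proof -
 define F where "F s = V (x0 + si * (s + ta))" for s
 have d: "(F has_real_derivative - psi be ms Y (F s)) (at s)" if "0 <= s" for s
 proof -
  have "((%s. x0 + si * (s + ta)) has_real_derivative si) (at s)" by (rule derivative_eq_intros refl | simp)+
  from DERIV_chain2[OF dV this]
  show ?thesis
   unfolding F_def[abs_def]
   by (rule DERIV_cong) (use si V1_sign[of "x0 + si * (s + ta)"] ta that in \<open>auto simp: psi_V\<close>)
 qed
 have "((%s. - psi be ms Y (F s)) has_integral F y - F x) {x..y}"
 proof (rule fundamental_theorem_of_calculus[OF assms(4)])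
  fix s assume "s : {x..y}"
  then have "0 <= s" using assms(3) by simp
  from has_field_derivative_at_within[OF d[OF this]]
  show "(F has_vector_derivative - psi be ms Y (F s)) (at s within {x..y})"
   by (simp add: has_real_derivative_iff_has_vector_derivative)
 qed
 then have "integral {x..y} (%s. - psi be ms Y (F s)) = F y - F x" by (rule integral_unique)
 then show "V (x0 + si * (y + ta)) - V (x0 + si * (x + ta)) = - integral {x..y} (%s. psi be ms Y (V (x0 + si * (s + ta))))"
  by (simp add: F_def)
 have "F y <= F x"
 proof (rule DERIV_nonpos_imp_nonincreasing[OF assms(4)])
  fix s assume "x <= s"
  then have "0 <= s" using assms(3) by simp
  moreover have "0 <= psi be ms Y (F s)" by (simp add: F_def psi_V)
  ultimately show "\<exists>z. (F has_real_derivative z) (at s) & z <= 0" using d[of s] by auto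
 qed
 then show "V (x0 + si * (y + ta)) <= V (x0 + si * (x + ta))" by (simp add: F_def)
qed

text \<open>The pulse cannot serve as a barrier from its peak, where \<open>psi\<close> fails to be
  Lipschitz. Moved inwards by a small \<open>ta\<close> it starts at the height
  \<open>mu < M\<close>, stays in the range where \<open>psi_lipschitz\<close> applies, and loses
  less than \<open>e / 2\<close> at \<open>x\<close>.\<close>

lemma pulse_lower_bound:
 assumes le: "!!n x. Kp (g n) x <= m n" and top: "!!n. Kp (g n) x0 = m n" and B: "!!n. norm (g n) <= B"
  and lim: "m >>> M" and res: "(%n. resid be ms (ms - m n) x0 (g n)) >>> 0" and e: "0 < e"
 shows "\<forall>\<^sub>F n in sequentially. V x - e <= Kp (g n) x"
proof -
 define si where "si = sg (x - x0)"
 define s where "s = \<bar>x - x0\<bar>"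
 have si: "si = 1 | si = - 1" and x: "x = x0 + si * s" and s0: "0 <= s" by (auto simp: si_def sg_def s_def)
 have "continuous_on UNIV (%r. V (x0 + si * r))"
  by (rule continuous_on_compose2[OF cont_V[of UNIV]]) (auto intro!: continuous_intros)
 then have "isCont (%r. V (x0 + si * r)) s" by (simp add: continuous_on_eq_continuous_at)
 then obtain d where d: "0 < d" "!!r. \<bar>r - s\<bar> < d ==> \<bar>V (x0 + si * r) - V (x0 + si * s)\<bar> < e / 2"
  unfolding continuous_at_eps_delta dist_real_def using half_gt_zero[OF e] by blast
 \<comment> \<open>Half the modulus of continuity of \<open>V\<close> at \<open>x\<close> for
   accuracy \<open>e / 2\<close>.\<close>
 define ta where "ta = d / 2"
 have "\<bar>V (x0 + si * (s + ta)) - V (x0 + si * s)\<bar> < e / 2" by (rule d(2)) (use d(1) in \<open>simp add: ta_def\<close>)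
 then have ta: "0 < ta" "V x - e / 2 < V (x0 + si * (s + ta))" using d(1) by (simp add: ta_def, subst x, linarith)
 define mu where "mu = V (x0 + si * ta)"
 have mu: "mu < ms - Y" using V_less_M[of "x0 + si * ta"] ta si by (auto simp: mu_def M_eq)
 obtain K where K: "0 <= K" "!!s t. s : {- B..mu} ==> t : {- B..mu} ==> \<bar>psi be ms Y s - psi be ms Y t\<bar> <= K * \<bar>s - t\<bar>"
  using psi_lipschitz[OF be_pos Y_pos mu] by blast
 have B0: "0 <= B" using B[of 0] norm_ge_zero[of "g 0"] by linarith
 \<comment> \<open>\<open>e1\<close> bounds the accumulated residual, \<open>e2\<close> the mismatch
   between the fields belonging to the heights \<open>m n\<close> and \<open>M\<close>; both tend to
   0.\<close>
 define e1 where "e1 n = sqrt s * norm (resid be ms (ms - m n) x0 (g n))" for n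
 define e2 where "e2 n = B * sqrt (be / 2 * \<bar>(ms - m n)^2 - Y^2\<bar>)" for n
 have main: "V (x0 + si * (s + ta)) - (e1 n + e2 n * s) * exp (K * s) <= Kp (g n) x" if init: "mu <= m n" for n
  unfolding x
 proof (rule comparison[of s "%r. Kp (g n) (x0 + si * r)" "%r. V (x0 + si * (r + ta))" "psi be ms (ms - m n)" "psi be ms Y"])
  show "continuous_on {0..s} (%r. Kp (g n) (x0 + si * r))"
   by (rule continuous_on_compose2[OF Kp_continuous]) (auto intro!: continuous_intros)
  show "continuous_on {0..s} (%r. V (x0 + si * (r + ta)))"
   by (rule continuous_on_compose2[OF cont_V[of UNIV]]) (auto intro!: continuous_intros)
  show "V (x0 + si * (z + ta)) - V (x0 + si * (y + ta)) <= - integral {y..z} (%r. psi be ms Y (V (x0 + si * (r + ta))))"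
   if "0 <= y" "y <= z" for y z
   using half_pulse(1)[OF si, of ta y z] that ta by simp
  show "- integral {y..z} (%r. psi be ms (ms - m n) (Kp (g n) (x0 + si * r))) - e1 n
    <= Kp (g n) (x0 + si * z) - Kp (g n) (x0 + si * y)" if yz: "0 <= y" "y <= z" "z <= s" for y z
  proof -
   have "sqrt (z - y) * norm (resid be ms (ms - m n) x0 (g n)) <= e1 n"
    unfolding e1_def using yz by (intro mult_right_mono real_sqrt_le_mono) auto
   then show ?thesis using resid_ac[OF si, of "g n" x0 ms "ms - m n" y z be] top[of n] yz by simp
  qed
  show "V (x0 + si * (0 + ta)) <= Kp (g n) (x0 + si * 0)" using init by (simp add: mu_def top)
  show "\<bar>psi be ms (ms - m n) (Kp (g n) (x0 + si * r)) - psi be ms Y (Kp (g n) (x0 + si * r))\<bar> <= e2 n" for r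
  proof -
   have "\<bar>Kp (g n) (x0 + si * r)\<bar> <= B" using abs_Kp_le B order_trans by blast
   then have "\<bar>Kp (g n) (x0 + si * r)\<bar> * sqrt (be / 2 * \<bar>(ms - m n)^2 - Y^2\<bar>) <= e2 n"
    unfolding e2_def using be_pos by (intro mult_right_mono) auto
   then show ?thesis using psi_diff[OF be_pos, of ms "ms - m n" "Kp (g n) (x0 + si * r)" Y] by linarith
  qed
  show "psi be ms Y (Kp (g n) (x0 + si * r)) - psi be ms Y (V (x0 + si * (r + ta))) <= K * (V (x0 + si * (r + ta)) - Kp (g n) (x0 + si * r))"
   if r: "r : {0..s}" and lt: "Kp (g n) (x0 + si * r) <= V (x0 + si * (r + ta))" for r
  proof -
   let ?f = "Kp (g n) (x0 + si * r)" and ?Z = "V (x0 + si * (r + ta))"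
   have "?Z <= mu" unfolding mu_def using half_pulse(2)[OF si, of ta 0 r] ta r by auto
   moreover have "- B <= ?f" using abs_Kp_le[of "g n" "x0 + si * r"] B[of n] by linarith
   ultimately have "\<bar>psi be ms Y ?f - psi be ms Y ?Z\<bar> <= K * \<bar>?f - ?Z\<bar>"
    using lt pos[of "x0 + si * (r + ta)"] B0 by (intro K(2)) auto
   then show ?thesis using lt by (simp add: abs_le_iff)
  qed
  show "0 <= e1 n" "0 <= e2 n" using s0 B0 be_pos by (auto simp: e1_def e2_def)
 qed (use s0 K continuous_on_psi in auto)
 have "(%n. sqrt s * norm (resid be ms (ms - m n) x0 (g n))) >>> sqrt s * norm (0::l2)"
  by (intro tendsto_intros res)
 then have l1: "e1 >>> 0" by (simp add: e1_def[abs_def])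
 have "(%n. B * sqrt (be / 2 * \<bar>(ms - m n)^2 - Y^2\<bar>)) >>> B * sqrt (be / 2 * \<bar>(ms - M)^2 - Y^2\<bar>)"
  by (intro tendsto_intros lim)
 then have l2: "e2 >>> 0" by (simp add: e2_def[abs_def] Y_def)
 have "(%n. (e1 n + e2 n * s) * exp (K * s)) >>> (0 + 0 * s) * exp (K * s)"
  by (intro tendsto_intros l1 l2)
 then have l3: "(%n. (e1 n + e2 n * s) * exp (K * s)) >>> 0" by (simp only: mult_zero_left add_0)
 have "\<forall>\<^sub>F n in sequentially. (e1 n + e2 n * s) * exp (K * s) < e / 2"
  by (rule order_tendstoD(2)[OF l3 half_gt_zero[OF e]])
 moreover have "\<forall>\<^sub>F n in sequentially. mu < m n"
  using order_tendstoD(1)[OF lim] mu by (simp add: M_eq)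
 ultimately show ?thesis
 proof eventually_elim
  case (elim n)
  then show ?case using main[of n] ta(2) by simp
 qed
qed

text \<open>Moving derivatives onto the smooth profile expresses this first order Sobolev pairing by
  v alone, so L2 convergence of \<open>ka (g n)\<close> is enough to pass to the limit.\<close>

lemma inner_G: "inner g G = inner (ka g) (toL2 V) - inner (ka g) (toL2 V2)"
proof -
 have D: "ka G - G = toL2 V1" unfolding ka_G by (simp add: G_def)
 have "inner g G = inner (ka g - (ka g - g)) (ka G - (ka G - G))" by simp
 also have "... = inner (ka g) (ka G) - inner (ka g) (ka G - G) - inner (ka g - g) (ka G) + inner (ka g - g) (ka G - G)"
  by (simp only: inner_diff_left inner_diff_right; simp)
 also have "... = inner (ka g) (toL2 V) + inner (ka g - g) (toL2 V1)"
  using inner_ka_by_parts[of g G, unfolded D, unfolded ka_G] unfolding D unfolding ka_G by simp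
 also have "inner (ka g - g) (toL2 V1) = - inner (ka g) (toL2 V2)"
  using wd_by_parts[OF wd_ka[of g] wd_V(2)] by simp
 finally show ?thesis by simp
qed

text \<open>Calibration at the varying heights \<open>m n\<close> forces the residual and u + k v to
  0. The residual gives V as an asymptotic lower bound, the momentum gives the L2 norm of v, and
  together they give convergence of v in L2; the energy then upgrades this to first
  derivatives.\<close>

lemma pulse_sequence:
 assumes m: "!!n. 0 < m n" "!!n. m n < ms" and le: "!!n x. Kp (fst (w n)) x <= m n" and top: "!!n. Kp (fst (w n)) x0 = m n"
  and lim_m: "m >>> M" and lim_E: "(%n. energy a b (w n)) >>> energy a b W"
  and lim_Q: "(%n. momentum (w n)) >>> momentum W"
 shows "w >>> W"
proof -
 define g where "g n = fst (w n)" for n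
 define u where "u n = snd (w n)" for n
 define y where "y n = ms - m n" for n
 define k where "k n = pspeed be ms (y n)" for n
 have y: "0 < y n" "y n < ms" "ms - y n = m n" for n using m[of n] by (auto simp: y_def)
 have lim_y: "y >>> Y" unfolding y_def[abs_def] Y_def by (intro tendsto_intros lim_m)
 have lim_k: "k >>> c"
  unfolding k_def[abs_def] c_eq by (rule isCont_tendsto_compose[OF DERIV_isCont[OF pspeed_deriv[OF be_pos be_ms]] lim_y])
 have lim_d: "(%n. pact be ms (y n)) >>> pact be ms Y"
  by (rule isCont_tendsto_compose[OF DERIV_isCont[OF pact_deriv[OF Y_pos Y_less]] lim_y])
 define A where "A n = 2 * (energy a b (w n) + k n * momentum (w n) - pact be ms (y n))" for n
 have "A >>> 2 * (energy a b W + c * momentum W - pact be ms Y)"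
  unfolding A_def[abs_def] by (intro tendsto_intros lim_E lim_k lim_Q lim_d)
 then have lim_A: "A >>> 0" by (simp add: action_W)
 have cal: "(norm (u n + k n *R ka (g n)))^2 + (norm (resid be ms (y n) x0 (g n)))^2 = A n" for n
  using calibration[OF be_def be_pos be_ms be_mult_ms y(1,2)[of n], of "w n" x0 "k n"] le[of n] top[of n]
  by (simp add: y(3) k_def A_def g_def u_def)
 have lim_p: "(%n. u n + k n *R ka (g n)) >>> 0"
  by (rule tendsto_0_if_square[OF _ lim_A]) (simp add: cal[symmetric])
 have lim_r: "(%n. resid be ms (y n) x0 (g n)) >>> 0"
  by (rule tendsto_0_if_square[OF _ lim_A]) (simp add: cal[symmetric])
 obtain E0 where E0: "!!n. \<bar>energy a b (w n)\<bar> <= E0"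
  using convergent_imp_Bseq[OF convergentI[OF lim_E]] by (auto simp: Bseq_def)
 define B where "B = sqrt (6 * E0)"
 have "norm (w n) <= B" for n
  unfolding B_def using energy_coercive[OF ab, of "w n"] E0[of n] by (intro real_le_rsqrt) linarith
 then have B: "norm (g n) <= B" "norm (ka (g n)) <= B" for n
  using norm_fst_snd_le(1)[of "w n"] norm_ka_le[of "g n"] unfolding g_def by (meson order_trans)+
 \<comment> \<open>Truncating v between 0 and V gives functions dominated by V that converge to it,
   while the pairing of v with them is at least their squared norm.\<close>
 define z where "z n x = max 0 (min (Kp (g n) x) (V x))" for n x
 have low: "\<forall>\<^sub>F n in sequentially. V x - e <= Kp (g n) x" if "0 < e" for x e
  by (rule pulse_lower_bound[OF _ _ B(1) lim_m _ that]) (use le top lim_r in \<open>simp_all add: g_def y_def\<close>)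
 have z_lim: "(%n. z n x) >>> V x" for x
 proof (rule LIMSEQ_I)
  fix e :: real assume e: "0 < e"
  from low[OF half_gt_zero[OF e], of x]
  show "\<exists>N. \<forall>n\<ge>N. norm (z n x - V x) < e"
   unfolding eventually_sequentially
  proof (elim exE, intro exI allI impI)
   fix N n assume "\<forall>n\<ge>N. V x - e / 2 <= Kp (g n) x" "N <= n"
   then have "V x - e / 2 <= Kp (g n) x" by blast
   then show "norm (z n x - V x) < e" using pos[of x] e by (auto simp: z_def max_def min_def abs_if)
  qed
 qed
 have z_bound: "\<bar>z n x\<bar> <= \<bar>V x\<bar>" "\<bar>z n x - V x\<bar> <= V x" for n x using pos[of x] by (auto simp: z_def max_def min_def)
 have [measurable]: "V : borel_measurable borel" by (rule borel_measurable_continuous_onI[OF cont_V])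
 have Lz: "L2_fun (z n)" for n
  by (rule L2_fun_bound[OF V_norm(1) _ z_bound(1)]) (simp add: z_def[abs_def])
 have lim_z: "(%n. toL2 (z n)) >>> toL2 V"
  by (rule L2_dominated_convergence[OF Lz V_norm(1) V_norm(1)]) (auto simp: z_lim z_bound)
 have zz: "(norm (toL2 (z n)))^2 <= inner (ka (g n)) (toL2 (z n))" for n
 proof -
  have "(norm (toL2 (z n)))^2 = (\<integral>x. z n x * z n x \<partial>lborel)"
   by (simp add: power2_norm_eq_inner inner_toL2[OF Lz Lz])
  also have "... <= (\<integral>x. Kp (g n) x * z n x \<partial>lborel)"
  proof (rule integral_mono[OF L2_fun_mult_integrable[OF Lz Lz] L2_fun_mult_integrable[OF L2_fun_Kp Lz]])
   fix x
   have "z n x = 0 | (0 <= z n x & z n x <= Kp (g n) x)" by (auto simp: z_def max_def min_def)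
   then show "z n x * z n x <= Kp (g n) x * z n x" by (auto intro: mult_right_mono)
  qed
  also have "... = inner (ka (g n)) (toL2 (z n))" by (simp add: ka_def inner_toL2[OF L2_fun_Kp Lz])
  finally show ?thesis .
 qed
 let ?N = "(norm (toL2 V))^2"
 \<comment> \<open>The momentum is the pairing of v with u + k v minus k times the squared norm of
   v, and the first term tends to 0.\<close>
 have lim_N: "(%n. (norm (ka (g n)))^2) >>> ?N"
 proof -
  have i0: "(%n. inner (ka (g n)) (u n + k n *R ka (g n))) >>> 0"
  proof (rule Lim_null_comparison)
   show "\<forall>\<^sub>F n in sequentially. norm (inner (ka (g n)) (u n + k n *R ka (g n))) <= B * norm (u n + k n *R ka (g n))"
   proof (rule always_eventually, rule allI)
    fix n
    show "norm (inner (ka (g n)) (u n + k n *R ka (g n))) <= B * norm (u n + k n *R ka (g n))"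
     using Cauchy_Schwarz_ineq2[of "ka (g n)" "u n + k n *R ka (g n)"]
      mult_right_mono[OF B(2)[of n] norm_ge_zero[of "u n + k n *R ka (g n)"]] by simp
   qed
   show "(%n. B * norm (u n + k n *R ka (g n))) >>> 0"
    using tendsto_mult[OF tendsto_const[of B] tendsto_norm_zero[OF lim_p]] by simp
  qed
  have kp: "0 < k n" for n unfolding k_def by (rule pspeed_pos(2)[OF be_pos be_ms])
  have "(%n. (inner (ka (g n)) (u n + k n *R ka (g n)) - momentum (w n)) / k n) >>> (0 - momentum W) / c"
   by (rule tendsto_divide[OF tendsto_diff[OF i0 lim_Q] lim_k]) (use c_pos in simp)
  moreover have "(inner (ka (g n)) (u n + k n *R ka (g n)) - momentum (w n)) / k n = (norm (ka (g n)))^2" for n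
   using kp[of n] by (simp add: momentum_def g_def u_def inner_simps power2_norm_eq_inner)
  moreover have "(0 - momentum W) / c = ?N" using c_pos by (simp add: momentum_W V_norm(2))
  ultimately show ?thesis by simp
 qed
 \<comment> \<open>In the expansion of the square, replacing V by the truncation \<open>z n\<close>
   in the mixed term costs at most a multiple of \<open>norm (toL2 V - toL2 (z n))\<close>; the
   lower bound \<open>zz\<close> then closes the estimate.\<close>
 have lim_ka: "(%n. ka (g n)) >>> toL2 V"
 proof -
  have "(%n. ka (g n) - toL2 V) >>> 0"
  proof (rule tendsto_0_if_square)
   fix n
   have "(norm (ka (g n) - toL2 V))^2 = (norm (ka (g n)))^2 + ?N - 2 * inner (ka (g n)) (toL2 (z n)) -
     2 * inner (ka (g n)) (toL2 V - toL2 (z n))"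
    unfolding power2_norm_eq_inner by (simp add: inner_simps inner_commute)
   moreover have "- inner (ka (g n)) (toL2 V - toL2 (z n)) <= B * norm (toL2 V - toL2 (z n))"
    using Cauchy_Schwarz_ineq2[of "ka (g n)" "toL2 V - toL2 (z n)"]
     mult_right_mono[OF B(2)[of n] norm_ge_zero[of "toL2 V - toL2 (z n)"]] by linarith
   ultimately show "(norm (ka (g n) - toL2 V))^2 <= (norm (ka (g n)))^2 + ?N - 2 * (norm (toL2 (z n)))^2 +
     2 * (B * norm (toL2 V - toL2 (z n)))"
    using zz[of n] by linarith
  next
   have "(%n. (norm (ka (g n)))^2 + ?N - 2 * (norm (toL2 (z n)))^2 + 2 * (B * norm (toL2 V - toL2 (z n)))) >>>
     ?N + ?N - 2 * (norm (toL2 V))^2 + 2 * (B * norm (toL2 V - toL2 V))"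
    by (rule tendsto_add[OF tendsto_diff[OF tendsto_add[OF lim_N tendsto_const]
        tendsto_mult[OF tendsto_const tendsto_power[OF tendsto_norm[OF lim_z]]]]
       tendsto_mult[OF tendsto_const tendsto_mult[OF tendsto_const tendsto_norm[OF tendsto_diff[OF tendsto_const lim_z]]]]])
   then show "(%n. (norm (ka (g n)))^2 + ?N - 2 * (norm (toL2 (z n)))^2 + 2 * (B * norm (toL2 V - toL2 (z n)))) >>> 0"
    by simp
  qed
  then show ?thesis by (rule LIM_zero_cancel)
 qed
 have lim_u: "u >>> - c *R toL2 V"
 proof -
  have "(%n. (u n + k n *R ka (g n)) - k n *R ka (g n)) >>> 0 - c *R toL2 V"
   by (rule tendsto_diff[OF lim_p tendsto_scaleR[OF lim_k lim_ka]])
  then show ?thesis by simp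
 qed
 have lim_X: "(%n. mulK (g n) (ka (g n))) >>> mulK G (ka G)"
 proof -
  have "(%n. mulK (g n) (ka (g n)) - mulK G (ka G)) >>> 0"
  proof (rule Lim_null_comparison)
   show "\<forall>\<^sub>F n in sequentially. norm (mulK (g n) (ka (g n)) - mulK G (ka G)) <= (B + norm G) * norm (ka (g n) - ka G)"
   proof (rule always_eventually, rule allI)
    fix n
    have "mulK (g n) (ka (g n)) - mulK G (ka G) = mulK (g n + G) (ka (g n) - ka G)"
     by (simp add: mulK.add_left mulK.diff_right mulK_ka_commute[of "g n" G])
    then have "norm (mulK (g n) (ka (g n)) - mulK G (ka G)) <= norm (g n + G) * norm (ka (g n) - ka G)"
     using norm_mulK_le by metis
    also have "... <= (B + norm G) * norm (ka (g n) - ka G)"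
     using norm_triangle_ineq[of "g n" G] B(1)[of n] by (intro mult_right_mono) auto
    finally show "norm (mulK (g n) (ka (g n)) - mulK G (ka G)) <= (B + norm G) * norm (ka (g n) - ka G)" .
   qed
   show "(%n. (B + norm G) * norm (ka (g n) - ka G)) >>> 0"
    using tendsto_mult[OF tendsto_const[of "B + norm G"] tendsto_norm_zero[OF LIM_zero[OF lim_ka]]] by (simp add: ka_G)
  qed
  then show ?thesis by (rule LIM_zero_cancel)
 qed
 \<comment> \<open>The energy solved for the squared Sobolev norm of v; every other term converges
   by what is already known.\<close>
 have gg: "inner g g = 2 * (energy a b (g, u) + (a / 3) * inner (ka g) (mulK g (ka g)) + (b / 4) * (norm (mulK g (ka g)))^2) - inner u u"
  for g u
  by (simp add: energy_def quartic_eq field_simps)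
 have lim_gg: "(%n. inner (g n) (g n)) >>> inner G G"
 proof -
  have ka_lim: "(%n. ka (g n)) >>> ka G" using lim_ka by (simp add: ka_G)
  have "(%n. energy a b (g n, u n)) >>> energy a b (G, - c *R toL2 V)" using lim_E by (simp add: g_def u_def W_def)
  then have "(%n. 2 * (energy a b (g n, u n) + (a / 3) * inner (ka (g n)) (mulK (g n) (ka (g n))) +
     (b / 4) * (norm (mulK (g n) (ka (g n))))^2) - inner (u n) (u n)) >>>
    2 * (energy a b (G, - c *R toL2 V) + (a / 3) * inner (ka G) (mulK G (ka G)) +
     (b / 4) * (norm (mulK G (ka G)))^2) - inner (- c *R toL2 V) (- c *R toL2 V)"
   by (intro tendsto_diff tendsto_mult tendsto_add tendsto_const tendsto_inner tendsto_power tendsto_norm ka_lim lim_X lim_u)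
  then show ?thesis unfolding gg[symmetric] .
 qed
 have "(%n. inner (ka (g n)) (toL2 V) - inner (ka (g n)) (toL2 V2)) >>> inner (toL2 V) (toL2 V) - inner (toL2 V) (toL2 V2)"
  by (intro tendsto_diff tendsto_inner tendsto_const lim_ka)
 then have lim_gG: "(%n. inner (g n) G) >>> inner G G" by (simp only: inner_G ka_G)
 have "g >>> G"
 proof -
  have "(%n. g n - G) >>> 0"
  proof (rule tendsto_0_if_square)
   show "(norm (g n - G))^2 <= inner (g n) (g n) - 2 * inner (g n) G + inner G G" for n
    unfolding power2_norm_eq_inner by (simp add: inner_simps inner_commute)
   have "(%n. inner (g n) (g n) - 2 * inner (g n) G + inner G G) >>> inner G G - 2 * inner G G + inner G G"
    by (rule tendsto_add[OF tendsto_diff[OF lim_gg tendsto_mult[OF tendsto_const lim_gG]] tendsto_const])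
   then show "(%n. inner (g n) (g n) - 2 * inner (g n) G + inner G G) >>> 0" by simp
  qed
  then show ?thesis by (rule LIM_zero_cancel)
 qed
 from tendsto_Pair[OF this lim_u] show ?thesis by (simp add: g_def u_def W_def)
qed

text \<open>By contradiction: counterexamples for tolerances tending to 0, translated so that their
  peaks lie at \<open>x0\<close>, converge to the wave by \<open>pulse_sequence\<close>.\<close>

lemma pulse_close:
 assumes ep: "0 < ep"
 shows "\<exists>et>0. \<forall>w. \<bar>mx (fst w) - M\<bar> < et & \<bar>energy a b w - energy a b W\<bar> < et & \<bar>momentum w - momentum W\<bar> < et -->
  (\<exists>si. norm (w - trS si W) < ep)"
proof (rule ccontr)
 assume "~ ?thesis"
 then have ex: "\<exists>w. \<bar>mx (fst w) - M\<bar> < et & \<bar>energy a b w - energy a b W\<bar> < et & \<bar>momentum w - momentum W\<bar> < et &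
   (\<forall>si. ep <= norm (w - trS si W))" if "0 < et" for et
  using that by (meson not_le)
 \<comment> \<open>Within this distance of \<open>M\<close> a height stays strictly between 0 and
   \<open>ms = M + Y\<close>, where a pulse of that height exists.\<close>
 define r where "r = min M Y"
 have r: "0 < r" using M_pos Y_pos by (simp add: r_def)
 define et where "et n = r * inverse (real (Suc n))" for n
 have et: "0 < et n" "et n <= r" for n
  using r by (auto simp: et_def intro!: mult_left_le[of _ r, simplified] inverse_le_1_iff[THEN iffD2])
 have lim_et: "et >>> 0"
  unfolding et_def[abs_def] using tendsto_mult[OF tendsto_const[of r] LIMSEQ_inverse_real_of_nat] by simp
 obtain w where w: "!!n. \<bar>mx (fst (w n)) - M\<bar> < et n" "!!n. \<bar>energy a b (w n) - energy a b W\<bar> < et n"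
   "!!n. \<bar>momentum (w n) - momentum W\<bar> < et n" "!!n si. ep <= norm (w n - trS si W)"
 proof -
  have "\<forall>n. \<exists>w. \<bar>mx (fst w) - M\<bar> < et n & \<bar>energy a b w - energy a b W\<bar> < et n & \<bar>momentum w - momentum W\<bar> < et n &
    (\<forall>si. ep <= norm (w - trS si W))" using ex et(1) by blast
  from choice[OF this] show ?thesis using that by blast
 qed
 have conv: "f >>> l" if "!!n. \<bar>f n - l\<bar> < et n" for f l
 proof -
  have "(%n. f n - l) >>> 0"
   by (rule Lim_null_comparison[OF _ lim_et]) (use that in \<open>auto intro!: always_eventually less_imp_le\<close>)
  then show ?thesis by (rule LIM_zero_cancel)
 qed
 define m where "m n = mx (fst (w n))" for n
 have m: "0 < m n" "m n < ms" for n
  using w(1)[of n] et(2)[of n] by (auto simp: m_def r_def M_eq)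
 have "\<exists>x. Kp (fst (w n)) x = m n" for n using mx_attained[of "fst (w n)"] m(1)[of n] by (metis m_def)
 then obtain p where p: "!!n. Kp (fst (w n)) (p n) = m n" by metis
 define w' where "w' n = trS (p n - x0) (w n)" for n
 have "w' >>> W"
 proof (rule pulse_sequence[of m])
  show "Kp (fst (w' n)) x <= m n" for n x using Kp_le_mx by (simp add: w'_def trS_def Kp_tr m_def)
  show "Kp (fst (w' n)) x0 = m n" for n using p by (simp add: w'_def trS_def Kp_tr)
  show "m >>> M" unfolding m_def[abs_def] by (rule conv[OF w(1)])
  show "(%n. energy a b (w' n)) >>> energy a b W" unfolding w'_def energy_trS by (rule conv[OF w(2)])
  show "(%n. momentum (w' n)) >>> momentum W" unfolding w'_def momentum_trS by (rule conv[OF w(3)])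
 qed (use m in auto)
 then obtain n where n: "norm (w' n - W) < ep" using LIMSEQ_D[OF _ ep] by blast
 have "w n - trS (x0 - p n) W = trS (x0 - p n) (w' n - W)"
  by (simp add: trS_diff w'_def trS_trS trS_0)
 then have "norm (w n - trS (x0 - p n) W) < ep" using n by (simp add: norm_trS)
 then show False using w(4)[of n "x0 - p n"] by simp
qed

text \<open>Calibration at the height of \<open>w\<close> itself, with the squares dropped. Passing
  to the energy and momentum of the wave costs no more than their deviations, since the speed is at
  most 1.\<close>

lemma peak_bound:
 assumes m: "0 < mx (fst w)" "mx (fst w) < ms"
 shows "pact be ms (ms - mx (fst w)) + pspeed be ms (ms - mx (fst w)) * (c * pnorm be ms Y) \<le>
  energy a b W + \<bar>energy a b w - energy a b W\<bar> + \<bar>momentum w - momentum W\<bar>"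
proof -
 let ?Y = "ms - mx (fst w)"
 let ?c = "pspeed be ms ?Y"
 obtain x1 where x1: "Kp (fst w) x1 = mx (fst w)" using mx_attained[OF m(1)] by blast
 have "energy a b w + ?c * momentum w = (norm (snd w + ?c *R ka (fst w)))^2 / 2 + pact be ms ?Y +
   (norm (resid be ms ?Y x1 (fst w)))^2 / 2"
  by (rule calibration[OF be_def be_pos be_ms be_mult_ms]) (use m x1 Kp_le_mx in auto)
 then have 1: "pact be ms ?Y <= energy a b w + ?c * momentum w" by simp
 have c: "0 < ?c" "?c <= 1"
 proof -
  show "0 < ?c" by (rule pspeed_pos[OF be_pos be_ms])
  have "?Y^2 <= ms^2" using m by (intro power_mono) auto
  then have "be * ?Y^2 <= be * ms^2" using be_pos by simp
  then show "?c <= 1" unfolding pspeed_def by simp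
 qed
 have "?c * (momentum w - momentum W) <= \<bar>?c * (momentum w - momentum W)\<bar>" by simp
 also have "... <= 1 * \<bar>momentum w - momentum W\<bar>" unfolding abs_mult using c by (intro mult_right_mono) auto
 finally have "?c * (momentum w - momentum W) <= \<bar>momentum w - momentum W\<bar>" by simp
 moreover have "?c * (c * pnorm be ms Y) = - (?c * momentum W)" by (simp add: momentum_W)
 moreover have "?c * (momentum w - momentum W) = ?c * momentum w - ?c * momentum W" by (rule right_diff_distrib)
 ultimately show ?thesis using 1 by linarith
qed

text \<open>A barrier argument: at the heights \<open>M + r\<close> and \<open>M - r\<close> the
  function \<open>h\<close> exceeds its minimum by a definite amount, which
  \<open>peak_bound\<close> forbids when energy and momentum are close to those of the wave. The
  maximum is continuous in time and cannot cross these heights.\<close>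

lemma peak_drift:
 assumes r: "0 < r" "r < M" "r < Y"
 shows "\<exists>et>0. \<forall>(T::real) w. continuous_on {0..T} w & \<bar>mx (fst (w 0)) - M\<bar> < r &
  (\<forall>t\<in>{0..T}. \<bar>energy a b (w t) - energy a b W\<bar> < et & \<bar>momentum (w t) - momentum W\<bar> < et) -->
  (\<forall>t\<in>{0..T}. \<bar>mx (fst (w t)) - M\<bar> < r)"
proof -
 define h where "h m = pact be ms (ms - m) + pspeed be ms (ms - m) * (c * pnorm be ms Y)" for m
 have hM: "h M = energy a b W"
  using action_W by (simp add: h_def Y_def[symmetric] c_eq[symmetric] momentum_W algebra_simps)
 have q: "c * pnorm be ms Y = pspeed be ms Y * pnorm be ms Y" by (simp add: c_eq[symmetric])
 have min: "h M < h m" if "0 < m" "m < ms" "m ~= M" for m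
  unfolding h_def Y_def[symmetric]
  by (rule pact_strict_min[OF be_pos be_ms _ _ Y_pos Y_less _ q]) (use that in \<open>auto simp: Y_def\<close>)
 have hr: "h M < h (M + r)" "h M < h (M - r)" using min[of "M + r"] min[of "M - r"] r M_le_ms by (auto simp: Y_def)
 define et where "et = min (h (M + r) - h M) (h (M - r) - h M) / 2"
 have et: "0 < et" using hr by (simp add: et_def)
 have no: "~ (mx (fst z) = M + r | mx (fst z) = M - r)"
  if "\<bar>energy a b z - energy a b W\<bar> < et" "\<bar>momentum z - momentum W\<bar> < et" for z
 proof
  assume *: "mx (fst z) = M + r | mx (fst z) = M - r"
  then have "0 < mx (fst z)" "mx (fst z) < ms" using r M_pos by (auto simp: Y_def)
  from peak_bound[OF this]
  have "h (mx (fst z)) <= energy a b W + \<bar>energy a b z - energy a b W\<bar> + \<bar>momentum z - momentum W\<bar>"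
   unfolding h_def .
  then have "h (mx (fst z)) < h M + 2 * et" unfolding hM using that by linarith
  then show False using * by (auto simp: et_def)
 qed
 show ?thesis
 proof (intro exI[of _ et] conjI allI impI ballI)
  fix T :: real and w t
  assume H: "continuous_on {0..T} w & \<bar>mx (fst (w 0)) - M\<bar> < r &
   (\<forall>t\<in>{0..T}. \<bar>energy a b (w t) - energy a b W\<bar> < et & \<bar>momentum (w t) - momentum W\<bar> < et)" and t: "t : {0..T}"
  have c: "continuous_on {0..t} (%t. mx (fst (w t)))"
   by (intro continuous_on_mx continuous_on_fst continuous_on_subset[OF conjunct1[OF H]]) (use t in auto)
  show "\<bar>mx (fst (w t)) - M\<bar> < r"
  proof (rule ccontr)
   assume "~ \<bar>mx (fst (w t)) - M\<bar> < r"
   then have "M + r <= mx (fst (w t)) | mx (fst (w t)) <= M - r" by linarith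
   then obtain s where s: "0 <= s" "s <= t" "mx (fst (w s)) = M + r | mx (fst (w s)) = M - r"
    using IVT'[of "%t. mx (fst (w t))" 0 "M + r" t, OF _ _ _ c] IVT2'[of "%t. mx (fst (w t))" t "M - r" 0, OF _ _ _ c] H t
    by (auto simp: abs_less_iff)
   then show False using no[of "w s"] H t by auto
  qed
 qed (rule et)
qed

theorem pulse_stable:
 assumes ep: "0 < ep"
 shows "\<exists>de>0. \<forall>(T::real) w. continuous_on {0..T} w & 0 <= T & norm (w 0 - W) < de &
  (\<forall>t\<in>{0..T}. energy a b (w t) = energy a b (w 0) & momentum (w t) = momentum (w 0)) -->
  (\<forall>t\<in>{0..T}. \<exists>si. norm (w t - trS si W) < ep)"
proof -
 obtain et1 where et1: "0 < et1" "!!w. \<bar>mx (fst w) - M\<bar> < et1 ==> \<bar>energy a b w - energy a b W\<bar> < et1 ==>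
   \<bar>momentum w - momentum W\<bar> < et1 ==> \<exists>si. norm (w - trS si W) < ep"
  using pulse_close[OF ep] by blast
 \<comment> \<open>Small enough both for \<open>pulse_close\<close> and for \<open>M - r\<close> and
   \<open>M + r\<close> to lie strictly between 0 and \<open>ms\<close>.\<close>
 define r where "r = min et1 (min M Y) / 2"
 have r: "0 < r" "r < M" "r < Y" "r < et1" using et1(1) M_pos Y_pos by (auto simp: r_def)
 obtain et2 where et2: "0 < et2" "!!(T::real) w. continuous_on {0..T} w ==> \<bar>mx (fst (w 0)) - M\<bar> < r ==>
   (\<forall>t\<in>{0..T}. \<bar>energy a b (w t) - energy a b W\<bar> < et2 & \<bar>momentum (w t) - momentum W\<bar> < et2) ==>
   (\<forall>t\<in>{0..T}. \<bar>mx (fst (w t)) - M\<bar> < r)"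
  using peak_drift[OF r(1-3)] by blast
 have "isCont (energy a b) W" "isCont momentum W"
  using continuous_on_energy[of a b] continuous_on_momentum
  unfolding continuous_on_eq_continuous_at[OF open_UNIV] by blast+
 then obtain d1 d2 where d: "0 < d1" "!!w. norm (w - W) < d1 ==> \<bar>energy a b w - energy a b W\<bar> < min et1 et2"
   "0 < d2" "!!w. norm (w - W) < d2 ==> \<bar>momentum w - momentum W\<bar> < min et1 et2"
  unfolding continuous_at_eps_delta dist_norm real_norm_def using et1(1) et2(1) by (metis min_less_iff_conj)
 show ?thesis
 proof (intro exI[of _ "min r (min d1 d2)"] conjI allI impI)
  fix T :: real and w
  assume H: "continuous_on {0..T} w & 0 <= T & norm (w 0 - W) < min r (min d1 d2) &
   (\<forall>t\<in>{0..T}. energy a b (w t) = energy a b (w 0) & momentum (w t) = momentum (w 0))"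
  then have "norm (w 0 - W) < min r (min d1 d2)" by (elim conjE)
  then have H2: "norm (w 0 - W) < r" "norm (w 0 - W) < d1" "norm (w 0 - W) < d2" by simp_all
  have H3: "energy a b (w t) = energy a b (w 0)" "momentum (w t) = momentum (w 0)" if "t : {0..T}" for t
   using H that by blast+
  have "\<bar>mx (fst (w 0)) - M\<bar> <= norm (w 0 - W)"
   using mx_lipschitz[of "fst (w 0)" "fst W"] norm_fst_snd_le(1)[of "w 0 - W"] mx_W by simp
  then have m0: "\<bar>mx (fst (w 0)) - M\<bar> < r" using H2(1) by simp
  have eq: "\<bar>energy a b (w t) - energy a b W\<bar> < min et1 et2 & \<bar>momentum (w t) - momentum W\<bar> < min et1 et2" if "t : {0..T}" for t
   unfolding H3[OF that] using d(2)[OF H2(2)] d(4)[OF H2(3)] by blast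
  then have eq2: "\<forall>t\<in>{0..T}. \<bar>energy a b (w t) - energy a b W\<bar> < et2 & \<bar>momentum (w t) - momentum W\<bar> < et2" by auto
  show "\<forall>t\<in>{0..T}. \<exists>si. norm (w t - trS si W) < ep"
  proof
   fix t assume t: "t : {0..T}"
   have "\<bar>mx (fst (w t)) - M\<bar> < r" using et2(2)[OF conjunct1[OF H] m0 eq2] t by blast
   then show "\<exists>si. norm (w t - trS si W) < ep" using r(4) eq[OF t] by (intro et1(2)) auto
  qed
 qed (use r d in auto)
qed

end

subsection \<open>Global solutions and the stability theorem\<close>

text \<open>Differentiating v v_x produces two products and v^2 v_x three, whence 4 = 2 * 2 and 9 =
  3 * 3. Linearity in \<open>h\<close> is what keeps the velocity from blowing up once the state is
  bounded.\<close>

lemma norm_DN2_le: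
 assumes B: "norm g <= B"
 shows "norm (DN2 a b g h) <= (4 * \<bar>a\<bar> * B + 9 * \<bar>b\<bar> * B^2) * norm h"
proof -
 have D: "norm (ka k - k) <= norm k" for k
 proof -
  have "(norm (ka k - k))^2 <= (norm k)^2" using norm_ka_sq[of k] by simp
  then show ?thesis by (rule power2_le_imp_le) simp
 qed
 have B0: "0 <= B" using B norm_ge_zero[of g] by linarith
 have 1: "norm (mulK g (ka h - h)) <= B * norm h"
  by (rule order_trans[OF norm_mulK_le]) (intro mult_mono B D B0 norm_ge_zero)
 have 2: "norm (mulK h (ka g - g)) <= B * norm h"
  using norm_mulK_le[of h "ka g - g"] mult_left_mono[OF order_trans[OF D B], of "norm h"] by (simp add: mult.commute)
 have 3: "norm (mulK g (ka h - h) + mulK h (ka g - g)) <= 2 * (B * norm h)"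
  using norm_triangle_ineq[of "mulK g (ka h - h)" "mulK h (ka g - g)"] 1 2 by linarith
 have 4: "norm (mulK g (mulK g (ka h - h) + mulK h (ka g - g))) <= B * (2 * (B * norm h))"
  by (rule order_trans[OF norm_mulK_le]) (intro mult_mono B 3 B0 norm_ge_zero)
 have "norm (mulK g (ka g - g)) <= B * B"
  by (rule order_trans[OF norm_mulK_le]) (intro mult_mono B order_trans[OF D B] B0 norm_ge_zero)
 then have 5: "norm (mulK h (mulK g (ka g - g))) <= norm h * (B * B)"
  using norm_mulK_le[of h "mulK g (ka g - g)"] mult_left_mono[of _ "B * B" "norm h"] by (meson norm_ge_zero order_trans)
 have 6: "norm (mulK g (mulK g (ka h - h) + mulK h (ka g - g)) + mulK h (mulK g (ka g - g))) <= 3 * (B^2 * norm h)"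
  using norm_triangle_ineq[of "mulK g (mulK g (ka h - h) + mulK h (ka g - g))" "mulK h (mulK g (ka g - g))"] 4 5
  by (simp add: power2_eq_square algebra_simps)
 have "norm (DN2 a b g h) <= norm ((2 * a) *R (mulK g (ka h - h) + mulK h (ka g - g))) +
   norm ((3 * b) *R (mulK g (mulK g (ka h - h) + mulK h (ka g - g)) + mulK h (mulK g (ka g - g))))"
  unfolding DN2_def by (rule norm_triangle_ineq)
 also have "... <= \<bar>2 * a\<bar> * (2 * (B * norm h)) + \<bar>3 * b\<bar> * (3 * (B^2 * norm h))"
  unfolding norm_scaleR by (intro add_mono mult_left_mono 3 6 abs_ge_zero)
 also have "... = (4 * \<bar>a\<bar> * B + 9 * \<bar>b\<bar> * B^2) * norm h" by (simp add: abs_mult algebra_simps)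
 finally show ?thesis .
qed

text \<open>The conserved energy bounds the state for all times; the velocity then satisfies a
  linear integral inequality, and Gronwall gives exponential growth at most. Together these form the
  a priori bound for \<open>global_solution\<close>.\<close>

lemma global_traj:
 assumes ab: "b <= - (a^2) / 3" and init: "genA w0 (y0 - Nl a b w0)"
 obtains z where "!!T. 0 <= T ==> ode_sol (ode_rhs a b) (w0, y0) T z"
proof -
 define B where "B = sqrt (6 * energy a b w0)"
 define C where "C = 4 * \<bar>a\<bar> * B + 9 * \<bar>b\<bar> * B^2"
 have B0: "0 <= B" using order_trans[OF zero_le_power2 energy_coercive[OF ab, of w0]] by (simp add: B_def)
 then have C0: "0 <= C" by (simp add: C_def)
 have bound: "norm (z t) <= B + norm y0 * exp (C * t)"
  if sol: "ode_sol (ode_rhs a b) (w0, y0) T z" and t: "t : {0..T}" for T z t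
 proof -
  note tr = ode_sol_imp_traj[OF sol init]
  have cz: "continuous_on {0..T} z" and
   eq: "!!r. r : {0..T} ==> z r = (w0, y0) + integral {0..r} (%s. ode_rhs a b s (z s))"
   using sol unfolding ode_sol_def by blast+
  have z0: "z 0 = (w0, y0)" using eq[of 0] t by simp
  have fstB: "norm (fst (z r)) <= B" if r: "r : {0..T}" for r
  proof -
   have "energy a b (fst (z r)) = energy a b w0" using traj_energy[OF tr r] z0 by simp
   then show ?thesis
    unfolding B_def using energy_coercive[OF ab, of "fst (z r)"] by (intro real_le_rsqrt) simp
  qed
  have rhs: "norm (snd (ode_rhs a b r (z r))) <= C * norm (snd (z r))" if r: "r : {0..T}" for r
  proof -
   have "norm (fst (fst (z r))) <= B" using fstB[OF r] norm_fst_snd_le(1)[of "fst (z r)"] by linarith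
   from norm_DN2_le[OF this, of a b "fst (S r (snd (z r)))"]
   have "norm (DN2 a b (fst (fst (z r))) (fst (S r (snd (z r))))) <= C * norm (fst (S r (snd (z r))))"
    unfolding C_def .
   also have "... <= C * norm (snd (z r))"
    using norm_fst_snd_le(1)[of "S r (snd (z r))"] C0 by (intro mult_left_mono) auto
   finally show ?thesis by (simp add: ode_rhs_def DNl_def norm_Pair)
  qed
  have cG: "continuous_on {0..T} (%s. ode_rhs a b s (z s))" by (rule pde.continuous_G[OF cz])
  have "norm (snd (z t)) <= norm y0 * exp (C * (t - 0))"
  proof (rule gronwall[of 0 T "%r. norm (snd (z r))" C "norm y0" t])
   show "continuous_on {0..T} (%r. norm (snd (z r)))" by (intro continuous_intros cz)
   fix r assume r: "r : {0..T}"
   have sub: "{0..r} \<subseteq> {0..T}" using r by auto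
   have i: "(%s. ode_rhs a b s (z s)) integrable_on {0..r}"
    by (rule integrable_continuous_interval[OF continuous_on_subset[OF cG sub]])
   have "snd (z r) = y0 + snd (integral {0..r} (%s. ode_rhs a b s (z s)))" using eq[OF r] by simp
   also have "snd (integral {0..r} (%s. ode_rhs a b s (z s))) = integral {0..r} (%s. snd (ode_rhs a b s (z s)))"
    using integral_linear[OF i bounded_linear_snd] by (simp add: o_def)
   finally have "norm (snd (z r)) <= norm y0 + norm (integral {0..r} (%s. snd (ode_rhs a b s (z s))))"
    using norm_triangle_ineq by metis
   also have "norm (integral {0..r} (%s. snd (ode_rhs a b s (z s)))) <= integral {0..r} (%s. C * norm (snd (z s)))"
   proof (rule integral_norm_bound_integral)
    show "(%s. snd (ode_rhs a b s (z s))) integrable_on {0..r}"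
     by (intro integrable_continuous_interval continuous_on_snd continuous_on_subset[OF cG sub])
    show "(%s. C * norm (snd (z s))) integrable_on {0..r}"
     by (intro integrable_continuous_interval continuous_intros continuous_on_subset[OF cz sub])
    show "norm (snd (ode_rhs a b s (z s))) <= C * norm (snd (z s))" if "s : {0..r}" for s
     using that sub by (intro rhs) blast
   qed
   also have "... = C * integral {0..r} (%s. norm (snd (z s)))" by simp
   finally show "norm (snd (z r)) <= norm y0 + C * integral {0..r} (%r. norm (snd (z r)))" by simp
  qed (use C0 t in auto)
  then show ?thesis using fstB[OF t] norm_Pair_le[of "fst (z t)" "snd (z t)"] by simp
 qed
 have mono: "B + norm y0 * exp (C * s) <= B + norm y0 * exp (C * t)" if "0 <= s" "s <= t" for s t
  using that C0 by (intro add_left_mono mult_left_mono) (auto intro: mult_left_mono)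
 show ?thesis
 proof (rule pde.global_solution[of a b "(w0, y0)" "%t. B + norm y0 * exp (C * t)"])
  show "\<exists>L. \<forall>t x y. norm x <= R --> norm y <= R --> norm (ode_rhs a b t x - ode_rhs a b t y) <= L * norm (x - y)" for R
   by (rule ode_rhs_lipschitz)
 qed (use bound mono that in blast)+
qed

section \<open>From states back to Sobolev distances\<close>

lemma in_H_scale:
 assumes "in_H k f"
 shows "in_H k (%x. q * f x)" "j <= k ==> hder k (%x. q * f x) j = q *R hder k f j"
proof -
 have 0: "q *R hder k f 0 = toL2 (%x. q * f x)" using assms by (simp add: hder_0 toL2_scale in_H_L2)
 note * = in_H_if_wd[of "%x. q * f x" "%j. q *R hder k f j" k, OF L2_fun_scale[OF in_H_L2[OF assms]] 0]
 show "in_H k (%x. q * f x)" using *(1) wd_scaleR[OF wd_hder[OF assms]] by blast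
 show "j <= k ==> hder k (%x. q * f x) j = q *R hder k f j" using *(2) wd_scaleR[OF wd_hder[OF assms]] by blast
qed

lemma in_H_translate:
 assumes "in_H k f"
 shows "in_H k (%x. f (x + s))" "j <= k ==> hder k (%x. f (x + s)) j = tr s (hder k f j)"
proof -
 have 0: "tr s (hder k f 0) = toL2 (%x. f (x + s))" using assms by (simp add: hder_0 tr_toL2 in_H_L2)
 note * = in_H_if_wd[of "%x. f (x + s)" "%j. tr s (hder k f j)" k, OF L2_fun_translate[OF in_H_L2[OF assms]] 0]
 show "in_H k (%x. f (x + s))" using *(1) wd_tr[OF wd_hder[OF assms]] by blast
 show "j <= k ==> hder k (%x. f (x + s)) j = tr s (hder k f j)" using *(2) wd_tr[OF wd_hder[OF assms]] by blast
qed

definition stat :: "(real => real) => (real => real) => state" where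
 "stat f h = (hder 3 f 0 - hder 3 f 1, hder 2 h 0)"

text \<open>\<open>H_norm_1\<close> identifies the first Sobolev norm of a difference with the L2
  norm of its datum, so the prescribed distance is exactly the norm of the state space.\<close>

lemma dist_H1L2_stat:
 assumes f: "in_H 3 f" "in_H 3 f'" and h: "in_H 2 h" "in_H 2 h'"
 shows "dist_H1L2 f h f' h' = norm (stat f h - stat f' h')"
proof -
 define d where "d x = f x - f' x" for x
 have d3: "in_H 3 d" and d3j: "!!j. j <= 3 ==> hder 3 d j = hder 3 f j - hder 3 f' j"
  using in_H_diff[OF f] by (simp_all add: d_def[abs_def])
 have d1: "in_H 1 d" by (rule in_H_mono[OF d3]) simp
 have hm: "hder 1 d 0 = hder 3 d 0" "hder 1 d 1 = hder 3 d 1" by (rule hder_mono[OF d3]; simp)+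
 have "hder 1 d 0 - hder 1 d 1 = fst (stat f h - stat f' h')"
  unfolding hm by (simp add: d3j stat_def)
 then have 1: "H_norm 1 d = norm (fst (stat f h - stat f' h'))" using H_norm_1[OF d1] by simp
 have "H_norm 0 (%x. h x - h' x) = norm (toL2 h - toL2 h')"
  using in_H_L2[OF h(1)] in_H_L2[OF h(2)] by (simp add: H_norm_0 L2_fun_diff toL2_diff)
 then have 2: "H_norm 0 (%x. h x - h' x) = norm (snd (stat f h - stat f' h'))"
  using hder_0[OF h(1)] hder_0[OF h(2)] by (simp add: stat_def)
 show ?thesis
  unfolding dist_H1L2_def 2 using 1 by (simp add: d_def[abs_def] norm_prod_def)
qed

lemma stat_translate:
 assumes "in_H 3 f" "in_H 2 h"
 shows "stat (%x. f (x + si)) (%x. h (x + si)) = trS si (stat f h)"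
 using in_H_translate(2)[OF assms(1), of 0] in_H_translate(2)[OF assms(1), of 1] in_H_translate(2)[OF assms(2), of 0]
 by (simp add: stat_def trS_def linear_tr)

text \<open>The sign changes \<open>(v, u) \<mapsto> (s v, r u)\<close> reduce every solitary wave to a positive pulse of positive speed.\<close>

definition flip :: "real => real => state => state" where "flip s r w = (s *R fst w, r *R snd w)"

lemma ka_minus: "ka (- g) = - ka g" using ka_scaleR[of "- 1" g] by simp

lemma flip:
 assumes "s = 1 | s = - 1" "r = 1 | r = - 1"
 shows "energy (s * a) b (flip s r w) = energy a b w" "momentum (flip s r w) = s * r * momentum w"
  "norm (flip s r w) = norm w"
 using assms
 by (auto simp: flip_def energy_def momentum_def inner_prod_def norm_prod_def ka_minus mulK.minus_left mulK.minus_right)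

lemma flip_diff: "flip s r (w - w') = flip s r w - flip s r w'"
 by (simp add: flip_def scaleR_diff_right)

lemma flip_trS: "flip s r (trS si w) = trS si (flip s r w)"
 by (simp add: flip_def trS_def linear_tr)

theorem theorem2:
  fixes a b c :: real and V :: "real \<Rightarrow> real"
  assumes "b \<le> - (a\<^sup>2) / 3"
    and "solitary_wave a b c V"
  shows "orbitally_stable a b V (\<lambda>x. - c * V x)"
proof -
 note ab = assms(1)
 obtain s where s: "s = 1 | s = - 1" and pulse: "pulse (s * a) b \<bar>c\<bar> (%x. s * V x) (%x. s * deriv V x)"
  using solitary_wave_pulse[OF assms] by blast
 interpret P: pulse "s * a" b "\<bar>c\<bar>" "%x. s * V x" "%x. s * deriv V x" by (rule pulse)
 define U where "U x = - c * V x" for x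
 \<comment> \<open>The sign for \<open>u\<close> is chosen so that the product \<open>s * r\<close>
   is the sign of \<open>c\<close>; this turns the second component \<open>- c V\<close> into that
   of a positive pulse of speed \<open>\<bar>c\<bar>\<close>.\<close>
 define r where "r = (if 0 <= c then s else - s)"
 have r: "r = 1 | r = - 1" using s by (auto simp: r_def)
 have ss: "s * s = 1" "s * (s * x) = x" for x using s by auto
 have HV: "in_H 3 V" and HV1: "hder 3 V 1 = toL2 (deriv V)"
 proof -
  have "L2_fun (deriv V)" using L2_fun_scale[OF P.V_Hk(1), of s] by (simp add: ss)
  then have "toL2 (%x. s * deriv V x) = s *R toL2 (deriv V)" by (rule toL2_scale)
  then show "in_H 3 V" "hder 3 V 1 = toL2 (deriv V)"
   using in_H_scale(1)[OF P.in_H_V(1), of s] in_H_scale(2)[OF P.in_H_V(1), of 1 s] P.in_H_V(2) by (simp_all add: ss del: One_nat_def)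
 qed
 have HU: "in_H 2 U" and HU0: "hder 2 U 0 = - c *R toL2 V"
 proof -
  have "in_H 2 V" by (rule in_H_mono[OF HV]) simp
  from in_H_scale(1)[OF this, of "- c"] in_H_scale(2)[OF this, of 0 "- c"] hder_0[OF this]
  show "in_H 2 U" "hder 2 U 0 = - c *R toL2 V" by (simp_all add: U_def[abs_def])
 qed
 have W: "flip s r (stat V U) = P.W"
 proof -
  have LV: "L2_fun V" "L2_fun (deriv V)"
   using L2_fun_scale[OF P.V_norm(1), of s] L2_fun_scale[OF P.V_Hk(1), of s] by (simp_all add: ss)
  have "s *R (toL2 V - toL2 (deriv V)) = P.G"
   unfolding P.G_def toL2_scale[OF LV(1)] toL2_scale[OF LV(2)] by (rule scaleR_diff_right)
  moreover have "r *R (- c *R toL2 V) = - \<bar>c\<bar> *R toL2 (%x. s * V x)"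
   unfolding toL2_scale[OF LV(1)] by (simp add: r_def)
  ultimately show ?thesis
   by (simp add: flip_def stat_def P.W_def HV1 HU0 hder_0[OF HV] del: One_nat_def)
 qed
 show ?thesis
  unfolding orbitally_stable_def U_def[abs_def, symmetric]
 proof (intro allI impI)
  fix ep :: real assume ep: "0 < ep"
  obtain de where de: "0 < de" "!!(T::real) w. continuous_on {0..T} w ==> 0 <= T ==> norm (w 0 - P.W) < de ==>
    (\<forall>t\<in>{0..T}. energy (s * a) b (w t) = energy (s * a) b (w 0) & momentum (w t) = momentum (w 0)) ==>
    (\<forall>t\<in>{0..T}. \<exists>si. norm (w t - trS si P.W) < ep)"
   using P.pulse_stable[OF ep] by blast
  show "\<exists>de>0. \<forall>T v u. 0 < T & is_solution a b V U T v u & dist_H1L2 (%x. v x 0) (%x. u x 0) V U < de -->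
   (\<exists>v' u'. is_solution a b V U \<infinity> v' u' &
    (\<forall>x t. 0 <= t & ereal t < T --> v' x t = v x t & u' x t = u x t) &
    (\<forall>t>0. (INF si. dist_H1L2 (%x. v' x t) (%x. u' x t) (%x. V (x + si)) (%x. U (x + si))) < ep))"
  proof (intro exI[of _ de] conjI allI impI de(1))
   fix T v u
   assume "0 < T & is_solution a b V U T v u & dist_H1L2 (%x. v x 0) (%x. u x 0) V U < de"
   then have T: "0 < T" and sol: "is_solution a b V U T v u"
    and close: "dist_H1L2 (%x. v x 0) (%x. u x 0) V U < de" by blast+
   let ?w = "sol_state v u" and ?y = "sol_velocity a b v u"
   have tr: "traj a b T' ?w ?y" if "0 < T'" "ereal T' < T" for T'
    by (rule is_solution_imp_traj[OF sol HV HU that])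
   \<comment> \<open>Any positive time before \<open>T\<close> will do: it only serves to read off
     that the initial state and velocity are compatible with the generator.\<close>
   obtain T1 where T1: "0 < T1" "ereal T1 < T"
    using ereal_dense2[OF T] by (auto simp: zero_ereal_def)
   have init: "genA (?w 0) (?y 0 - Nl a b (?w 0))"
    using traj_genA[OF tr[OF T1], of 0] T1(1) by simp
   obtain z where z: "!!T. 0 <= T ==> ode_sol (ode_rhs a b) (?w 0, ?y 0) T z"
    using global_traj[OF ab init] by blast
   have gtr: "traj a b T (%t. fst (z t)) (%t. S t (snd (z t)))" if "0 <= T" for T
    by (rule ode_sol_imp_traj[OF z[OF that] init])
   \<comment> \<open>Both curves solve the same ordinary differential equation with the same data on
     an interval reaching beyond \<open>t\<close>.\<close>
   have agree: "fst (z t) = ?w t" if t: "0 <= t" "ereal t < T" for t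
   proof -
    obtain T' where T': "t < T'" "ereal T' < T" using ereal_dense2[OF t(2)] by auto
    then have "ode_sol (ode_rhs a b) (?w 0, ?y 0) T' (%t. (?w t, S (- t) (?y t)))"
     using t(1) by (intro traj_imp_ode_sol tr) auto
    from pde.unique[OF ode_rhs_lipschitz z this, of t] have "z t = (?w t, S (- t) (?y t))" using t T' by simp
    then show ?thesis by simp
   qed
   obtain v' u' where sol': "is_solution a b V U \<infinity> v' u'"
    and same: "!!x t. 0 <= t ==> ereal t < T ==> v' x t = v x t & u' x t = u x t"
    and state: "!!t. 0 <= t ==> sol_state v' u' t = fst (z t)"
    using traj_imp_is_solution[OF sol HV HU T gtr agree] by blast
   have stat: "stat (%x. f x t) (%x. h x t) = sol_state f h t" for f h t
    by (simp add: stat_def sol_state_def)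
   have w0: "norm (fst (z 0) - stat V U) < de"
   proof -
    have "in_H 3 (%x. v x 0)" "in_H 2 (%x. u x 0)"
     using is_solution_in_H[OF sol HV HU, of 0] T by (simp_all add: zero_ereal_def)
    from dist_H1L2_stat[OF this(1) HV this(2) HU] close
    have "norm (sol_state v u 0 - stat V U) < de" unfolding stat by simp
    then show ?thesis using agree[of 0] T by (simp add: zero_ereal_def)
   qed
   have inf: "(INF si. dist_H1L2 (%x. v' x t) (%x. u' x t) (%x. V (x + si)) (%x. U (x + si))) < ep" if t: "0 < t" for t
   proof -
    note gt = gtr[OF less_imp_le[OF t]]
    have "\<forall>q\<in>{0..t}. \<exists>si. norm (flip s r (fst (z q)) - trS si P.W) < ep"
    proof (rule de(2))
     have cf: "continuous_on {0..t} (%q. fst (z q))" using gt by (simp add: traj_def)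
     show "continuous_on {0..t} (%q. flip s r (fst (z q)))"
      unfolding flip_def by (intro continuous_on_Pair continuous_on_scaleR continuous_on_const
        continuous_on_fst[OF cf] continuous_on_snd[OF cf])
     show "norm (flip s r (fst (z 0)) - P.W) < de"
      using w0 flip(3)[OF s r, of "fst (z 0) - stat V U"] by (simp add: flip_diff W)
     show "\<forall>q\<in>{0..t}. energy (s * a) b (flip s r (fst (z q))) = energy (s * a) b (flip s r (fst (z 0))) &
       momentum (flip s r (fst (z q))) = momentum (flip s r (fst (z 0)))"
     proof
      fix q assume q: "q : {0..t}"
      show "energy (s * a) b (flip s r (fst (z q))) = energy (s * a) b (flip s r (fst (z 0))) &
       momentum (flip s r (fst (z q))) = momentum (flip s r (fst (z 0)))"
       unfolding flip(1,2)[OF s r] traj_energy[OF gt q] traj_momentum[OF gt q] by simp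
     qed
    qed (use t in simp)
    moreover have "t : {0..t}" using t by simp
    ultimately obtain si where si: "norm (flip s r (fst (z t)) - trS si P.W) < ep" by blast
    have "flip s r (fst (z t)) - trS si P.W = flip s r (fst (z t) - trS si (stat V U))"
     by (simp add: flip_diff flip_trS W)
    then have near: "norm (fst (z t) - trS si (stat V U)) < ep" using si flip(3)[OF s r] by simp
    have "in_H 3 (%x. v' x t)" "in_H 2 (%x. u' x t)"
     using is_solution_in_H[OF sol' HV HU, of t] t by simp_all
    from dist_H1L2_stat[OF this(1) in_H_translate(1)[OF HV] this(2) in_H_translate(1)[OF HU], of si si]
    have "dist_H1L2 (%x. v' x t) (%x. u' x t) (%x. V (x + si)) (%x. U (x + si)) < ep"
     using near state[of t] t by (simp add: stat stat_translate[OF HV HU])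
    moreover have "(INF si. dist_H1L2 (%x. v' x t) (%x. u' x t) (%x. V (x + si)) (%x. U (x + si))) \<le>
      dist_H1L2 (%x. v' x t) (%x. u' x t) (%x. V (x + si)) (%x. U (x + si))"
     by (rule cINF_lower) (auto intro!: bdd_belowI[of _ 0] simp: dist_H1L2_def)
    ultimately show ?thesis by simp
   qed
   show "\<exists>v' u'. is_solution a b V U \<infinity> v' u' &
    (\<forall>x t. 0 <= t & ereal t < T --> v' x t = v x t & u' x t = u x t) &
    (\<forall>t>0. (INF si. dist_H1L2 (%x. v' x t) (%x. u' x t) (%x. V (x + si)) (%x. U (x + si))) < ep)"
    using sol' same inf by blast
  qed
 qed
qed

end
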